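(* Let $n\ge 1$, let $\Omega\subset\mathbb{R}^n$ be a regular and bounded domain with boundary $\partial\Omega$ of class $C^2$, let $\mu_1,\mu_2$ be two real numbers and let $\tau>0$. Let $g:\mathbb{R}^+\to\mathbb{R}^+$ be a $C^1$ function with $g(0)>0$ and $1-\int_0^\infty g(s)\,ds=l>0$, and suppose there is a positive constant $\zeta$ with $g'(t)\le-\zeta g(t)$ for all $t>0$. Then, given $u_0\in H_0^1(\Omega)$, $u_1\in L^2(\Omega)$, $f_0\in L^2(-\tau,0;L^2(\Omega))$ and $T>0$, there exists a weak solution $u$ on $(0,T)$ (in the sense defined in the context) of the problem $$\begin{cases}u_{tt}(x,t)-\Delta u(x,t)+\int_0^t g(t-s)\Delta u(x,s)\,ds+\mu_1u_t(x,t)+\mu_2u_t(x,t-\tau)=0,& x\in\Omega,\ t>0,\\ u(x,t)=0,& x\in\partial\Omega,\ t\ge0,\\ u(x,0)=u_0(x),\quad u_t(x,0)=u_1(x),& x\in\Omega,\\ u_t(x,t-\tau)=f_0(x,t-\tau),& x\in\Omega,\ 0<t<\tau.\end{cases}$$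
   Context: $(\cdot,\cdot)$ denotes the inner product of $L^2(\Omega)$ (also for vector-valued functions). For $T>0$ let $$U=\{u: u\in L^2(0,T;H_0^1(\Omega)),\ u_t\in L^2(0,T;L^2(\Omega))\},\qquad V=\{v: v\in U,\ v(x,T)=0,\ v_t(x,T)=0\}.$$ A function $u\in U$ is called a weak solution of the problem if $$-\int_0^T(u_t,v_t)\,dt+\int_0^T(\nabla u(t),\nabla v(t))\,dt-\int_0^T\int_0^t g(t-s)(\nabla u(s),\nabla v(s))\,ds\,dt+\mu_1\int_0^T(u_t(t),v)\,dt+\mu_2\int_0^T(u_t(t-\tau),v)\,dt+(v(x,0),u_1(x))=0$$ for each $v\in V$, and $$u(x,0)=u_0,\qquad u_t(x,0)=u_1,\qquad u_t(x,t-\tau)=f_0(x,t-\tau)\ \text{ for } t\in(0,\tau).$$ The initial values are understood through $u\in C(0,T;L^2(\Omega))$ and $u_t\in C(0,T;H^{-1}(\Omega))$.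
   Formalization: In the weak identity the initial term is taken as −(v(x,0),u_1), since the plus sign forces u_t(0)=−u_1, and the memory term as g(t−s)(∇u(s),∇v(t)), since ∇v(s) does not correspond to the displayed equation. *)

theory Defs
  imports "HOL-Analysis.Analysis"
begin

section \<open>Smooth functions and \<open>C\<^sup>2\<close> domains\<close>

definition partial :: "'a::euclidean_space \<Rightarrow> ('a \<Rightarrow> real) \<Rightarrow> 'a \<Rightarrow> real" where
  "partial b f x = frechet_derivative f (at x) b"

primrec Ck :: "nat \<Rightarrow> ('a::euclidean_space \<Rightarrow> real) \<Rightarrow> bool" where
  "Ck 0 f \<longleftrightarrow> continuous_on UNIV f"
| "Ck (Suc k) f \<longleftrightarrow> (\<forall>x. f differentiable (at x)) \<and> (\<forall>b\<in>Basis. Ck k (partial b f))"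

definition test_functions :: "'a::euclidean_space set \<Rightarrow> ('a \<Rightarrow> real) set" where
  "test_functions \<Omega> =
     {\<phi>. (\<forall>k. Ck k \<phi>) \<and> (\<exists>K. compact K \<and> K \<subseteq> \<Omega> \<and> (\<forall>x. x \<notin> K \<longrightarrow> \<phi> x = 0))}"

text \<open>
  Near each boundary point, in orthonormal coordinates whose last axis is \<open>e\<close>, the set is the
  region above the graph of a \<open>C\<^sup>2\<close> function of the remaining coordinates.  The graph function
  is given on the whole space and evaluated at the projection of \<open>x\<close> to the hyperplane
  orthogonal to \<open>e\<close>; every \<open>C\<^sup>2\<close> function on that hyperplane arises in this way.
\<close>
definition C2_boundary :: "'a::euclidean_space set \<Rightarrow> bool" where
  "C2_boundary \<Omega> \<longleftrightarrow>
     (\<forall>x0\<in>frontier \<Omega>. \<exists>r>0. \<exists>e \<gamma>. norm e = 1 \<and> Ck 2 \<gamma> \<and>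
        \<Omega> \<inter> ball x0 r = {x \<in> ball x0 r. x \<bullet> e > \<gamma> (x - (x \<bullet> e) *\<^sub>R e)})"

definition bounded_C2_domain :: "'a::euclidean_space set \<Rightarrow> bool" where
  "bounded_C2_domain \<Omega> \<longleftrightarrow>
     open \<Omega> \<and> connected \<Omega> \<and> \<Omega> \<noteq> {} \<and> bounded \<Omega> \<and> C2_boundary \<Omega>"


section \<open>Lebesgue and Sobolev spaces\<close>

text \<open>
  Elements of the function spaces are represented by functions, and equality is almost
  everywhere equality; the norms below are accordingly seminorms.
\<close>

definition L2 :: "'a::euclidean_space set \<Rightarrow> ('a \<Rightarrow> 'b::euclidean_space) set" where
  "L2 \<Omega> = {f. f \<in> borel_measurable (lebesgue_on \<Omega>) \<and>
              integrable (lebesgue_on \<Omega>) (\<lambda>x. (norm (f x))\<^sup>2)}"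

definition l2_inner ::
    "'a::euclidean_space set \<Rightarrow> ('a \<Rightarrow> 'b::euclidean_space) \<Rightarrow> ('a \<Rightarrow> 'b) \<Rightarrow> real" where
  "l2_inner \<Omega> f h = (\<integral>x. f x \<bullet> h x \<partial>lebesgue_on \<Omega>)"

definition l2_norm :: "'a::euclidean_space set \<Rightarrow> ('a \<Rightarrow> 'b::euclidean_space) \<Rightarrow> real" where
  "l2_norm \<Omega> f = sqrt (l2_inner \<Omega> f f)"

definition has_weak_gradient ::
    "'a::euclidean_space set \<Rightarrow> ('a \<Rightarrow> real) \<Rightarrow> ('a \<Rightarrow> 'a) \<Rightarrow> bool" where
  "has_weak_gradient \<Omega> u G \<longleftrightarrow>
     G \<in> L2 \<Omega> \<and>
     (\<forall>\<phi>\<in>test_functions \<Omega>. \<forall>b\<in>Basis.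
        (\<integral>x. u x * partial b \<phi> x \<partial>lebesgue_on \<Omega>) = - (\<integral>x. (G x \<bullet> b) * \<phi> x \<partial>lebesgue_on \<Omega>))"

definition H1 :: "'a::euclidean_space set \<Rightarrow> ('a \<Rightarrow> real) set" where
  "H1 \<Omega> = {u \<in> L2 \<Omega>. \<exists>G. has_weak_gradient \<Omega> u G}"

definition weak_grad :: "'a::euclidean_space set \<Rightarrow> ('a \<Rightarrow> real) \<Rightarrow> 'a \<Rightarrow> 'a" where
  "weak_grad \<Omega> u = (SOME G. has_weak_gradient \<Omega> u G)"

definition h1_norm :: "'a::euclidean_space set \<Rightarrow> ('a \<Rightarrow> real) \<Rightarrow> real" where
  "h1_norm \<Omega> u = sqrt ((l2_norm \<Omega> u)\<^sup>2 + (l2_norm \<Omega> (weak_grad \<Omega> u))\<^sup>2)"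

definition H01 :: "'a::euclidean_space set \<Rightarrow> ('a \<Rightarrow> real) set" where
  "H01 \<Omega> = {u \<in> H1 \<Omega>. \<exists>\<phi>. (\<forall>k. \<phi> k \<in> test_functions \<Omega>) \<and>
               (\<lambda>k::nat. h1_norm \<Omega> (\<lambda>x. \<phi> k x - u x)) \<longlonglongrightarrow> 0}"

definition Hm1 :: "'a::euclidean_space set \<Rightarrow> (('a \<Rightarrow> real) \<Rightarrow> real) set" where
  "Hm1 \<Omega> = {F. (\<forall>\<phi>\<in>H01 \<Omega>. \<forall>\<psi>\<in>H01 \<Omega>. F (\<lambda>x. \<phi> x + \<psi> x) = F \<phi> + F \<psi>) \<and>
               (\<forall>c. \<forall>\<phi>\<in>H01 \<Omega>. F (\<lambda>x. c * \<phi> x) = c * F \<phi>) \<and>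
               (\<exists>C. \<forall>\<phi>\<in>H01 \<Omega>. \<bar>F \<phi>\<bar> \<le> C * h1_norm \<Omega> \<phi>)}"

definition hm1_norm :: "'a::euclidean_space set \<Rightarrow> (('a \<Rightarrow> real) \<Rightarrow> real) \<Rightarrow> real" where
  "hm1_norm \<Omega> F = (SUP \<phi>\<in>{\<phi> \<in> H01 \<Omega>. h1_norm \<Omega> \<phi> \<le> 1}. \<bar>F \<phi>\<bar>)"


section \<open>Functions of time with values in a function space\<close>

text \<open>
  In this section \<open>X\<close> is a space of real functions and \<open>N\<close> its (semi)norm.
\<close>

definition strongly_measurable ::
    "real set \<Rightarrow> ('c \<Rightarrow> real) set \<Rightarrow> (('c \<Rightarrow> real) \<Rightarrow> real) \<Rightarrow> (real \<Rightarrow> 'c \<Rightarrow> real) \<Rightarrow> bool" where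
  "strongly_measurable I X N u \<longleftrightarrow>
     (\<exists>s. (\<forall>k::nat. simple_function (lebesgue_on I) (s k) \<and> (\<forall>t\<in>I. s k t \<in> X)) \<and>
          (AE t in lebesgue_on I. (\<lambda>k. N (\<lambda>x. s k t x - u t x)) \<longlonglongrightarrow> 0))"

definition bochner_L2 ::
    "real set \<Rightarrow> ('c \<Rightarrow> real) set \<Rightarrow> (('c \<Rightarrow> real) \<Rightarrow> real) \<Rightarrow> (real \<Rightarrow> 'c \<Rightarrow> real) set" where
  "bochner_L2 I X N =
     {u. (AE t in lebesgue_on I. u t \<in> X) \<and> strongly_measurable I X N u \<and>
         integrable (lebesgue_on I) (\<lambda>t. (N (u t))\<^sup>2)}"

definition space_continuous_on ::
    "real set \<Rightarrow> ('c \<Rightarrow> real) set \<Rightarrow> (('c \<Rightarrow> real) \<Rightarrow> real) \<Rightarrow> (real \<Rightarrow> 'c \<Rightarrow> real) \<Rightarrow> bool" where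
  "space_continuous_on I X N u \<longleftrightarrow>
     (\<forall>t\<in>I. u t \<in> X) \<and>
     (\<forall>t\<in>I. ((\<lambda>s. N (\<lambda>x. u s x - u t x)) \<longlongrightarrow> 0) (at t within I))"

text \<open>
  \<open>w\<close> is the weak time derivative on \<open>(0,T)\<close> of \<open>u\<close>, and it lies in \<open>L\<^sup>2(0,T;L\<^sup>2(\<Omega>))\<close>.
  The defining identity \<open>\<integral> \<phi>'(t) u(t) dt = - \<integral> \<phi>(t) w(t) dt\<close> between elements of
  \<open>L\<^sup>2(\<Omega>)\<close> is written by pairing it with all \<open>\<psi> \<in> L\<^sup>2(\<Omega>)\<close>.
\<close>
definition has_time_deriv ::
    "'a::euclidean_space set \<Rightarrow> real \<Rightarrow> (real \<Rightarrow> 'a \<Rightarrow> real) \<Rightarrow> (real \<Rightarrow> 'a \<Rightarrow> real) \<Rightarrow> bool" where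
  "has_time_deriv \<Omega> T u w \<longleftrightarrow>
     w \<in> bochner_L2 {0<..<T} (L2 \<Omega>) (l2_norm \<Omega>) \<and>
     (\<forall>\<phi>\<in>test_functions {0<..<T}. \<forall>\<psi>\<in>L2 \<Omega>.
        (\<integral>t. deriv \<phi> t * l2_inner \<Omega> (u t) \<psi> \<partial>lebesgue_on {0<..<T}) =
        - (\<integral>t. \<phi> t * l2_inner \<Omega> (w t) \<psi> \<partial>lebesgue_on {0<..<T}))"

text \<open>
  \<open>uc\<close> is the representative of \<open>u\<close> in \<open>C([0,T];L\<^sup>2(\<Omega>))\<close>, and \<open>F\<close> is the representative of
  \<open>w\<close> in \<open>C([0,T];H\<^sup>-\<^sup>1(\<Omega>))\<close>, where \<open>L\<^sup>2(\<Omega>)\<close> is embedded in \<open>H\<^sup>-\<^sup>1(\<Omega>)\<close> through the inner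
  product.  The values of \<open>u\<close> and of \<open>u\<^sub>t\<close> at the times \<open>0\<close> and \<open>T\<close> are those of these
  representatives.
\<close>
definition L2_continuous_version ::
    "'a::euclidean_space set \<Rightarrow> real \<Rightarrow> (real \<Rightarrow> 'a \<Rightarrow> real) \<Rightarrow> (real \<Rightarrow> 'a \<Rightarrow> real) \<Rightarrow> bool" where
  "L2_continuous_version \<Omega> T u uc \<longleftrightarrow>
     space_continuous_on {0..T} (L2 \<Omega>) (l2_norm \<Omega>) uc \<and>
     (AE t in lebesgue_on {0<..<T}. AE x in lebesgue_on \<Omega>. uc t x = u t x)"

definition Hm1_continuous_version ::
    "'a::euclidean_space set \<Rightarrow> real \<Rightarrow> (real \<Rightarrow> 'a \<Rightarrow> real) \<Rightarrow> (real \<Rightarrow> ('a \<Rightarrow> real) \<Rightarrow> real) \<Rightarrow> bool"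
  where
  "Hm1_continuous_version \<Omega> T w F \<longleftrightarrow>
     space_continuous_on {0..T} (Hm1 \<Omega>) (hm1_norm \<Omega>) F \<and>
     (AE t in lebesgue_on {0<..<T}. \<forall>\<phi>\<in>H01 \<Omega>. F t \<phi> = l2_inner \<Omega> (w t) \<phi>)"


section \<open>Weak solutions\<close>

definition space_U :: "'a::euclidean_space set \<Rightarrow> real \<Rightarrow> (real \<Rightarrow> 'a \<Rightarrow> real) set" where
  "space_U \<Omega> T =
     {u \<in> bochner_L2 {0<..<T} (H01 \<Omega>) (h1_norm \<Omega>). \<exists>w. has_time_deriv \<Omega> T u w}"

definition space_V :: "'a::euclidean_space set \<Rightarrow> real \<Rightarrow> (real \<Rightarrow> 'a \<Rightarrow> real) set" where
  "space_V \<Omega> T =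
     {v \<in> space_U \<Omega> T.
        (\<exists>vc. L2_continuous_version \<Omega> T v vc \<and> (AE x in lebesgue_on \<Omega>. vc T x = 0)) \<and>
        (\<exists>z F. has_time_deriv \<Omega> T v z \<and> Hm1_continuous_version \<Omega> T z F \<and>
               (\<forall>\<phi>\<in>H01 \<Omega>. F T \<phi> = 0))}"

text \<open>
  The identity obtained from the equation by pairing it with \<open>v\<close> and integrating by parts in
  time and space.  Here \<open>w\<close> stands for \<open>u\<^sub>t\<close> on \<open>(-\<tau>,T)\<close>, \<open>z\<close> for \<open>v\<^sub>t\<close>, and \<open>v0\<close> for \<open>v(0)\<close>.
  Since \<open>v(T) = 0\<close>, integration by parts gives
  \<open>\<integral> (u\<^sub>t\<^sub>t,v) dt = - \<integral> (u\<^sub>t,v\<^sub>t) dt - (u\<^sub>1,v(0))\<close>, so the initial term carries a minus sign; with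
  a plus sign the identity would be incompatible with \<open>u\<^sub>t(0) = u\<^sub>1\<close> unless \<open>u\<^sub>1 = 0\<close>.  The
  memory term pairs \<open>\<nabla>u(s)\<close> with \<open>\<nabla>v(t)\<close>, the test function being evaluated at the time of
  the outer integral.
\<close>
definition weak_identity ::
    "'a::euclidean_space set \<Rightarrow> (real \<Rightarrow> real) \<Rightarrow> real \<Rightarrow> real \<Rightarrow> real \<Rightarrow> real \<Rightarrow> ('a \<Rightarrow> real) \<Rightarrow>
     (real \<Rightarrow> 'a \<Rightarrow> real) \<Rightarrow> (real \<Rightarrow> 'a \<Rightarrow> real) \<Rightarrow>
     (real \<Rightarrow> 'a \<Rightarrow> real) \<Rightarrow> (real \<Rightarrow> 'a \<Rightarrow> real) \<Rightarrow> ('a \<Rightarrow> real) \<Rightarrow> bool" where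
  "weak_identity \<Omega> g \<mu>1 \<mu>2 \<tau> T u1 u w v z v0 \<longleftrightarrow>
     - (\<integral>t. l2_inner \<Omega> (w t) (z t) \<partial>lebesgue_on {0<..<T})
     + (\<integral>t. l2_inner \<Omega> (weak_grad \<Omega> (u t)) (weak_grad \<Omega> (v t)) \<partial>lebesgue_on {0<..<T})
     - (\<integral>t. (\<integral>s. g (t - s) * l2_inner \<Omega> (weak_grad \<Omega> (u s)) (weak_grad \<Omega> (v t))
               \<partial>lebesgue_on {0<..<t}) \<partial>lebesgue_on {0<..<T})
     + \<mu>1 * (\<integral>t. l2_inner \<Omega> (w t) (v t) \<partial>lebesgue_on {0<..<T})
     + \<mu>2 * (\<integral>t. l2_inner \<Omega> (w (t - \<tau>)) (v t) \<partial>lebesgue_on {0<..<T})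
     - l2_inner \<Omega> v0 u1 = 0"

definition weak_solution ::
    "'a::euclidean_space set \<Rightarrow> (real \<Rightarrow> real) \<Rightarrow> real \<Rightarrow> real \<Rightarrow> real \<Rightarrow> real \<Rightarrow>
     ('a \<Rightarrow> real) \<Rightarrow> ('a \<Rightarrow> real) \<Rightarrow> (real \<Rightarrow> 'a \<Rightarrow> real) \<Rightarrow> (real \<Rightarrow> 'a \<Rightarrow> real) \<Rightarrow> bool" where
  "weak_solution \<Omega> g \<mu>1 \<mu>2 \<tau> T u0 u1 f0 u \<longleftrightarrow>
     u \<in> space_U \<Omega> T \<and>
     (\<exists>uc. L2_continuous_version \<Omega> T u uc \<and> (AE x in lebesgue_on \<Omega>. uc 0 x = u0 x)) \<and>
     (\<exists>w. has_time_deriv \<Omega> T u w \<and>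
          (\<exists>F. Hm1_continuous_version \<Omega> T w F \<and> (\<forall>\<phi>\<in>H01 \<Omega>. F 0 \<phi> = l2_inner \<Omega> u1 \<phi>)) \<and>
          (AE t in lebesgue_on {0<..<\<tau>}. AE x in lebesgue_on \<Omega>. w (t - \<tau>) x = f0 (t - \<tau>) x) \<and>
          (\<forall>v\<in>space_V \<Omega> T. \<forall>z vc.
             has_time_deriv \<Omega> T v z \<longrightarrow> L2_continuous_version \<Omega> T v vc \<longrightarrow>
             weak_identity \<Omega> g \<mu>1 \<mu>2 \<tau> T u1 u w v z (vc 0)))"

end

theory Submission
  imports Defs
begin

text \<open>
No compactness and no approximation scheme is needed: a weak solution comes directly from a
  projection theorem of Lions.  The unknowns are the velocity \<open>w\<close> and the gradient \<open>G\<close>, in the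
  Hilbert space of square integrable functions of time, restricted to the closed subspace in which
  \<open>G\<close> is the gradient of the primitive of \<open>w\<close>.  The weak identity is a family of linear equations,
  one for each test function \<open>v\<close>, and it is solvable as soon as each equation has a multiplier that
  bounds its right-hand side.  The multiplier \<open>\<integral>\<^sub>0\<^sup>t exp (\<gamma> s) v(s) ds\<close> turns the left-hand side into
  the energy identity with the weight \<open>exp (- \<gamma> t)\<close>.  For large \<open>\<gamma>\<close> this absorbs the damping and
  the delay, which are bounded in the velocity, and also the memory term, which is of the same
  order as the energy after one integration by parts in time (this uses that \<open>g\<close> is \<open>C\<^sup>1\<close>).
  Testing with \<open>\<theta>(t) \<phi>(x)\<close> then gives the velocity as a continuous function with values in the
  dual space, together with its initial value.
\<close>

section \<open>Projections and a theorem of Lions\<close>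

text \<open>The energy of a test function controls the weighted primitive of its gradient, not the
  gradient itself. Whatever is paired with that gradient must therefore have an integrable time
  derivative. This holds for the memory term and for the elastic and memory terms left on the right
  when the initial value is subtracted from the unknown. The subtraction makes the displacement
  exactly the primitive of the velocity.

  The gradient operator enters the estimates only through its graph: the closure of the pairs formed
  by a test function and its gradient, a closed subspace of a product of Hilbert spaces. The
  abstract problem thus contains no space variable and lives in arbitrary separable Hilbert spaces.

  Classes of square integrable functions form a type whose values lie in any separable Hilbert space
  and which is again complete and separable. Applying it once to space and once to time gives the
  spaces of the projection theorem. The definitions instead speak of Lebesgue measurable functions
  and seminorms, so a separate layer translates in both directions.\<close>

lemma parallelogram:
  fixes x y :: "'a::real_inner"
  shows "(norm (x - y))\<^sup>2 = 2 * (norm x)\<^sup>2 + 2 * (norm y)\<^sup>2 - (norm (x + y))\<^sup>2"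
  by (simp add: power2_norm_eq_inner inner_simps inner_commute)

text \<open>A minimising sequence for the distance to \<open>S\<close> is Cauchy by the
  parallelogram identity, because midpoints stay in \<open>S\<close>. Orthogonality is the
  first-order condition at the minimiser.\<close>

lemma projection_exists:
  fixes S :: "'a::{real_inner,banach} set"
  assumes S: "subspace S" "closed S"
  shows "\<exists>p\<in>S. \<forall>s\<in>S. (x - p) \<bullet> s = 0"
proof -
  define d where "d = infdist x S"
  have ne: "S \<noteq> {}" using S(1) subspace_0 by blast
  have d_le: "d \<le> norm (x - s)" if "s \<in> S" for s
    using infdist_le[OF that, of x] by (simp add: d_def dist_norm)
  have d0: "d \<ge> 0" by (simp add: d_def infdist_nonneg)
  have "\<exists>s\<in>S. (norm (x - s))\<^sup>2 < d\<^sup>2 + inverse (real (Suc n))" for n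
  proof -
    have "d < sqrt (d\<^sup>2 + inverse (real (Suc n)))"
      using d0 by (intro real_less_rsqrt) simp
    then have "\<exists>s\<in>S. dist x s < sqrt (d\<^sup>2 + inverse (real (Suc n)))"
      unfolding d_def infdist_notempty[OF ne] by (subst (asm) cINF_less_iff) (auto simp: ne)
    then obtain s where s: "s \<in> S" "norm (x - s) < sqrt (d\<^sup>2 + inverse (real (Suc n)))"
      by (auto simp: dist_norm)
    have "(norm (x - s))\<^sup>2 < (sqrt (d\<^sup>2 + inverse (real (Suc n))))\<^sup>2"
      using s(2) by (intro power_strict_mono) auto
    then show ?thesis using s(1) by (intro bexI[of _ s]) auto
  qed
  then obtain s where sS: "\<And>n. s n \<in> S"
    and sd: "\<And>n. (norm (x - s n))\<^sup>2 < d\<^sup>2 + inverse (real (Suc n))" by metis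
  have est: "(norm (s m - s n))\<^sup>2 \<le> 2 * inverse (real (Suc n)) + 2 * inverse (real (Suc m))" for m n
  proof -
    have "(1/2) *\<^sub>R (s n + s m) \<in> S" using S(1) sS by (intro subspace_mul subspace_add)
    from d_le[OF this] have "d\<^sup>2 \<le> (norm (x - (1/2) *\<^sub>R (s n + s m)))\<^sup>2"
      using d0 by (intro power_mono) auto
    moreover have "(x - s n) + (x - s m) = 2 *\<^sub>R (x - (1/2) *\<^sub>R (s n + s m))"
      by (simp add: algebra_simps scaleR_2)
    ultimately have "4 * d\<^sup>2 \<le> (norm ((x - s n) + (x - s m)))\<^sup>2"
      by (simp add: power_mult_distrib)
    moreover have "s m - s n = (x - s n) - (x - s m)" by simp
    ultimately show ?thesis using parallelogram[of "x - s n" "x - s m"] sd[of n] sd[of m] by simp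
  qed
  have "Cauchy s"
  proof (rule CauchyI)
    fix e :: real assume e: "e > 0"
    obtain N where N: "inverse (real (Suc N)) < e\<^sup>2 / 4" using reals_Archimedean[of "e\<^sup>2/4"] e by auto
    have "norm (s m - s n) < e" if "m \<ge> N" "n \<ge> N" for m n
    proof -
      have "inverse (real (Suc n)) \<le> inverse (real (Suc N))" "inverse (real (Suc m)) \<le> inverse (real (Suc N))"
        using that by (auto simp: divide_simps)
      then have "(norm (s m - s n))\<^sup>2 < e\<^sup>2" using est[of m n] N by linarith
      then show ?thesis using e by (simp add: power2_less_imp_less)
    qed
    then show "\<exists>M. \<forall>m\<ge>M. \<forall>n\<ge>M. norm (s m - s n) < e" by blast
  qed
  then obtain p where p: "s \<longlonglongrightarrow> p" using Cauchy_convergent_iff convergent_def by blast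
  have pS: "p \<in> S" using closed_sequentially[OF S(2) _ p] sS by blast
  have "(\<lambda>n. (norm (x - s n))\<^sup>2) \<longlonglongrightarrow> (norm (x - p))\<^sup>2" by (intro tendsto_intros p)
  moreover have "(\<lambda>n. d\<^sup>2 + inverse (real (Suc n))) \<longlonglongrightarrow> d\<^sup>2 + 0"
    by (intro tendsto_intros LIMSEQ_inverse_real_of_nat)
  ultimately have pd: "(norm (x - p))\<^sup>2 \<le> d\<^sup>2"
    using sd by (intro LIMSEQ_le[of _ _ "\<lambda>n. d\<^sup>2 + inverse (real (Suc n))"]) (auto intro: less_imp_le)
  have "(x - p) \<bullet> t = 0" if t: "t \<in> S" for t
  proof (cases "t = 0")
    case False
    \<comment> \<open>This scalar minimises the distance from \<open>x - p\<close> to the line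
      spanned by \<open>t\<close>; minimality of \<open>p\<close> then forces the square of the
      inner product to be nonpositive.\<close>
    define c where "c = ((x - p) \<bullet> t) / (t \<bullet> t)"
    have "p + c *\<^sub>R t \<in> S" using S(1) pS t by (intro subspace_mul subspace_add)
    from d_le[OF this] have "d\<^sup>2 \<le> (norm (x - (p + c *\<^sub>R t)))\<^sup>2"
      using d0 by (intro power_mono) auto
    with pd have "(norm (x - p))\<^sup>2 \<le> (norm ((x - p) - c *\<^sub>R t))\<^sup>2"
      unfolding diff_diff_eq by (rule order_trans)
    also have "\<dots> = (norm (x - p))\<^sup>2 - 2 * c * ((x - p) \<bullet> t) + c * c * (t \<bullet> t)"
      unfolding power2_norm_eq_inner by (simp add: inner_simps inner_commute algebra_simps)
    also have "c * c * (t \<bullet> t) = c * ((x - p) \<bullet> t)" using False by (simp add: c_def)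
    finally have "c * ((x - p) \<bullet> t) \<le> 0" by simp
    then have "((x - p) \<bullet> t)\<^sup>2 / (t \<bullet> t) \<le> 0" by (simp add: c_def power2_eq_square)
    moreover have "t \<bullet> t > 0" using False by simp
    ultimately have "((x - p) \<bullet> t)\<^sup>2 \<le> 0" by (simp add: divide_le_0_iff)
    then show ?thesis by simp
  qed simp
  then show ?thesis using pS by blast
qed

definition hproj :: "'a::{real_inner,banach} set \<Rightarrow> 'a \<Rightarrow> 'a" where
  "hproj S x = (SOME p. p \<in> S \<and> (\<forall>s\<in>S. (x - p) \<bullet> s = 0))"

context
  fixes S :: "'a::{real_inner,banach} set"
  assumes S: "subspace S" "closed S"
begin

lemma hproj_in: "hproj S x \<in> S" and hproj_orth: "s \<in> S \<Longrightarrow> (x - hproj S x) \<bullet> s = 0"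
proof -
  have "\<exists>p. p \<in> S \<and> (\<forall>s\<in>S. (x - p) \<bullet> s = 0)" using projection_exists[OF S] by blast
  from someI_ex[OF this] show "hproj S x \<in> S" "s \<in> S \<Longrightarrow> (x - hproj S x) \<bullet> s = 0"
    by (auto simp: hproj_def)
qed

text \<open>Two candidates differ by an element of \<open>S\<close> that is orthogonal to
  \<open>S\<close>, hence to itself. Linearity of \<open>hproj\<close> is read off from this
  characterisation.\<close>

lemma hproj_unique: "p \<in> S \<Longrightarrow> (\<And>s. s \<in> S \<Longrightarrow> (x - p) \<bullet> s = 0) \<Longrightarrow> hproj S x = p"
proof -
  assume p: "p \<in> S" "\<And>s. s \<in> S \<Longrightarrow> (x - p) \<bullet> s = 0"
  let ?d = "hproj S x - p"
  have "?d \<in> S" using p hproj_in S(1) by (intro subspace_diff)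
  then have "(x - p) \<bullet> ?d - (x - hproj S x) \<bullet> ?d = 0" using p hproj_orth by simp
  then have "?d \<bullet> ?d = 0" by (simp add: inner_simps)
  then show ?thesis by simp
qed

lemma hproj_id: "x \<in> S \<Longrightarrow> hproj S x = x"
  by (rule hproj_unique) auto

lemma hproj_inner: "s \<in> S \<Longrightarrow> s \<bullet> hproj S x = s \<bullet> x"
  using hproj_orth[of s x] by (simp add: inner_simps inner_commute)

lemma hproj_bounded_linear: "bounded_linear (hproj S)"
proof (rule bounded_linear_intro[of _ 1])
  show "hproj S (x + y) = hproj S x + hproj S y" for x y
    using hproj_orth[of _ x] hproj_orth[of _ y] hproj_in S(1)
    by (intro hproj_unique subspace_add) (auto simp: inner_simps)
  show "hproj S (r *\<^sub>R x) = r *\<^sub>R hproj S x" for r x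
  proof (intro hproj_unique subspace_mul S(1) hproj_in)
    fix s assume "s \<in> S"
    then show "(r *\<^sub>R x - r *\<^sub>R hproj S x) \<bullet> s = 0"
      using hproj_orth[of s x] by (simp add: scaleR_diff_right[symmetric])
  qed
  show "norm (hproj S x) \<le> norm x * 1" for x
  proof -
    have "(norm (hproj S x))\<^sup>2 = hproj S x \<bullet> x"
      using hproj_inner[OF hproj_in] by (simp add: power2_norm_eq_inner)
    also have "\<dots> \<le> norm (hproj S x) * norm x" by (rule norm_cauchy_schwarz)
    finally show ?thesis by (cases "hproj S x = 0") (auto simp: power2_eq_square)
  qed
qed

end

lemma subspace_closure:
  fixes S :: "'a::real_normed_vector set"
  assumes "subspace S" shows "subspace (closure S)"
proof (rule subspaceI)
  show "0 \<in> closure S" using assms closure_subset subspace_0 by blast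
next
  fix x y assume "x \<in> closure S" "y \<in> closure S"
  then obtain u v where "\<And>n. u n \<in> S" "u \<longlonglongrightarrow> x" "\<And>n. v n \<in> S" "v \<longlonglongrightarrow> y"
    by (metis closure_sequential)
  then show "x + y \<in> closure S"
    unfolding closure_sequential using assms
    by (intro exI[of _ "\<lambda>n. u n + v n"]) (auto intro: tendsto_add subspace_add)
next
  fix c x assume "x \<in> closure S"
  then obtain u where "\<And>n. u n \<in> S" "u \<longlonglongrightarrow> x" by (metis closure_sequential)
  then show "c *\<^sub>R x \<in> closure S"
    unfolding closure_sequential using assms
    by (intro exI[of _ "\<lambda>n. c *\<^sub>R u n"]) (auto intro: tendsto_scaleR subspace_mul)
qed

text \<open>The residual of the projection onto the closure is orthogonal to \<open>S\<close>, hence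
  zero. This reduces separability of the space of classes to a vanishing statement.\<close>

lemma dense_if_orth_trivial:
  fixes S :: "'a::{real_inner,banach} set"
  assumes "subspace S" "\<And>x. (\<And>s. s \<in> S \<Longrightarrow> x \<bullet> s = 0) \<Longrightarrow> x = 0"
  shows "closure S = UNIV"
proof -
  have C: "subspace (closure S)" "closed (closure S)"
    using assms(1) by (auto simp: subspace_closure)
  have "x \<in> closure S" for x
  proof -
    have "x - hproj (closure S) x = 0"
      using hproj_orth[OF C] closure_subset by (intro assms(2)) blast
    then show ?thesis using hproj_in[OF C, of x] by simp
  qed
  then show ?thesis by blast
qed

text \<open>
  The set \<open>S\<close> is the graph of a linear problem \<open>f \<bullet> y = c\<close>.  Solvability in \<open>F\<close> follows
  since the a priori estimate keeps \<open>(0, 1)\<close> out of the closure of the graph projected to \<open>F\<close>.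
\<close>
theorem lions_projection:
  fixes F :: "'a::{real_inner,banach} set" and S :: "('a \<times> real) set"
  assumes F: "subspace F" "closed F" and S: "subspace S" and C: "C \<ge> 0"
    and est: "\<And>y c. (y, c) \<in> S \<Longrightarrow> \<exists>f\<in>F. \<bar>c\<bar> * norm f \<le> C * (f \<bullet> y) \<and> (c \<noteq> 0 \<longrightarrow> f \<noteq> 0)"
  shows "\<exists>f\<in>F. \<forall>(y, c)\<in>S. f \<bullet> y = c"
proof -
  \<comment> \<open>Elements of \<open>F\<close> see only the component of \<open>y\<close> in
    \<open>F\<close>. Projecting the graph first makes the solution a vector of
    \<open>F\<close>.\<close>
  define P where "P = (\<lambda>(y, c::real). (hproj F y, c))"
  interpret h: bounded_linear "hproj F" by (rule hproj_bounded_linear[OF F])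
  have "linear P"
    unfolding P_def by (rule linearI) (auto simp: h.add h.scaleR)
  then have P: "subspace (P ` S)" using S by (rule linear_subspace_image)
  define R where "R = closure (P ` S)"
  have R: "subspace R" "closed R" using P by (auto simp: R_def subspace_closure)
  have bd: "\<bar>c\<bar> \<le> C * norm (hproj F y)" if yc: "(y, c) \<in> S" for y c
  proof (cases "c = 0")
    case False
    obtain f where f: "f \<in> F" "\<bar>c\<bar> * norm f \<le> C * (f \<bullet> y)" "f \<noteq> 0"
      using est[OF yc] False by blast
    have "f \<bullet> y = f \<bullet> hproj F y" using hproj_inner[OF F f(1)] by simp
    also have "\<dots> \<le> norm f * norm (hproj F y)" by (rule norm_cauchy_schwarz)
    finally have "\<bar>c\<bar> * norm f \<le> C * (norm f * norm (hproj F y))"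
      using f(2) C by (meson mult_left_mono order_trans)
    then show ?thesis using f(3) by (simp add: mult_ac)
  qed (use C in auto)
  have "closed {q :: 'a \<times> real. \<bar>snd q\<bar> \<le> C * norm (fst q)}"
    by (intro closed_Collect_le continuous_intros)
  moreover have "P ` S \<subseteq> {q. \<bar>snd q\<bar> \<le> C * norm (fst q)}" using bd by (auto simp: P_def)
  ultimately have "R \<subseteq> {q. \<bar>snd q\<bar> \<le> C * norm (fst q)}"
    unfolding R_def by (intro closure_minimal)
  then have "(0, 1) \<notin> R" by auto
  \<comment> \<open>The component of (0, 1) orthogonal to \<open>R\<close> is a normal vector of the
    projected graph. Its second coordinate equals its squared norm and is positive; dividing by it
    expresses \<open>c\<close> as a linear functional of \<open>y\<close>.\<close>
  define q where "q = (0, 1) - hproj R (0, 1)"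
  have q: "q \<noteq> 0" using hproj_in[OF R, of "(0,1)"] \<open>(0, 1) \<notin> R\<close> by (auto simp: q_def)
  have qo: "q \<bullet> r = 0" if "r \<in> R" for r using hproj_orth[OF R that] by (simp add: q_def)
  have "q \<bullet> q = q \<bullet> (0, 1) - q \<bullet> hproj R (0, 1)" by (simp add: q_def inner_diff_right)
  also have "\<dots> = q \<bullet> (0, 1)" using qo hproj_in[OF R] by simp
  finally have b: "snd q > 0" using q by (metis inner_gt_zero_iff inner_Pair inner_zero_right prod.collapse add_0 inner_real_def mult.right_neutral)
  define f where "f = - (1 / snd q) *\<^sub>R hproj F (fst q)"
  have "f \<bullet> y = c" if yc: "(y, c) \<in> S" for y c
  proof -
    have "(hproj F y, c) \<in> R"
      using yc closure_subset[of "P ` S"] by (auto simp: R_def P_def image_iff split: prod.splits)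
    from qo[OF this] have "fst q \<bullet> hproj F y + snd q * c = 0"
      by (cases q) auto
    moreover have "fst q \<bullet> hproj F y = hproj F (fst q) \<bullet> y"
      using hproj_inner[OF F hproj_in[OF F], of y "fst q"] hproj_inner[OF F hproj_in[OF F], of "fst q" y]
      by (simp add: inner_commute)
    ultimately have "hproj F (fst q) \<bullet> y = - (snd q * c)" by simp
    then show ?thesis using b by (simp add: f_def)
  qed
  moreover have "f \<in> F" unfolding f_def using F hproj_in by (intro subspace_mul)  auto
  ultimately show ?thesis by blast
qed

section \<open>Square integrable functions with values in a Hilbert space\<close>

text \<open>Boxes whose closure lies inside \<open>\<Omega>\<close> ask only for local integrability
  there. On one such box the positive and the negative part of \<open>f\<close> define finite
  measures that agree on an intersection-stable generator, the rational boxes, so they coincide.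
  Countably many boxes cover \<open>\<Omega>\<close>.\<close>

lemma lborel_AE_zero_if_box_integrals_zero:
  fixes f :: "'a::euclidean_space \<Rightarrow> real"
  assumes [measurable]: "f \<in> borel_measurable lborel" and "open \<Omega>"
    and int: "\<And>a b. (\<forall>i\<in>Basis. a \<bullet> i \<in> \<rat> \<and> b \<bullet> i \<in> \<rat>) \<Longrightarrow> cbox a b \<subseteq> \<Omega> \<Longrightarrow>
          integrable lborel (\<lambda>x. indicator (box a b) x * f x)"
    and zero: "\<And>a b. (\<forall>i\<in>Basis. a \<bullet> i \<in> \<rat> \<and> b \<bullet> i \<in> \<rat>) \<Longrightarrow> cbox a b \<subseteq> \<Omega> \<Longrightarrow>
          (\<integral>x. indicator (box a b) x * f x \<partial>lborel) = 0"
  shows "AE x in lborel. x \<in> \<Omega> \<longrightarrow> f x = 0"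
proof -
  define rat where "rat = {a :: 'a. \<forall>i\<in>Basis. a \<bullet> i \<in> \<rat>}"
  define G where "G = {box a b |a b. a \<in> rat \<and> b \<in> rat}"
  have Gi: "Int_stable G"
  proof (rule Int_stableI)
    fix A B assume "A \<in> G" "B \<in> G"
    then obtain a b c d where "A = box a b" "B = box c d" "a \<in> rat" "b \<in> rat" "c \<in> rat" "d \<in> rat"
      by (auto simp: G_def)
    then show "A \<inter> B \<in> G" unfolding G_def mem_Collect_eq
      by (intro exI[of _ "\<Sum>i\<in>Basis. max (a \<bullet> i) (c \<bullet> i) *\<^sub>R i"] exI[of _ "\<Sum>i\<in>Basis. min (b \<bullet> i) (d \<bullet> i) *\<^sub>R i"])
         (auto simp: box_Int_box rat_def max_def min_def)
  qed
  have Gs: "sets borel = sigma_sets UNIV G"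
  proof -
    have "(borel :: 'a measure) = sigma UNIV G"
    proof (unfold borel_def, rule sigma_eqI)
      show "sigma_sets UNIV {S::'a set. open S} = sigma_sets UNIV G"
      proof (rule sigma_sets_eqI)
        fix M :: "'a set" assume "M \<in> {S. open S}"
        then have M: "open M" by simp
        let ?I = "{f \<in> Basis \<rightarrow>\<^sub>E \<rat> \<times> \<rat>. box (\<Sum>i\<in>Basis. fst (f i) *\<^sub>R i) (\<Sum>i\<in>Basis. snd (f i) *\<^sub>R i) \<subseteq> M}"
        have "countable ?I" using countable_rat by (intro countable_Collect countable_PiE) auto
        moreover have "box (\<Sum>i\<in>Basis. fst (f i) *\<^sub>R i) (\<Sum>i\<in>Basis. snd (f i) *\<^sub>R i) \<in> G" if "f \<in> ?I" for f
        proof -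
          have "fst (f i) \<in> \<rat>" "snd (f i) \<in> \<rat>" if "i \<in> Basis" for i
            using \<open>f \<in> ?I\<close> that by (auto simp: PiE_iff mem_Times_iff)
          then show ?thesis unfolding G_def rat_def mem_Collect_eq
            by (intro exI[of _ "\<Sum>i\<in>Basis. fst (f i) *\<^sub>R i"] exI[of _ "\<Sum>i\<in>Basis. snd (f i) *\<^sub>R i"]) auto
        qed
        ultimately show "M \<in> sigma_sets UNIV G"
          by (subst open_UNION_box[OF M]) (intro sigma_sets_UNION[OF countable_image], auto)
      next
        fix B assume "B \<in> G"
        then show "B \<in> sigma_sets UNIV {S. open S}" by (auto simp: G_def)
      qed
    qed auto
    moreover have "sets (sigma UNIV G) = sigma_sets UNIV G" by (rule sets_measure_of) auto
    ultimately show ?thesis by metis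
  qed
  \<comment> \<open>On a single box \<open>f\<close> is integrable and may be replaced by its
    cut-off \<open>h\<close>; the integral of \<open>h\<close> over a rational box is that of
    \<open>f\<close> over the intersection, again a rational box inside
    \<open>\<Omega>\<close>.\<close>
  have box0: "AE x in lborel. x \<in> box u v \<longrightarrow> f x = 0" if uv: "u \<in> rat" "v \<in> rat" "cbox u v \<subseteq> \<Omega>" for u v
  proof -
    define h where "h x = indicator (box u v) x * f x" for x
    have [measurable]: "h \<in> borel_measurable borel" unfolding h_def by measurable
    have hint: "integrable lborel h" unfolding h_def using uv by (intro int) (auto simp: rat_def)
    have hz: "(\<integral>x. indicator (box a b) x * h x \<partial>lborel) = 0" if "a \<in> rat" "b \<in> rat" for a b
    proof -
      define c where "c = (\<Sum>i\<in>Basis. max (a \<bullet> i) (u \<bullet> i) *\<^sub>R i)"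
      define d where "d = (\<Sum>i\<in>Basis. min (b \<bullet> i) (v \<bullet> i) *\<^sub>R i)"
      have "box a b \<inter> box u v = box c d" by (simp add: box_Int_box c_def d_def)
      then have "indicator (box a b) x * h x = indicator (box c d) x * f x" for x
        by (metis h_def indicator_inter_arith mult.assoc)
      moreover have "c \<in> rat" "d \<in> rat" using that uv by (auto simp: c_def d_def rat_def max_def min_def)
      moreover have "cbox c d \<subseteq> \<Omega>"
      proof -
        have "cbox c d \<subseteq> cbox u v" unfolding c_def d_def by (auto simp: mem_box)
        then show ?thesis using uv by blast
      qed
      ultimately show ?thesis using zero by (simp add: rat_def)
    qed
    define m1 where "m1 = density lborel (\<lambda>x. ennreal (h x))"
    define m2 where "m2 = density lborel (\<lambda>x. ennreal (- h x))"
    have fin: "(\<integral>\<^sup>+x. ennreal (h x) \<partial>lborel) < \<infinity>" "(\<integral>\<^sup>+x. ennreal (- h x) \<partial>lborel) < \<infinity>"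
      using hint unfolding real_integrable_def by (auto simp: top.not_eq_extremum)
    have eqG: "emeasure m1 X = emeasure m2 X" if X: "X \<in> G" for X
    proof -
      obtain a b where ab: "X = box a b" "a \<in> rat" "b \<in> rat" using X by (auto simp: G_def)
      have i: "integrable lborel (\<lambda>x. indicator X x * h x)"
        using integrable_mult_indicator[OF _ hint, of X] ab by simp
      have f: "(\<integral>\<^sup>+x. ennreal (indicator X x * h x) \<partial>lborel) \<noteq> \<infinity>"
              "(\<integral>\<^sup>+x. ennreal (- (indicator X x * h x)) \<partial>lborel) \<noteq> \<infinity>"
        using i unfolding real_integrable_def by auto
      have "enn2real (\<integral>\<^sup>+x. ennreal (indicator X x * h x) \<partial>lborel)
          = enn2real (\<integral>\<^sup>+x. ennreal (- (indicator X x * h x)) \<partial>lborel)"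
        using real_lebesgue_integral_def[OF i] hz[OF ab(2,3)] ab by simp
      then have "(\<integral>\<^sup>+x. ennreal (indicator X x * h x) \<partial>lborel)
          = (\<integral>\<^sup>+x. ennreal (- (indicator X x * h x)) \<partial>lborel)"
        using f by (metis ennreal_enn2real infinity_ennreal_def top.not_eq_extremum)
      moreover have "emeasure m1 X = (\<integral>\<^sup>+x. ennreal (indicator X x * h x) \<partial>lborel)"
        unfolding m1_def using ab by (subst emeasure_density) (auto intro!: nn_integral_cong simp: indicator_def)
      moreover have "emeasure m2 X = (\<integral>\<^sup>+x. ennreal (- (indicator X x * h x)) \<partial>lborel)"
        unfolding m2_def using ab by (subst emeasure_density) (auto intro!: nn_integral_cong simp: indicator_def)
      ultimately show ?thesis by simp
    qed
    have "m1 = m2"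
    proof (rule measure_eqI_generator_eq[where E=G and \<Omega>=UNIV and A="\<lambda>n::nat. box (- (real n *\<^sub>R One)) (real n *\<^sub>R One)"])
      show "Int_stable G" by (rule Gi)
      show "G \<subseteq> Pow UNIV" by simp
      show "emeasure m1 X = emeasure m2 X" if "X \<in> G" for X by (rule eqG[OF that])
      show "sets m1 = sigma_sets UNIV G" "sets m2 = sigma_sets UNIV G" using Gs by (simp_all add: m1_def m2_def)
      show "range (\<lambda>n::nat. box (- (real n *\<^sub>R One)) (real n *\<^sub>R One)) \<subseteq> G"
        unfolding G_def rat_def by force
      show "(\<Union>n::nat. box (- (real n *\<^sub>R One)) (real n *\<^sub>R One)) = (UNIV :: 'a set)"
        using UN_box_eq_UNIV by simp
      have "emeasure m1 X \<le> (\<integral>\<^sup>+x. ennreal (h x) \<partial>lborel)" if "X \<in> sets borel" for X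
        unfolding m1_def using that by (subst emeasure_density) (auto intro!: nn_integral_mono simp: indicator_def)
      then show "emeasure m1 (box (- (real n *\<^sub>R One)) (real n *\<^sub>R One)) \<noteq> \<infinity>" for n :: nat
        using fin(1) by (metis box_borel infinity_ennreal_def neq_top_trans top.not_eq_extremum)
    qed
    \<comment> \<open>Where \<open>h\<close> is positive, the density of \<open>m2\<close> is a
      truncated negative number and vanishes. Equality of the measures transfers this to
      \<open>m1\<close>, whose density is positive there, so the set is null.\<close>
    have "emeasure m1 {x. h x > 0} = emeasure m2 {x. h x > 0}" by (simp add: \<open>m1 = m2\<close>)
    moreover have "emeasure m2 {x. h x > 0} = 0"
      unfolding m2_def by (subst emeasure_density) (auto simp: nn_integral_0_iff_AE indicator_def ennreal_neg)
    ultimately have "emeasure m1 {x. h x > 0} = 0" by simp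
    then have p: "AE x in lborel. \<not> h x > 0"
      unfolding m1_def by (subst (asm) emeasure_density) (auto simp: nn_integral_0_iff_AE indicator_def)
    have "emeasure m2 {x. h x < 0} = emeasure m1 {x. h x < 0}" by (simp add: \<open>m1 = m2\<close>)
    moreover have "emeasure m1 {x. h x < 0} = 0"
      unfolding m1_def by (subst emeasure_density) (auto simp: nn_integral_0_iff_AE indicator_def ennreal_neg)
    ultimately have "emeasure m2 {x. h x < 0} = 0" by simp
    then have n: "AE x in lborel. \<not> h x < 0"
      unfolding m2_def by (subst (asm) emeasure_density) (auto simp: nn_integral_0_iff_AE indicator_def)
    from p n show ?thesis by eventually_elim (auto simp: h_def indicator_def)
  qed
  define I where "I = {(u, v). u \<in> rat \<and> v \<in> rat \<and> cbox u v \<subseteq> \<Omega>}"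
  have "\<exists>u v. (u, v) \<in> I \<and> x \<in> box u v" if x: "x \<in> \<Omega>" for x
  proof -
    obtain e where e: "e > 0" "cball x e \<subseteq> \<Omega>" using \<open>open \<Omega>\<close> x open_contains_cball by blast
    obtain a b where ab: "\<forall>i\<in>Basis. a \<bullet> i \<in> \<rat> \<and> b \<bullet> i \<in> \<rat>" "x \<in> box a b" "box a b \<subseteq> ball x e"
      using rational_boxes[OF e(1), of x] by blast
    have "cbox a b = closure (box a b)" using ab(2) by (intro closure_box[symmetric]) auto
    also have "\<dots> \<subseteq> cball x e" using ab(3) ball_subset_cball by (intro closure_minimal) blast+
    finally have "cbox a b \<subseteq> \<Omega>" using e by blast
    then show ?thesis using ab unfolding I_def rat_def by blast
  qed
  moreover have "box u v \<subseteq> \<Omega>" if "(u, v) \<in> I" for u v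
    using that box_subset_cbox[of u v] unfolding I_def by blast
  ultimately have \<Omega>: "\<Union>((\<lambda>(u,v). box u v) ` I) = \<Omega>" by blast
  obtain J where J: "J \<subseteq> (\<lambda>(u,v). box u v) ` I" "countable J" "\<Union>J = \<Union>((\<lambda>(u,v). box u v) ` I)"
    by (rule Lindelof[of "(\<lambda>(u,v). box u v) ` I"]) auto
  have JO: "\<Union>J = \<Omega>" using J(3) \<Omega> by (rule trans)
  have "AE x in lborel. x \<in> B \<longrightarrow> f x = 0" if B: "B \<in> J" for B
  proof -
    obtain u v where uv: "B = box u v" "(u, v) \<in> I" using subsetD[OF J(1) B] by (elim imageE) (simp split: prod.splits)
    then have "u \<in> rat" "v \<in> rat" "cbox u v \<subseteq> \<Omega>" by (simp_all add: I_def)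
    then show ?thesis unfolding uv(1) by (rule box0)
  qed
  then have "AE x in lborel. \<forall>B\<in>J. x \<in> B \<longrightarrow> f x = 0"
    using J(2) by (subst AE_ball_countable) auto
  then show ?thesis by eventually_elim (use JO in blast)
qed

section \<open>Square integrable functions and their space of classes\<close>

definition sqint :: "('a::euclidean_space \<Rightarrow> 'b::{real_inner,banach,second_countable_topology}) \<Rightarrow> bool" where
  "sqint f \<longleftrightarrow> f \<in> borel_measurable borel \<and> integrable lborel (\<lambda>x. (norm (f x))\<^sup>2)"

lemma sqint_measurable: "sqint f \<Longrightarrow> f \<in> borel_measurable borel"
  by (simp add: sqint_def)

lemma sqint_bound:
  assumes "sqint f" "g \<in> borel_measurable borel" "AE x in lborel. norm (g x) \<le> c * norm (f x)"
  shows "sqint g"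
  unfolding sqint_def
proof
  show "integrable lborel (\<lambda>x. (norm (g x))\<^sup>2)"
  proof (rule Bochner_Integration.integrable_bound)
    show "integrable lborel (\<lambda>x. c\<^sup>2 * (norm (f x))\<^sup>2)" using assms(1) by (simp add: sqint_def)
    show "AE x in lborel. norm ((norm (g x))\<^sup>2) \<le> norm (c\<^sup>2 * (norm (f x))\<^sup>2)"
      using assms(3)
    proof eventually_elim
      case (elim x)
      then have "(norm (g x))\<^sup>2 \<le> (c * norm (f x))\<^sup>2" by (intro power_mono) auto
      then show ?case by (simp add: power_mult_distrib)
    qed
  qed (use assms in measurable)
qed (rule assms)

lemma sqint_inner_integrable:
  assumes "sqint f" "sqint g" shows "integrable lborel (\<lambda>x. f x \<bullet> g x)"
proof (rule Bochner_Integration.integrable_bound)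
  show "integrable lborel (\<lambda>x. (norm (f x))\<^sup>2 + (norm (g x))\<^sup>2)" using assms by (simp add: sqint_def)
  show "AE x in lborel. norm (f x \<bullet> g x) \<le> norm ((norm (f x))\<^sup>2 + (norm (g x))\<^sup>2)"
  proof (rule AE_I2)
    fix x
    have "\<bar>f x \<bullet> g x\<bar> \<le> norm (f x) * norm (g x)" by (rule Cauchy_Schwarz_ineq2)
    also have "\<dots> \<le> (norm (f x))\<^sup>2 + (norm (g x))\<^sup>2"
      using sum_squares_bound[of "norm (f x)" "norm (g x)"] mult_nonneg_nonneg[OF norm_ge_zero norm_ge_zero, of "f x" "g x"] by linarith
    finally show "norm (f x \<bullet> g x) \<le> norm ((norm (f x))\<^sup>2 + (norm (g x))\<^sup>2)" by simp
  qed
qed (use assms in \<open>intro borel_measurable_inner; simp add: sqint_def\<close>)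

lemma sqint_zero: "sqint (\<lambda>x. 0)" by (simp add: sqint_def)

lemma sqint_scaleR: assumes "sqint f" shows "sqint (\<lambda>x. c *\<^sub>R f x)"
  using assms by (intro sqint_bound[OF assms, where c="\<bar>c\<bar>"]) (auto simp: sqint_def)

lemma sqint_add: assumes "sqint f" "sqint g" shows "sqint (\<lambda>x. f x + g x)"
  unfolding sqint_def
proof
  show "integrable lborel (\<lambda>x. (norm (f x + g x))\<^sup>2)"
    unfolding power2_norm_eq_inner inner_add_left inner_add_right
    using assms by (intro Bochner_Integration.integrable_add sqint_inner_integrable)
qed (use assms in \<open>intro borel_measurable_add; simp add: sqint_def\<close>)

lemma sqint_uminus: "sqint f \<Longrightarrow> sqint (\<lambda>x. - f x)"
  using sqint_scaleR[of f "-1"] by simp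

lemma sqint_diff: "sqint f \<Longrightarrow> sqint g \<Longrightarrow> sqint (\<lambda>x. f x - g x)"
  using sqint_add[of f "\<lambda>x. - g x"] sqint_uminus[of g] by simp

\<comment> \<open>The relation is partial because only square integrable functions have a class. The
  sort of the values is proved below for the quotient as well, so the construction can be iterated:
  functions of time whose values are classes of functions of the space variable.\<close>
quotient_type (overloaded) ('a, 'b) lsq =
  "'a::euclidean_space \<Rightarrow> 'b::{real_inner,banach,second_countable_topology}" / partial:
  "\<lambda>f g. sqint f \<and> sqint g \<and> (AE x in lborel. f x = g x)"
proof (rule part_equivpI)
  show "\<exists>f::'a\<Rightarrow>'b. sqint f \<and> sqint f \<and> (AE x in lborel. f x = f x)"
    using sqint_zero by auto
qed (auto simp: symp_def transp_def elim!: eventually_elim2)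

instantiation lsq :: (euclidean_space, "{real_inner,banach,second_countable_topology}") real_vector
begin

lift_definition zero_lsq :: "('a, 'b) lsq" is "\<lambda>x. 0" by (simp add: sqint_zero)
lift_definition plus_lsq :: "('a, 'b) lsq \<Rightarrow> ('a, 'b) lsq \<Rightarrow> ('a, 'b) lsq" is "\<lambda>f g x. f x + g x"
  by (auto simp: sqint_add elim!: eventually_elim2)
lift_definition minus_lsq :: "('a, 'b) lsq \<Rightarrow> ('a, 'b) lsq \<Rightarrow> ('a, 'b) lsq" is "\<lambda>f g x. f x - g x"
  by (auto simp: sqint_diff elim!: eventually_elim2)
lift_definition uminus_lsq :: "('a, 'b) lsq \<Rightarrow> ('a, 'b) lsq" is "\<lambda>f x. - f x"
  by (auto simp: sqint_uminus elim!: eventually_mono)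
lift_definition scaleR_lsq :: "real \<Rightarrow> ('a, 'b) lsq \<Rightarrow> ('a, 'b) lsq" is "\<lambda>c f x. c *\<^sub>R f x"
  by (auto simp: sqint_scaleR elim!: eventually_mono)
instance
proof
  fix a b c :: "('a, 'b) lsq" and r s :: real
  show "a + b + c = a + (b + c)" by transfer (auto simp: sqint_add add.assoc)
  show "a + b = b + a" by transfer (auto simp: sqint_add add.commute)
  show "0 + a = a" by transfer auto
  show "- a + a = 0" by transfer (auto simp: sqint_zero)
  show "a - b = a + - b" by transfer (auto simp: sqint_diff)
  show "r *\<^sub>R (a + b) = r *\<^sub>R a + r *\<^sub>R b"
    by transfer (auto simp: sqint_add sqint_scaleR scaleR_add_right[symmetric])
  show "(r + s) *\<^sub>R a = r *\<^sub>R a + s *\<^sub>R a"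
    by transfer (auto simp: sqint_add sqint_scaleR scaleR_add_left[symmetric])
  show "r *\<^sub>R s *\<^sub>R a = (r * s) *\<^sub>R a" by transfer (auto simp: sqint_scaleR)
  show "1 *\<^sub>R a = a" by transfer auto
qed

end

instantiation lsq :: (euclidean_space, "{real_inner,banach,second_countable_topology}") real_inner
begin

lift_definition inner_lsq :: "('a, 'b) lsq \<Rightarrow> ('a, 'b) lsq \<Rightarrow> real" is "\<lambda>f g. \<integral>x. f x \<bullet> g x \<partial>lborel"
  by (intro integral_cong_AE) (auto simp: sqint_def elim!: eventually_elim2)
definition norm_lsq :: "('a, 'b) lsq \<Rightarrow> real" where "norm_lsq f = sqrt (f \<bullet> f)"
definition dist_lsq :: "('a, 'b) lsq \<Rightarrow> ('a, 'b) lsq \<Rightarrow> real" where "dist_lsq f g = norm (f - g)"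
definition sgn_lsq :: "('a, 'b) lsq \<Rightarrow> ('a, 'b) lsq" where "sgn_lsq f = inverse (norm f) *\<^sub>R f"
definition uniformity_lsq :: "(('a, 'b) lsq \<times> ('a, 'b) lsq) filter" where
  "uniformity_lsq = (INF e\<in>{0 <..}. principal {(x, y). dist x y < e})"
definition open_lsq :: "('a, 'b) lsq set \<Rightarrow> bool" where
  "open_lsq U \<longleftrightarrow> (\<forall>x\<in>U. eventually (\<lambda>(x', y). x' = x \<longrightarrow> y \<in> U) uniformity)"

instance
proof
  fix a b c :: "('a, 'b) lsq" and r s :: real and U :: "('a, 'b) lsq set"
  show "dist a b = norm (a - b)" by (simp add: dist_lsq_def)
  show "sgn a = a /\<^sub>R norm a" by (simp add: sgn_lsq_def)
  show "uniformity = (INF e\<in>{0 <..}. principal {(x, y::('a, 'b) lsq). dist x y < e})"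
    by (simp add: uniformity_lsq_def)
  show "open U \<longleftrightarrow> (\<forall>x\<in>U. \<forall>\<^sub>F (x', y) in uniformity. x' = x \<longrightarrow> y \<in> U)" by (simp add: open_lsq_def)
  show "a \<bullet> b = b \<bullet> a" by transfer (simp add: inner_commute)
  show "(a + b) \<bullet> c = a \<bullet> c + b \<bullet> c" by transfer (auto simp: inner_add_left sqint_inner_integrable)
  show "(r *\<^sub>R a) \<bullet> b = r * (a \<bullet> b)" by transfer auto
  show "0 \<le> a \<bullet> a" by transfer simp
  show "(a \<bullet> a = 0) = (a = 0)"
    by transfer (auto simp: integral_nonneg_eq_0_iff_AE sqint_inner_integrable sqint_zero)
  show "norm a = sqrt (a \<bullet> a)" by (simp add: norm_lsq_def)
qed

end

definition cls :: "('a::euclidean_space \<Rightarrow> 'b::{real_inner,banach,second_countable_topology}) \<Rightarrow> ('a, 'b) lsq" where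
  "cls = abs_lsq"

text \<open>A chosen representative. It is a Borel function on the whole space, but identities for
  it hold almost everywhere only, whence the rules for sums and multiples below.\<close>

definition fn :: "('a::euclidean_space, 'b::{real_inner,banach,second_countable_topology}) lsq \<Rightarrow> 'a \<Rightarrow> 'b" where
  "fn = rep_lsq"

lemma sqint_fn: "sqint (fn F)" and cls_fn: "cls (fn F) = F"
  using Quotient_rep_reflp[OF Quotient_lsq, of F] Quotient_abs_rep[OF Quotient_lsq, of F]
  by (auto simp: fn_def cls_def)

lemma measurable_fn[measurable]: "fn F \<in> borel_measurable borel"
  using sqint_fn sqint_measurable by blast

lemma cls_eq_iff: "sqint f \<Longrightarrow> sqint g \<Longrightarrow> cls f = cls g \<longleftrightarrow> (AE x in lborel. f x = g x)"
  unfolding cls_def using Quotient_rel[OF Quotient_lsq, of f g] by simp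

lemma fn_cls: "sqint f \<Longrightarrow> AE x in lborel. fn (cls f) x = f x"
  using cls_eq_iff[OF sqint_fn] cls_fn by blast

lemma cls_add: "sqint f \<Longrightarrow> sqint g \<Longrightarrow> cls f + cls g = cls (\<lambda>x. f x + g x)"
  unfolding cls_def by (rule plus_lsq.abs_eq) auto

lemma cls_diff: "sqint f \<Longrightarrow> sqint g \<Longrightarrow> cls f - cls g = cls (\<lambda>x. f x - g x)"
  unfolding cls_def by (rule minus_lsq.abs_eq) auto

lemma cls_scaleR: "sqint f \<Longrightarrow> c *\<^sub>R cls f = cls (\<lambda>x. c *\<^sub>R f x)"
  unfolding cls_def by (rule scaleR_lsq.abs_eq) auto

lemma cls_zero: "cls (\<lambda>x. 0) = 0"
  unfolding cls_def by (simp add: zero_lsq_def)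

lemma inner_cls: "sqint f \<Longrightarrow> sqint g \<Longrightarrow> cls f \<bullet> cls g = (\<integral>x. f x \<bullet> g x \<partial>lborel)"
  unfolding cls_def by (rule inner_lsq.abs_eq) auto

lemma norm_cls: "sqint f \<Longrightarrow> (norm (cls f))\<^sup>2 = (\<integral>x. (norm (f x))\<^sup>2 \<partial>lborel)"
  by (simp add: power2_norm_eq_inner inner_cls)

lemma inner_fn: "F \<bullet> G = (\<integral>x. fn F x \<bullet> fn G x \<partial>lborel)"
  using inner_cls[OF sqint_fn sqint_fn, of F G] by (simp add: cls_fn)

lemma norm_fn: "(norm F)\<^sup>2 = (\<integral>x. (norm (fn F x))\<^sup>2 \<partial>lborel)"
  by (simp add: power2_norm_eq_inner inner_fn)

lemma fn_add: "AE x in lborel. fn (F + G) x = fn F x + fn G x"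
  using fn_cls[OF sqint_add[OF sqint_fn sqint_fn], of F G] cls_add[OF sqint_fn sqint_fn, of F G] by (simp add: cls_fn)

lemma fn_diff: "AE x in lborel. fn (F - G) x = fn F x - fn G x"
  using fn_cls[OF sqint_diff[OF sqint_fn sqint_fn], of F G] cls_diff[OF sqint_fn sqint_fn, of F G] by (simp add: cls_fn)

lemma fn_scaleR: "AE x in lborel. fn (c *\<^sub>R F) x = c *\<^sub>R fn F x"
  using fn_cls[OF sqint_scaleR[OF sqint_fn], of c F] cls_scaleR[OF sqint_fn, of c F] by (simp add: cls_fn)

lemma fn_zero: "AE x in lborel. fn 0 x = 0"
  using fn_cls[OF sqint_zero] by (simp add: cls_zero)

lemma nn_integral_fn: "(\<integral>\<^sup>+x. ennreal ((norm (fn F x))\<^sup>2) \<partial>lborel) = ennreal ((norm F)\<^sup>2)"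
  unfolding norm_fn by (rule nn_integral_eq_integral) (use sqint_fn in \<open>auto simp: sqint_def\<close>)

text \<open>The form with the nonnegative integral feeds Fatou's lemma in the completeness proof,
  where integrability of the limit is not yet known.\<close>

lemma nn_integral_fn_diff:
  "(\<integral>\<^sup>+x. ennreal ((norm (fn F x - fn G x))\<^sup>2) \<partial>lborel) = ennreal ((norm (F - G))\<^sup>2)"
proof -
  have "(\<integral>\<^sup>+x. ennreal ((norm (fn F x - fn G x))\<^sup>2) \<partial>lborel) = (\<integral>\<^sup>+x. ennreal ((norm (fn (F - G) x))\<^sup>2) \<partial>lborel)"
    using fn_diff[of F G] by (intro nn_integral_cong_AE) (auto elim!: eventually_mono)
  then show ?thesis by (simp add: nn_integral_fn)
qed

text \<open>The Riesz-Fischer argument: along a subsequence with geometrically small increments the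
  representatives converge almost everywhere, and Fatou's lemma bounds the distance of the limit to
  each member.\<close>

instance lsq :: (euclidean_space, "{real_inner,banach,second_countable_topology}") banach
proof
  fix X :: "nat \<Rightarrow> ('a, 'b) lsq"
  assume X: "Cauchy X"
  have "\<exists>N. \<forall>m\<ge>N. \<forall>n\<ge>N. norm (X m - X n) < (1/2)^k" for k
    using CauchyD[OF X, of "(1/2)^k"] by simp
  then obtain r where r: "\<And>k m n. m \<ge> r k \<Longrightarrow> n \<ge> r k \<Longrightarrow> norm (X m - X n) < (1/2)^k" by metis
  \<comment> \<open>Partial sums of \<open>r\<close> dominate all earlier values of
    \<open>r\<close>, so each member of the subsequence is past every threshold up to its own
    index.\<close>
  define R where "R k = (\<Sum>i\<le>k. r i)" for k
  have Rr: "R j \<ge> r k" if "j \<ge> k" for j k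
    unfolding R_def using that by (intro member_le_sum) auto
  define y where "y k = fn (X (R k))" for k
  have [measurable]: "y k \<in> borel_measurable borel" for k by (simp add: y_def)
  have yn: "(\<integral>\<^sup>+x. ennreal ((norm (y j x - y k x))\<^sup>2) \<partial>lborel) \<le> ennreal (((1/2)^k)\<^sup>2)" if "j \<ge> k" for j k
    unfolding y_def nn_integral_fn_diff using r[OF Rr[OF that] Rr[OF order_refl]]
    by (intro ennreal_leI power_mono) auto
  \<comment> \<open>The squared norm of the k-th increment is at most (1/4)^k, so the weight 2^k
    used next still leaves a convergent series.\<close>
  define d where "d k x = y (Suc k) x - y k x" for k x
  have [measurable]: "d k \<in> borel_measurable borel" for k unfolding d_def by measurable
  have "(\<integral>\<^sup>+x. (\<Sum>k. ennreal (2^k * (norm (d k x))\<^sup>2)) \<partial>lborel) = (\<Sum>k. \<integral>\<^sup>+x. ennreal (2^k * (norm (d k x))\<^sup>2) \<partial>lborel)"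
    by (rule nn_integral_suminf) measurable
  also have "\<dots> \<le> (\<Sum>k. ennreal ((1/2)^k))"
  proof (rule suminf_le)
    fix k
    have "(\<integral>\<^sup>+x. ennreal (2^k * (norm (d k x))\<^sup>2) \<partial>lborel) = ennreal (2^k) * (\<integral>\<^sup>+x. ennreal ((norm (d k x))\<^sup>2) \<partial>lborel)"
      by (simp add: ennreal_mult nn_integral_cmult)
    also have "\<dots> \<le> ennreal (2^k) * ennreal (((1/2)^k)\<^sup>2)"
      unfolding d_def by (intro mult_left_mono yn) auto
    also have "\<dots> = ennreal ((1/2)^k)"
      by (simp add: ennreal_mult'[symmetric] power2_eq_square power_mult_distrib[symmetric] field_simps)
    finally show "(\<integral>\<^sup>+x. ennreal (2^k * (norm (d k x))\<^sup>2) \<partial>lborel) \<le> ennreal ((1/2)^k)" .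
  qed auto
  also have "\<dots> < \<infinity>"
    by (subst suminf_ennreal2) (auto intro: summable_geometric simp: less_top[symmetric])
  finally have "AE x in lborel. (\<Sum>k. ennreal (2^k * (norm (d k x))\<^sup>2)) \<noteq> \<infinity>"
    by (intro nn_integral_PInf_AE) auto
  then have conv: "AE x in lborel. (\<lambda>k. y k x) \<longlonglongrightarrow> lim (\<lambda>k. y k x)"
  proof eventually_elim
    case (elim x)
    then have s: "summable (\<lambda>k. 2^k * (norm (d k x))\<^sup>2)"
      by (intro summable_suminf_not_top) (auto simp: infinity_ennreal_def)
    have "summable (\<lambda>k. norm (d k x))"
    proof (rule summable_comparison_test')
      show "summable (\<lambda>k. 2^k * (norm (d k x))\<^sup>2 + (1/2)^k)" using s by (intro summable_add) (auto intro: summable_geometric)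
      fix k :: nat
      \<comment> \<open>With p = 2^k, the square of p n - 1 turns the summable weighted squares into
        a bound for the norms: each is at most 2^k times its square plus (1/2)^k.\<close>
      have "2 * (p * n) \<le> p * (p * n\<^sup>2) + 1" for p n :: real
        using zero_le_power2[of "p * n - 1"] by (simp add: power2_eq_square algebra_simps)
      then have "2 * (2^k * norm (d k x)) \<le> 2^k * (2^k * (norm (d k x))\<^sup>2) + 1" .
      then have "2^k * norm (d k x) \<le> 2^k * (2^k * (norm (d k x))\<^sup>2 + (1/2)^k)"
        using mult_nonneg_nonneg[of "2^k" "norm (d k x)"] by (simp add: distrib_left power_mult_distrib[symmetric] del: mult_nonneg_nonneg)
      then show "norm (norm (d k x)) \<le> 2^k * (norm (d k x))\<^sup>2 + (1/2)^k" by simp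
    qed
    then have "summable (\<lambda>k. d k x)" by (rule summable_norm_cancel)
    then have "convergent (\<lambda>n. \<Sum>k<n. d k x)" by (simp add: summable_iff_convergent)
    moreover have "(\<Sum>k<n. d k x) = y n x - y 0 x" for n by (induction n) (auto simp: d_def)
    ultimately have "convergent (\<lambda>n. y n x - y 0 x)" by simp
    then have "convergent (\<lambda>n. (y n x - y 0 x) + y 0 x)" by (intro convergent_add convergent_const)
    then show ?case by (simp add: convergent_LIMSEQ_iff)
  qed
  define z where "z x = lim (\<lambda>k. y k x)" for x
  have [measurable]: "z \<in> borel_measurable borel" unfolding z_def by measurable
  have zn: "(\<integral>\<^sup>+x. ennreal ((norm (z x - y k x))\<^sup>2) \<partial>lborel) \<le> ennreal (((1/2)^k)\<^sup>2)" for k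
  proof -
    have "(\<integral>\<^sup>+x. ennreal ((norm (z x - y k x))\<^sup>2) \<partial>lborel) = (\<integral>\<^sup>+x. liminf (\<lambda>j. ennreal ((norm (y j x - y k x))\<^sup>2)) \<partial>lborel)"
    proof (rule nn_integral_cong_AE)
      show "AE x in lborel. ennreal ((norm (z x - y k x))\<^sup>2) = liminf (\<lambda>j. ennreal ((norm (y j x - y k x))\<^sup>2))"
        using conv
      proof eventually_elim
        case (elim x)
        then have "(\<lambda>j. ennreal ((norm (y j x - y k x))\<^sup>2)) \<longlonglongrightarrow> ennreal ((norm (z x - y k x))\<^sup>2)"
          unfolding z_def by (intro tendsto_intros tendsto_ennrealI)
        then show ?case by (intro lim_imp_Liminf[symmetric]) auto
      qed
    qed
    also have "\<dots> \<le> liminf (\<lambda>j. \<integral>\<^sup>+x. ennreal ((norm (y j x - y k x))\<^sup>2) \<partial>lborel)"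
      by (rule nn_integral_liminf) measurable
    also have "\<dots> \<le> liminf (\<lambda>j. ennreal (((1/2)^k)\<^sup>2))"
      using yn by (intro Liminf_mono) (auto simp: eventually_sequentially)
    also have "\<dots> = ennreal (((1/2)^k)\<^sup>2)" by (simp add: Liminf_const)
    finally show ?thesis .
  qed
  have zy: "sqint (\<lambda>x. z x - y k x)" for k
    unfolding sqint_def
  proof
    show "integrable lborel (\<lambda>x. (norm (z x - y k x))\<^sup>2)"
      using zn[of k] by (intro integrableI_nonneg) (auto simp: less_top[symmetric] top_unique)
  qed measurable
  have ysq: "sqint (y k)" for k by (simp add: y_def sqint_fn)
  have zsq: "sqint z" using sqint_add[OF zy[of 0] ysq[of 0]] by simp
  have zX: "norm (X (R k) - cls z) \<le> (1/2)^k" for k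
  proof -
    have "X (R k) = cls (y k)" by (simp add: y_def cls_fn)
    then have "cls z - X (R k) = cls (\<lambda>x. z x - y k x)" using cls_diff[OF zsq ysq] by simp
    then have "ennreal ((norm (cls z - X (R k)))\<^sup>2) = (\<integral>\<^sup>+x. ennreal ((norm (z x - y k x))\<^sup>2) \<partial>lborel)"
      using norm_cls[OF zy[of k]] nn_integral_eq_integral[of lborel "\<lambda>x. (norm (z x - y k x))\<^sup>2"] zy[of k]
      by (simp add: sqint_def)
    then have "ennreal ((norm (cls z - X (R k)))\<^sup>2) \<le> ennreal (((1/2)^k)\<^sup>2)" using zn[of k] by simp
    then have "(norm (cls z - X (R k)))\<^sup>2 \<le> ((1/2)^k)\<^sup>2" by (subst (asm) ennreal_le_iff) auto
    then show ?thesis by (simp add: norm_minus_commute abs_le_square_iff[symmetric])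
  qed
  have "X \<longlonglongrightarrow> cls z"
  proof (rule LIMSEQ_I)
    fix e :: real assume e: "e > 0"
    obtain k where k: "(1/2)^k < e / 2" using real_arch_pow_inv[of "e/2" "1/2"] e by auto
    have "norm (X n - cls z) < e" if "n \<ge> r k" for n
    proof -
      have "norm (X n - cls z) \<le> norm (X n - X (R k)) + norm (X (R k) - cls z)"
        using norm_triangle_ineq[of "X n - X (R k)" "X (R k) - cls z"] by simp
      then show ?thesis using r[OF that Rr[OF order_refl]] zX[of k] k by linarith
    qed
    then show "\<exists>no. \<forall>n\<ge>no. norm (X n - cls z) < e" by blast
  qed
  then show "convergent X" by (auto simp: convergent_def)
qed

lemma second_countable_if_countable_dense:
  fixes D :: "'a::metric_space set"
  assumes "countable D" "closure D = UNIV"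
  shows "\<exists>B::'a set set. countable B \<and> open = generate_topology B"
proof -
  define B where "B = (\<lambda>(x, n). ball x (inverse (real (Suc n)))) ` (D \<times> (UNIV :: nat set))"
  have "topological_basis B"
  proof (rule topological_basisI)
    show "open b" if "b \<in> B" for b using that by (auto simp: B_def)
    fix O' :: "'a set" and x assume "open O'" "x \<in> O'"
    then obtain e where e: "e > 0" "ball x e \<subseteq> O'" using openE by blast
    obtain n where n: "inverse (real (Suc n)) < e / 2" using reals_Archimedean[of "e/2"] e by auto
    obtain y where y: "y \<in> D" "dist y x < inverse (real (Suc n))"
      using assms(2) closure_approachable[of x D] by (metis UNIV_I inverse_positive_iff_positive of_nat_0_less_iff zero_less_Suc)
    have "ball y (inverse (real (Suc n))) \<subseteq> ball x e"
    proof
      fix z assume "z \<in> ball y (inverse (real (Suc n)))"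
      then have "dist x z < e" using dist_triangle[of x z y] y(2) n by (simp add: dist_commute)
      then show "z \<in> ball x e" by simp
    qed
    then show "\<exists>b\<in>B. x \<in> b \<and> b \<subseteq> O'"
      using y e unfolding B_def by (intro bexI[of _ "ball y (inverse (real (Suc n)))"]) (auto simp: dist_commute)
  qed
  moreover have "countable B" unfolding B_def using assms(1) by auto
  ultimately show ?thesis using topological_basis_imp_subbasis by blast
qed

lemma sqint_indicator_box: "sqint (\<lambda>x. indicator (box a b) x *\<^sub>R c)"
proof -
  have "(\<lambda>x. (norm (indicat_real (box a b) x *\<^sub>R c))\<^sup>2) = (\<lambda>x. (norm c)\<^sup>2 * indicat_real (box a b) x)"
    by (auto simp: indicator_def)
  then show ?thesis by (simp add: sqint_def emeasure_lborel_box_eq)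
qed

text \<open>Finite sums of indicators of rational boxes with coefficients from a countable dense set
  form a countable set. Its closure is a subspace, and a class orthogonal to it has vanishing
  integrals over all rational boxes, hence is zero.\<close>

instance lsq :: (euclidean_space, "{real_inner,banach,second_countable_topology}") second_countable_topology
proof
  define rat where "rat = {a :: 'a. \<forall>i\<in>Basis. a \<bullet> i \<in> \<rat>}"
  obtain D :: "'b set" where D: "countable D" "closure D = UNIV"
  proof -
    obtain D :: "'b set" where D: "countable D" "\<And>X. open X \<Longrightarrow> X \<noteq> {} \<Longrightarrow> \<exists>d\<in>D. d \<in> X"
      using countable_dense_exists by blast
    have "- closure D = {}" using D(2)[of "- closure D"] closure_subset by blast
    then show ?thesis using that D(1) by blast
  qed
  have "countable rat"
  proof -
    have "rat \<subseteq> (\<lambda>f. \<Sum>i\<in>Basis. f i *\<^sub>R i) ` (Basis \<rightarrow>\<^sub>E \<rat>)"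
    proof
      fix x assume "x \<in> rat"
      then show "x \<in> (\<lambda>f. \<Sum>i\<in>Basis. f i *\<^sub>R i) ` (Basis \<rightarrow>\<^sub>E \<rat>)"
        by (intro image_eqI[of _ _ "restrict (\<lambda>i. x \<bullet> i) Basis"]) (auto simp: rat_def euclidean_representation)
    qed
    then show ?thesis using countable_rat by (meson countable_PiE countable_image countable_subset finite_Basis)
  qed
  define E :: "'a \<times> 'a \<times> 'b \<Rightarrow> ('a, 'b) lsq" where "E = (\<lambda>(a, b, c). cls (\<lambda>x. indicator (box a b) x *\<^sub>R c))"
  \<comment> \<open>Lists encode finite sums with repetition and keep the set countable.\<close>
  define A where "A = sum_list ` lists (E ` (rat \<times> rat \<times> D))"
  have cA: "countable A" unfolding A_def using \<open>countable rat\<close> D(1) by (intro countable_image countable_lists countable_SIGMA)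
  have cl: "E (a, b, c) \<in> closure (E ` (rat \<times> rat \<times> D))" if ab: "a \<in> rat" "b \<in> rat" for a b c
  proof -
    have "c \<in> closure D" using D by simp
    then obtain s where s: "\<And>n. s n \<in> D" "s \<longlonglongrightarrow> c" unfolding closure_sequential by blast
    have "(norm (E (a, b, s n) - E (a, b, c)))\<^sup>2 = (norm (s n - c))\<^sup>2 * measure lborel (box a b)" for n
    proof -
      have "E (a, b, s n) - E (a, b, c) = cls (\<lambda>x. indicator (box a b) x *\<^sub>R (s n - c))"
        by (simp add: E_def cls_diff sqint_indicator_box scaleR_diff_right)
      then have "(norm (E (a, b, s n) - E (a, b, c)))\<^sup>2 = (\<integral>x. (norm (indicat_real (box a b) x *\<^sub>R (s n - c)))\<^sup>2 \<partial>lborel)"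
        by (simp add: norm_cls sqint_indicator_box)
      also have "\<dots> = (\<integral>x. (norm (s n - c))\<^sup>2 * indicat_real (box a b) x \<partial>lborel)"
        by (intro Bochner_Integration.integral_cong) (auto simp: indicator_def)
      finally show ?thesis by simp
    qed
    then have "(\<lambda>n. (norm (E (a, b, s n) - E (a, b, c)))\<^sup>2) = (\<lambda>n. (norm (s n - c))\<^sup>2 * measure lborel (box a b))" by simp
    moreover have "(\<lambda>n. (norm (s n - c))\<^sup>2 * measure lborel (box a b)) \<longlonglongrightarrow> (norm (c - c))\<^sup>2 * measure lborel (box a b)"
      by (intro tendsto_intros s)
    ultimately have "(\<lambda>n. (norm (E (a, b, s n) - E (a, b, c)))\<^sup>2) \<longlonglongrightarrow> 0" by simp
    then have "(\<lambda>n. sqrt ((norm (E (a, b, s n) - E (a, b, c)))\<^sup>2)) \<longlonglongrightarrow> sqrt 0" by (intro tendsto_intros)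
    then have "(\<lambda>n. E (a, b, s n)) \<longlonglongrightarrow> E (a, b, c)" by (simp add: LIM_zero_iff tendsto_norm_zero_iff)
    then show ?thesis unfolding closure_sequential using ab s by (intro exI[of _ "\<lambda>n. E (a, b, s n)"]) auto
  qed
  have EA: "E ` (rat \<times> rat \<times> D) \<subseteq> A"
    unfolding A_def by (force intro!: image_eqI[of _ sum_list "[x]" for x])
  have A0: "0 \<in> A" unfolding A_def by (intro image_eqI[of _ _ "[]"]) auto
  have A_add: "x + y \<in> A" if "x \<in> A" "y \<in> A" for x y
  proof -
    from that obtain xs ys where "xs \<in> lists (E ` (rat \<times> rat \<times> D))" "ys \<in> lists (E ` (rat \<times> rat \<times> D))" "x = sum_list xs" "y = sum_list ys"
      by (auto simp: A_def)
    then show ?thesis unfolding A_def by (intro image_eqI[of _ _ "xs @ ys"]) auto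
  qed
  have cA_add: "x + y \<in> closure A" if xy: "x \<in> closure A" "y \<in> closure A" for x y
  proof -
    obtain u v where "\<And>n. u n \<in> A" "u \<longlonglongrightarrow> x" "\<And>n. v n \<in> A" "v \<longlonglongrightarrow> y"
      using xy by (metis closure_sequential)
    then show ?thesis
      unfolding closure_sequential using A_add by (intro exI[of _ "\<lambda>n. u n + v n"]) (auto intro: tendsto_add)
  qed
  \<comment> \<open>Coefficients in \<open>D\<close> are not stable under scaling, so multiples are
    recovered only as limits.\<close>
  have A_scale: "r *\<^sub>R x \<in> closure A" if "x \<in> A" for r x
  proof -
    from that obtain xs where xs: "xs \<in> lists (E ` (rat \<times> rat \<times> D))" "x = sum_list xs" by (auto simp: A_def)
    have "r *\<^sub>R sum_list xs \<in> closure A" using xs(1)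
    proof (induction xs)
      case Nil
      then show ?case using A0 closure_subset by auto
    next
      case (Cons e xs)
      then obtain a b c where e: "e = E (a, b, c)" "a \<in> rat" "b \<in> rat" by auto
      have "r *\<^sub>R e = E (a, b, r *\<^sub>R c)" unfolding e E_def by (simp add: cls_scaleR sqint_indicator_box mult.commute)
      then have "r *\<^sub>R e \<in> closure A" using cl[of a b "r *\<^sub>R c"] e closure_mono[OF EA] by auto
      then show ?case using Cons cA_add by (simp add: scaleR_add_right)
    qed
    then show ?thesis using xs by simp
  qed
  have "subspace (closure A)"
  proof (rule subspaceI)
    show "0 \<in> closure A" using A0 closure_subset by blast
    show "x + y \<in> closure A" if "x \<in> closure A" "y \<in> closure A" for x y using cA_add that .
    fix r x assume "x \<in> closure A"
    then obtain u where "\<And>n. u n \<in> A" "u \<longlonglongrightarrow> x" by (metis closure_sequential)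
    then show "r *\<^sub>R x \<in> closure A"
      using closed_sequentially[OF closed_closure, of "\<lambda>n. r *\<^sub>R u n" A "r *\<^sub>R x"] A_scale
      by (simp add: tendsto_scaleR)
  qed
  moreover have "F = 0" if orth: "\<And>G. G \<in> closure A \<Longrightarrow> F \<bullet> G = 0" for F
  proof -
    have "AE x in lborel. x \<in> UNIV \<longrightarrow> fn F x \<bullet> c = 0" if "c \<in> D" for c
    proof (rule lborel_AE_zero_if_box_integrals_zero)
      fix a b :: 'a assume ab: "\<forall>i\<in>Basis. a \<bullet> i \<in> \<rat> \<and> b \<bullet> i \<in> \<rat>"
      have eq: "indicator (box a b) x * (fn F x \<bullet> c) = fn F x \<bullet> (indicator (box a b) x *\<^sub>R c)" for x by simp
      show "integrable lborel (\<lambda>x. indicator (box a b) x * (fn F x \<bullet> c))"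
        unfolding eq by (intro sqint_inner_integrable sqint_fn sqint_indicator_box)
      have "E (a, b, c) \<in> closure A" using ab that EA closure_subset by (fastforce simp: rat_def)
      then have "F \<bullet> E (a, b, c) = 0" by (rule orth)
      then show "(\<integral>x. indicator (box a b) x * (fn F x \<bullet> c) \<partial>lborel) = 0"
        unfolding eq using inner_cls[OF sqint_fn[of F] sqint_indicator_box[of a b c]] by (simp add: cls_fn E_def)
    qed (auto intro!: borel_measurable_inner)
    then have "AE x in lborel. \<forall>c\<in>D. fn F x \<bullet> c = 0" using D(1) by (subst AE_ball_countable) auto
    then have "AE x in lborel. fn F x = 0"
    proof eventually_elim
      case (elim x)
      have "closed {c. fn F x \<bullet> c = 0}" by (intro closed_Collect_eq continuous_intros)
      then have "closure D \<subseteq> {c. fn F x \<bullet> c = 0}" using elim by (intro closure_minimal) auto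
      then have "fn F x \<bullet> fn F x = 0" using D(2) by blast
      then show ?case by simp
    qed
    then have "cls (fn F) = cls (\<lambda>x. 0)" by (simp add: cls_eq_iff sqint_fn sqint_zero)
    then show ?thesis by (simp add: cls_fn cls_zero)
  qed
  ultimately have "closure (closure A) = UNIV" by (intro dense_if_orth_trivial) auto
  then show "\<exists>B::('a, 'b) lsq set set. countable B \<and> open = generate_topology B"
    using cA by (intro second_countable_if_countable_dense) auto
qed

section \<open>Primitives and convolutions on a bounded time interval\<close>

text \<open>Supplies the dominating function whenever Fubini's theorem is applied to a double
  integral in time.\<close>

lemma integrable_pair_mult:
  fixes f g :: "'a \<Rightarrow> real"
  assumes "sigma_finite_measure M" and f: "integrable M f" and g: "integrable M g"
  shows "integrable (M \<Otimes>\<^sub>M M) (\<lambda>p. f (fst p) * g (snd p))"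
proof -
  interpret sigma_finite_measure M by fact
  interpret P: pair_sigma_finite M M ..
  have [measurable]: "f \<in> borel_measurable M" "g \<in> borel_measurable M" using f g by auto
  have "integrable (M \<Otimes>\<^sub>M M) (\<lambda>(x, y). f x * g y)"
  proof (rule P.Fubini_integrable)
    show "(\<lambda>(x, y). f x * g y) \<in> borel_measurable (M \<Otimes>\<^sub>M M)" by measurable
    show "integrable M (\<lambda>x. \<integral>y. norm (case (x, y) of (x, y) \<Rightarrow> f x * g y) \<partial>M)"
      using f by (simp add: abs_mult)
    show "AE x in M. integrable M (\<lambda>y. case (x, y) of (x, y) \<Rightarrow> f x * g y)"
      using g by simp
  qed
  then show ?thesis by (simp add: case_prod_beta')
qed

section \<open>The time interval as a measure on the line\<close>

locale time_interval =
  fixes T :: real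
  assumes T_pos: "T > 0"
begin

text \<open>A density on the whole line instead of a restricted space: functions of time stay total
  Borel functions, and their values outside the interval are invisible to \<open>M\<close>.\<close>

definition M :: "real measure" where "M = density lborel (\<lambda>t. ennreal (indicator {0<..<T} t))"

lemma sets_M[simp, measurable_cong]: "sets M = sets borel" and space_M[simp]: "space M = UNIV"
  by (simp_all add: M_def)

lemma measurable_M1[simp]: "measurable M N = measurable borel N"
  by (rule measurable_cong_sets) auto

lemma AE_M: "(AE t in M. P t) \<longleftrightarrow> (AE t in lborel. 0 < t \<and> t < T \<longrightarrow> P t)"
  unfolding M_def by (subst AE_density) (auto simp: indicator_def intro!: AE_cong)

lemma AE_M_interval: "AE t in M. 0 < t \<and> t < T"
  by (simp add: AE_M)

lemma AE_MI: "(\<And>t. 0 < t \<Longrightarrow> t < T \<Longrightarrow> P t) \<Longrightarrow> AE t in M. P t"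
  by (simp add: AE_M)

lemma AE_M_neq: "AE t in M. t \<noteq> c"
  using AE_lborel_singleton[of c] unfolding AE_M by eventually_elim simp

lemma emeasure_M: "emeasure M UNIV = ennreal T"
  unfolding M_def using T_pos by (subst emeasure_density) (auto simp: nn_integral_indicator ennreal_indicator)

sublocale finite_measure M
  by (rule finite_measureI) (simp add: emeasure_M)

sublocale P: pair_sigma_finite M M ..

lemma integral_M:
  fixes f :: "real \<Rightarrow> 'b::{banach,second_countable_topology}"
  assumes "f \<in> borel_measurable borel"
  shows "integral\<^sup>L M f = (\<integral>t. indicator {0<..<T} t *\<^sub>R f t \<partial>lborel)"
  unfolding M_def using assms by (subst integral_density) auto

lemma integrable_M:
  fixes f :: "real \<Rightarrow> 'b::{banach,second_countable_topology}"
  assumes "f \<in> borel_measurable borel"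
  shows "integrable M f \<longleftrightarrow> integrable lborel (\<lambda>t. indicator {0<..<T} t *\<^sub>R f t)"
  unfolding M_def using assms by (subst integrable_density) auto

lemma integrable_bounded_M:
  fixes f :: "real \<Rightarrow> 'b::{banach,second_countable_topology}"
  assumes "f \<in> borel_measurable borel" "\<And>t. 0 < t \<Longrightarrow> t < T \<Longrightarrow> norm (f t) \<le> B"
  shows "integrable M f"
  by (rule integrable_const_bound[where B=B]) (use assms in \<open>auto simp: AE_M\<close>)

lemma integrable_bounded_scaleR_M:
  fixes f :: "real \<Rightarrow> 'b::{banach,second_countable_topology}" and h :: "real \<Rightarrow> real"
  assumes h: "h \<in> borel_measurable borel" "\<And>t. 0 < t \<Longrightarrow> t < T \<Longrightarrow> \<bar>h t\<bar> \<le> B" and f: "integrable M f"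
  shows "integrable M (\<lambda>t. h t *\<^sub>R f t)"
proof (rule Bochner_Integration.integrable_bound)
  show "integrable M (\<lambda>t. \<bar>B\<bar> * norm (f t))" using f by simp
  have [measurable]: "f \<in> borel_measurable borel" using f by auto
  show "(\<lambda>t. h t *\<^sub>R f t) \<in> borel_measurable M" using h by simp
  show "AE t in M. norm (h t *\<^sub>R f t) \<le> norm (\<bar>B\<bar> * norm (f t))"
    using AE_M_interval
  proof eventually_elim
    case (elim t)
    then have "\<bar>h t\<bar> \<le> \<bar>B\<bar>" using h(2)[of t] by linarith
    then have "\<bar>h t\<bar> * norm (f t) \<le> \<bar>B\<bar> * norm (f t)" by (intro mult_right_mono) auto
    then show ?case by (auto simp: abs_mult)
  qed
qed

section \<open>Primitives of integrable functions and integration by parts in time\<close>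

lemma integrable_cut:
  fixes a :: "real \<Rightarrow> 'b::{banach,second_countable_topology}"
  assumes "integrable M a" shows "integrable M (\<lambda>s. if s < t then a s else 0)"
proof -
  have [measurable]: "a \<in> borel_measurable borel" using assms by auto
  show ?thesis by (rule Bochner_Integration.integrable_bound[OF assms]) auto
qed

text \<open>Since \<open>M\<close> has no mass outside the interval, this is the primitive starting
  from 0, continued by 0 to the left and by the full integral to the right of the interval.\<close>

definition prim :: "(real \<Rightarrow> 'b::{banach,second_countable_topology}) \<Rightarrow> real \<Rightarrow> 'b" where
  "prim a t = (\<integral>s. (if s < t then a s else 0) \<partial>M)"

lemma prim_0: "prim a 0 = 0"
  unfolding prim_def by (intro integral_eq_zero_AE AE_MI) simp

lemma prim_T:
  assumes "integrable M a" "T \<le> t" shows "prim a t = integral\<^sup>L M a"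
proof -
  have [measurable]: "a \<in> borel_measurable borel" using assms by auto
  show ?thesis unfolding prim_def using assms(2)
    by (intro integral_cong_AE AE_MI) auto
qed

lemma prim_cong_AE:
  assumes "AE s in M. a s = b s" "a \<in> borel_measurable borel" "b \<in> borel_measurable borel"
  shows "prim a t = prim b t"
  unfolding prim_def using assms by (intro integral_cong_AE) (auto elim!: eventually_mono)

lemma prim_add: "integrable M a \<Longrightarrow> integrable M b \<Longrightarrow> prim (\<lambda>s. a s + b s) t = prim a t + prim b t"
  unfolding prim_def
  by (subst Bochner_Integration.integral_add[symmetric]) (auto intro!: integrable_cut Bochner_Integration.integral_cong)

lemma prim_diff: "integrable M a \<Longrightarrow> integrable M b \<Longrightarrow> prim (\<lambda>s. a s - b s) t = prim a t - prim b t"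
  unfolding prim_def
  by (subst Bochner_Integration.integral_diff[symmetric]) (auto intro!: integrable_cut Bochner_Integration.integral_cong)

lemma prim_linear:
  assumes "bounded_linear f" "integrable M a"
  shows "f (prim a t) = prim (\<lambda>s. f (a s)) t"
proof -
  interpret bounded_linear f by fact
  have "f (prim a t) = (\<integral>s. f (if s < t then a s else 0) \<partial>M)"
    unfolding prim_def using integral_bounded_linear[OF assms(1) integrable_cut[OF assms(2)]] by simp
  then show ?thesis unfolding prim_def by (simp add: if_distrib[of f] zero cong: if_cong)
qed

lemma prim_scaleR: "integrable M a \<Longrightarrow> prim (\<lambda>s. c *\<^sub>R a s) t = c *\<^sub>R prim a t"
  using prim_linear[OF bounded_linear_scaleR_right] by metis

lemma prim_inner:
  fixes a :: "real \<Rightarrow> 'b::{real_inner,banach,second_countable_topology}"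
  shows "integrable M a \<Longrightarrow> prim a t \<bullet> c = prim (\<lambda>s. a s \<bullet> c) t"
  using prim_linear[OF bounded_linear_inner_left] by metis

lemma norm_prim_le: "integrable M a \<Longrightarrow> norm (prim a t) \<le> prim (\<lambda>s. norm (a s)) t"
  unfolding prim_def using integral_norm_bound[of M "\<lambda>s. if s < t then a s else 0"]
  by (simp add: if_distrib[of norm] cong: if_cong)

lemma prim_mono:
  assumes "integrable M a" "integrable M b" "\<And>s. 0 < s \<Longrightarrow> s < T \<Longrightarrow> a s \<le> (b s :: real)"
  shows "prim a t \<le> prim b t"
  unfolding prim_def
  by (intro integral_mono_AE integrable_cut assms AE_MI) (use assms(3) in auto)

lemma prim_norm_le_integral: "integrable M a \<Longrightarrow> norm (prim a t) \<le> (\<integral>s. norm (a s) \<partial>M)"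
proof -
  assume a: "integrable M a"
  have "prim (\<lambda>s. norm (a s)) t \<le> (\<integral>s. norm (a s) \<partial>M)"
    unfolding prim_def using a by (intro integral_mono integrable_cut) auto
  with norm_prim_le[OF a, of t] show ?thesis by simp
qed

text \<open>Dominated convergence: the cut-off integrands converge except possibly at the single
  time \<open>s = t\<close>, which is a null set.\<close>

lemma prim_continuous:
  assumes "integrable M a" shows "continuous_on UNIV (prim a)"
proof (rule continuous_at_imp_continuous_on, intro ballI)
  fix t :: real
  have [measurable]: "a \<in> borel_measurable borel" using assms by auto
  show "isCont (prim a) t"
    unfolding continuous_at_sequentially
  proof (intro allI impI)
    fix x :: "nat \<Rightarrow> real" assume x: "x \<longlonglongrightarrow> t"
    show "(prim a \<circ> x) \<longlonglongrightarrow> prim a t"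
      unfolding o_def prim_def
    proof (rule integral_dominated_convergence[where w="\<lambda>s. norm (a s)"])
      show "AE s in M. (\<lambda>n. if s < x n then a s else 0) \<longlonglongrightarrow> (if s < t then a s else 0)"
        using AE_M_neq[of t]
      proof eventually_elim
        case (elim s)
        have "eventually (\<lambda>n. (if s < x n then a s else 0) = (if s < t then a s else 0)) sequentially"
        proof (cases "s < t")
          case True
          from order_tendstoD(1)[OF x True] show ?thesis by eventually_elim (use True in auto)
        next
          case False
          then have "t < s" using elim by auto
          from order_tendstoD(2)[OF x this] show ?thesis by eventually_elim (use False in auto)
        qed
        then show ?case by (rule tendsto_eventually)
      qed
    qed (use assms in auto)
  qed
qed

lemma prim_measurable[measurable]:
  assumes "integrable M a" shows "prim a \<in> borel_measurable borel"
  using borel_measurable_continuous_onI[OF prim_continuous[OF assms]] .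

text \<open>The product rule for functions that are merely primitives, where no pointwise derivative
  is at hand. The double integral over the square splits along the diagonal, and each triangle is
  integrated first in the variable that yields a primitive.\<close>

lemma prim_product_0:
  fixes a b :: "real \<Rightarrow> 'b::{real_inner,banach,second_countable_topology}"
  assumes a: "integrable M a" and b: "integrable M b"
  shows "prim a t \<bullet> prim b t = prim (\<lambda>s. a s \<bullet> prim b s + prim a s \<bullet> b s) t"
proof -
  have [measurable]: "a \<in> borel_measurable borel" "b \<in> borel_measurable borel" using a b by auto
  define f where "f p = (if fst p < t \<and> snd p < t then a (fst p) \<bullet> b (snd p) else 0)" for p
  define f1 where "f1 p = (if snd p < fst p then f p else 0)" for p
  define f2 where "f2 p = (if fst p < snd p then f p else 0)" for p
  have [measurable]: "f \<in> borel_measurable (M \<Otimes>\<^sub>M M)" unfolding f_def by measurable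
  have [measurable]: "f1 \<in> borel_measurable (M \<Otimes>\<^sub>M M)" "f2 \<in> borel_measurable (M \<Otimes>\<^sub>M M)"
    unfolding f1_def f2_def by measurable
  have ab: "integrable (M \<Otimes>\<^sub>M M) (\<lambda>p. norm (a (fst p)) * norm (b (snd p)))"
    by (intro integrable_pair_mult sigma_finite_measure_axioms integrable_norm a b)
  have i: "integrable (M \<Otimes>\<^sub>M M) f" "integrable (M \<Otimes>\<^sub>M M) f1" "integrable (M \<Otimes>\<^sub>M M) f2"
    by (rule Bochner_Integration.integrable_bound[OF ab];
        auto simp: f_def f1_def f2_def abs_mult Cauchy_Schwarz_ineq2)+
  have "prim a t \<bullet> prim b t = (\<integral>x. (\<integral>y. f (x, y) \<partial>M) \<partial>M)"
  proof -
    have "(\<integral>y. f (x, y) \<partial>M) = (if x < t then a x \<bullet> prim b t else 0)" for x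
    proof (cases "x < t")
      case True
      have "a x \<bullet> prim b t = (\<integral>y. a x \<bullet> (if y < t then b y else 0) \<partial>M)"
        unfolding prim_def by (intro integral_inner_right[symmetric] integrable_cut[OF b])
      also have "\<dots> = (\<integral>y. f (x, y) \<partial>M)" using True by (intro Bochner_Integration.integral_cong) (auto simp: f_def)
      finally show ?thesis using True by simp
    qed (simp add: f_def)
    then have "(\<integral>x. (\<integral>y. f (x, y) \<partial>M) \<partial>M) = prim (\<lambda>x. a x \<bullet> prim b t) t"
      unfolding prim_def[of "\<lambda>x. a x \<bullet> prim b t"] by simp
    then show ?thesis using prim_inner[OF a] by metis
  qed
  also have "\<dots> = integral\<^sup>L (M \<Otimes>\<^sub>M M) f" using P.integral_fst[of "\<lambda>x y. f (x, y)"] i by simp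
  also have "\<dots> = integral\<^sup>L (M \<Otimes>\<^sub>M M) (\<lambda>p. f1 p + f2 p)"
  proof (rule integral_cong_AE)
    \<comment> \<open>Points are null for \<open>M\<close>, hence the diagonal is null for the
      product, and both triangles may be taken open.\<close>
    have "AE p in M \<Otimes>\<^sub>M M. fst p \<noteq> snd p"
    proof (rule P.AE_pair_measure)
      show "{p \<in> space (M \<Otimes>\<^sub>M M). fst p \<noteq> snd p} \<in> sets (M \<Otimes>\<^sub>M M)"
        by measurable
      show "AE x in M. AE y in M. fst (x, y) \<noteq> snd (x, y)"
      proof (rule AE_I2)
        fix x
        show "AE y in M. fst (x, y) \<noteq> snd (x, y)" using AE_M_neq[of x] by eventually_elim simp
      qed
    qed
    then show "AE p in M \<Otimes>\<^sub>M M. f p = f1 p + f2 p"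
      by eventually_elim (auto simp: f1_def f2_def)
  qed measurable
  also have "\<dots> = integral\<^sup>L (M \<Otimes>\<^sub>M M) f1 + integral\<^sup>L (M \<Otimes>\<^sub>M M) f2"
    using i by simp
  also have "integral\<^sup>L (M \<Otimes>\<^sub>M M) f1 = (\<integral>x. (\<integral>y. f1 (x, y) \<partial>M) \<partial>M)"
    using P.integral_fst[of "\<lambda>x y. f1 (x, y)"] i by simp
  also have "\<dots> = prim (\<lambda>s. a s \<bullet> prim b s) t"
    unfolding prim_def[of "\<lambda>s. a s \<bullet> prim b s"]
  proof (rule Bochner_Integration.integral_cong[OF refl])
    fix x
    show "(\<integral>y. f1 (x, y) \<partial>M) = (if x < t then a x \<bullet> prim b x else 0)"
    proof (cases "x < t")
      case True
      have "a x \<bullet> prim b x = (\<integral>y. a x \<bullet> (if y < x then b y else 0) \<partial>M)"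
        unfolding prim_def by (intro integral_inner_right[symmetric] integrable_cut[OF b])
      also have "\<dots> = (\<integral>y. f1 (x, y) \<partial>M)" using True by (intro Bochner_Integration.integral_cong) (auto simp: f_def f1_def)
      finally show ?thesis using True by simp
    next
      case False
      then have "f1 (x, y) = 0" for y by (auto simp: f_def f1_def)
      then show ?thesis using False by simp
    qed
  qed
  also have "integral\<^sup>L (M \<Otimes>\<^sub>M M) f2 = (\<integral>y. (\<integral>x. f2 (x, y) \<partial>M) \<partial>M)"
    using P.integral_snd[of "\<lambda>x y. f2 (x, y)"] i by simp
  also have "\<dots> = prim (\<lambda>s. prim a s \<bullet> b s) t"
    unfolding prim_def[of "\<lambda>s. prim a s \<bullet> b s"]
  proof (rule Bochner_Integration.integral_cong[OF refl])
    fix y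
    show "(\<integral>x. f2 (x, y) \<partial>M) = (if y < t then prim a y \<bullet> b y else 0)"
    proof (cases "y < t")
      case True
      have "prim a y \<bullet> b y = (\<integral>x. (if x < y then a x else 0) \<bullet> b y \<partial>M)"
        unfolding prim_def by (intro integral_inner_left[symmetric] integrable_cut[OF a])
      also have "\<dots> = (\<integral>x. f2 (x, y) \<partial>M)" using True by (intro Bochner_Integration.integral_cong) (auto simp: f_def f2_def)
      finally show ?thesis using True by simp
    next
      case False
      then have "f2 (x, y) = 0" for x by (auto simp: f_def f2_def)
      then show ?thesis using False by simp
    qed
  qed
  also have "prim (\<lambda>s. a s \<bullet> prim b s) t + prim (\<lambda>s. prim a s \<bullet> b s) t
      = prim (\<lambda>s. a s \<bullet> prim b s + prim a s \<bullet> b s) t"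
  proof (rule prim_add[symmetric])
    show "integrable M (\<lambda>s. a s \<bullet> prim b s)"
    proof (rule Bochner_Integration.integrable_bound)
      show "integrable M (\<lambda>s. norm (a s) * (\<integral>s. norm (b s) \<partial>M))" using a by simp
      show "(\<lambda>s. a s \<bullet> prim b s) \<in> borel_measurable M" using b by simp
      show "AE s in M. norm (a s \<bullet> prim b s) \<le> norm (norm (a s) * (\<integral>s. norm (b s) \<partial>M))"
        using order_trans[OF Cauchy_Schwarz_ineq2 mult_left_mono[OF prim_norm_le_integral[OF b] norm_ge_zero]]
        by (intro AE_I2) (simp add: abs_mult)
    qed
    show "integrable M (\<lambda>s. prim a s \<bullet> b s)"
    proof (rule Bochner_Integration.integrable_bound)
      show "integrable M (\<lambda>s. (\<integral>s. norm (a s) \<partial>M) * norm (b s))" using b by simp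
      show "(\<lambda>s. prim a s \<bullet> b s) \<in> borel_measurable M" using a by simp
      show "AE s in M. norm (prim a s \<bullet> b s) \<le> norm ((\<integral>s. norm (a s) \<partial>M) * norm (b s))"
        using order_trans[OF Cauchy_Schwarz_ineq2 mult_right_mono[OF prim_norm_le_integral[OF a] norm_ge_zero]]
        by (intro AE_I2) (simp add: abs_mult)
    qed
  qed
  finally show ?thesis .
qed

lemma integrable_inner_bounded:
  fixes a B :: "real \<Rightarrow> 'b::{real_inner,banach,second_countable_topology}"
  assumes a: "integrable M a" and B: "B \<in> borel_measurable borel" "\<And>t. 0 < t \<Longrightarrow> t < T \<Longrightarrow> norm (B t) \<le> K"
  shows "integrable M (\<lambda>s. a s \<bullet> B s)" "integrable M (\<lambda>s. B s \<bullet> a s)"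
proof -
  have [measurable]: "a \<in> borel_measurable borel" using a by auto
  show "integrable M (\<lambda>s. a s \<bullet> B s)"
  proof (rule Bochner_Integration.integrable_bound)
    show "integrable M (\<lambda>s. norm (a s) * \<bar>K\<bar>)" using a by simp
    show "(\<lambda>s. a s \<bullet> B s) \<in> borel_measurable M" using B by simp
    show "AE s in M. norm (a s \<bullet> B s) \<le> norm (norm (a s) * \<bar>K\<bar>)"
      using AE_M_interval
    proof eventually_elim
      case (elim s)
      then have "norm (B s) \<le> \<bar>K\<bar>" using B(2)[of s] by linarith
      from order_trans[OF Cauchy_Schwarz_ineq2 mult_left_mono[OF this norm_ge_zero[of "a s"]]]
      show ?case
        by (auto simp: abs_mult)
    qed
  qed
  then show "integrable M (\<lambda>s. B s \<bullet> a s)" by (simp add: inner_commute)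
qed

lemma prim_bounded: "integrable M a \<Longrightarrow> norm (A0 + prim a t) \<le> norm A0 + (\<integral>s. norm (a s) \<partial>M)"
  using norm_triangle_ineq[of A0 "prim a t"] prim_norm_le_integral[of a t] by linarith

lemma integrable_prim_density:
  fixes a b :: "real \<Rightarrow> 'b::{real_inner,banach,second_countable_topology}"
  assumes a: "integrable M a" and b: "integrable M b"
  shows "integrable M (\<lambda>s. a s \<bullet> (B0 + prim b s) + (A0 + prim a s) \<bullet> b s)"
  using assms
  by (intro Bochner_Integration.integrable_add integrable_inner_bounded[OF _ _ prim_bounded]) auto

lemma prim_product:
  fixes a b :: "real \<Rightarrow> 'b::{real_inner,banach,second_countable_topology}"
  assumes a: "integrable M a" and b: "integrable M b"
  shows "(A0 + prim a t) \<bullet> (B0 + prim b t)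
    = A0 \<bullet> B0 + prim (\<lambda>s. a s \<bullet> (B0 + prim b s) + (A0 + prim a s) \<bullet> b s) t"
proof -
  have i: "integrable M (\<lambda>s. a s \<bullet> prim b s + prim a s \<bullet> b s)" using integrable_prim_density[OF a b, of 0 0] by simp
  have j: "integrable M (\<lambda>s. a s \<bullet> B0)" "integrable M (\<lambda>s. b s \<bullet> A0)" using a b by auto
  have "(\<lambda>s. a s \<bullet> (B0 + prim b s) + (A0 + prim a s) \<bullet> b s)
    = (\<lambda>s. (a s \<bullet> prim b s + prim a s \<bullet> b s) + (a s \<bullet> B0 + b s \<bullet> A0))"
    by (simp add: inner_add_left inner_add_right inner_commute[of A0] fun_eq_iff)
  then have "prim (\<lambda>s. a s \<bullet> (B0 + prim b s) + (A0 + prim a s) \<bullet> b s) t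
    = prim (\<lambda>s. (a s \<bullet> prim b s + prim a s \<bullet> b s) + (a s \<bullet> B0 + b s \<bullet> A0)) t" by simp
  also have "\<dots> = prim a t \<bullet> prim b t + (prim a t \<bullet> B0 + prim b t \<bullet> A0)"
    by (simp only: prim_add[OF i Bochner_Integration.integrable_add[OF j]] prim_add[OF j]
        prim_product_0[OF a b, symmetric] prim_inner[OF a, symmetric] prim_inner[OF b, symmetric])
  finally show ?thesis by (simp add: inner_simps inner_commute)
qed

lemma prim_FTC:
  fixes F f :: "real \<Rightarrow> real"
  assumes "0 \<le> t" "t \<le> T" and [measurable]: "f \<in> borel_measurable borel"
    and d: "\<And>x. 0 \<le> x \<Longrightarrow> x \<le> T \<Longrightarrow> (F has_real_derivative f x) (at x within {0..T})"
    and c: "continuous_on {0..T} f"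
  shows "F t = F 0 + prim f t"
proof -
  have "(\<integral>x. indicator {0..t} x *\<^sub>R f x \<partial>lborel) = F t - F 0"
  proof (rule integral_FTC_Icc)
    fix x assume "0 \<le> x" "x \<le> t"
    then show "(F has_vector_derivative f x) (at x within {0..t})"
      using d[of x] assms(2) unfolding has_real_derivative_iff_has_vector_derivative[symmetric]
      by (auto intro: DERIV_subset)
  qed (use assms(1,2) c in \<open>auto intro: continuous_on_subset\<close>)
  moreover have "prim f t = (\<integral>x. indicator {0..t} x *\<^sub>R f x \<partial>lborel)"
  proof -
    have "AE x in lborel. x \<noteq> 0 \<and> x \<noteq> t" using AE_lborel_singleton[of 0] AE_lborel_singleton[of t] by eventually_elim auto
    then have ae: "AE x in lborel. indicator {0<..<T} x *\<^sub>R (if x < t then f x else 0) = indicator {0..t} x *\<^sub>R f x"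
      by eventually_elim (use assms(1,2) in \<open>auto simp: indicator_def\<close>)
    have m: "(\<lambda>s. if s < t then f s else 0) \<in> borel_measurable borel" by measurable
    show ?thesis unfolding prim_def integral_M[OF m]
      by (rule integral_cong_AE[OF _ _ ae]) measurable
  qed
  ultimately show ?thesis by simp
qed

lemma mult_le_interval: "0 < t \<Longrightarrow> t < T \<Longrightarrow> c * t \<le> \<bar>c\<bar> * T"
  by (rule order_trans[OF mult_right_mono mult_left_mono]) auto

text \<open>The product rule applied twice, the exponential being a primitive as well. The later
  integrations by parts in time are instances, with exponent \<open>\<gamma>\<close>, its negative,
  or 0.\<close>

lemma weighted_product_integral:
  fixes a b :: "real \<Rightarrow> 'b::{real_inner,banach,second_countable_topology}"
  assumes a: "integrable M a" and b: "integrable M b"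
    and A: "\<And>t. 0 \<le> t \<Longrightarrow> t \<le> T \<Longrightarrow> A t = A0 + prim a t"
    and B: "\<And>t. 0 \<le> t \<Longrightarrow> t \<le> T \<Longrightarrow> B t = B0 + prim b t"
    and [measurable]: "A \<in> borel_measurable borel" "B \<in> borel_measurable borel"
  shows "(\<integral>t. exp (c * t) * (a t \<bullet> B t + A t \<bullet> b t + c * (A t \<bullet> B t)) \<partial>M)
    = exp (c * T) * (A T \<bullet> B T) - A0 \<bullet> B0"
proof -
  have [measurable]: "a \<in> borel_measurable borel" "b \<in> borel_measurable borel"
    "prim a \<in> borel_measurable borel" "prim b \<in> borel_measurable borel" using a b by auto
  define y where "y s = a s \<bullet> (B0 + prim b s) + (A0 + prim a s) \<bullet> b s" for s
  define e where "e s = c * exp (c * s)" for s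
  have yi: "integrable M y" unfolding y_def by (rule integrable_prim_density[OF a b])
  have [measurable]: "y \<in> borel_measurable borel" using yi by auto
  have [measurable]: "e \<in> borel_measurable borel" unfolding e_def[abs_def] by measurable
  have ei: "integrable M e"
    by (rule integrable_bounded_M[where B="\<bar>c\<bar> * exp (\<bar>c\<bar> * T)"])
       (auto simp: e_def abs_mult intro!: mult_left_mono mult_le_interval)
  have y: "A t \<bullet> B t = A0 \<bullet> B0 + prim y t" if "0 \<le> t" "t \<le> T" for t
    unfolding A[OF that] B[OF that] y_def by (rule prim_product[OF a b])
  have e: "exp (c * t) = 1 + prim e t" if "0 \<le> t" "t \<le> T" for t
  proof -
    have "exp (c * t) = exp (c * 0) + prim e t"
    proof (rule prim_FTC[OF that])
      show "((\<lambda>t. exp (c * t)) has_real_derivative e x) (at x within {0..T})" for x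
        unfolding e_def by (auto intro!: derivative_eq_intros)
      show "continuous_on {0..T} e" unfolding e_def[abs_def] by (intro continuous_intros)
    qed measurable
    then show ?thesis by simp
  qed
  have pm[measurable]: "prim y \<in> borel_measurable borel" "prim e \<in> borel_measurable borel" using yi ei by auto
  have "(1 + prim e T) \<bullet> (A0 \<bullet> B0 + prim y T)
    = 1 \<bullet> (A0 \<bullet> B0) + prim (\<lambda>s. e s \<bullet> (A0 \<bullet> B0 + prim y s) + (1 + prim e s) \<bullet> y s) T"
    by (rule prim_product[OF ei yi])
  then have "exp (c * T) * (A T \<bullet> B T) = A0 \<bullet> B0 + prim (\<lambda>s. e s \<bullet> (A0 \<bullet> B0 + prim y s) + (1 + prim e s) \<bullet> y s) T"
    using y[of T] e[of T] T_pos by simp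
  also have "prim (\<lambda>s. e s \<bullet> (A0 \<bullet> B0 + prim y s) + (1 + prim e s) \<bullet> y s) T
    = (\<integral>s. e s \<bullet> (A0 \<bullet> B0 + prim y s) + (1 + prim e s) \<bullet> y s \<partial>M)"
    by (rule prim_T[OF integrable_prim_density[OF ei yi]]) simp
  also have "\<dots> = (\<integral>t. exp (c * t) * (a t \<bullet> B t + A t \<bullet> b t + c * (A t \<bullet> B t)) \<partial>M)"
  proof (rule integral_cong_AE)
    show "AE s in M. e s \<bullet> (A0 \<bullet> B0 + prim y s) + (1 + prim e s) \<bullet> y s
       = exp (c * s) * (a s \<bullet> B s + A s \<bullet> b s + c * (A s \<bullet> B s))"
      using AE_M_interval
    proof eventually_elim
      case (elim s)
      then have "0 \<le> s" "s \<le> T" by auto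
      note y = y[OF this, symmetric] and e = e[OF this, symmetric] and A = A[OF this, symmetric] and B = B[OF this, symmetric]
      show ?case unfolding y e unfolding y_def A B by (simp add: e_def algebra_simps)
    qed
  qed measurable
  finally show ?thesis by simp
qed

section \<open>Convolution in time and its adjoint\<close>

definition conv :: "(real \<Rightarrow> real) \<Rightarrow> (real \<Rightarrow> 'b::{banach,second_countable_topology}) \<Rightarrow> real \<Rightarrow> 'b" where
  "conv g q t = prim (\<lambda>s. g (t - s) *\<^sub>R q s) t"

text \<open>The adjoint of \<open>conv\<close> for the inner product of square integrable functions
  of time; where \<open>conv\<close> integrates over the past, it integrates over the future up to
  \<open>T\<close>.\<close>

definition conv_adj :: "(real \<Rightarrow> real) \<Rightarrow> (real \<Rightarrow> 'b::{banach,second_countable_topology}) \<Rightarrow> real \<Rightarrow> 'b" where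
  "conv_adj g k s = (\<integral>t. (if s < t then g (t - s) *\<^sub>R k t else 0) \<partial>M)"

context
  fixes g :: "real \<Rightarrow> real" and K :: real
  assumes g[measurable]: "g \<in> borel_measurable borel" and gK: "\<And>x. \<bar>g x\<bar> \<le> K"
begin

lemma kernel_bound_nonneg: "K \<ge> 0" using gK[of 0] by linarith

lemma integrable_kernel_mult:
  fixes q :: "real \<Rightarrow> 'b::{banach,second_countable_topology}"
  assumes "integrable M q"
  shows "integrable M (\<lambda>s. g (t - s) *\<^sub>R q s)" "integrable M (\<lambda>s. if s < t then g (t - s) *\<^sub>R q s else 0)"
    "integrable M (\<lambda>s. if t < s then g (s - t) *\<^sub>R q s else 0)"
proof -
  have [measurable]: "q \<in> borel_measurable borel" using assms by auto
  show 1: "integrable M (\<lambda>s. g (t - s) *\<^sub>R q s)"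
    by (rule integrable_bounded_scaleR_M[OF _ gK assms]) measurable
  show "integrable M (\<lambda>s. if s < t then g (t - s) *\<^sub>R q s else 0)" by (rule integrable_cut[OF 1])
  have "integrable M (\<lambda>s. g (s - t) *\<^sub>R q s)"
    by (rule integrable_bounded_scaleR_M[OF _ gK assms]) measurable
  then show "integrable M (\<lambda>s. if t < s then g (s - t) *\<^sub>R q s else 0)"
    by (rule Bochner_Integration.integrable_bound) auto
qed

lemma norm_conv_le:
  assumes "integrable M q" shows "norm (conv g q t) \<le> K * prim (\<lambda>s. norm (q s)) t"
proof -
  have "norm (conv g q t) \<le> prim (\<lambda>s. norm (g (t - s) *\<^sub>R q s)) t"
    unfolding conv_def by (rule norm_prim_le) (rule integrable_kernel_mult[OF assms])
  also have "\<dots> \<le> prim (\<lambda>s. K *\<^sub>R norm (q s)) t"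
    by (rule prim_mono[OF integrable_norm[OF integrable_kernel_mult(1)[OF assms]]])
       (use assms gK in \<open>auto intro: mult_right_mono\<close>)
  finally show ?thesis using prim_scaleR[of "\<lambda>s. norm (q s)" K t] assms by simp
qed

lemma norm_conv_le_integral:
  assumes "integrable M q" shows "norm (conv g q t) \<le> K * (\<integral>s. norm (q s) \<partial>M)"
proof -
  have "prim (\<lambda>s. norm (q s)) t \<le> (\<integral>s. norm (q s) \<partial>M)"
    using prim_norm_le_integral[of "\<lambda>s. norm (q s)" t] assms by simp
  then show ?thesis using norm_conv_le[OF assms, of t] kernel_bound_nonneg
    by (meson mult_left_mono order_trans)
qed

lemma norm_conv_adj_le_integral:
  assumes "integrable M k" shows "norm (conv_adj g k t) \<le> K * (\<integral>s. norm (k s) \<partial>M)"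
proof -
  have "norm (conv_adj g k t) \<le> (\<integral>s. norm (if t < s then g (s - t) *\<^sub>R k s else 0) \<partial>M)"
    unfolding conv_adj_def by (rule integral_norm_bound)
  also have "\<dots> \<le> (\<integral>s. K * norm (k s) \<partial>M)"
    by (rule integral_mono)
       (use assms integrable_kernel_mult(3)[OF assms, of t] gK kernel_bound_nonneg in \<open>auto intro: mult_right_mono\<close>)
  finally show ?thesis by simp
qed

lemma conv_measurable[measurable]:
  assumes "integrable M q" shows "conv g q \<in> borel_measurable borel"
proof -
  have [measurable]: "q \<in> borel_measurable borel" using assms by auto
  have "(\<lambda>t. \<integral>s. (if s < t then g (t - s) *\<^sub>R q s else 0) \<partial>M) \<in> borel_measurable borel"
    by (rule borel_measurable_lebesgue_integral) measurable
  then show ?thesis unfolding conv_def[abs_def] prim_def .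
qed

lemma conv_adj_measurable[measurable]:
  assumes "integrable M k" shows "conv_adj g k \<in> borel_measurable borel"
proof -
  have [measurable]: "k \<in> borel_measurable borel" using assms by auto
  show ?thesis unfolding conv_adj_def[abs_def]
    by (rule borel_measurable_lebesgue_integral) measurable
qed

text \<open>Both sides integrate the same function over the triangle s < t, in the two
  orders.\<close>

lemma conv_adjoint:
  fixes q k :: "real \<Rightarrow> 'b::{real_inner,banach,second_countable_topology}"
  assumes q: "integrable M q" and k: "integrable M k"
  shows "(\<integral>t. conv g q t \<bullet> k t \<partial>M) = (\<integral>s. q s \<bullet> conv_adj g k s \<partial>M)"
proof -
  have [measurable]: "q \<in> borel_measurable borel" "k \<in> borel_measurable borel" using q k by auto
  define f where "f t s = (if s < t then g (t - s) * (q s \<bullet> k t) else 0)" for t s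
  have [measurable]: "case_prod f \<in> borel_measurable (M \<Otimes>\<^sub>M M)" unfolding f_def by measurable
  have kq: "integrable (M \<Otimes>\<^sub>M M) (\<lambda>p. (K * norm (k (fst p))) * norm (q (snd p)))"
    using q k by (intro integrable_pair_mult sigma_finite_measure_axioms) auto
  have "integrable (M \<Otimes>\<^sub>M M) (case_prod f)"
  proof (rule Bochner_Integration.integrable_bound[OF kq])
    show "AE p in M \<Otimes>\<^sub>M M. norm (case_prod f p) \<le> norm (K * norm (k (fst p)) * norm (q (snd p)))"
    proof (intro AE_I2)
      fix p
      have "\<bar>g (fst p - snd p)\<bar> * \<bar>q (snd p) \<bullet> k (fst p)\<bar> \<le> K * (norm (q (snd p)) * norm (k (fst p)))"
        using gK kernel_bound_nonneg by (intro mult_mono Cauchy_Schwarz_ineq2) auto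
      then show "norm (case_prod f p) \<le> norm (K * norm (k (fst p)) * norm (q (snd p)))"
        using kernel_bound_nonneg by (auto simp: f_def abs_mult split_beta mult_ac)
    qed
  qed measurable
  then have "(\<integral>s. (\<integral>t. f t s \<partial>M) \<partial>M) = (\<integral>t. (\<integral>s. f t s \<partial>M) \<partial>M)" by (rule P.Fubini_integral)
  moreover have "(\<integral>t. f t s \<partial>M) = q s \<bullet> conv_adj g k s" for s
    unfolding conv_adj_def f_def
    by (subst integral_inner_right[symmetric]) (auto intro: integrable_kernel_mult k intro!: Bochner_Integration.integral_cong)
  moreover have "(\<integral>s. f t s \<partial>M) = conv g q t \<bullet> k t" for t
    unfolding conv_def prim_def f_def
    by (subst integral_inner_left[symmetric]) (auto intro: integrable_kernel_mult q intro!: Bochner_Integration.integral_cong)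
  ultimately show ?thesis by simp
qed

lemma conv_add: "integrable M p \<Longrightarrow> integrable M q \<Longrightarrow> conv g (\<lambda>s. p s + q s) t = conv g p t + conv g q t"
  unfolding conv_def by (subst prim_add[symmetric]) (auto intro: integrable_kernel_mult simp: scaleR_add_right)

lemma conv_adj_add:
  assumes "integrable M p" "integrable M q"
  shows "conv_adj g (\<lambda>s. p s + q s) t = conv_adj g p t + conv_adj g q t"
  unfolding conv_adj_def
  by (subst Bochner_Integration.integral_add[symmetric])
     (auto intro: integrable_kernel_mult assms intro!: Bochner_Integration.integral_cong simp: scaleR_add_right)

lemma conv_adj_scaleR:
  "conv_adj g (\<lambda>s. c *\<^sub>R p s) t = c *\<^sub>R conv_adj g p t"
  unfolding conv_adj_def
  unfolding integral_scaleR_right[symmetric]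
  by (rule Bochner_Integration.integral_cong) (auto simp: scaleR_left_commute)

end

text \<open>Differentiating the kernel instead of \<open>q\<close> gives the convolution an
  integrable time derivative although \<open>q\<close> has none. The integrated form follows from
  Fubini's theorem on s < r < t: integrating g' (r - s) over r gives g (t - s) - g 0.\<close>

lemma conv_eq_prim:
  fixes q :: "real \<Rightarrow> 'b::{real_inner,banach,second_countable_topology}"
  assumes g: "g \<in> borel_measurable borel" "\<And>x. \<bar>g x\<bar> \<le> K"
    and g': "continuous_on UNIV g'" "\<And>x. \<bar>g' x\<bar> \<le> K"
    and d: "\<And>x. 0 \<le> x \<Longrightarrow> x \<le> T \<Longrightarrow> (g has_real_derivative g' x) (at x within {0..T})"
    and q: "integrable M q" and t: "t \<le> T"
  shows "conv g q t = prim (\<lambda>r. g 0 *\<^sub>R q r + conv g' q r) t"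
proof -
  have [measurable]: "g' \<in> borel_measurable borel" using g'(1) by (rule borel_measurable_continuous_onI)
  note g'm = this
  have [measurable]: "q \<in> borel_measurable borel" using q by auto
  note [measurable] = g(1)
  have ci: "integrable M (conv g' q)"
    by (rule integrable_bounded_M[OF conv_measurable[OF g'm g'(2) q]])
       (rule norm_conv_le_integral[OF g'm g'(2) q])
  define f where "f r s = (if s < r \<and> r < t then g' (r - s) *\<^sub>R q s else 0)" for r s
  have [measurable]: "case_prod f \<in> borel_measurable (M \<Otimes>\<^sub>M M)" unfolding f_def by measurable
  have K0: "K \<ge> 0" using g(2)[of 0] by linarith
  have kq: "integrable (M \<Otimes>\<^sub>M M) (\<lambda>p. K * norm (q (snd p)))"
    using q by (intro integrable_pair_mult[where f="\<lambda>_. K"] sigma_finite_measure_axioms) auto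
  have "integrable (M \<Otimes>\<^sub>M M) (case_prod f)"
    by (rule Bochner_Integration.integrable_bound[OF kq])
       (auto simp: f_def abs_mult K0 split_beta intro!: mult_right_mono g'(2))
  then have F: "(\<integral>s. (\<integral>r. f r s \<partial>M) \<partial>M) = (\<integral>r. (\<integral>s. f r s \<partial>M) \<partial>M)" by (rule P.Fubini_integral)
  have "(\<integral>r. (\<integral>s. f r s \<partial>M) \<partial>M) = prim (conv g' q) t"
    unfolding conv_def prim_def f_def by (intro Bochner_Integration.integral_cong) auto
  moreover have "(\<integral>s. (\<integral>r. f r s \<partial>M) \<partial>M) = prim (\<lambda>s. (g (t - s) - g 0) *\<^sub>R q s) t"
    unfolding prim_def
  proof (rule integral_cong_AE)
    show "AE s in M. (\<integral>r. f r s \<partial>M) = (if s < t then (g (t - s) - g 0) *\<^sub>R q s else 0)"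
      using AE_M_interval
    proof eventually_elim
      case (elim s)
      show ?case
      proof (cases "s < t")
        case True
        have "(\<integral>x. indicator {s..t} x *\<^sub>R g' (x - s) \<partial>lborel) = g (t - s) - g (s - s)"
        proof (rule integral_FTC_Icc)
          show "s \<le> t" using True by simp
          fix x assume x: "s \<le> x" "x \<le> t"
          have "(g \<circ> (\<lambda>x. x - s) has_real_derivative g' (x - s) * 1) (at x within {s..t})"
          proof (rule DERIV_image_chain)
            show "(g has_field_derivative g' (x - s)) (at (x - s) within (\<lambda>x. x - s) ` {s..t})"
              by (rule DERIV_subset[OF d]) (use x t elim in auto)
          qed (auto intro!: derivative_eq_intros)
          then show "((\<lambda>x. g (x - s)) has_vector_derivative g' (x - s)) (at x within {s..t})"
            unfolding has_real_derivative_iff_has_vector_derivative by (simp add: o_def)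
        next
          show "continuous_on {s..t} (\<lambda>x. g' (x - s))"
            by (rule continuous_on_compose2[OF g'(1)]) (auto intro!: continuous_intros)
        qed
        moreover have "(\<integral>x. indicator {s..t} x *\<^sub>R g' (x - s) \<partial>lborel) = (\<integral>r. (if s < r \<and> r < t then g' (r - s) else 0) \<partial>M)"
        proof -
          have "AE x in lborel. x \<noteq> s \<and> x \<noteq> t" using AE_lborel_singleton[of s] AE_lborel_singleton[of t] by eventually_elim auto
          then have ae: "AE x in lborel. indicator {s..t} x *\<^sub>R g' (x - s)
              = indicator {0<..<T} x *\<^sub>R (if s < x \<and> x < t then g' (x - s) else 0)"
            by eventually_elim (use elim t in \<open>auto simp: indicator_def\<close>)
          have m: "(\<lambda>r. if s < r \<and> r < t then g' (r - s) else 0) \<in> borel_measurable borel" by measurable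
          show ?thesis unfolding integral_M[OF m]
            by (rule integral_cong_AE[OF _ _ ae]) measurable
        qed
        moreover have "integrable M (\<lambda>r. if s < r \<and> r < t then g' (r - s) else 0)"
          by (rule integrable_bounded_M[where B=K]) (auto simp: g'(2) K0)
        then have "(\<integral>r. (if s < r \<and> r < t then g' (r - s) else 0) *\<^sub>R q s \<partial>M) = (\<integral>r. (if s < r \<and> r < t then g' (r - s) else 0) \<partial>M) *\<^sub>R q s"
          by (intro integral_scaleR_left)
        moreover have "(\<integral>r. (if s < r \<and> r < t then g' (r - s) else 0) *\<^sub>R q s \<partial>M) = (\<integral>r. f r s \<partial>M)"
          unfolding f_def by (intro Bochner_Integration.integral_cong) auto
        ultimately show ?thesis using True by simp
      next
        case False
        then have "f r s = 0" for r by (simp add: f_def)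
        then show ?thesis using False by simp
      qed
    qed
  qed measurable
  ultimately have 1: "prim (conv g' q) t = prim (\<lambda>s. (g (t - s) - g 0) *\<^sub>R q s) t" using F by simp
  also have "\<dots> = prim (\<lambda>s. g (t - s) *\<^sub>R q s) t - prim (\<lambda>s. g 0 *\<^sub>R q s) t"
    using q by (subst prim_diff[symmetric]) (auto intro: integrable_kernel_mult[OF g] simp: scaleR_diff_left)
  finally have "prim (\<lambda>s. g 0 *\<^sub>R q s) t + prim (conv g' q) t = prim (\<lambda>s. g (t - s) *\<^sub>R q s) t" by simp
  then show ?thesis using q ci by (simp add: prim_add conv_def[of g])
qed

section \<open>Square integrability on the time interval\<close>

definition sq :: "(real \<Rightarrow> 'b::{real_inner,banach,second_countable_topology}) \<Rightarrow> bool" where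
  "sq f \<longleftrightarrow> f \<in> borel_measurable borel \<and> integrable M (\<lambda>t. (norm (f t))\<^sup>2)"

lemma sq_measurable: "sq f \<Longrightarrow> f \<in> borel_measurable borel" by (simp add: sq_def)

lemma sq_iff_sqint: "f \<in> borel_measurable borel \<Longrightarrow> sq f \<longleftrightarrow> sqint (\<lambda>t. indicator {0<..<T} t *\<^sub>R f t)"
proof -
  assume f: "f \<in> borel_measurable borel"
  have "(\<lambda>t. (norm (indicator {0<..<T} t *\<^sub>R f t))\<^sup>2) = (\<lambda>t. indicator {0<..<T} t *\<^sub>R (norm (f t))\<^sup>2)"
    by (auto simp: indicator_def)
  then show ?thesis using f by (simp add: sq_def sqint_def integrable_M)
qed

lemma sqD: "sq f \<Longrightarrow> sqint (\<lambda>t. indicator {0<..<T} t *\<^sub>R f t)"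
  using sq_iff_sqint sq_measurable by blast

lemma sq_add: assumes "sq f" "sq g" shows "sq (\<lambda>t. f t + g t)"
  using sqint_add[OF sqD[OF assms(1)] sqD[OF assms(2)]] assms
  by (subst sq_iff_sqint) (auto intro: borel_measurable_add sq_measurable simp: scaleR_add_right)

lemma sq_scaleR: assumes "sq f" shows "sq (\<lambda>t. c *\<^sub>R f t)"
  using sqint_scaleR[OF sqD[OF assms], of c] assms
  by (subst sq_iff_sqint) (auto intro: borel_measurable_scaleR sq_measurable simp: mult.commute)

lemma sq_uminus: "sq f \<Longrightarrow> sq (\<lambda>t. - f t)" using sq_scaleR[of f "-1"] by simp

lemma sq_diff: "sq f \<Longrightarrow> sq g \<Longrightarrow> sq (\<lambda>t. f t - g t)" using sq_add[of f "\<lambda>t. - g t"] sq_uminus[of g] by simp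

lemma sq_inner_integrable: assumes "sq f" "sq g" shows "integrable M (\<lambda>t. f t \<bullet> g t)"
proof -
  have "integrable lborel (\<lambda>t. (indicator {0<..<T} t *\<^sub>R f t) \<bullet> (indicator {0<..<T} t *\<^sub>R g t))"
    by (intro sqint_inner_integrable sqD assms)
  moreover have "(\<lambda>t. (indicator {0<..<T} t *\<^sub>R f t) \<bullet> (indicator {0<..<T} t *\<^sub>R g t)) = (\<lambda>t. indicator {0<..<T} t *\<^sub>R (f t \<bullet> g t))"
    by (auto simp: indicator_def)
  ultimately show ?thesis using assms by (simp add: integrable_M sq_measurable borel_measurable_inner)
qed

lemma sq_bounded:
  assumes "f \<in> borel_measurable borel" "\<And>t. 0 < t \<Longrightarrow> t < T \<Longrightarrow> norm (f t) \<le> B"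
  shows "sq f"
  unfolding sq_def using assms
  by (intro conjI integrable_bounded_M[where B="B\<^sup>2"]) (auto intro!: power_mono)

lemma sq_norm: "sq f \<Longrightarrow> sq (\<lambda>t. norm (f t))"
  by (auto simp: sq_def intro: borel_measurable_norm)

lemma sq_integrable: assumes "sq f" shows "integrable M f"
proof -
  have "integrable M (\<lambda>t. norm (f t) \<bullet> 1)"
    by (rule sq_inner_integrable[OF sq_norm[OF assms] sq_bounded[where B=1]]) auto
  then show ?thesis using assms by (simp add: integrable_norm_iff sq_measurable)
qed

lemma sq_bounded_scaleR:
  assumes h: "h \<in> borel_measurable borel" "\<And>t. 0 < t \<Longrightarrow> t < T \<Longrightarrow> \<bar>h t\<bar> \<le> B" and f: "sq f"
  shows "sq (\<lambda>t. h t *\<^sub>R f t)"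
proof -
  note [measurable] = h(1) sq_measurable[OF f]
  have "integrable M (\<lambda>t. (h t)\<^sup>2 *\<^sub>R (norm (f t))\<^sup>2)"
  proof (rule integrable_bounded_scaleR_M[where B="B\<^sup>2"])
    show "\<bar>(h t)\<^sup>2\<bar> \<le> B\<^sup>2" if "0 < t" "t < T" for t using power_mono[OF h(2)[OF that], of 2] by simp
  qed (use f in \<open>auto simp: sq_def\<close>)
  then show ?thesis by (simp add: sq_def power_mult_distrib)
qed

lemma sq_prim: "integrable M a \<Longrightarrow> sq (\<lambda>t. A0 + prim a t)"
  by (rule sq_bounded[OF _ prim_bounded]) auto

text \<open>Functions on the time interval are extended by zero, so that they become elements of a Hilbert space.\<close>

definition tcls :: "(real \<Rightarrow> 'b::{real_inner,banach,second_countable_topology}) \<Rightarrow> (real, 'b) lsq" where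
  "tcls f = cls (\<lambda>t. indicator {0<..<T} t *\<^sub>R f t)"

lemma sq_sqint: "sqint f \<Longrightarrow> sq f"
  unfolding sq_iff_sqint[OF sqint_measurable]
  by (rule sqint_bound[where c=1]) (auto simp: indicator_def sqint_measurable intro!: borel_measurable_scaleR)

lemma inner_tcls:
  assumes f: "sq f" shows "F \<bullet> tcls f = (\<integral>t. fn F t \<bullet> f t \<partial>M)"
proof -
  note [measurable] = sq_measurable[OF f]
  have "cls (fn F) \<bullet> tcls f = (\<integral>t. fn F t \<bullet> (indicator {0<..<T} t *\<^sub>R f t) \<partial>lborel)"
    unfolding tcls_def by (rule inner_cls) (intro sqint_fn sqD f)+
  then show ?thesis by (simp add: cls_fn integral_M)
qed

lemma fn_tcls:
  assumes f: "sq f" shows "AE t in M. fn (tcls f) t = f t"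
proof -
  have "AE t in lborel. fn (tcls f) t = indicator {0<..<T} t *\<^sub>R f t"
    unfolding tcls_def by (rule fn_cls) (rule sqD[OF f])
  then show ?thesis unfolding AE_M by eventually_elim auto
qed

lemma inner_tcls_tcls:
  assumes "sq f" "sq h" shows "tcls f \<bullet> tcls h = (\<integral>t. f t \<bullet> h t \<partial>M)"
proof -
  note [measurable] = sq_measurable[OF assms(1)] sq_measurable[OF assms(2)]
  show ?thesis unfolding inner_tcls[OF assms(2)] using fn_tcls[OF assms(1)]
    by (intro integral_cong_AE) (auto elim!: eventually_mono)
qed

lemma tcls_add: "sq f \<Longrightarrow> sq h \<Longrightarrow> tcls f + tcls h = tcls (\<lambda>t. f t + h t)"
  unfolding tcls_def by (simp add: cls_add sqD scaleR_add_right)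

lemma tcls_scaleR: "sq f \<Longrightarrow> c *\<^sub>R tcls f = tcls (\<lambda>t. c *\<^sub>R f t)"
  unfolding tcls_def by (simp add: cls_scaleR sqD mult.commute)

text \<open>The delayed velocity for a history equal to zero. The contribution of the true history
  is a given function of time and is kept apart as data.\<close>

definition shift :: "real \<Rightarrow> (real \<Rightarrow> 'b::{banach,second_countable_topology}) \<Rightarrow> real \<Rightarrow> 'b" where
  "shift \<tau> w t = (if \<tau> < t then w (t - \<tau>) else 0)"

definition shift_adj :: "real \<Rightarrow> (real \<Rightarrow> 'b::{banach,second_countable_topology}) \<Rightarrow> real \<Rightarrow> 'b" where
  "shift_adj \<tau> v t = (if t + \<tau> < T then v (t + \<tau>) else 0)"

lemma shift_measurable[measurable]: "w \<in> borel_measurable borel \<Longrightarrow> shift \<tau> w \<in> borel_measurable borel"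
  "w \<in> borel_measurable borel \<Longrightarrow> shift_adj \<tau> w \<in> borel_measurable borel"
proof -
  assume [measurable]: "w \<in> borel_measurable borel"
  show "shift \<tau> w \<in> borel_measurable borel" unfolding shift_def[abs_def] by measurable
  show "shift_adj \<tau> w \<in> borel_measurable borel" unfolding shift_adj_def[abs_def] by measurable
qed

lemma integrable_shift:
  assumes "\<tau> \<ge> 0" "integrable M f"
  shows "integrable M (shift \<tau> f)" "integrable M (shift_adj \<tau> f)"
proof -
  have [measurable]: "f \<in> borel_measurable borel" using assms by auto
  have i: "integrable lborel (\<lambda>t. indicator {0<..<T} t *\<^sub>R f t)" using assms by (simp add: integrable_M)
  have 1: "integrable lborel (\<lambda>t. indicator {0<..<T} (c + 1 * t) *\<^sub>R f (c + 1 * t))" for c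
    by (rule lborel_integrable_real_affine[OF i]) simp
  show "integrable M (shift \<tau> f)"
    unfolding integrable_M[OF shift_measurable(1)[OF \<open>f \<in> _\<close>]]
    by (rule Bochner_Integration.integrable_bound[OF 1[of "-\<tau>"]]) (use assms(1) in \<open>auto simp: shift_def indicator_def\<close>)
  show "integrable M (shift_adj \<tau> f)"
    unfolding integrable_M[OF shift_measurable(2)[OF \<open>f \<in> _\<close>]]
    by (rule Bochner_Integration.integrable_bound[OF 1[of "\<tau>"]]) (use assms(1) in \<open>auto simp: shift_adj_def indicator_def add.commute\<close>)
qed

lemma sq_shift:
  assumes "\<tau> \<ge> 0" "sq f" shows "sq (shift \<tau> f)" "sq (shift_adj \<tau> f)"
proof -
  have "(\<lambda>t. (norm (shift \<tau> f t))\<^sup>2) = shift \<tau> (\<lambda>t. (norm (f t))\<^sup>2)"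
    "(\<lambda>t. (norm (shift_adj \<tau> f t))\<^sup>2) = shift_adj \<tau> (\<lambda>t. (norm (f t))\<^sup>2)"
    by (auto simp: shift_def shift_adj_def)
  then show "sq (shift \<tau> f)" "sq (shift_adj \<tau> f)" using assms integrable_shift[OF assms(1), of "\<lambda>t. (norm (f t))\<^sup>2"]
    by (auto simp: sq_def)
qed

text \<open>Translation preserves the integral over the line; the mass pushed beyond
  \<open>T\<close> is lost, and it is nonnegative.\<close>

lemma integral_shift_le:
  fixes f :: "real \<Rightarrow> real"
  assumes "\<tau> \<ge> 0" "integrable M f" "\<And>t. f t \<ge> 0"
  shows "(\<integral>t. shift \<tau> f t \<partial>M) \<le> (\<integral>t. f t \<partial>M)"
proof -
  have [measurable]: "f \<in> borel_measurable borel" using assms by auto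
  have i: "integrable lborel (\<lambda>t. indicator {0<..<T} t *\<^sub>R f t)" using assms by (simp add: integrable_M)
  have 1: "integrable lborel (\<lambda>t. indicator {0<..<T} (- \<tau> + 1 * t) *\<^sub>R f (- \<tau> + 1 * t))"
    by (rule lborel_integrable_real_affine[OF i]) simp
  have "(\<integral>t. shift \<tau> f t \<partial>M) \<le> (\<integral>t. indicator {0<..<T} (- \<tau> + 1 * t) *\<^sub>R f (- \<tau> + 1 * t) \<partial>lborel)"
    unfolding integral_M[OF shift_measurable(1)[OF \<open>f \<in> _\<close>]]
    using integrable_shift(1)[OF assms(1,2)] integrable_M[OF shift_measurable(1)[OF \<open>f \<in> _\<close>], of \<tau>]
    by (intro integral_mono 1) (use assms in \<open>auto simp: shift_def indicator_def\<close>)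
  also have "\<dots> = (\<integral>t. indicator {0<..<T} t *\<^sub>R f t \<partial>lborel)"
    using lborel_integral_real_affine[of 1 "\<lambda>t. indicator {0<..<T} t *\<^sub>R f t" "-\<tau>"] by simp
  finally show ?thesis by (simp add: integral_M)
qed

lemma shift_adjoint:
  fixes w v :: "real \<Rightarrow> 'b::{real_inner,banach,second_countable_topology}"
  assumes "\<tau> \<ge> 0" and [measurable]: "w \<in> borel_measurable borel" "v \<in> borel_measurable borel"
  shows "(\<integral>t. shift \<tau> w t \<bullet> v t \<partial>M) = (\<integral>t. w t \<bullet> shift_adj \<tau> v t \<partial>M)"
proof -
  have "(\<integral>t. shift \<tau> w t \<bullet> v t \<partial>M) = (\<integral>t. indicator {0<..<T} t *\<^sub>R (shift \<tau> w t \<bullet> v t) \<partial>lborel)"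
    by (rule integral_M) measurable
  also have "\<dots> = \<bar>1\<bar> *\<^sub>R (\<integral>t. indicator {0<..<T} (\<tau> + 1 * t) *\<^sub>R (shift \<tau> w (\<tau> + 1 * t) \<bullet> v (\<tau> + 1 * t)) \<partial>lborel)"
    by (rule lborel_integral_real_affine) simp
  also have "\<dots> = (\<integral>t. indicator {0<..<T} t *\<^sub>R (w t \<bullet> shift_adj \<tau> v t) \<partial>lborel)"
    using assms(1) by (simp, intro Bochner_Integration.integral_cong) (auto simp: shift_def shift_adj_def indicator_def add.commute)
  also have "\<dots> = (\<integral>t. w t \<bullet> shift_adj \<tau> v t \<partial>M)"
    by (rule integral_M[symmetric]) measurable
  finally show ?thesis .
qed

end

section \<open>The abstract problem\<close>

context time_interval
begin

lemma tcls_eq_iff: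
  assumes "sq f" "sq h" shows "tcls f = tcls h \<longleftrightarrow> (AE t in M. f t = h t)"
proof -
  have "tcls f = tcls h \<longleftrightarrow> (AE t in lborel. indicator {0<..<T} t *\<^sub>R f t = indicator {0<..<T} t *\<^sub>R h t)"
    unfolding tcls_def by (rule cls_eq_iff[OF sqD[OF assms(1)] sqD[OF assms(2)]])
  also have "\<dots> \<longleftrightarrow> (AE t in M. f t = h t)"
    unfolding AE_M by (rule AE_cong) (auto simp: indicator_def)
  finally show ?thesis .
qed

lemma sq_zero: "sq (\<lambda>t. 0)" by (simp add: sq_def)

lemma tcls_zero: "tcls (\<lambda>t. 0) = 0" by (simp add: tcls_def cls_zero)

lemma norm_tcls: "sq f \<Longrightarrow> (norm (tcls f))\<^sup>2 = (\<integral>t. (norm (f t))\<^sup>2 \<partial>M)"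
  by (simp add: power2_norm_eq_inner inner_tcls_tcls)

lemma integral_Cauchy_Schwarz:
  assumes "sq f" "sq h"
  shows "\<bar>\<integral>t. f t \<bullet> h t \<partial>M\<bar> \<le> sqrt (\<integral>t. (norm (f t))\<^sup>2 \<partial>M) * sqrt (\<integral>t. (norm (h t))\<^sup>2 \<partial>M)"
  using Cauchy_Schwarz_ineq2[of "tcls f" "tcls h"] assms
  by (simp add: inner_tcls_tcls norm_tcls[symmetric])

lemma integrable_exp_mult:
  fixes f :: "real \<Rightarrow> 'b::{banach,second_countable_topology}"
  assumes "integrable M f" shows "integrable M (\<lambda>t. exp (c * t) *\<^sub>R f t)"
  by (rule integrable_bounded_scaleR_M[OF _ _ assms, where B="exp (\<bar>c\<bar> * T)"]) (auto intro: mult_le_interval)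

lemma sq_exp_mult:
  fixes f :: "real \<Rightarrow> 'b::{real_inner,banach,second_countable_topology}"
  assumes "sq f" shows "sq (\<lambda>t. exp (c * t) *\<^sub>R f t)"
  by (rule sq_bounded_scaleR[OF _ _ assms, where B="exp (\<bar>c\<bar> * T)"]) (auto intro: mult_le_interval)

lemma integrable_exp_inner:
  fixes f h :: "real \<Rightarrow> 'b::{real_inner,banach,second_countable_topology}"
  shows "sq f \<Longrightarrow> sq h \<Longrightarrow> integrable M (\<lambda>t. exp (c * t) * (f t \<bullet> h t))"
  using integrable_exp_mult[OF sq_inner_integrable, of f h c] by simp

text \<open>The projection onto \<open>S\<close> is bounded and linear, hence commutes with the
  integral, and it fixes almost every value.\<close>

lemma prim_in_subspace:
  fixes S :: "'b::{real_inner,banach,second_countable_topology} set"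
  assumes S: "subspace S" "closed S" and a: "integrable M a" "AE t in M. a t \<in> S"
  shows "prim a t \<in> S"
proof -
  note bl = hproj_bounded_linear[OF S]
  have [measurable]: "a \<in> borel_measurable borel" using a by auto
  have "integrable M (\<lambda>t. hproj S (a t))" by (rule integrable_bounded_linear[OF bl a(1)])
  then have "prim (\<lambda>t. hproj S (a t)) t = prim a t"
    using a(2) by (intro prim_cong_AE) (auto elim!: eventually_mono simp: hproj_id[OF S])
  then have "hproj S (prim a t) = prim a t" using prim_linear[OF bl a(1), of t] by simp
  then show ?thesis using hproj_in[OF S] by metis
qed

lemma prim_Pair:
  fixes a :: "real \<Rightarrow> 'b::{banach,second_countable_topology}" and b :: "real \<Rightarrow> 'c::{banach,second_countable_topology}"
  assumes "integrable M a" "integrable M b"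
  shows "prim (\<lambda>t. (a t, b t)) t = (prim a t, prim b t)"
proof -
  have i: "integrable M (\<lambda>t. (a t, b t))"
  proof -
    have "integrable M (\<lambda>t. (a t, 0 :: 'c) + (0 :: 'b, b t))"
      using assms by (intro Bochner_Integration.integrable_add
        integrable_bounded_linear[of "\<lambda>x. (x, 0)"] integrable_bounded_linear[of "\<lambda>x. (0, x)"])
        (auto intro: bounded_linear_Pair bounded_linear_ident bounded_linear_zero)
    then show ?thesis by simp
  qed
  show ?thesis
    using prim_linear[OF bounded_linear_fst i, of t] prim_linear[OF bounded_linear_snd i, of t]
    by (simp add: prod_eq_iff)
qed

lemma sq_Pair:
  fixes a :: "real \<Rightarrow> 'b::{real_inner,banach,second_countable_topology}"
    and b :: "real \<Rightarrow> 'c::{real_inner,banach,second_countable_topology}"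
  assumes "sq a" "sq b" shows "sq (\<lambda>t. (a t, b t))"
proof -
  note [measurable] = sq_measurable[OF assms(1)] sq_measurable[OF assms(2)]
  have "(\<lambda>t. (a t, b t)) \<in> borel_measurable borel"
    unfolding borel_prod[symmetric] by measurable
  then show ?thesis using assms by (simp add: sq_def norm_prod_def)
qed

end

text \<open>\<open>VV\<close> stands for the graph of the gradient, \<open>'h\<close> and
  \<open>'k\<close> for square integrable functions and vector fields, and \<open>p\<close> for the
  part of the delay term that comes from the history. The kernel is bounded on the whole line; the
  application extends it by constants outside [0, T].\<close>

locale hyperbolic_problem = time_interval T for T :: real +
  fixes VV :: "('h::{real_inner,banach,second_countable_topology} \<times> 'k::{real_inner,banach,second_countable_topology}) set"
    and g g' :: "real \<Rightarrow> real" and K \<mu>1 \<mu>2 \<tau> :: real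
    and u0 :: 'h and k0 :: 'k and u1 :: 'h and p :: "real \<Rightarrow> 'h"
  assumes VV: "subspace VV" "closed VV" and tau: "\<tau> \<ge> 0"
    and g_cont: "continuous_on UNIV g" and gK: "\<And>x. \<bar>g x\<bar> \<le> K"
    and g'_cont: "continuous_on UNIV g'" and g'K: "\<And>x. \<bar>g' x\<bar> \<le> K"
    and g_deriv: "\<And>x. 0 \<le> x \<Longrightarrow> x \<le> T \<Longrightarrow> (g has_real_derivative g' x) (at x within {0..T})"
    and uk0: "(u0, k0) \<in> VV" and p: "sq p"
begin

lemma g_meas[measurable]: "g \<in> borel_measurable borel" "g' \<in> borel_measurable borel"
  using g_cont g'_cont by (auto intro: borel_measurable_continuous_onI)

lemma K0: "K \<ge> 0" using gK[of 0] by linarith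

lemma sq_conv:
  fixes q :: "real \<Rightarrow> 'b::{real_inner,banach,second_countable_topology}"
  assumes "integrable M q"
  shows "sq (conv g q)" "sq (conv g' q)" "sq (conv_adj g q)"
  by (rule sq_bounded[OF conv_measurable[OF g_meas(1) gK assms] norm_conv_le_integral[OF g_meas(1) gK assms]]
      sq_bounded[OF conv_measurable[OF g_meas(2) g'K assms] norm_conv_le_integral[OF g_meas(2) g'K assms]]
      sq_bounded[OF conv_adj_measurable[OF g_meas(1) gK assms] norm_conv_adj_le_integral[OF g_meas(1) gK assms]])+

text \<open>
  A test function is given by its time derivative \<open>z\<close> and its gradient \<open>k\<close>;
  its value is the primitive of \<open>z\<close> that vanishes at time \<open>T\<close>.
\<close>
definition val :: "(real \<Rightarrow> 'h) \<Rightarrow> real \<Rightarrow> 'h" where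
  "val z t = - integral\<^sup>L M z + prim z t"

definition is_test :: "(real \<Rightarrow> 'h) \<Rightarrow> (real \<Rightarrow> 'k) \<Rightarrow> bool" where
  "is_test z k \<longleftrightarrow> sq z \<and> sq k \<and> (AE t in M. (val z t, k t) \<in> VV)"

definition bform :: "(real \<Rightarrow> 'h) \<Rightarrow> (real \<Rightarrow> 'k) \<Rightarrow> (real \<Rightarrow> 'h) \<Rightarrow> (real \<Rightarrow> 'k) \<Rightarrow> real" where
  "bform w G z k = - (\<integral>t. w t \<bullet> z t \<partial>M) + (\<integral>t. G t \<bullet> k t \<partial>M) - (\<integral>t. conv g G t \<bullet> k t \<partial>M)
     + \<mu>1 * (\<integral>t. w t \<bullet> val z t \<partial>M) + \<mu>2 * (\<integral>t. shift \<tau> w t \<bullet> val z t \<partial>M)"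

text \<open>The unknown will be the displacement minus its initial value. These are the elastic and
  memory terms of the constant gradient \<open>k0\<close>, which the subtraction leaves on the
  right-hand side.\<close>

definition rhs0 :: "real \<Rightarrow> 'k" where
  "rhs0 t = k0 - conv g (\<lambda>_. k0) t"

definition lform :: "(real \<Rightarrow> 'h) \<Rightarrow> (real \<Rightarrow> 'k) \<Rightarrow> real" where
  "lform z k = val z 0 \<bullet> u1 - \<mu>2 * (\<integral>t. p t \<bullet> val z t \<partial>M) - (\<integral>t. rhs0 t \<bullet> k t \<partial>M)"

lemma sq_val: "sq z \<Longrightarrow> sq (val z)"
  unfolding val_def[abs_def] by (intro sq_prim sq_integrable)

lemma val_add: "sq z \<Longrightarrow> sq y \<Longrightarrow> val (\<lambda>t. z t + y t) t = val z t + val y t"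
  by (simp add: val_def prim_add sq_integrable)

lemma val_scaleR: "sq z \<Longrightarrow> val (\<lambda>t. c *\<^sub>R z t) t = c *\<^sub>R val z t"
  by (simp add: val_def prim_scaleR sq_integrable algebra_simps)

lemma val_T: "sq z \<Longrightarrow> val z T = 0"
  by (simp add: val_def prim_T sq_integrable)

lemma sq_rhs0: "sq rhs0"
  unfolding rhs0_def[abs_def] by (intro sq_diff sq_conv sq_bounded[where B="norm k0"]) auto

text \<open>\<open>dual_w\<close> and \<open>dual_G\<close> represent the weak form as inner
  products with the velocity and the gradient: delay and memory are moved onto the test function by
  their adjoints. They form the vectors \<open>y\<close> of the projection theorem.\<close>

definition dual_w :: "(real \<Rightarrow> 'h) \<Rightarrow> real \<Rightarrow> 'h" where
  "dual_w z t = - z t + \<mu>1 *\<^sub>R val z t + \<mu>2 *\<^sub>R shift_adj \<tau> (val z) t"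

definition dual_G :: "(real \<Rightarrow> 'k) \<Rightarrow> real \<Rightarrow> 'k" where
  "dual_G k t = k t - conv_adj g k t"

lemma sq_dual: "sq z \<Longrightarrow> sq (dual_w z)" "sq k \<Longrightarrow> sq (dual_G k)"
  unfolding dual_w_def[abs_def] dual_G_def[abs_def]
  by (intro sq_add sq_uminus sq_scaleR sq_shift tau sq_val sq_diff sq_conv sq_integrable; simp)+

lemma bform_eq_dual:
  assumes w: "sq w" and G: "sq G" and z: "sq z" and k: "sq k"
  shows "(\<integral>t. w t \<bullet> dual_w z t \<partial>M) + (\<integral>t. G t \<bullet> dual_G k t \<partial>M) = bform w G z k"
proof -
  note v = sq_val[OF z]
  have "(\<integral>t. w t \<bullet> dual_w z t \<partial>M) = (\<integral>t. - (w t \<bullet> z t) + \<mu>1 * (w t \<bullet> val z t) + \<mu>2 * (w t \<bullet> shift_adj \<tau> (val z) t) \<partial>M)"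
    unfolding dual_w_def by (simp add: inner_simps)
  also have "\<dots> = - (\<integral>t. w t \<bullet> z t \<partial>M) + \<mu>1 * (\<integral>t. w t \<bullet> val z t \<partial>M) + \<mu>2 * (\<integral>t. w t \<bullet> shift_adj \<tau> (val z) t \<partial>M)"
    using sq_inner_integrable[OF w z] sq_inner_integrable[OF w v] sq_inner_integrable[OF w sq_shift(2)[OF tau v]]
    by simp
  also have "(\<integral>t. w t \<bullet> shift_adj \<tau> (val z) t \<partial>M) = (\<integral>t. shift \<tau> w t \<bullet> val z t \<partial>M)"
    by (rule shift_adjoint[symmetric]) (use tau w v sq_measurable in auto)
  finally have 1: "(\<integral>t. w t \<bullet> dual_w z t \<partial>M) = - (\<integral>t. w t \<bullet> z t \<partial>M) + \<mu>1 * (\<integral>t. w t \<bullet> val z t \<partial>M)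
    + \<mu>2 * (\<integral>t. shift \<tau> w t \<bullet> val z t \<partial>M)" .
  have "(\<integral>t. G t \<bullet> dual_G k t \<partial>M) = (\<integral>t. G t \<bullet> k t \<partial>M) - (\<integral>t. G t \<bullet> conv_adj g k t \<partial>M)"
    unfolding dual_G_def inner_diff_right
    using sq_inner_integrable[OF G k] sq_inner_integrable[OF G sq_conv(3)[OF sq_integrable[OF k]]] by simp
  also have "(\<integral>t. G t \<bullet> conv_adj g k t \<partial>M) = (\<integral>t. conv g G t \<bullet> k t \<partial>M)"
    by (rule conv_adjoint[OF g_meas(1) gK sq_integrable[OF G] sq_integrable[OF k], symmetric])
  finally show ?thesis using 1 by (simp add: bform_def)
qed

subsection \<open>The a priori estimate\<close>

text \<open>Half of \<open>\<gamma>\<close> is the factor that the weight puts in front of the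
  kinetic and the elastic energy. It has to exceed the losses:
  \<open>\<bar>\<mu>1\<bar> + \<bar>\<mu>2\<bar>\<close> kinetic energies for damping and delay, and
  \<open>5 * K + 2 * K\<^sup>2\<close> elastic energies for the memory. The final 1 leaves one
  energy of each kind and makes 1 / \<open>\<gamma>\<close> at most 1.\<close>

definition \<gamma> :: real where "\<gamma> = 2 * (\<bar>\<mu>1\<bar> + \<bar>\<mu>2\<bar> + 5 * K + 2 * K\<^sup>2 + 1)"

lemma gamma: "\<gamma> \<ge> 1" "\<gamma> / 2 \<ge> \<bar>\<mu>1\<bar> + \<bar>\<mu>2\<bar> + 1" "\<gamma> / 2 \<ge> 5 * K + 2 * K\<^sup>2 + 1"
  using K0 zero_le_power2[of K] unfolding \<gamma>_def by auto

text \<open>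
  The multiplier for a test function \<open>v\<close> is \<open>\<integral>\<^sub>0\<^sup>t exp (\<gamma> s) v(s) ds\<close>; since \<open>v = exp (- \<gamma> t)\<close> times its
  derivative, this is the energy identity with an exponential weight.
\<close>
definition mul_w :: "(real \<Rightarrow> 'h) \<Rightarrow> real \<Rightarrow> 'h" where
  "mul_w z t = exp (\<gamma> * t) *\<^sub>R val z t"

definition mul_G :: "(real \<Rightarrow> 'k) \<Rightarrow> real \<Rightarrow> 'k" where
  "mul_G k = prim (\<lambda>t. exp (\<gamma> * t) *\<^sub>R k t)"

text \<open>Let \<Phi> be the multiplier, so that v = exp (- \<gamma> t) \<Phi>'. Kinetic and
  elastic energy then carry the same weight: exp (- \<gamma> t) times the square of \<Phi>' is exp
  (\<gamma> t) times the square of v.\<close>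

definition kinE :: "(real \<Rightarrow> 'h) \<Rightarrow> real" where
  "kinE z = (\<integral>t. exp (\<gamma> * t) * (norm (val z t))\<^sup>2 \<partial>M)"

definition elaE :: "(real \<Rightarrow> 'k) \<Rightarrow> real" where
  "elaE k = (\<integral>t. exp (- \<gamma> * t) * (norm (mul_G k t))\<^sup>2 \<partial>M)"

definition endE :: "(real \<Rightarrow> 'k) \<Rightarrow> real" where
  "endE k = exp (- \<gamma> * T) * (norm (mul_G k T))\<^sup>2"

text \<open>The elastic identity produces half of \<open>endE\<close>; one quarter is spent on the
  memory term, which leaves the quarter here.\<close>

definition energy :: "(real \<Rightarrow> 'h) \<Rightarrow> (real \<Rightarrow> 'k) \<Rightarrow> real" where
  "energy z k = (norm (val z 0))\<^sup>2 / 2 + kinE z + elaE k + endE k / 4"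

lemma energy_parts_nonneg: "kinE z \<ge> 0" "elaE k \<ge> 0" "endE k \<ge> 0"
  by (auto simp: kinE_def elaE_def endE_def)

lemma sq_mul: "sq z \<Longrightarrow> sq (mul_w z)" "sq k \<Longrightarrow> sq (mul_G k)"
  using sq_prim[OF sq_integrable[OF sq_exp_mult[of k \<gamma>]], of 0]
  unfolding mul_w_def[abs_def] mul_G_def by (simp_all add: sq_exp_mult sq_val)

text \<open>Makes the multiplier admissible as an unknown: the weight depends on time only, so
  weighted pairs stay in \<open>VV\<close>, and a closed subspace is stable under integration in
  time.\<close>

lemma mul_in_VV:
  assumes "is_test z k" shows "(prim (mul_w z) t, mul_G k t) \<in> VV"
proof -
  have z: "sq z" and k: "sq k" and V: "AE t in M. (val z t, k t) \<in> VV" using assms by (auto simp: is_test_def)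
  have "prim (\<lambda>t. (mul_w z t, exp (\<gamma> * t) *\<^sub>R k t)) t \<in> VV"
  proof (rule prim_in_subspace[OF VV])
    show "integrable M (\<lambda>t. (mul_w z t, exp (\<gamma> * t) *\<^sub>R k t))"
      by (intro sq_integrable sq_Pair sq_mul sq_exp_mult z k)
    show "AE t in M. (mul_w z t, exp (\<gamma> * t) *\<^sub>R k t) \<in> VV"
      using V
    proof eventually_elim
      case (elim t)
      then have "exp (\<gamma> * t) *\<^sub>R (val z t, k t) \<in> VV" using VV by (intro subspace_mul)
      then show ?case by (simp add: mul_w_def)
    qed
  qed
  then show ?thesis
    by (subst (asm) prim_Pair) (auto intro: sq_integrable sq_mul sq_exp_mult z k simp: mul_G_def)
qed

text \<open>Integrate the derivative of exp (\<gamma> t) times the square of v. The test function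
  vanishes at \<open>T\<close>, so the only boundary term is the one at 0, and it has the good
  sign.\<close>

lemma kinetic_identity:
  assumes z: "sq z"
  shows "- (\<integral>t. mul_w z t \<bullet> z t \<partial>M) = (norm (val z 0))\<^sup>2 / 2 + \<gamma> / 2 * kinE z"
proof -
  note v = sq_val[OF z]
  have v0: "val z 0 = - integral\<^sup>L M z" by (simp add: val_def prim_0)
  have "(\<integral>t. exp (\<gamma> * t) * (z t \<bullet> val z t + val z t \<bullet> z t + \<gamma> * (val z t \<bullet> val z t)) \<partial>M)
      = exp (\<gamma> * T) * (val z T \<bullet> val z T) - (- integral\<^sup>L M z) \<bullet> (- integral\<^sup>L M z)"
    using v z by (intro weighted_product_integral sq_integrable) (auto simp: val_def[abs_def] sq_measurable)
  also have "\<dots> = - (norm (val z 0))\<^sup>2" by (simp add: val_T z v0 power2_norm_eq_inner)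
  also have "(\<integral>t. exp (\<gamma> * t) * (z t \<bullet> val z t + val z t \<bullet> z t + \<gamma> * (val z t \<bullet> val z t)) \<partial>M)
      = (\<integral>t. 2 * (exp (\<gamma> * t) * (val z t \<bullet> z t)) + \<gamma> * (exp (\<gamma> * t) * (val z t \<bullet> val z t)) \<partial>M)"
    by (simp add: inner_commute algebra_simps)
  also have "\<dots> = 2 * (\<integral>t. exp (\<gamma> * t) * (val z t \<bullet> z t) \<partial>M) + \<gamma> * kinE z"
    using integrable_exp_inner[OF v z, of \<gamma>] integrable_exp_inner[OF v v, of \<gamma>]
    by (simp add: kinE_def power2_norm_eq_inner)
  finally show ?thesis by (simp add: mul_w_def)
qed

text \<open>Here \<open>k\<close> is exp (- \<gamma> t) times the derivative of
  \<open>mul_G k\<close>, and \<open>mul_G k\<close> vanishes at 0; the remaining boundary term at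
  \<open>T\<close> has the good sign.\<close>

lemma elastic_identity:
  assumes k: "sq k"
  shows "(\<integral>t. mul_G k t \<bullet> k t \<partial>M) = endE k / 2 + \<gamma> / 2 * elaE k"
proof -
  define a where "a t = exp (\<gamma> * t) *\<^sub>R k t" for t
  have a: "sq a" unfolding a_def by (rule sq_exp_mult[OF k])
  define q where "q = mul_G k"
  have q: "q = prim a" by (simp add: q_def mul_G_def a_def[abs_def])
  have sqq: "sq q" unfolding q_def by (rule sq_mul(2)[OF k])
  have "(\<integral>t. exp (- \<gamma> * t) * (a t \<bullet> q t + q t \<bullet> a t + (- \<gamma>) * (q t \<bullet> q t)) \<partial>M)
      = exp (- \<gamma> * T) * (q T \<bullet> q T) - 0 \<bullet> (0::'k)"
    using a sqq by (intro weighted_product_integral sq_integrable) (auto simp: q sq_measurable)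
  also have "\<dots> = endE k" by (simp add: endE_def q_def power2_norm_eq_inner)
  also have "(\<integral>t. exp (- \<gamma> * t) * (a t \<bullet> q t + q t \<bullet> a t + (- \<gamma>) * (q t \<bullet> q t)) \<partial>M)
      = (\<integral>t. 2 * (q t \<bullet> k t) - \<gamma> * (exp (- \<gamma> * t) * (q t \<bullet> q t)) \<partial>M)"
    unfolding a_def
    by (rule Bochner_Integration.integral_cong) (auto simp: inner_commute algebra_simps exp_minus)
  also have "\<dots> = 2 * (\<integral>t. q t \<bullet> k t \<partial>M) - \<gamma> * elaE k"
    using sq_inner_integrable[OF sqq k] integrable_exp_inner[OF sqq sqq, of "-\<gamma>"]
    by (simp add: elaE_def power2_norm_eq_inner q_def)
  finally show ?thesis by (simp add: q_def)
qed

text \<open>The energy controls \<open>mul_G k\<close> and not \<open>k\<close>. Writing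
  \<open>k\<close> as the weighted derivative of \<open>mul_G k\<close> moves the time derivative to
  \<open>r\<close>, which therefore has to be a primitive.\<close>

lemma gradient_integral_by_parts:
  assumes k: "sq k" and r': "integrable M r'" and r: "\<And>t. 0 \<le> t \<Longrightarrow> t \<le> T \<Longrightarrow> r t = r0 + prim r' t"
    and rsq: "sq r" "sq r'"
  shows "(\<integral>t. r t \<bullet> k t \<partial>M) = exp (- \<gamma> * T) * (mul_G k T \<bullet> r T)
     - (\<integral>t. exp (- \<gamma> * t) * (mul_G k t \<bullet> (r' t - \<gamma> *\<^sub>R r t)) \<partial>M)"
proof -
  define a where "a t = exp (\<gamma> * t) *\<^sub>R k t" for t
  have a: "sq a" unfolding a_def by (rule sq_exp_mult[OF k])
  define q where "q = mul_G k"
  have q: "q = prim a" by (simp add: q_def mul_G_def a_def[abs_def])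
  have sqq: "sq q" unfolding q_def by (rule sq_mul(2)[OF k])
  have "(\<integral>t. exp (- \<gamma> * t) * (a t \<bullet> r t + q t \<bullet> r' t + (- \<gamma>) * (q t \<bullet> r t)) \<partial>M)
      = exp (- \<gamma> * T) * (q T \<bullet> r T) - 0 \<bullet> r0"
    using a sqq r r' rsq by (intro weighted_product_integral sq_integrable) (auto simp: q sq_measurable)
  also have "(\<integral>t. exp (- \<gamma> * t) * (a t \<bullet> r t + q t \<bullet> r' t + (- \<gamma>) * (q t \<bullet> r t)) \<partial>M)
      = (\<integral>t. r t \<bullet> k t + exp (- \<gamma> * t) * (q t \<bullet> (r' t - \<gamma> *\<^sub>R r t)) \<partial>M)"
    unfolding a_def
    by (rule Bochner_Integration.integral_cong) (auto simp: inner_commute inner_diff_right algebra_simps exp_minus)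
  also have "\<dots> = (\<integral>t. r t \<bullet> k t \<partial>M) + (\<integral>t. exp (- \<gamma> * t) * (q t \<bullet> (r' t - \<gamma> *\<^sub>R r t)) \<partial>M)"
    by (intro Bochner_Integration.integral_add sq_inner_integrable integrable_exp_inner sqq rsq k sq_diff sq_scaleR)
  finally show ?thesis by (simp add: q_def)
qed

text \<open>Replaces the running integral \<open>N\<close> by \<open>q\<close> itself with a gain of
  1 / \<gamma>, and this gain tames the memory term. Integrating the derivative of exp (- \<gamma>
  t) N^2 ties the mixed integral \<open>I\<close> to the square integral \<open>Z\<close>, and
  Young's inequality absorbs \<open>Z\<close>.\<close>

lemma running_norm_estimate:
  assumes q: "sq q" and Y: "Y = (\<integral>t. exp (- \<gamma> * t) * (norm (q t))\<^sup>2 \<partial>M)"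
    and N: "N = prim (\<lambda>t. norm (q t))"
  shows "exp (- \<gamma> * T) * (N T)\<^sup>2 \<le> 2 * Y / \<gamma>"
    and "(\<integral>t. exp (- \<gamma> * t) * (norm (q t) * N t) \<partial>M) \<le> 2 * Y / \<gamma>"
proof -
  have n: "sq (\<lambda>t. norm (q t))" by (rule sq_norm[OF q])
  have sN: "sq N" using sq_prim[OF sq_integrable[OF n], of 0] by (simp add: N)
  define I where "I = (\<integral>t. exp (- \<gamma> * t) * (norm (q t) * N t) \<partial>M)"
  define Z where "Z = (\<integral>t. exp (- \<gamma> * t) * (N t * N t) \<partial>M)"
  have i: "integrable M (\<lambda>t. exp (- \<gamma> * t) * (norm (q t) * N t))"
    "integrable M (\<lambda>t. exp (- \<gamma> * t) * (N t * N t))" "integrable M (\<lambda>t. exp (- \<gamma> * t) * (norm (q t))\<^sup>2)"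
    using integrable_exp_inner[OF n sN, of "-\<gamma>"] integrable_exp_inner[OF sN sN, of "-\<gamma>"]
      integrable_exp_inner[OF n n, of "-\<gamma>"] by (simp_all add: power2_eq_square)
  have g0: "\<gamma> > 0" using gamma(1) by simp
  have "(\<integral>t. exp (- \<gamma> * t) * (norm (q t) \<bullet> N t + N t \<bullet> norm (q t) + (- \<gamma>) * (N t \<bullet> N t)) \<partial>M)
      = exp (- \<gamma> * T) * (N T \<bullet> N T) - 0 \<bullet> (0::real)"
    using n sN by (intro weighted_product_integral sq_integrable) (auto simp: N sq_measurable)
  also have "(\<integral>t. exp (- \<gamma> * t) * (norm (q t) \<bullet> N t + N t \<bullet> norm (q t) + (- \<gamma>) * (N t \<bullet> N t)) \<partial>M)
     = (\<integral>t. 2 * (exp (- \<gamma> * t) * (norm (q t) * N t)) - \<gamma> * (exp (- \<gamma> * t) * (N t * N t)) \<partial>M)"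
    by (rule Bochner_Integration.integral_cong) (auto simp: algebra_simps)
  also have "\<dots> = 2 * I - \<gamma> * Z" using i by (simp add: I_def Z_def)
  finally have 1: "2 * I - \<gamma> * Z = exp (- \<gamma> * T) * (N T)\<^sup>2" by (simp add: power2_eq_square)
  \<comment> \<open>Young's inequality with weights 1 / \<gamma> and \<gamma> / 4: twice the second
    term is half of the \<gamma> Z available in the identity for \<open>I\<close>, so
    \<open>Z\<close> can be absorbed.\<close>
  have "I \<le> (\<integral>t. (1 / \<gamma>) * (exp (- \<gamma> * t) * (norm (q t))\<^sup>2) + (\<gamma> / 4) * (exp (- \<gamma> * t) * (N t * N t)) \<partial>M)"
    unfolding I_def
  proof (rule integral_mono)
    fix t
    have "norm (q t) * N t \<le> (1 / \<gamma>) * (norm (q t))\<^sup>2 + (\<gamma> / 4) * (N t * N t)"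
    proof -
      have "0 \<le> (norm (q t) - (\<gamma> / 2) * N t)\<^sup>2 / \<gamma>" using g0 by simp
      also have "\<dots> = (1 / \<gamma>) * (norm (q t))\<^sup>2 + (\<gamma> / 4) * (N t * N t) - norm (q t) * N t"
        using g0 by (simp add: power2_eq_square field_simps)
      finally show ?thesis by simp
    qed
    from mult_left_mono[OF this, of "exp (- \<gamma> * t)"]
    show "exp (- \<gamma> * t) * (norm (q t) * N t)
       \<le> (1 / \<gamma>) * (exp (- \<gamma> * t) * (norm (q t))\<^sup>2) + (\<gamma> / 4) * (exp (- \<gamma> * t) * (N t * N t))"
      by (simp add: algebra_simps)
  qed (intro Bochner_Integration.integrable_add integrable_mult_right i)+
  also have "\<dots> = Y / \<gamma> + \<gamma> / 4 * Z" using i by (simp add: Y Z_def)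
  finally have 2: "I \<le> Y / \<gamma> + \<gamma> / 4 * Z" .
  have "Z \<ge> 0" unfolding Z_def by (rule Bochner_Integration.integral_nonneg) simp
  then have gz: "\<gamma> * Z \<ge> 0" using g0 by simp
  show "exp (- \<gamma> * T) * (N T)\<^sup>2 \<le> 2 * Y / \<gamma>" using 1 2 gz by simp
  have "exp (- \<gamma> * T) * (N T)\<^sup>2 \<ge> 0" by simp
  then have "\<gamma> * Z \<le> 4 * (Y / \<gamma>)" using 1 2 by linarith
  then show "(\<integral>t. exp (- \<gamma> * t) * (norm (q t) * N t) \<partial>M) \<le> 2 * Y / \<gamma>" using 2 unfolding I_def[symmetric] by simp
qed

text \<open>The memory of the multiplier is integrated by parts against \<open>k\<close>; it is
  bounded by \<open>K\<close> times the running integral of the norm of \<open>q\<close>, and its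
  derivative in addition by \<open>K\<close> times the norm of \<open>q\<close>. The boundary term
  at \<open>T\<close> costs a quarter of \<open>endE\<close> and 2 K^2 elastic energies, the
  remaining integral costs 5 K of them.\<close>

lemma memory_estimate:
  assumes k: "sq k"
  shows "\<bar>\<integral>t. conv g (mul_G k) t \<bullet> k t \<partial>M\<bar> \<le> endE k / 4 + (5 * K + 2 * K\<^sup>2) * elaE k"
proof -
  define q where "q = mul_G k"
  have q: "sq q" unfolding q_def by (rule sq_mul(2)[OF k])
  note qi = sq_integrable[OF q]
  define m where "m = conv g q"
  define m' where "m' r = g 0 *\<^sub>R q r + conv g' q r" for r
  have m: "sq m" "sq m'" unfolding m_def m'_def by (intro sq_add sq_scaleR q sq_conv qi)+
  define N where "N = prim (\<lambda>t. norm (q t))"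
  have n: "sq (\<lambda>t. norm (q t))" by (rule sq_norm[OF q])
  have sN: "sq N" using sq_prim[OF sq_integrable[OF n], of 0] by (simp add: N_def)
  have N0: "N t \<ge> 0" for t unfolding N_def prim_def by (rule Bochner_Integration.integral_nonneg) simp
  have mN: "norm (m t) \<le> K * N t" "norm (conv g' q t) \<le> K * N t" for t
    unfolding m_def N_def by (rule norm_conv_le[OF g_meas(1) gK qi] norm_conv_le[OF g_meas(2) g'K qi])+
  have Y: "elaE k = (\<integral>t. exp (- \<gamma> * t) * (norm (q t))\<^sup>2 \<partial>M)" by (simp add: elaE_def q_def)
  note R = running_norm_estimate[OF q Y N_def]
  have ibp: "(\<integral>t. m t \<bullet> k t \<partial>M) = exp (- \<gamma> * T) * (q T \<bullet> m T)
     - (\<integral>t. exp (- \<gamma> * t) * (q t \<bullet> (m' t - \<gamma> *\<^sub>R m t)) \<partial>M)"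
    unfolding q_def
  proof (rule gradient_integral_by_parts[OF k sq_integrable[OF m(2)] _ m])
    fix t assume "0 \<le> t" "t \<le> T"
    then show "m t = 0 + prim m' t"
      unfolding m_def m'_def using conv_eq_prim[OF g_meas(1) gK g'_cont g'K g_deriv qi] by simp
  qed
  have g0: "\<gamma> > 0" using gamma(1) by simp
  have 1: "\<bar>exp (- \<gamma> * T) * (q T \<bullet> m T)\<bar> \<le> endE k / 4 + 2 * K\<^sup>2 * elaE k"
  proof -
    have "\<bar>q T \<bullet> m T\<bar> \<le> norm (q T) * (K * N T)"
      using order_trans[OF Cauchy_Schwarz_ineq2 mult_left_mono[OF mN(1) norm_ge_zero]] .
    \<comment> \<open>The split a b \<le> a^2 / 4 + b^2 keeps the share of \<open>endE\<close> below
      the half that the elastic identity offers.\<close>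
    also have "\<dots> \<le> (norm (q T))\<^sup>2 / 4 + (K * N T)\<^sup>2"
      using zero_le_power2[of "norm (q T) / 2 - K * N T"] by (simp add: power2_diff power_divide)
    finally have "exp (- \<gamma> * T) * \<bar>q T \<bullet> m T\<bar> \<le> exp (- \<gamma> * T) * ((norm (q T))\<^sup>2 / 4 + (K * N T)\<^sup>2)"
      by (rule mult_left_mono) simp
    also have "\<dots> = endE k / 4 + K\<^sup>2 * (exp (- \<gamma> * T) * (N T)\<^sup>2)"
      by (simp add: endE_def q_def power_mult_distrib algebra_simps)
    also have "\<dots> \<le> endE k / 4 + K\<^sup>2 * (2 * elaE k)"
    proof -
      have "2 * elaE k / \<gamma> \<le> 2 * elaE k" using gamma(1) energy_parts_nonneg(2)[of k] by (simp add: divide_le_eq mult_left_le mult_le_cancel_left1)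
      then have "exp (- \<gamma> * T) * (N T)\<^sup>2 \<le> 2 * elaE k" using R(1) by linarith
      then show ?thesis by (intro add_left_mono mult_left_mono) auto
    qed
    finally show ?thesis by (simp add: abs_mult)
  qed
  have i: "integrable M (\<lambda>t. exp (- \<gamma> * t) * (norm (q t) * N t))" "integrable M (\<lambda>t. exp (- \<gamma> * t) * (norm (q t))\<^sup>2)"
    using integrable_exp_inner[OF n sN, of "-\<gamma>"] integrable_exp_inner[OF n n, of "-\<gamma>"] by (simp_all add: power2_eq_square)
  have "\<bar>\<integral>t. exp (- \<gamma> * t) * (q t \<bullet> (m' t - \<gamma> *\<^sub>R m t)) \<partial>M\<bar>
    \<le> (\<integral>t. \<bar>exp (- \<gamma> * t) * (q t \<bullet> (m' t - \<gamma> *\<^sub>R m t))\<bar> \<partial>M)" by (rule integral_abs_bound)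
  also have "\<dots> \<le> (\<integral>t. K * (exp (- \<gamma> * t) * (norm (q t))\<^sup>2) + (K + \<gamma> * K) * (exp (- \<gamma> * t) * (norm (q t) * N t)) \<partial>M)"
  proof (rule integral_mono)
    fix t
    have "norm (m' t - \<gamma> *\<^sub>R m t) \<le> norm (m' t) + norm (\<gamma> *\<^sub>R m t)" by (rule norm_triangle_ineq4)
    also have "norm (\<gamma> *\<^sub>R m t) \<le> \<gamma> * (K * N t)" using g0 mN(1)[of t] by simp
    also have "norm (m' t) \<le> norm (g 0 *\<^sub>R q t) + norm (conv g' q t)" unfolding m'_def by (rule norm_triangle_ineq)
    also have "norm (g 0 *\<^sub>R q t) \<le> K * norm (q t)" using gK by (simp add: mult_right_mono)
    finally have "norm (m' t - \<gamma> *\<^sub>R m t) \<le> K * norm (q t) + (K + \<gamma> * K) * N t" using mN(2)[of t] by (simp add: algebra_simps)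
    from order_trans[OF Cauchy_Schwarz_ineq2 mult_left_mono[OF this norm_ge_zero]]
    have "\<bar>q t \<bullet> (m' t - \<gamma> *\<^sub>R m t)\<bar> \<le> norm (q t) * (K * norm (q t) + (K + \<gamma> * K) * N t)" .
    from mult_left_mono[OF this, of "exp (- \<gamma> * t)"]
    have "exp (- \<gamma> * t) * \<bar>q t \<bullet> (m' t - \<gamma> *\<^sub>R m t)\<bar>
      \<le> exp (- \<gamma> * t) * (norm (q t) * (K * norm (q t) + (K + \<gamma> * K) * N t))" by simp
    also have "\<dots> = K * (exp (- \<gamma> * t) * (norm (q t))\<^sup>2) + (K + \<gamma> * K) * (exp (- \<gamma> * t) * (norm (q t) * N t))"
      by (simp add: power2_eq_square algebra_simps)
    finally show "\<bar>exp (- \<gamma> * t) * (q t \<bullet> (m' t - \<gamma> *\<^sub>R m t))\<bar>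
      \<le> K * (exp (- \<gamma> * t) * (norm (q t))\<^sup>2) + (K + \<gamma> * K) * (exp (- \<gamma> * t) * (norm (q t) * N t))"
      unfolding abs_mult[of "exp (- \<gamma> * t)"] by simp
  next
    show "integrable M (\<lambda>t. \<bar>exp (- \<gamma> * t) * (q t \<bullet> (m' t - \<gamma> *\<^sub>R m t))\<bar>)"
      by (intro integrable_abs integrable_exp_inner q sq_diff sq_scaleR m)
  qed (intro Bochner_Integration.integrable_add integrable_mult_right i)
  also have "\<dots> = K * elaE k + (K + \<gamma> * K) * (\<integral>t. exp (- \<gamma> * t) * (norm (q t) * N t) \<partial>M)"
    using i by (simp add: Y)
  \<comment> \<open>The factor \<open>\<gamma>\<close> stems from differentiating the weight and
    cancels against the gain 1 / \<gamma> of the running integral. The resulting constant is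
    independent of \<open>\<gamma>\<close>, so \<open>\<gamma>\<close> can be chosen large compared
    with it.\<close>
  also have "\<dots> \<le> K * elaE k + (K + \<gamma> * K) * (2 * elaE k / \<gamma>)"
    using R(2) K0 g0 by (intro add_left_mono mult_left_mono) auto
  also have "\<dots> \<le> K * elaE k + 4 * K * elaE k"
  proof -
    have "(K + \<gamma> * K) * (2 * elaE k / \<gamma>) = 2 * (K * elaE k) / \<gamma> + 2 * (K * elaE k)" using g0 by (simp add: field_simps)
    moreover have "K * elaE k \<ge> 0" using K0 energy_parts_nonneg(2) by simp
    then have "2 * (K * elaE k) / \<gamma> \<le> 2 * (K * elaE k)" using gamma(1) by (simp add: divide_le_eq mult_left_le mult_le_cancel_left1)
    ultimately show ?thesis by simp
  qed
  finally have 2: "\<bar>\<integral>t. exp (- \<gamma> * t) * (q t \<bullet> (m' t - \<gamma> *\<^sub>R m t)) \<partial>M\<bar> \<le> 5 * K * elaE k" by simp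
  show ?thesis using ibp 1 2 unfolding m_def[symmetric] q_def[symmetric] by (simp add: algebra_simps)
qed

text \<open>Since the delay is nonnegative, the weight at t - \<tau> is at most the weight at t.
  After a b \<le> (a^2 + b^2) / 2, one half is a translate of the kinetic density, whose integral
  does not grow, and the other half is bounded by that density.\<close>

lemma delay_estimate:
  assumes z: "sq z"
  shows "\<bar>\<integral>t. shift \<tau> (mul_w z) t \<bullet> val z t \<partial>M\<bar> \<le> kinE z"
proof -
  define v where "v = val z"
  have v: "sq v" unfolding v_def by (rule sq_val[OF z])
  define f where "f t = exp (\<gamma> * t) * (norm (v t))\<^sup>2" for t
  have fi: "integrable M f" unfolding f_def using integrable_exp_inner[OF v v, of \<gamma>] by (simp add: power2_norm_eq_inner)
  have g0: "\<gamma> > 0" using gamma(1) by simp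
  have "\<bar>\<integral>t. shift \<tau> (mul_w z) t \<bullet> v t \<partial>M\<bar> \<le> (\<integral>t. \<bar>shift \<tau> (mul_w z) t \<bullet> v t\<bar> \<partial>M)" by (rule integral_abs_bound)
  also have "\<dots> \<le> (\<integral>t. (1/2) * shift \<tau> f t + (1/2) * f t \<partial>M)"
  proof (rule integral_mono)
    fix t
    show "\<bar>shift \<tau> (mul_w z) t \<bullet> v t\<bar> \<le> (1/2) * shift \<tau> f t + (1/2) * f t"
    proof (cases "\<tau> < t")
      case True
      have "\<bar>v (t - \<tau>) \<bullet> v t\<bar> \<le> norm (v (t - \<tau>)) * norm (v t)" by (rule Cauchy_Schwarz_ineq2)
      also have "\<dots> \<le> ((norm (v (t - \<tau>)))\<^sup>2 + (norm (v t))\<^sup>2) / 2"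
        using sum_squares_bound[of "norm (v (t - \<tau>))" "norm (v t)"] by simp
      finally have "exp (\<gamma> * (t - \<tau>)) * \<bar>v (t - \<tau>) \<bullet> v t\<bar>
          \<le> exp (\<gamma> * (t - \<tau>)) * (((norm (v (t - \<tau>)))\<^sup>2 + (norm (v t))\<^sup>2) / 2)"
        by (rule mult_left_mono) simp
      also have "\<dots> = (1/2) * shift \<tau> f t + (1/2) * (exp (\<gamma> * (t - \<tau>)) * (norm (v t))\<^sup>2)"
        using True by (simp add: shift_def f_def algebra_simps)
      also have "exp (\<gamma> * (t - \<tau>)) * (norm (v t))\<^sup>2 \<le> f t"
        unfolding f_def using g0 tau by (intro mult_right_mono) auto
      finally show ?thesis using True by (simp add: shift_def mul_w_def v_def abs_mult)
    next
      case False
      then show ?thesis by (simp add: shift_def f_def)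
    qed
  next
    show "integrable M (\<lambda>t. \<bar>shift \<tau> (mul_w z) t \<bullet> v t\<bar>)"
      by (intro integrable_abs sq_inner_integrable sq_shift tau sq_mul z v)
  qed (intro Bochner_Integration.integrable_add integrable_mult_right fi integrable_shift tau)
  also have "\<dots> = (1/2) * (\<integral>t. shift \<tau> f t \<partial>M) + (1/2) * (\<integral>t. f t \<partial>M)"
    using fi integrable_shift(1)[OF tau fi] by simp
  also have "(\<integral>t. shift \<tau> f t \<partial>M) \<le> (\<integral>t. f t \<partial>M)"
    by (rule integral_shift_le[OF tau fi]) (simp add: f_def)
  finally show ?thesis by (simp add: f_def v_def kinE_def)
qed

text \<open>The two energy identities are added, and the choice of \<open>\<gamma>\<close> absorbs
  damping, delay and memory.\<close>

lemma coercivity: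
  assumes z: "sq z" and k: "sq k"
  shows "energy z k \<le> bform (mul_w z) (mul_G k) z k"
proof -
  have "(\<integral>t. mul_w z t \<bullet> val z t \<partial>M) = kinE z"
    by (simp add: mul_w_def kinE_def power2_norm_eq_inner)
  then have b: "bform (mul_w z) (mul_G k) z k = (norm (val z 0))\<^sup>2 / 2 + \<gamma> / 2 * kinE z + (endE k / 2 + \<gamma> / 2 * elaE k)
    - (\<integral>t. conv g (mul_G k) t \<bullet> k t \<partial>M) + \<mu>1 * kinE z + \<mu>2 * (\<integral>t. shift \<tau> (mul_w z) t \<bullet> val z t \<partial>M)"
    unfolding bform_def kinetic_identity[OF z] elastic_identity[OF k] by simp
  have "- (\<mu>1 * kinE z) \<le> \<bar>\<mu>1\<bar> * kinE z"
    using mult_right_mono[of "- \<mu>1" "\<bar>\<mu>1\<bar>" "kinE z"] energy_parts_nonneg(1) by simp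
  moreover have "- (\<mu>2 * (\<integral>t. shift \<tau> (mul_w z) t \<bullet> val z t \<partial>M)) \<le> \<bar>\<mu>2\<bar> * kinE z"
    using mult_left_mono[OF delay_estimate[OF z], of "\<bar>\<mu>2\<bar>"]
      abs_ge_minus_self[of "\<mu>2 * (\<integral>t. shift \<tau> (mul_w z) t \<bullet> val z t \<partial>M)"] by (simp add: abs_mult)
  moreover have "(\<bar>\<mu>1\<bar> + \<bar>\<mu>2\<bar> + 1) * kinE z \<le> \<gamma> / 2 * kinE z"
    by (intro mult_right_mono gamma energy_parts_nonneg)
  moreover have "(5 * K + 2 * K\<^sup>2 + 1) * elaE k \<le> \<gamma> / 2 * elaE k"
    by (intro mult_right_mono gamma energy_parts_nonneg)
  ultimately show ?thesis
    using memory_estimate[OF k] unfolding b energy_def by (simp add: algebra_simps)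
qed

text \<open>Each datum is met by one part of the energy: the initial velocity by the value of the
  test function at 0, the history by the kinetic energy, and \<open>rhs0\<close>, which is paired
  with \<open>k\<close>, by the elastic energy and \<open>endE\<close> after an integration by
  parts.\<close>

lemma lform_bound: "\<exists>C\<ge>0. \<forall>z k. sq z \<longrightarrow> sq k \<longrightarrow> \<bar>lform z k\<bar> \<le> C * sqrt (energy z k)"
proof -
  \<comment> \<open>The time derivative of \<open>rhs0\<close>, as given by
    \<open>conv_eq_prim\<close> for a constant function.\<close>
  define r' where "r' t = - (g 0 *\<^sub>R k0 + conv g' (\<lambda>_. k0) t)" for t
  have ci: "integrable M (\<lambda>_. k0)" by simp
  have r': "sq r'" unfolding r'_def by (intro sq_uminus sq_add sq_conv ci sq_bounded[where B="norm (g 0 *\<^sub>R k0)"]) auto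
  define \<rho> where "\<rho> t = r' t - \<gamma> *\<^sub>R rhs0 t" for t
  have rho: "sq \<rho>" unfolding \<rho>_def by (intro sq_diff sq_scaleR r' sq_rhs0)
  define P where "P = sqrt (\<integral>t. (norm (p t))\<^sup>2 \<partial>M)"
  define R where "R = sqrt (\<integral>t. exp (- \<gamma> * t) * (norm (\<rho> t))\<^sup>2 \<partial>M)"
  define C where "C = 2 * norm u1 + \<bar>\<mu>2\<bar> * P + 2 * norm (rhs0 T) + R"
  have "P \<ge> 0" "R \<ge> 0" by (auto simp: P_def R_def)
  then have "C \<ge> 0" by (simp add: C_def)
  moreover have "\<bar>lform z k\<bar> \<le> C * sqrt (energy z k)" if z: "sq z" and k: "sq k" for z k
  proof -
    let ?D = "sqrt (energy z k)"
    have v: "sq (val z)" by (rule sq_val[OF z])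
    note nn = energy_parts_nonneg(1)[of z] energy_parts_nonneg(2,3)[of k]
    have g0: "\<gamma> > 0" using gamma(1) by simp
    have D: "norm (val z 0) \<le> 2 * ?D" "sqrt (kinE z) \<le> ?D" "sqrt (elaE k) \<le> ?D" "sqrt (endE k) \<le> 2 * ?D"
    proof -
      have "sqrt ((norm (val z 0))\<^sup>2) \<le> sqrt (4 * energy z k)"
        by (rule real_sqrt_le_mono) (use nn in \<open>simp add: energy_def\<close>)
      then show "norm (val z 0) \<le> 2 * ?D" by (simp add: real_sqrt_mult)
      show "sqrt (kinE z) \<le> ?D" "sqrt (elaE k) \<le> ?D"
        by (rule real_sqrt_le_mono; use nn in \<open>simp add: energy_def\<close>)+
      have "sqrt (endE k) \<le> sqrt (4 * energy z k)"
        by (rule real_sqrt_le_mono) (use nn in \<open>simp add: energy_def\<close>)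
      then show "sqrt (endE k) \<le> 2 * ?D" by (simp add: real_sqrt_mult)
    qed
    have 1: "\<bar>val z 0 \<bullet> u1\<bar> \<le> 2 * norm u1 * ?D"
      using order_trans[OF Cauchy_Schwarz_ineq2 mult_right_mono[OF D(1) norm_ge_zero]] by (simp add: mult_ac)
    have "\<bar>\<integral>t. p t \<bullet> val z t \<partial>M\<bar> \<le> P * sqrt (\<integral>t. (norm (val z t))\<^sup>2 \<partial>M)"
      unfolding P_def by (rule integral_Cauchy_Schwarz[OF p v])
    also have "sqrt (\<integral>t. (norm (val z t))\<^sup>2 \<partial>M) \<le> sqrt (kinE z)"
      unfolding kinE_def
    proof (intro real_sqrt_le_mono integral_mono_AE AE_MI)
      show "integrable M (\<lambda>t. (norm (val z t))\<^sup>2)" using v by (simp add: sq_def)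
      show "integrable M (\<lambda>t. exp (\<gamma> * t) * (norm (val z t))\<^sup>2)"
        using integrable_exp_inner[OF v v, of \<gamma>] by (simp add: power2_norm_eq_inner)
      fix t :: real assume "0 < t"
      then show "(norm (val z t))\<^sup>2 \<le> exp (\<gamma> * t) * (norm (val z t))\<^sup>2"
        using g0 mult_right_mono[of 1 "exp (\<gamma> * t)" "(norm (val z t))\<^sup>2"] by simp
    qed
    finally have "\<bar>\<integral>t. p t \<bullet> val z t \<partial>M\<bar> \<le> P * ?D"
      using D(2) \<open>P \<ge> 0\<close> by (meson mult_left_mono order_trans)
    from mult_left_mono[OF this, of "\<bar>\<mu>2\<bar>"]
    have 2: "\<bar>\<mu>2 * (\<integral>t. p t \<bullet> val z t \<partial>M)\<bar> \<le> \<bar>\<mu>2\<bar> * P * ?D" by (simp add: abs_mult mult_ac)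
    have q: "sq (mul_G k)" by (rule sq_mul(2)[OF k])
    have ibp: "(\<integral>t. rhs0 t \<bullet> k t \<partial>M) = exp (- \<gamma> * T) * (mul_G k T \<bullet> rhs0 T)
        - (\<integral>t. exp (- \<gamma> * t) * (mul_G k t \<bullet> (r' t - \<gamma> *\<^sub>R rhs0 t)) \<partial>M)"
    proof (rule gradient_integral_by_parts[OF k sq_integrable[OF r'] _ sq_rhs0 r'])
      fix t assume "0 \<le> t" "t \<le> T"
      then have "conv g (\<lambda>_. k0) t = prim (\<lambda>r. g 0 *\<^sub>R k0 + conv g' (\<lambda>_. k0) r) t"
        using conv_eq_prim[OF g_meas(1) gK g'_cont g'K g_deriv ci] by simp
      moreover have "prim r' t = - prim (\<lambda>r. g 0 *\<^sub>R k0 + conv g' (\<lambda>_. k0) r) t"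
        using prim_scaleR[of "\<lambda>r. g 0 *\<^sub>R k0 + conv g' (\<lambda>_. k0) r" "-1" t] sq_integrable[OF sq_conv(2)[OF ci]]
        by (simp add: r'_def[abs_def])
      ultimately show "rhs0 t = k0 + prim r' t" by (simp add: rhs0_def)
    qed
    have "exp (- \<gamma> * T) * \<bar>mul_G k T \<bullet> rhs0 T\<bar> \<le> exp (- \<gamma> * T) * (norm (mul_G k T) * norm (rhs0 T))"
      by (intro mult_left_mono Cauchy_Schwarz_ineq2) simp
    \<comment> \<open>\<open>endE\<close> enters through its square root, hence with the square root
      of the weight. The weight is at most 1, so this only enlarges the bound.\<close>
    also have "\<dots> \<le> sqrt (exp (- \<gamma> * T)) * (norm (mul_G k T) * norm (rhs0 T))"
    proof (rule mult_right_mono)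
      have "exp (- \<gamma> * T) \<le> 1" using g0 T_pos by simp
      then have "exp (- \<gamma> * T) * exp (- \<gamma> * T) \<le> exp (- \<gamma> * T)" by (intro mult_left_le) auto
      then show "exp (- \<gamma> * T) \<le> sqrt (exp (- \<gamma> * T))" by (intro real_le_rsqrt) (simp add: power2_eq_square)
    qed simp
    also have "\<dots> = sqrt (endE k) * norm (rhs0 T)" by (simp add: endE_def real_sqrt_mult)
    also have "\<dots> \<le> (2 * ?D) * norm (rhs0 T)" by (intro mult_right_mono D) simp
    finally have 3: "\<bar>exp (- \<gamma> * T) * (mul_G k T \<bullet> rhs0 T)\<bar> \<le> 2 * norm (rhs0 T) * ?D" by (simp add: abs_mult mult_ac)
    \<comment> \<open>Half of the weight goes to each factor of the Cauchy-Schwarz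
      inequality.\<close>
    define c where "c = - \<gamma> / 2"
    have cc: "exp (c * t) * exp (c * t) = exp (- \<gamma> * t)" for t
      unfolding c_def exp_add[symmetric] by (simp add: algebra_simps)
    have eq: "(\<integral>t. exp (- \<gamma> * t) * (mul_G k t \<bullet> \<rho> t) \<partial>M)
      = (\<integral>t. (exp (c * t) *\<^sub>R mul_G k t) \<bullet> (exp (c * t) *\<^sub>R \<rho> t) \<partial>M)"
      unfolding cc[symmetric] by (simp add: mult_ac)
    have "\<bar>\<integral>t. exp (- \<gamma> * t) * (mul_G k t \<bullet> \<rho> t) \<partial>M\<bar>
      \<le> sqrt (\<integral>t. (norm (exp (c * t) *\<^sub>R mul_G k t))\<^sup>2 \<partial>M) * sqrt (\<integral>t. (norm (exp (c * t) *\<^sub>R \<rho> t))\<^sup>2 \<partial>M)"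
      unfolding eq by (intro integral_Cauchy_Schwarz sq_exp_mult q rho)
    also have "\<dots> = sqrt (elaE k) * R"
    proof -
      have "(norm (exp (c * t) *\<^sub>R x))\<^sup>2 = (exp (c * t) * exp (c * t)) * (norm x)\<^sup>2" for t and x :: 'k
        by (simp add: power_mult_distrib power2_eq_square)
      note this[unfolded cc]
      then show ?thesis unfolding elaE_def R_def by simp
    qed
    also have "\<dots> \<le> ?D * R" by (intro mult_right_mono D \<open>R \<ge> 0\<close>)
    finally have 4: "\<bar>\<integral>t. exp (- \<gamma> * t) * (mul_G k t \<bullet> (r' t - \<gamma> *\<^sub>R rhs0 t)) \<partial>M\<bar> \<le> R * ?D"
      unfolding \<rho>_def by (simp add: mult_ac)
    show ?thesis
      using 1 2 3 4 unfolding lform_def ibp C_def distrib_right by linarith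
  qed
  ultimately show ?thesis by blast
qed

text \<open>The projection theorem measures the multiplier without weights; on a bounded interval
  this costs a factor exp (\<gamma> T) under the root.\<close>

lemma norm_multiplier:
  assumes z: "sq z" and k: "sq k"
  shows "norm (tcls (mul_w z), tcls (mul_G k)) \<le> sqrt (exp (\<gamma> * T) * energy z k)"
proof -
  note v = sq_val[OF z] and q = sq_mul(2)[OF k]
  have g0: "\<gamma> > 0" using gamma(1) by simp
  have "(norm (tcls (mul_w z)))\<^sup>2 \<le> exp (\<gamma> * T) * kinE z"
  proof -
    have "(norm (tcls (mul_w z)))\<^sup>2 = (\<integral>t. (norm (mul_w z t))\<^sup>2 \<partial>M)" by (rule norm_tcls[OF sq_mul(1)[OF z]])
    also have "\<dots> \<le> (\<integral>t. exp (\<gamma> * T) * (exp (\<gamma> * t) * (norm (val z t))\<^sup>2) \<partial>M)"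
    proof (rule integral_mono_AE)
      show "integrable M (\<lambda>t. (norm (mul_w z t))\<^sup>2)" using sq_mul(1)[OF z] by (simp add: sq_def)
      show "integrable M (\<lambda>t. exp (\<gamma> * T) * (exp (\<gamma> * t) * (norm (val z t))\<^sup>2))"
        using integrable_exp_inner[OF v v, of \<gamma>] by (simp add: power2_norm_eq_inner)
      show "AE t in M. (norm (mul_w z t))\<^sup>2 \<le> exp (\<gamma> * T) * (exp (\<gamma> * t) * (norm (val z t))\<^sup>2)"
      proof (rule AE_MI)
        fix t assume t: "0 < t" "t < T"
        have "exp (\<gamma> * t) \<le> exp (\<gamma> * T)" using g0 t by simp
        then have "exp (\<gamma> * t) * (exp (\<gamma> * t) * (norm (val z t))\<^sup>2) \<le> exp (\<gamma> * T) * (exp (\<gamma> * t) * (norm (val z t))\<^sup>2)"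
          by (intro mult_right_mono) auto
        moreover have "(norm (mul_w z t))\<^sup>2 = exp (\<gamma> * t) * (exp (\<gamma> * t) * (norm (val z t))\<^sup>2)"
          by (simp add: mul_w_def power_mult_distrib power2_eq_square mult_ac)
        ultimately show "(norm (mul_w z t))\<^sup>2 \<le> exp (\<gamma> * T) * (exp (\<gamma> * t) * (norm (val z t))\<^sup>2)" by simp
      qed
    qed
    finally show ?thesis by (simp add: kinE_def)
  qed
  moreover have "(norm (tcls (mul_G k)))\<^sup>2 \<le> exp (\<gamma> * T) * elaE k"
  proof -
    have "(norm (tcls (mul_G k)))\<^sup>2 = (\<integral>t. (norm (mul_G k t))\<^sup>2 \<partial>M)" by (rule norm_tcls[OF q])
    also have "\<dots> \<le> (\<integral>t. exp (\<gamma> * T) * (exp (- \<gamma> * t) * (norm (mul_G k t))\<^sup>2) \<partial>M)"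
    proof (rule integral_mono_AE)
      show "integrable M (\<lambda>t. (norm (mul_G k t))\<^sup>2)" using q by (simp add: sq_def)
      show "integrable M (\<lambda>t. exp (\<gamma> * T) * (exp (- \<gamma> * t) * (norm (mul_G k t))\<^sup>2))"
        using integrable_exp_inner[OF q q, of "-\<gamma>"] by (simp add: power2_norm_eq_inner)
      show "AE t in M. (norm (mul_G k t))\<^sup>2 \<le> exp (\<gamma> * T) * (exp (- \<gamma> * t) * (norm (mul_G k t))\<^sup>2)"
      proof (rule AE_MI)
        fix t assume t: "0 < t" "t < T"
        have "1 \<le> exp (\<gamma> * T) * exp (- \<gamma> * t)" unfolding exp_add[symmetric] using g0 t by simp
        from mult_right_mono[OF this zero_le_power2[of "norm (mul_G k t)"]]
        show "(norm (mul_G k t))\<^sup>2 \<le> exp (\<gamma> * T) * (exp (- \<gamma> * t) * (norm (mul_G k t))\<^sup>2)" by (simp add: mult_ac)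
      qed
    qed
    finally show ?thesis by (simp add: elaE_def)
  qed
  moreover have "kinE z + elaE k \<le> energy z k" using energy_parts_nonneg(3)[of k] by (simp add: energy_def)
  then have "exp (\<gamma> * T) * (kinE z + elaE k) \<le> exp (\<gamma> * T) * energy z k" by (rule mult_left_mono) simp
  ultimately show ?thesis unfolding norm_prod_def by (intro real_sqrt_le_mono) (simp add: distrib_left)
qed

end

section \<open>Primitives of classes and bounds on the time interval\<close>

context time_interval
begin

lemma sq_fn: "sq (fn F)"
  by (rule sq_sqint[OF sqint_fn])

lemma AE_lborel_M: "AE t in lborel. P t \<Longrightarrow> AE t in M. P t"
  unfolding AE_M by (auto elim: eventually_mono)

lemma sq_bounded_linear:
  fixes f :: "'b::{real_inner,banach,second_countable_topology} \<Rightarrow> 'c::{real_inner,banach,second_countable_topology}"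
  assumes f: "bounded_linear f" and s: "sq s"
  shows "sq (\<lambda>t. f (s t))"
proof -
  obtain C where C: "\<And>x. norm (f x) \<le> norm x * C" using bounded_linear.bounded[OF f] by blast
  have m: "(\<lambda>t. f (s t)) \<in> borel_measurable borel"
    using borel_measurable_continuous_on[OF linear_continuous_on[OF f] sq_measurable[OF s]] .
  have "sqint (\<lambda>t. indicator {0<..<T} t *\<^sub>R f (s t))"
  proof (rule sqint_bound[OF sqD[OF s]])
    show "AE x in lborel. norm (indicat_real {0<..<T} x *\<^sub>R f (s x)) \<le> C * norm (indicat_real {0<..<T} x *\<^sub>R s x)"
      using C by (auto simp: indicator_def mult.commute)
  qed (use m in measurable)
  then show ?thesis using m by (simp add: sq_iff_sqint)
qed

lemma prim_fn_add: "prim (fn (W + W')) t = prim (fn W) t + prim (fn W') t"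
proof -
  have "prim (fn (W + W')) t = prim (\<lambda>s. fn W s + fn W' s) t"
    by (rule prim_cong_AE[OF AE_lborel_M[OF fn_add]]) measurable
  then show ?thesis by (simp add: prim_add sq_integrable sq_fn)
qed

lemma prim_fn_scaleR: "prim (fn (c *\<^sub>R W)) t = c *\<^sub>R prim (fn W) t"
proof -
  have "prim (fn (c *\<^sub>R W)) t = prim (\<lambda>s. c *\<^sub>R fn W s) t"
    by (rule prim_cong_AE[OF AE_lborel_M[OF fn_scaleR]]) measurable
  then show ?thesis by (simp add: prim_scaleR sq_integrable sq_fn)
qed

lemma norm_prim_le_sqrt: "sq a \<Longrightarrow> norm (prim a t) \<le> sqrt T * sqrt (\<integral>t. (norm (a t))\<^sup>2 \<partial>M)"
proof -
  assume a: "sq a"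
  have "norm (prim a t) \<le> (\<integral>t. norm (a t) \<partial>M)" by (rule prim_norm_le_integral[OF sq_integrable[OF a]])
  also have "\<dots> \<le> \<bar>\<integral>t. 1 \<bullet> norm (a t) \<partial>M\<bar>" by simp
  also have "\<dots> \<le> sqrt (\<integral>t. (norm (1::real))\<^sup>2 \<partial>M) * sqrt (\<integral>t. (norm (norm (a t)))\<^sup>2 \<partial>M)"
    by (rule integral_Cauchy_Schwarz[OF sq_bounded[where B=1] sq_norm[OF a]]) auto
  also have "(\<integral>t. (norm (1::real))\<^sup>2 \<partial>M) = T" using emeasure_M T_pos by (simp add: measure_def)
  finally show ?thesis by simp
qed

lemma norm_restrict_le: "(\<integral>t. (norm (fn F t))\<^sup>2 \<partial>M) \<le> (norm F)\<^sup>2"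
proof -
  have "(\<integral>t. (norm (fn F t))\<^sup>2 \<partial>M) = (\<integral>t. indicator {0<..<T} t *\<^sub>R (norm (fn F t))\<^sup>2 \<partial>lborel)"
    by (rule integral_M) measurable
  also have "\<dots> \<le> (\<integral>t. (norm (fn F t))\<^sup>2 \<partial>lborel)"
  proof (rule integral_mono)
    show i: "integrable lborel (\<lambda>t. (norm (fn F t))\<^sup>2)" using sqint_fn[of F] by (simp add: sqint_def)
    show "integrable lborel (\<lambda>t. indicator {0<..<T} t *\<^sub>R (norm (fn F t))\<^sup>2)"
      by (rule integrable_mult_indicator[OF _ i]) simp
  qed (auto simp: indicator_def)
  finally show ?thesis by (simp add: norm_fn)
qed

end

context hyperbolic_problem
begin

subsection \<open>Existence\<close>

text \<open>The component orthogonal to \<open>VV\<close> at each time, for a velocity and a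
  gradient. Its kernel is the space of admissible unknowns; as the kernel of a bounded operator it
  is closed, without an argument about limits almost everywhere.\<close>

definition defect :: "(real, 'h) lsq \<times> (real, 'k) lsq \<Rightarrow> (real, 'h \<times> 'k) lsq" where
  "defect x = tcls (\<lambda>t. (prim (fn (fst x)) t, fn (snd x) t) - hproj VV (prim (fn (fst x)) t, fn (snd x) t))"

lemma bounded_linear_compl: "bounded_linear (\<lambda>x. x - hproj VV x)"
  using bounded_linear_sub[OF bounded_linear_ident hproj_bounded_linear[OF VV]] .

lemma norm_compl_le: "norm (x - hproj VV x) \<le> norm x"
proof -
  have "(norm (x - hproj VV x))\<^sup>2 = (x - hproj VV x) \<bullet> x"
    using hproj_orth[OF VV hproj_in[OF VV], of x x] by (simp add: power2_norm_eq_inner inner_diff_right)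
  also have "\<dots> \<le> norm (x - hproj VV x) * norm x" by (rule norm_cauchy_schwarz)
  finally show ?thesis by (cases "norm (x - hproj VV x) = 0") (auto simp: power2_eq_square)
qed

lemma sq_defect: "sq (\<lambda>t. (prim (fn W) t, fn G t) - hproj VV (prim (fn W) t, fn G t))"
  using sq_prim[OF sq_integrable[OF sq_fn[of W]], of 0]
  by (intro sq_bounded_linear[OF bounded_linear_compl] sq_Pair sq_fn) simp

text \<open>The constant: at each time the primitive is at most sqrt T times the norm of the
  velocity, so its square integrates to at most T^2 times the squared norm; the gradient contributes
  1.\<close>

lemma bounded_linear_defect: "bounded_linear defect"
proof (rule bounded_linear_intro[where K="sqrt (T\<^sup>2 + 1)"])
  interpret c: bounded_linear "\<lambda>x. x - hproj VV x" by (rule bounded_linear_compl)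
  fix x y :: "(real, 'h) lsq \<times> (real, 'k) lsq"
  show "defect (x + y) = defect x + defect y"
    unfolding defect_def tcls_add[OF sq_defect sq_defect] tcls_eq_iff[OF sq_defect sq_add[OF sq_defect sq_defect]]
    using AE_lborel_M[OF fn_add[of "snd x" "snd y"]]
    by eventually_elim
       (use c.add[of "(prim (fn (fst x)) _, fn (snd x) _)" "(prim (fn (fst y)) _, fn (snd y) _)"] in \<open>simp add: prim_fn_add\<close>)
next
  interpret c: bounded_linear "\<lambda>x. x - hproj VV x" by (rule bounded_linear_compl)
  fix r and x :: "(real, 'h) lsq \<times> (real, 'k) lsq"
  show "defect (r *\<^sub>R x) = r *\<^sub>R defect x"
    unfolding defect_def tcls_scaleR[OF sq_defect] tcls_eq_iff[OF sq_defect sq_scaleR[OF sq_defect]]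
    using AE_lborel_M[OF fn_scaleR[of r "snd x"]]
    by eventually_elim
       (use c.scaleR[of r "(prim (fn (fst x)) _, fn (snd x) _)"] in \<open>simp add: prim_fn_scaleR\<close>)
next
  fix x :: "(real, 'h) lsq \<times> (real, 'k) lsq"
  obtain W G where x: "x = (W, G)" by (cases x)
  have "(norm (defect x))\<^sup>2 = (\<integral>t. (norm ((prim (fn W) t, fn G t) - hproj VV (prim (fn W) t, fn G t)))\<^sup>2 \<partial>M)"
    unfolding defect_def x by (simp add: norm_tcls sq_defect)
  also have "\<dots> \<le> (\<integral>t. T * (norm W)\<^sup>2 + (norm (fn G t))\<^sup>2 \<partial>M)"
  proof (rule integral_mono)
    show "integrable M (\<lambda>t. (norm ((prim (fn W) t, fn G t) - hproj VV (prim (fn W) t, fn G t)))\<^sup>2)"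
      using sq_defect[of W G] by (simp add: sq_def)
    show "integrable M (\<lambda>t. T * (norm W)\<^sup>2 + (norm (fn G t))\<^sup>2)" using sq_fn[of G] by (simp add: sq_def)
    fix t
    have "norm (prim (fn W) t) \<le> sqrt T * norm W"
    proof -
      have "sqrt (\<integral>t. (norm (fn W t))\<^sup>2 \<partial>M) \<le> norm W" using real_sqrt_le_mono[OF norm_restrict_le[of W]] by simp
      then show ?thesis using norm_prim_le_sqrt[OF sq_fn[of W], of t] T_pos
        by (meson mult_left_mono order_trans real_sqrt_ge_zero less_imp_le)
    qed
    then have "(norm (prim (fn W) t))\<^sup>2 \<le> (sqrt T * norm W)\<^sup>2" by (intro power_mono) auto
    moreover have "(norm ((prim (fn W) t, fn G t) - hproj VV (prim (fn W) t, fn G t)))\<^sup>2 \<le> (norm (prim (fn W) t, fn G t))\<^sup>2"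
      by (intro power_mono norm_compl_le) simp
    ultimately show "(norm ((prim (fn W) t, fn G t) - hproj VV (prim (fn W) t, fn G t)))\<^sup>2 \<le> T * (norm W)\<^sup>2 + (norm (fn G t))\<^sup>2"
      using T_pos by (simp add: norm_prod_def power_mult_distrib)
  qed
  also have "\<dots> = T\<^sup>2 * (norm W)\<^sup>2 + (\<integral>t. (norm (fn G t))\<^sup>2 \<partial>M)"
    using sq_fn[of G] emeasure_M T_pos by (simp add: sq_def measure_def power2_eq_square)
  also have "\<dots> \<le> (T\<^sup>2 + 1) * (norm x)\<^sup>2"
  proof -
    have "(T\<^sup>2 + 1) * (norm x)\<^sup>2 = T\<^sup>2 * (norm W)\<^sup>2 + (norm W)\<^sup>2 + (T\<^sup>2 * (norm G)\<^sup>2 + (norm G)\<^sup>2)"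
      by (simp add: x norm_prod_def algebra_simps)
    moreover have "0 \<le> T\<^sup>2 * (norm G)\<^sup>2" "0 \<le> (norm W)\<^sup>2" by auto
    ultimately show ?thesis using norm_restrict_le[of G] by linarith
  qed
  finally have "norm (defect x) \<le> sqrt ((T\<^sup>2 + 1) * (norm x)\<^sup>2)" by (rule real_le_rsqrt)
  then show "norm (defect x) \<le> norm x * sqrt (T\<^sup>2 + 1)" by (simp add: real_sqrt_mult mult.commute)
qed

lemma defect_eq_0_iff: "defect x = 0 \<longleftrightarrow> (AE t in M. (prim (fn (fst x)) t, fn (snd x) t) \<in> VV)"
proof -
  have "defect x = 0 \<longleftrightarrow> (AE t in M. (prim (fn (fst x)) t, fn (snd x) t) - hproj VV (prim (fn (fst x)) t, fn (snd x) t) = 0)"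
    unfolding defect_def tcls_zero[symmetric] by (rule tcls_eq_iff[OF sq_defect sq_zero])
  also have "\<dots> \<longleftrightarrow> (AE t in M. (prim (fn (fst x)) t, fn (snd x) t) \<in> VV)"
    by (rule AE_cong) (metis eq_iff_diff_eq_0 hproj_id[OF VV] hproj_in[OF VV])
  finally show ?thesis .
qed

text \<open>A relation and not a function: two tests with the same dual vectors are not known in
  advance to have the same right-hand side.\<close>

definition equations :: "(((real, 'h) lsq \<times> (real, 'k) lsq) \<times> real) set" where
  "equations = {((tcls (dual_w z), tcls (dual_G k)), lform z k) |z k. is_test z k}"

lemma is_test_add:
  assumes "is_test z k" "is_test y j" shows "is_test (\<lambda>t. z t + y t) (\<lambda>t. k t + j t)"
proof -
  have sz: "sq z" "sq y" and V: "AE t in M. (val z t, k t) \<in> VV" "AE t in M. (val y t, j t) \<in> VV"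
    using assms by (auto simp: is_test_def)
  from V have "AE t in M. (val (\<lambda>t. z t + y t) t, k t + j t) \<in> VV"
  proof eventually_elim
    case (elim t)
    from subspace_add[OF VV(1) this] show ?case by (simp add: val_add sz)
  qed
  then show ?thesis using assms by (simp add: is_test_def sq_add)
qed

lemma is_test_scaleR:
  assumes "is_test z k" shows "is_test (\<lambda>t. c *\<^sub>R z t) (\<lambda>t. c *\<^sub>R k t)"
proof -
  have sz: "sq z" and V: "AE t in M. (val z t, k t) \<in> VV" using assms by (auto simp: is_test_def)
  from V have "AE t in M. (val (\<lambda>t. c *\<^sub>R z t) t, c *\<^sub>R k t) \<in> VV"
  proof eventually_elim
    case (elim t)
    from subspace_mul[OF VV(1) this, of c] show ?case by (simp add: val_scaleR sz)
  qed
  then show ?thesis using assms by (simp add: is_test_def sq_scaleR)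
qed

lemma dual_add:
  assumes "sq z" "sq y" "sq k" "sq j"
  shows "dual_w (\<lambda>t. z t + y t) = (\<lambda>t. dual_w z t + dual_w y t)"
    "dual_G (\<lambda>t. k t + j t) = (\<lambda>t. dual_G k t + dual_G j t)"
  using assms
  by (auto simp: fun_eq_iff dual_w_def dual_G_def val_add shift_adj_def scaleR_add_right
      conv_adj_add[OF g_meas(1) gK] sq_integrable)

lemma dual_scaleR:
  assumes "sq z" "sq k"
  shows "dual_w (\<lambda>t. c *\<^sub>R z t) = (\<lambda>t. c *\<^sub>R dual_w z t)" "dual_G (\<lambda>t. c *\<^sub>R k t) = (\<lambda>t. c *\<^sub>R dual_G k t)"
  using assms
  by (auto simp: fun_eq_iff dual_w_def dual_G_def val_scaleR shift_adj_def algebra_simps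
      conv_adj_scaleR[OF g_meas(1) gK])

lemma lform_add:
  assumes "sq z" "sq y" "sq k" "sq j"
  shows "lform (\<lambda>t. z t + y t) (\<lambda>t. k t + j t) = lform z k + lform y j"
  unfolding lform_def using assms
  by (simp add: val_add inner_add_left inner_add_right sq_inner_integrable p sq_val sq_rhs0 algebra_simps)

lemma lform_scaleR:
  assumes "sq z" "sq k" shows "lform (\<lambda>t. c *\<^sub>R z t) (\<lambda>t. c *\<^sub>R k t) = c * lform z k"
  unfolding lform_def using assms by (simp add: val_scaleR algebra_simps)

lemma subspace_equations: "subspace equations"
proof (rule subspaceI)
  have "is_test (\<lambda>t. 0) (\<lambda>t. 0)"
    using subspace_0[OF VV(1)] by (simp add: is_test_def sq_zero val_def prim_def zero_prod_def)
  then have "((tcls (dual_w (\<lambda>t. 0)), tcls (dual_G (\<lambda>t. 0))), lform (\<lambda>t. 0) (\<lambda>t. 0)) \<in> equations"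
    unfolding equations_def by blast
  moreover have "dual_w (\<lambda>t. 0) = (\<lambda>t. 0)" "dual_G (\<lambda>t. 0) = (\<lambda>t. 0)" "lform (\<lambda>t. 0) (\<lambda>t. 0) = 0"
    using dual_scaleR[OF sq_zero sq_zero, of 0] lform_scaleR[OF sq_zero sq_zero, of 0] by auto
  ultimately show "0 \<in> equations" by (simp add: tcls_zero zero_prod_def)
next
  fix x y assume "x \<in> equations" "y \<in> equations"
  then obtain z k z' k' where x: "x = ((tcls (dual_w z), tcls (dual_G k)), lform z k)" "is_test z k"
    and y: "y = ((tcls (dual_w z'), tcls (dual_G k')), lform z' k')" "is_test z' k'"
    by (auto simp: equations_def)
  have s: "sq z" "sq k" "sq z'" "sq k'" using x y by (auto simp: is_test_def)
  have "x + y = ((tcls (dual_w (\<lambda>t. z t + z' t)), tcls (dual_G (\<lambda>t. k t + k' t))), lform (\<lambda>t. z t + z' t) (\<lambda>t. k t + k' t))"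
    unfolding x y using s by (simp add: dual_add tcls_add sq_dual lform_add)
  then show "x + y \<in> equations" unfolding equations_def using is_test_add[OF x(2) y(2)] by blast
next
  fix c x assume "x \<in> equations"
  then obtain z k where x: "x = ((tcls (dual_w z), tcls (dual_G k)), lform z k)" "is_test z k"
    by (auto simp: equations_def)
  have s: "sq z" "sq k" using x by (auto simp: is_test_def)
  have "c *\<^sub>R x = ((tcls (dual_w (\<lambda>t. c *\<^sub>R z t)), tcls (dual_G (\<lambda>t. c *\<^sub>R k t))), lform (\<lambda>t. c *\<^sub>R z t) (\<lambda>t. c *\<^sub>R k t))"
    unfolding x using s by (simp add: dual_scaleR tcls_scaleR sq_dual lform_scaleR)
  then show "c *\<^sub>R x \<in> equations" unfolding equations_def using is_test_scaleR[OF x(2)] by blast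
qed

text \<open>The projection theorem with the kernel of \<open>defect\<close> as trial space and the
  multiplier as witness. The energy bounds the pairing from below; its square root bounds both the
  right-hand side and the norm of the multiplier, so their product is again of the size of the
  energy.\<close>

lemma exists_solution0:
  "\<exists>w G. sq w \<and> sq G \<and> (AE t in M. (prim w t, G t) \<in> VV) \<and>
     (\<forall>z k. is_test z k \<longrightarrow> bform w G z k = lform z k)"
proof -
  define F where "F = {x. defect x = 0}"
  interpret d: bounded_linear defect by (rule bounded_linear_defect)
  have F: "subspace F" unfolding F_def by (rule subspaceI) (auto simp: d.zero d.add d.scaleR)
  have "closed F" unfolding F_def
    by (intro closed_Collect_eq linear_continuous_on[OF bounded_linear_defect] continuous_intros)
  obtain C where C: "C \<ge> 0" "\<And>z k. sq z \<Longrightarrow> sq k \<Longrightarrow> \<bar>lform z k\<bar> \<le> C * sqrt (energy z k)"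
    using lform_bound by blast
  have "\<exists>f\<in>F. \<forall>(y, c)\<in>equations. f \<bullet> y = c"
  proof (rule lions_projection[OF F \<open>closed F\<close> subspace_equations])
    show "0 \<le> C * sqrt (exp (\<gamma> * T))" using C(1) by simp
    fix y c assume "(y, c) \<in> equations"
    then obtain z k where y: "y = (tcls (dual_w z), tcls (dual_G k))" "c = lform z k" and t: "is_test z k"
      by (auto simp: equations_def)
    have z: "sq z" and k: "sq k" using t by (auto simp: is_test_def)
    define f where "f = (tcls (mul_w z), tcls (mul_G k))"
    have "AE t in M. (prim (fn (fst f)) t, fn (snd f) t) \<in> VV"
      using fn_tcls[OF sq_mul(2)[OF k]]
    proof eventually_elim
      case (elim t)
      have "prim (fn (fst f)) t = prim (mul_w z) t" unfolding f_def fst_conv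
        by (rule prim_cong_AE[OF fn_tcls[OF sq_mul(1)[OF z]]]) (auto simp: sq_measurable sq_mul z)
      then show ?case using elim mul_in_VV[OF t] by (simp add: f_def)
    qed
    then have fF: "f \<in> F" by (simp add: F_def defect_eq_0_iff)
    have "f \<bullet> y = bform (mul_w z) (mul_G k) z k"
      unfolding f_def y inner_Pair
      by (simp add: inner_tcls_tcls sq_mul sq_dual z k bform_eq_dual)
    then have e: "energy z k \<le> f \<bullet> y" using coercivity[OF z k] by simp
    have e0: "energy z k \<ge> 0" by (simp add: energy_def energy_parts_nonneg)
    have "\<bar>c\<bar> * norm f \<le> (C * sqrt (energy z k)) * sqrt (exp (\<gamma> * T) * energy z k)"
      unfolding y f_def using C z k e0 by (intro mult_mono norm_multiplier) auto
    also have "\<dots> = C * sqrt (exp (\<gamma> * T)) * (sqrt (energy z k) * sqrt (energy z k))"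
      by (simp add: real_sqrt_mult)
    also have "\<dots> = C * sqrt (exp (\<gamma> * T)) * energy z k" using e0 by simp
    also have "\<dots> \<le> C * sqrt (exp (\<gamma> * T)) * (f \<bullet> y)"
      using e C(1) by (intro mult_left_mono) auto
    finally have "\<bar>c\<bar> * norm f \<le> C * sqrt (exp (\<gamma> * T)) * (f \<bullet> y)" .
    \<comment> \<open>If the multiplier vanishes, so does the energy by coercivity, and then the
      right-hand side by its bound.\<close>
    moreover have "f \<noteq> 0" if "c \<noteq> 0"
    proof
      assume "f = 0"
      then have "energy z k = 0" using e e0 by simp
      then show False using C(2)[OF z k] that y by simp
    qed
    ultimately show "\<exists>f\<in>F. \<bar>c\<bar> * norm f \<le> C * sqrt (exp (\<gamma> * T)) * (f \<bullet> y) \<and> (c \<noteq> 0 \<longrightarrow> f \<noteq> 0)"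
      using fF by blast
  qed
  then obtain f where f: "f \<in> F" "\<And>y c. (y, c) \<in> equations \<Longrightarrow> f \<bullet> y = c" by (auto split: prod.splits)
  obtain W G where WG: "f = (W, G)" by (cases f)
  have "bform (fn W) (fn G) z k = lform z k" if t: "is_test z k" for z k
  proof -
    have z: "sq z" and k: "sq k" using t by (auto simp: is_test_def)
    have "f \<bullet> (tcls (dual_w z), tcls (dual_G k)) = lform z k"
      by (rule f(2)) (use t in \<open>auto simp: equations_def\<close>)
    then show ?thesis
      unfolding WG inner_Pair by (simp add: inner_tcls sq_dual z k bform_eq_dual sq_fn)
  qed
  moreover have "AE t in M. (prim (fn W) t, fn G t) \<in> VV" using f(1) by (simp add: F_def defect_eq_0_iff WG)
  ultimately show ?thesis by (intro exI[of _ "fn W"] exI[of _ "fn G"]) (simp add: sq_fn)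
qed

text \<open>Adding the initial value back returns \<open>rhs0\<close> to the elastic and memory
  terms, and the history \<open>p\<close> rejoins the delayed velocity.\<close>

theorem exists_solution:
  "\<exists>w G. sq w \<and> sq G \<and> (AE t in M. (u0 + prim w t, G t) \<in> VV) \<and>
     (\<forall>z k. is_test z k \<longrightarrow>
        - (\<integral>t. w t \<bullet> z t \<partial>M) + (\<integral>t. G t \<bullet> k t \<partial>M) - (\<integral>t. conv g G t \<bullet> k t \<partial>M)
        + \<mu>1 * (\<integral>t. w t \<bullet> val z t \<partial>M) + \<mu>2 * (\<integral>t. (shift \<tau> w t + p t) \<bullet> val z t \<partial>M)
        - val z 0 \<bullet> u1 = 0)"
proof -
  obtain w G where w: "sq w" and G: "sq G" and V: "AE t in M. (prim w t, G t) \<in> VV"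
    and eq: "\<And>z k. is_test z k \<Longrightarrow> bform w G z k = lform z k" using exists_solution0 by blast
  have k0: "sq (\<lambda>_. k0)" by (rule sq_bounded[where B="norm k0"]) auto
  define H where "H t = k0 + G t" for t
  have H: "sq H" unfolding H_def by (intro sq_add k0 G)
  have "AE t in M. (u0 + prim w t, H t) \<in> VV"
    using V
  proof eventually_elim
    case (elim t)
    from subspace_add[OF VV(1) uk0 this] show ?case by (simp add: H_def)
  qed
  moreover have "- (\<integral>t. w t \<bullet> z t \<partial>M) + (\<integral>t. H t \<bullet> k t \<partial>M) - (\<integral>t. conv g H t \<bullet> k t \<partial>M)
        + \<mu>1 * (\<integral>t. w t \<bullet> val z t \<partial>M) + \<mu>2 * (\<integral>t. (shift \<tau> w t + p t) \<bullet> val z t \<partial>M)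
        - val z 0 \<bullet> u1 = 0" if t: "is_test z k" for z k
  proof -
    have z: "sq z" and k: "sq k" using t by (auto simp: is_test_def)
    have c: "conv g H t = conv g (\<lambda>_. k0) t + conv g G t" for t
      unfolding H_def by (rule conv_add[OF g_meas(1) gK sq_integrable[OF k0] sq_integrable[OF G]])
    have "(\<integral>t. H t \<bullet> k t \<partial>M) = (\<integral>t. k0 \<bullet> k t \<partial>M) + (\<integral>t. G t \<bullet> k t \<partial>M)"
      unfolding H_def inner_add_left using sq_inner_integrable[OF k0 k] sq_inner_integrable[OF G k] by simp
    moreover have "(\<integral>t. conv g H t \<bullet> k t \<partial>M) = (\<integral>t. conv g (\<lambda>_. k0) t \<bullet> k t \<partial>M) + (\<integral>t. conv g G t \<bullet> k t \<partial>M)"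
      unfolding c inner_add_left
      by (intro Bochner_Integration.integral_add sq_inner_integrable sq_conv sq_integrable k0 k G)
    moreover have "(\<integral>t. rhs0 t \<bullet> k t \<partial>M) = (\<integral>t. k0 \<bullet> k t \<partial>M) - (\<integral>t. conv g (\<lambda>_. k0) t \<bullet> k t \<partial>M)"
      unfolding rhs0_def inner_diff_left
      by (intro Bochner_Integration.integral_diff sq_inner_integrable sq_conv sq_integrable k0 k)
    moreover have "(\<integral>t. (shift \<tau> w t + p t) \<bullet> val z t \<partial>M) = (\<integral>t. shift \<tau> w t \<bullet> val z t \<partial>M) + (\<integral>t. p t \<bullet> val z t \<partial>M)"
      unfolding inner_add_left
      by (intro Bochner_Integration.integral_add sq_inner_integrable sq_shift tau w p sq_val z)
    ultimately show ?thesis using eq[OF t] unfolding bform_def lform_def by (simp add: algebra_simps)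
  qed
  ultimately show ?thesis using w H by (intro exI[of _ w] exI[of _ H]) simp
qed

text \<open>Testing with \<open>\<theta>(t) \<phi>\<close> for scalar \<open>\<theta>\<close> recovers the equation integrated once in time.\<close>

theorem velocity_in_dual:
  assumes w: "sq w" and G: "sq G"
    and eq: "\<And>z k. is_test z k \<Longrightarrow>
        - (\<integral>t. w t \<bullet> z t \<partial>M) + (\<integral>t. G t \<bullet> k t \<partial>M) - (\<integral>t. conv g G t \<bullet> k t \<partial>M)
        + \<mu>1 * (\<integral>t. w t \<bullet> val z t \<partial>M) + \<mu>2 * (\<integral>t. (shift \<tau> w t + p t) \<bullet> val z t \<partial>M)
        - val z 0 \<bullet> u1 = 0"
  shows "\<exists>a b. continuous_on UNIV a \<and> continuous_on UNIV b \<and> a 0 = u1 \<and> b 0 = 0 \<and>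
    (AE t in M. \<forall>(\<phi>, \<kappa>)\<in>VV. w t \<bullet> \<phi> = a t \<bullet> \<phi> + b t \<bullet> \<kappa>)"
proof -
  \<comment> \<open>\<open>d\<close> collects what is paired with the test function and
    \<open>e\<close> what is paired with its gradient. Subtracting their primitives from the initial
    values u1 and 0 gives the velocity as an element of the dual.\<close>
  define d where "d t = \<mu>1 *\<^sub>R w t + \<mu>2 *\<^sub>R (shift \<tau> w t + p t)" for t
  define e where "e t = G t - conv g G t" for t
  have d: "sq d" unfolding d_def by (intro sq_add sq_scaleR w sq_shift tau p)
  have e: "sq e" unfolding e_def by (intro sq_diff G sq_conv sq_integrable)
  define a where "a t = u1 - prim d t" for t
  define b where "b t = - prim e t" for t
  have ca: "continuous_on UNIV a" unfolding a_def by (intro continuous_intros prim_continuous sq_integrable d)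
  have cb: "continuous_on UNIV b" unfolding b_def by (intro continuous_intros prim_continuous sq_integrable e)
  have dual: "AE t in M. w t \<bullet> \<phi> = a t \<bullet> \<phi> + b t \<bullet> \<kappa>" if V: "(\<phi>, \<kappa>) \<in> VV" for \<phi> \<kappa>
  proof -
    define \<rho> where "\<rho> t = e t \<bullet> \<kappa> + d t \<bullet> \<phi>" for t
    have c: "sq (\<lambda>_. c)" for c :: "'b::{real_inner,banach,second_countable_topology}"
      by (rule sq_bounded[where B="norm c"]) auto
    have ri: "integrable M \<rho>" unfolding \<rho>_def
      by (intro Bochner_Integration.integrable_add sq_inner_integrable e d c)
    have pr: "prim \<rho> t = prim e t \<bullet> \<kappa> + prim d t \<bullet> \<phi>" for t
      unfolding \<rho>_def using e d
      by (subst prim_add) (auto simp: prim_inner sq_integrable intro!: sq_inner_integrable c)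
    \<comment> \<open>The residual of the equation integrated once in time. Its primitive that
      vanishes at \<open>T\<close> serves below as the scalar factor of the test function, which
      turns the weak identity into the vanishing of the integral of D^2. The factor is free at 0,
      and this brings in \<open>u1\<close>.\<close>
    define D where "D t = w t \<bullet> \<phi> + prim \<rho> t - u1 \<bullet> \<phi>" for t
    have D: "sq D"
    proof -
      have "sq (\<lambda>t. w t \<bullet> \<phi>)" by (rule sq_bounded_linear[OF bounded_linear_inner_left w])
      from sq_add[OF this sq_prim[OF ri, of "- (u1 \<bullet> \<phi>)"]] show ?thesis
        unfolding D_def by (simp add: algebra_simps)
    qed
    define \<theta> where "\<theta> t = - integral\<^sup>L M D + prim D t" for t
    note Di = sq_integrable[OF D]
    have th: "sq \<theta>" unfolding \<theta>_def by (rule sq_prim[OF Di])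
    have th_meas[measurable]: "\<theta> \<in> borel_measurable borel" by (rule sq_measurable[OF th])
    have thT: "\<theta> T = 0" by (simp add: \<theta>_def prim_T[OF Di])
    have th0: "\<theta> 0 = - integral\<^sup>L M D" by (simp add: \<theta>_def prim_0)
    have z: "sq (\<lambda>t. D t *\<^sub>R \<phi>)" by (rule sq_bounded_linear[OF bounded_linear_scaleR_left D])
    have k: "sq (\<lambda>t. \<theta> t *\<^sub>R \<kappa>)" by (rule sq_bounded_linear[OF bounded_linear_scaleR_left th])
    have v: "val (\<lambda>t. D t *\<^sub>R \<phi>) t = \<theta> t *\<^sub>R \<phi>" for t
    proof -
      have "prim (\<lambda>t. D t *\<^sub>R \<phi>) t = prim D t *\<^sub>R \<phi>" using prim_linear[OF bounded_linear_scaleR_left Di] by metis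
      moreover have "integral\<^sup>L M (\<lambda>t. D t *\<^sub>R \<phi>) = integral\<^sup>L M D *\<^sub>R \<phi>" using Di by simp
      ultimately show ?thesis by (simp add: val_def \<theta>_def scaleR_diff_left)
    qed
    have "is_test (\<lambda>t. D t *\<^sub>R \<phi>) (\<lambda>t. \<theta> t *\<^sub>R \<kappa>)"
      unfolding is_test_def v using z k subspace_mul[OF VV(1) V] by simp
    note eq[OF this, unfolded v]
    also have "(\<integral>t. w t \<bullet> D t *\<^sub>R \<phi> \<partial>M) = (\<integral>t. D t * (w t \<bullet> \<phi>) \<partial>M)" by simp
    finally have 1: "- (\<integral>t. D t * (w t \<bullet> \<phi>) \<partial>M) + (\<integral>t. G t \<bullet> \<theta> t *\<^sub>R \<kappa> \<partial>M) - (\<integral>t. conv g G t \<bullet> \<theta> t *\<^sub>R \<kappa> \<partial>M)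
        + \<mu>1 * (\<integral>t. w t \<bullet> \<theta> t *\<^sub>R \<phi> \<partial>M) + \<mu>2 * (\<integral>t. (shift \<tau> w t + p t) \<bullet> \<theta> t *\<^sub>R \<phi> \<partial>M)
        + integral\<^sup>L M D * (u1 \<bullet> \<phi>) = 0" by (simp add: th0 inner_commute)
    have thphi: "sq (\<lambda>t. \<theta> t *\<^sub>R \<phi>)" by (rule sq_bounded_linear[OF bounded_linear_scaleR_left th])
    have "(\<integral>t. \<theta> t * \<rho> t \<partial>M) = (\<integral>t. (G t \<bullet> \<theta> t *\<^sub>R \<kappa> - conv g G t \<bullet> \<theta> t *\<^sub>R \<kappa>)
        + (\<mu>1 * (w t \<bullet> \<theta> t *\<^sub>R \<phi>) + \<mu>2 * ((shift \<tau> w t + p t) \<bullet> \<theta> t *\<^sub>R \<phi>)) \<partial>M)"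
      by (rule Bochner_Integration.integral_cong) (auto simp: \<rho>_def d_def e_def inner_simps algebra_simps)
    also have "\<dots> = (\<integral>t. G t \<bullet> \<theta> t *\<^sub>R \<kappa> \<partial>M) - (\<integral>t. conv g G t \<bullet> \<theta> t *\<^sub>R \<kappa> \<partial>M)
        + (\<mu>1 * (\<integral>t. w t \<bullet> \<theta> t *\<^sub>R \<phi> \<partial>M) + \<mu>2 * (\<integral>t. (shift \<tau> w t + p t) \<bullet> \<theta> t *\<^sub>R \<phi> \<partial>M))"
    proof -
      have i: "integrable M (\<lambda>t. G t \<bullet> \<theta> t *\<^sub>R \<kappa>)" "integrable M (\<lambda>t. conv g G t \<bullet> \<theta> t *\<^sub>R \<kappa>)"
        "integrable M (\<lambda>t. w t \<bullet> \<theta> t *\<^sub>R \<phi>)" "integrable M (\<lambda>t. (shift \<tau> w t + p t) \<bullet> \<theta> t *\<^sub>R \<phi>)"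
        by (intro sq_inner_integrable G k thphi w sq_conv sq_integrable sq_add sq_shift tau p)+
      show ?thesis
        by (simp only: Bochner_Integration.integral_add[OF Bochner_Integration.integrable_diff[OF i(1,2)]
            Bochner_Integration.integrable_add[OF integrable_mult_right[OF i(3)] integrable_mult_right[OF i(4)]]]
            Bochner_Integration.integral_diff[OF i(1,2)]
            Bochner_Integration.integral_add[OF integrable_mult_right[OF i(3)] integrable_mult_right[OF i(4)]]
            integral_mult_right_zero)
    qed
    finally have 2: "(\<integral>t. \<theta> t * \<rho> t \<partial>M) = (\<integral>t. D t * (w t \<bullet> \<phi>) \<partial>M) - integral\<^sup>L M D * (u1 \<bullet> \<phi>)"
      using 1 by linarith
    have prm: "sq (prim \<rho>)" using sq_prim[OF ri, of 0] by simp
    \<comment> \<open>With exponent 0 this is the plain integration by parts; the boundary terms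
      vanish because \<theta> vanishes at \<open>T\<close> and the primitive of \<rho> at 0.\<close>
    have "(\<integral>t. exp (0 * t) * (D t \<bullet> prim \<rho> t + \<theta> t \<bullet> \<rho> t + 0 * (\<theta> t \<bullet> prim \<rho> t)) \<partial>M)
      = exp (0 * T) * (\<theta> T \<bullet> prim \<rho> T) - (- integral\<^sup>L M D) \<bullet> 0"
      by (rule weighted_product_integral[OF Di ri]) (auto simp: \<theta>_def[abs_def] ri Di)
    then have "(\<integral>t. D t * prim \<rho> t + \<theta> t * \<rho> t \<partial>M) = 0" by (simp add: thT)
    moreover have "integrable M (\<lambda>t. D t * prim \<rho> t)" using sq_inner_integrable[OF D prm] by simp
    moreover have "integrable M (\<lambda>t. \<theta> t * \<rho> t)"
      using integrable_inner_bounded(2)[OF ri th_meas prim_bounded[OF Di, of "- integral\<^sup>L M D", folded \<theta>_def]] by simp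
    ultimately have 3: "(\<integral>t. D t * prim \<rho> t \<partial>M) = - (\<integral>t. \<theta> t * \<rho> t \<partial>M)" by simp
    have "(\<integral>t. (norm (D t))\<^sup>2 \<partial>M) = (\<integral>t. (D t * (w t \<bullet> \<phi>) + D t * prim \<rho> t) - D t * (u1 \<bullet> \<phi>) \<partial>M)"
      by (rule Bochner_Integration.integral_cong) (auto simp: power2_eq_square D_def algebra_simps)
    also have "\<dots> = ((\<integral>t. D t * (w t \<bullet> \<phi>) \<partial>M) + (\<integral>t. D t * prim \<rho> t \<partial>M)) - integral\<^sup>L M D * (u1 \<bullet> \<phi>)"
    proof -
      have "integrable M (\<lambda>t. D t * (w t \<bullet> \<phi>))" using sq_inner_integrable[OF w z] by simp
      then show ?thesis using \<open>integrable M (\<lambda>t. D t * prim \<rho> t)\<close> Di by simp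
    qed
    finally have "(\<integral>t. (norm (D t))\<^sup>2 \<partial>M) = 0" using 2 3 by simp
    then have "AE t in M. (norm (D t))\<^sup>2 = 0"
      by (subst (asm) integral_nonneg_eq_0_iff_AE) (use D in \<open>auto simp: sq_def\<close>)
    then show ?thesis
      by eventually_elim (auto simp: D_def a_def b_def pr inner_diff_left)
  qed
  \<comment> \<open>So far the exceptional null set depends on the pair. Both sides are continuous
    in the pair, so a countable dense set suffices; composing with the projection allows this set to
    be dense in the whole product space.\<close>
  obtain E :: "('h \<times> 'k) set" where E: "countable E" "\<And>X. open X \<Longrightarrow> X \<noteq> {} \<Longrightarrow> \<exists>d\<in>E. d \<in> X"
    using countable_dense_exists by blast
  define l where "l t x = w t \<bullet> fst (hproj VV x) - a t \<bullet> fst (hproj VV x) - b t \<bullet> snd (hproj VV x)" for t x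
  have lc: "continuous_on UNIV (l t)" for t
    unfolding l_def by (intro continuous_intros linear_continuous_on[OF hproj_bounded_linear[OF VV]])
  have "AE t in M. l t x = 0" for x
    using dual[of "fst (hproj VV x)" "snd (hproj VV x)"] hproj_in[OF VV, of x]
    by (auto simp: l_def elim!: eventually_mono)
  then have "AE t in M. \<forall>x\<in>E. l t x = 0" using E(1) by (subst AE_ball_countable) auto
  then have "AE t in M. \<forall>(\<phi>, \<kappa>)\<in>VV. w t \<bullet> \<phi> = a t \<bullet> \<phi> + b t \<bullet> \<kappa>"
  proof eventually_elim
    case (elim t)
    have "open {x. l t x \<noteq> 0}" using lc[of t] by (intro open_Collect_neq continuous_intros) auto
    then have "{x. l t x \<noteq> 0} = {}" using E(2) elim by blast
    then have l0: "l t x = 0" for x by blast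
    show ?case
    proof (clarify)
      fix \<phi> \<kappa> assume "(\<phi>, \<kappa>) \<in> VV"
      then show "w t \<bullet> \<phi> = a t \<bullet> \<phi> + b t \<bullet> \<kappa>"
        using l0[of "(\<phi>, \<kappa>)"] by (simp add: l_def hproj_id[OF VV])
    qed
  qed
  moreover have "a 0 = u1" "b 0 = 0" by (simp_all add: a_def b_def prim_0)
  ultimately show ?thesis using ca cb by (intro exI[of _ a] exI[of _ b]) simp
qed

end

section \<open>Test functions\<close>

text \<open>The functions exp (- 1 / x) / x^m, cut off at 0. The powers of 1 / x are included
  because differentiation produces them; up to linear combinations the family is then closed under
  derivatives.\<close>

definition flat_exp :: "nat \<Rightarrow> real \<Rightarrow> real" where
  "flat_exp m x = (if 0 < x then exp (- inverse x) * inverse x ^ m else 0)"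

lemma flat_exp_tendsto: "(flat_exp m \<longlongrightarrow> 0) (at_right 0)"
proof -
  have "((\<lambda>x. inverse x ^ m / exp (inverse x)) \<longlongrightarrow> 0) (at_right (0::real))"
    using filterlim_compose[OF tendsto_power_div_exp_0 filterlim_inverse_at_top_right] .
  then show ?thesis
    by (rule Lim_transform_eventually)
       (auto simp: flat_exp_def eventually_at_filter exp_minus field_simps)
qed

lemma flat_exp_deriv:
  "(flat_exp m has_real_derivative (flat_exp (m + 2) x - real m * flat_exp (m + 1) x)) (at x)"
proof -
  consider "x < 0" | "x = 0" | "x > 0" by linarith
  then show ?thesis
  proof cases
    case 1
    have "((\<lambda>_. 0) has_real_derivative 0) (at x)" by simp
    then have "(flat_exp m has_real_derivative 0) (at x)"
      by (rule has_field_derivative_transform_within_open[of _ _ _ "{..<0}"]) (use 1 in \<open>auto simp: flat_exp_def\<close>)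
    then show ?thesis using 1 by (simp add: flat_exp_def)
  next
    \<comment> \<open>From the right, the difference quotient at 0 is the member of the family with
      index m + 1, so its limit is the flatness already shown.\<close>
    case 2
    have "((\<lambda>h. (flat_exp m (0 + h) - flat_exp m 0) / h) \<longlongrightarrow> 0) (at 0)"
    proof (rule filterlim_split_at_real)
      show "((\<lambda>h. (flat_exp m (0 + h) - flat_exp m 0) / h) \<longlongrightarrow> 0) (at_left 0)"
        by (rule tendsto_eventually) (auto simp: flat_exp_def eventually_at_filter)
      show "((\<lambda>h. (flat_exp m (0 + h) - flat_exp m 0) / h) \<longlongrightarrow> 0) (at_right 0)"
        using flat_exp_tendsto[of "m + 1"]
        by (rule Lim_transform_eventually) (auto simp: flat_exp_def eventually_at_filter field_simps)
    qed
    then show ?thesis using 2 unfolding DERIV_def by (simp add: flat_exp_def)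
  next
    case 3
    have "((\<lambda>x. exp (- inverse x) * inverse x ^ m) has_real_derivative
      flat_exp (m + 2) x - real m * flat_exp (m + 1) x) (at x)"
    proof -
      have i: "(inverse has_real_derivative - (inverse x * inverse x)) (at x)"
        using 3 by (auto intro!: derivative_eq_intros simp: power2_eq_square)
      have "((\<lambda>x. exp (- inverse x) * inverse x ^ m) has_real_derivative
          exp (- inverse x) * - (- (inverse x * inverse x)) * inverse x ^ m
          + (real m * (- (inverse x * inverse x) * inverse x ^ (m - Suc 0))) * exp (- inverse x)) (at x)"
        by (intro DERIV_mult DERIV_power DERIV_fun_exp DERIV_minus i)
      moreover have "exp (- inverse x) * - (- (inverse x * inverse x)) * inverse x ^ m
          + (real m * (- (inverse x * inverse x) * inverse x ^ (m - Suc 0))) * exp (- inverse x)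
        = flat_exp (m + 2) x - real m * flat_exp (m + 1) x"
        using 3 by (cases m) (simp_all add: flat_exp_def algebra_simps)
      ultimately show ?thesis by simp
    qed
    then show ?thesis
      by (rule has_field_derivative_transform_within_open[of _ _ _ "{0<..}"]) (use 3 in \<open>auto simp: flat_exp_def\<close>)
  qed
qed

text \<open>An algebra of functions that is visibly closed under differentiation and contains bumps.\<close>

inductive_set smooth :: "('a::euclidean_space \<Rightarrow> real) set" where
  smooth_const: "(\<lambda>x. c) \<in> smooth"
| smooth_flat: "(\<lambda>x. flat_exp m (x \<bullet> b + d)) \<in> smooth"
| smooth_add: "f \<in> smooth \<Longrightarrow> h \<in> smooth \<Longrightarrow> (\<lambda>x. f x + h x) \<in> smooth"
| smooth_mult: "f \<in> smooth \<Longrightarrow> h \<in> smooth \<Longrightarrow> (\<lambda>x. f x * h x) \<in> smooth"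

lemma smooth_has_derivative:
  "f \<in> smooth \<Longrightarrow> \<exists>f'. (\<forall>v. (\<lambda>x. f' x v) \<in> smooth) \<and> (\<forall>x. (f has_derivative f' x) (at x))"
proof (induction rule: smooth.induct)
  case (smooth_const c)
  then show ?case by (intro exI[of _ "\<lambda>x v. 0"]) (auto intro: smooth.smooth_const)
next
  case (smooth_flat m b d)
  let ?f' = "\<lambda>x v. (flat_exp (m + 2) (x \<bullet> b + d) + (- real m) * flat_exp (m + 1) (x \<bullet> b + d)) * (v \<bullet> b)"
  have "((\<lambda>x. flat_exp m (x \<bullet> b + d)) has_derivative ?f' x) (at x)" for x
  proof -
    have "((\<lambda>x. x \<bullet> b + d) has_derivative (\<lambda>v. v \<bullet> b)) (at x)"
      by (auto intro!: derivative_eq_intros)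
    from has_derivative_compose[OF this flat_exp_deriv[of m, unfolded has_field_derivative_def]]
    show ?thesis by simp
  qed
  moreover have "(\<lambda>x. ?f' x v) \<in> smooth" for v by (intro smooth.intros)
  ultimately show ?case by (intro exI[of _ ?f'] conjI allI)
next
  case (smooth_add f h)
  then obtain f' h' where f': "\<And>v. (\<lambda>x. f' x v) \<in> smooth" "\<And>x. (f has_derivative f' x) (at x)"
    and h': "\<And>v. (\<lambda>x. h' x v) \<in> smooth" "\<And>x. (h has_derivative h' x) (at x)" by blast
  then show ?case
    by (intro exI[of _ "\<lambda>x v. f' x v + h' x v"]) (auto intro!: smooth.intros has_derivative_add)
next
  case (smooth_mult f h)
  then obtain f' h' where f': "\<And>v. (\<lambda>x. f' x v) \<in> smooth" "\<And>x. (f has_derivative f' x) (at x)"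
    and h': "\<And>v. (\<lambda>x. h' x v) \<in> smooth" "\<And>x. (h has_derivative h' x) (at x)" by blast
  then show ?case using smooth_mult.hyps
    by (intro exI[of _ "\<lambda>x v. f x * h' x v + f' x v * h x"]) (auto intro!: smooth.intros has_derivative_mult)
qed

lemma partial_eqI: "(f has_derivative f') (at x) \<Longrightarrow> partial b f x = f' b"
  unfolding partial_def using frechet_derivative_at by metis

lemma smooth_Ck: "f \<in> smooth \<Longrightarrow> Ck k f"
proof (induction k arbitrary: f)
  case 0
  obtain f' where "\<And>x. (f has_derivative f' x) (at x)" using smooth_has_derivative[OF 0] by blast
  then have "continuous_on UNIV f"
    by (intro continuous_at_imp_continuous_on) (auto intro: has_derivative_continuous)
  then show ?case by simp
next
  case (Suc k)
  obtain f' where f': "\<And>v. (\<lambda>x. f' x v) \<in> smooth" "\<And>x. (f has_derivative f' x) (at x)"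
    using smooth_has_derivative[OF Suc.prems] by blast
  have "partial b f = (\<lambda>x. f' x b)" for b using partial_eqI[OF f'(2)] by blast
  then show ?case using f' Suc.IH by (auto simp: differentiable_def)
qed

lemma smooth_prod: "finite A \<Longrightarrow> (\<And>i. i \<in> A \<Longrightarrow> f i \<in> smooth) \<Longrightarrow> (\<lambda>x. \<Prod>i\<in>A. f i x) \<in> smooth"
  by (induction A rule: finite_induct) (auto intro: smooth.intros)

text \<open>The scale Suc n sharpens the bumps: exp (- 1 / (n c)) tends to 1 for c > 0, so they
  converge to the indicator of the open box. The arguments are written as affine functions to match
  the generators of \<open>smooth\<close>.\<close>

definition box_bump :: "'a::euclidean_space \<Rightarrow> 'a \<Rightarrow> nat \<Rightarrow> 'a \<Rightarrow> real" where
  "box_bump a b n x = (\<Prod>i\<in>Basis. flat_exp 0 (x \<bullet> (real (Suc n) *\<^sub>R i) + - real (Suc n) * (a \<bullet> i)) *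
     flat_exp 0 (x \<bullet> (- real (Suc n) *\<^sub>R i) + real (Suc n) * (b \<bullet> i)))"

lemma flat_exp_0_range: "0 \<le> flat_exp 0 x" "flat_exp 0 x \<le> 1"
  by (auto simp: flat_exp_def)

lemma box_bump_smooth: "box_bump a b n \<in> smooth"
  unfolding box_bump_def[abs_def] by (intro smooth_prod smooth.intros finite_Basis)

lemma box_bump_range: "0 \<le> box_bump a b n x" "box_bump a b n x \<le> 1"
  unfolding box_bump_def
  by (intro prod_nonneg mult_nonneg_nonneg flat_exp_0_range)
     (intro prod_le_1 conjI mult_nonneg_nonneg mult_le_one flat_exp_0_range)

lemma box_bump_outside:
  assumes "x \<notin> box a b" shows "box_bump a b n x = 0"
proof -
  obtain i where i: "i \<in> Basis" "\<not> (a \<bullet> i < x \<bullet> i \<and> x \<bullet> i < b \<bullet> i)" using assms by (auto simp: mem_box)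
  have 1: "x \<bullet> (real (Suc n) *\<^sub>R i) + - real (Suc n) * (a \<bullet> i) = real (Suc n) * (x \<bullet> i - a \<bullet> i)"
    "x \<bullet> (- real (Suc n) *\<^sub>R i) + real (Suc n) * (b \<bullet> i) = real (Suc n) * (b \<bullet> i - x \<bullet> i)"
    by (simp_all only: inner_scaleR_right right_diff_distrib)
  have "flat_exp 0 (real (Suc n) * (x \<bullet> i - a \<bullet> i)) * flat_exp 0 (real (Suc n) * (b \<bullet> i - x \<bullet> i)) = 0"
    using i(2) by (auto simp: flat_exp_def zero_less_mult_iff simp del: of_nat_Suc)
  then show ?thesis unfolding box_bump_def using i(1) 1 by (intro prod_zero finite_Basis bexI[of _ i]) simp
qed

lemma box_bump_tendsto: "(\<lambda>n. box_bump a b n x) \<longlonglongrightarrow> indicator (box a b) x"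
proof (cases "x \<in> box a b")
  case True
  have f: "(\<lambda>n. flat_exp 0 (real (Suc n) * c)) \<longlonglongrightarrow> 1" if c: "c > 0" for c
  proof -
    have "(\<lambda>n. exp (- (inverse (real (Suc n)) * inverse c))) \<longlonglongrightarrow> exp (- (0 * inverse c))"
      by (intro tendsto_intros LIMSEQ_inverse_real_of_nat)
    moreover have "(\<lambda>n. exp (- (inverse (real (Suc n)) * inverse c))) = (\<lambda>n. flat_exp 0 (real (Suc n) * c))"
      using c by (auto simp: flat_exp_def zero_less_mult_iff simp del: of_nat_Suc)
    ultimately show ?thesis by simp
  qed
  have 1: "x \<bullet> (real (Suc n) *\<^sub>R i) + - real (Suc n) * (a \<bullet> i) = real (Suc n) * (x \<bullet> i - a \<bullet> i)"
    "x \<bullet> (- real (Suc n) *\<^sub>R i) + real (Suc n) * (b \<bullet> i) = real (Suc n) * (b \<bullet> i - x \<bullet> i)" for n i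
    by (simp_all only: inner_scaleR_right right_diff_distrib)
  have "(\<lambda>n. box_bump a b n x) \<longlonglongrightarrow> (\<Prod>i\<in>(Basis::'a set). 1 * 1)"
    unfolding box_bump_def 1 using True by (intro tendsto_prod tendsto_mult f) (auto simp: mem_box)
  then show ?thesis using True by simp
qed (simp add: box_bump_outside)

lemma box_bump_test:
  assumes "cbox a b \<subseteq> \<Omega>" shows "box_bump a b n \<in> test_functions \<Omega>"
  unfolding test_functions_def
  using assms box_subset_cbox[of a b] box_bump_outside[of _ a b]
  by (auto intro!: smooth_Ck box_bump_smooth exI[of _ "cbox a b"])

section \<open>Calculus of test functions\<close>

lemma test_differentiable: "\<phi> \<in> test_functions \<Omega> \<Longrightarrow> \<phi> differentiable (at x)"
proof -
  assume "\<phi> \<in> test_functions \<Omega>"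
  then have "Ck (Suc 0) \<phi>" unfolding test_functions_def by blast
  then show ?thesis by simp
qed

lemma test_continuous: "\<phi> \<in> test_functions \<Omega> \<Longrightarrow> continuous_on UNIV \<phi>"
  by (auto simp: test_functions_def dest: spec[of _ 0])

lemma test_measurable: "\<phi> \<in> test_functions \<Omega> \<Longrightarrow> \<phi> \<in> borel_measurable borel"
  by (intro borel_measurable_continuous_onI test_continuous)

lemma test_outside: "\<phi> \<in> test_functions \<Omega> \<Longrightarrow> x \<notin> \<Omega> \<Longrightarrow> \<phi> x = 0"
  by (auto simp: test_functions_def)

lemma has_derivative_frechet: "f differentiable (at x) \<Longrightarrow> (f has_derivative frechet_derivative f (at x)) (at x)"
  by (simp add: frechet_derivative_works[symmetric])

lemma partial_add: "f differentiable (at x) \<Longrightarrow> h differentiable (at x) \<Longrightarrow>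
    partial b (\<lambda>x. f x + h x) x = partial b f x + partial b h x"
  by (rule partial_eqI[OF has_derivative_add[OF has_derivative_frechet has_derivative_frechet], folded partial_def])

lemma partial_cmult: "f differentiable (at x) \<Longrightarrow> partial b (\<lambda>x. c * f x) x = c * partial b f x"
  by (rule partial_eqI[OF has_derivative_mult_right[OF has_derivative_frechet], folded partial_def])

lemma partial_mult: "f differentiable (at x) \<Longrightarrow> h differentiable (at x) \<Longrightarrow>
    partial b (\<lambda>x. f x * h x) x = f x * partial b h x + partial b f x * h x"
  by (rule partial_eqI[OF has_derivative_mult[OF has_derivative_frechet has_derivative_frechet], folded partial_def])

lemma Ck_add: "Ck k f \<Longrightarrow> Ck k h \<Longrightarrow> Ck k (\<lambda>x. f x + h x)"
proof (induction k arbitrary: f h)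
  case 0
  then show ?case by (auto intro: continuous_on_add)
next
  case (Suc k)
  then have "partial b (\<lambda>x. f x + h x) = (\<lambda>x. partial b f x + partial b h x)" for b
    by (auto simp: partial_add)
  with Suc show ?case by auto
qed

lemma Ck_cmult: "Ck k f \<Longrightarrow> Ck k (\<lambda>x. c * f x)"
proof (induction k arbitrary: f)
  case 0
  then show ?case by (auto intro: continuous_on_mult)
next
  case (Suc k)
  then have "partial b (\<lambda>x. c * f x) = (\<lambda>x. c * partial b f x)" for b
    by (auto simp: partial_cmult)
  with Suc show ?case by auto
qed

lemma test_add:
  assumes "\<phi> \<in> test_functions \<Omega>" "\<psi> \<in> test_functions \<Omega>"
  shows "(\<lambda>x. \<phi> x + \<psi> x) \<in> test_functions \<Omega>"
proof -
  obtain K L where "compact K" "K \<subseteq> \<Omega>" "\<forall>x. x \<notin> K \<longrightarrow> \<phi> x = 0" "compact L" "L \<subseteq> \<Omega>" "\<forall>x. x \<notin> L \<longrightarrow> \<psi> x = 0"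
    using assms unfolding test_functions_def by blast
  then have "compact (K \<union> L) \<and> K \<union> L \<subseteq> \<Omega> \<and> (\<forall>x. x \<notin> K \<union> L \<longrightarrow> \<phi> x + \<psi> x = 0)" by auto
  then show ?thesis using assms Ck_add unfolding test_functions_def by blast
qed

lemma test_cmult: "\<phi> \<in> test_functions \<Omega> \<Longrightarrow> (\<lambda>x. c * \<phi> x) \<in> test_functions \<Omega>"
proof -
  assume a: "\<phi> \<in> test_functions \<Omega>"
  then obtain K where "compact K" "K \<subseteq> \<Omega>" "\<forall>x. x \<notin> K \<longrightarrow> \<phi> x = 0" unfolding test_functions_def by blast
  then have "compact K \<and> K \<subseteq> \<Omega> \<and> (\<forall>x. x \<notin> K \<longrightarrow> c * \<phi> x = 0)" by auto
  then show ?thesis using a Ck_cmult unfolding test_functions_def by blast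
qed

lemma test_partial:
  assumes "\<phi> \<in> test_functions \<Omega>" "b \<in> Basis"
  shows "partial b \<phi> \<in> test_functions \<Omega>"
proof -
  obtain K where K: "compact K" "K \<subseteq> \<Omega>" "\<And>x. x \<notin> K \<Longrightarrow> \<phi> x = 0"
    using assms unfolding test_functions_def by blast
  have "Ck k (partial b \<phi>)" for k
  proof -
    have "Ck (Suc k) \<phi>" using assms(1) unfolding test_functions_def by blast
    then show ?thesis using assms(2) by simp
  qed
  moreover have "partial b \<phi> x = 0" if "x \<notin> K" for x
  proof -
    have "(\<phi> has_derivative (\<lambda>_. 0)) (at x)"
      by (rule has_derivative_transform_within_open[of "\<lambda>_. 0" _ _ _ "- K"])
         (use that K compact_imp_closed in auto)
    then show ?thesis by (rule partial_eqI)
  qed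
  ultimately show ?thesis unfolding test_functions_def using K by blast
qed

section \<open>Integration by parts in space and the fundamental lemma\<close>

lemma integrable_compact_support:
  fixes f :: "'a::euclidean_space \<Rightarrow> real"
  assumes "continuous_on UNIV f" "compact K" "\<And>x. x \<notin> K \<Longrightarrow> f x = 0"
  shows "integrable lborel f"
proof -
  have "integrable lborel (\<lambda>x. indicator K x *\<^sub>R f x)"
    by (rule borel_integrable_compact[OF assms(2)]) (use assms(1) continuous_on_subset in blast)
  moreover have "(\<lambda>x. indicator K x *\<^sub>R f x) = f" using assms(3) by (auto simp: fun_eq_iff indicator_def)
  ultimately show ?thesis by simp
qed

lemma sqint_test: assumes "\<phi> \<in> test_functions \<Omega>" shows "sqint \<phi>"
proof -
  obtain K where K: "compact K" "\<And>x. x \<notin> K \<Longrightarrow> \<phi> x = 0" using assms unfolding test_functions_def by blast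
  have "integrable lborel (\<lambda>x. (norm (\<phi> x))\<^sup>2)"
    by (rule integrable_compact_support[OF _ K(1)]) (use K test_continuous[OF assms] in \<open>auto intro!: continuous_intros\<close>)
  then show ?thesis using test_measurable[OF assms] by (simp add: sqint_def)
qed

text \<open>Translation invariance gives the divergence theorem for compactly supported functions.\<close>

lemma integral_partial_zero:
  fixes f :: "'a::euclidean_space \<Rightarrow> real"
  assumes d: "\<And>x. f differentiable (at x)" and c: "continuous_on UNIV (partial b f)"
    and K: "compact K" "\<And>x. x \<notin> K \<Longrightarrow> f x = 0"
  shows "integral\<^sup>L lborel (partial b f) = 0"
proof -
  have fc: "continuous_on UNIV f"
    using d by (intro continuous_at_imp_continuous_on) (auto intro: differentiable_imp_continuous_within)
  have fi: "integrable lborel f" by (rule integrable_compact_support[OF fc K])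
  have fm[measurable]: "f \<in> borel_measurable borel" using fc by (rule borel_measurable_continuous_onI)
  have cm[measurable]: "partial b f \<in> borel_measurable borel" using c by (rule borel_measurable_continuous_onI)
  have p0: "partial b f x = 0" if "x \<notin> K" for x
  proof -
    have "(f has_derivative (\<lambda>_. 0)) (at x)"
      by (rule has_derivative_transform_within_open[of "\<lambda>_. 0" _ _ _ "- K"])
         (use that K compact_imp_closed in auto)
    then show ?thesis by (rule partial_eqI)
  qed
  obtain C where C: "\<And>x. \<bar>partial b f x\<bar> \<le> C"
  proof -
    have "bounded (partial b f ` K)"
      by (intro compact_imp_bounded compact_continuous_image continuous_on_subset[OF c] K) simp
    then obtain C where "\<And>x. x \<in> K \<Longrightarrow> \<bar>partial b f x\<bar> \<le> C" by (auto simp: bounded_iff)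
    then have "\<bar>partial b f x\<bar> \<le> max C 0" for x by (cases "x \<in> K") (force simp: p0)+
    then show ?thesis using that by blast
  qed
  obtain R where R: "\<And>x. x \<in> K \<Longrightarrow> norm x \<le> R" using compact_imp_bounded[OF K(1)] by (auto simp: bounded_iff)
  \<comment> \<open>All difference quotients with step at most 1 vanish outside this ball, which
    makes the dominating function integrable.\<close>
  define L where "L = cball (0::'a) (R + norm b)"
  have line: "((\<lambda>t. f (x + t *\<^sub>R b)) has_real_derivative partial b f (x + t *\<^sub>R b)) (at t)" for x t
  proof -
    have 1: "((\<lambda>t. x + t *\<^sub>R b) has_derivative (\<lambda>h. h *\<^sub>R b)) (at t)"
      by (auto intro!: derivative_eq_intros)
    have 2: "(f has_derivative frechet_derivative f (at (x + t *\<^sub>R b))) (at (x + t *\<^sub>R b))"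
      by (rule has_derivative_frechet[OF d])
    from has_derivative_compose[OF 1 2]
    have "((\<lambda>t. f (x + t *\<^sub>R b)) has_derivative (\<lambda>h. frechet_derivative f (at (x + t *\<^sub>R b)) (h *\<^sub>R b))) (at t)" .
    moreover have "frechet_derivative f (at (x + t *\<^sub>R b)) (h *\<^sub>R b) = partial b f (x + t *\<^sub>R b) * h" for h
      using linear_cmul[OF has_derivative_linear[OF 2], of h b] by (simp add: partial_def mult.commute)
    ultimately show ?thesis unfolding has_field_derivative_def by (simp add: fun_eq_iff)
  qed
  define h where "h n = inverse (real (Suc n))" for n
  have h: "0 < h n" "h n \<le> 1" for n by (auto simp: h_def divide_simps)
  \<comment> \<open>Each difference quotient has integral 0 because translation preserves the
    integral, and the mean value theorem bounds it by the bound \<open>C\<close> of the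
    derivative.\<close>
  define q where "q n x = (f (x + h n *\<^sub>R b) - f x) / h n" for n x
  have "(\<lambda>n. integral\<^sup>L lborel (q n)) \<longlonglongrightarrow> integral\<^sup>L lborel (partial b f)"
  proof (rule integral_dominated_convergence[where w="\<lambda>x. indicator L x *\<^sub>R C"])
    show "integrable lborel (\<lambda>x. indicator L x *\<^sub>R C)" unfolding L_def
      by (rule borel_integrable_compact) auto
    show "AE x in lborel. (\<lambda>n. q n x) \<longlonglongrightarrow> partial b f x"
    proof (rule AE_I2)
      fix x
      have "((\<lambda>k. (f (x + (0 + k) *\<^sub>R b) - f (x + 0 *\<^sub>R b)) / k) \<longlongrightarrow> partial b f (x + 0 *\<^sub>R b)) (at 0)"
        using line[of x 0] unfolding DERIV_def .
      moreover have "filterlim h (at 0) sequentially"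
        unfolding filterlim_at h_def[abs_def] using LIMSEQ_inverse_real_of_nat by (auto simp del: of_nat_Suc)
      ultimately show "(\<lambda>n. q n x) \<longlonglongrightarrow> partial b f x"
        unfolding q_def using filterlim_compose by fastforce
    qed
    show "AE x in lborel. norm (q n x) \<le> indicator L x *\<^sub>R C" for n
    proof (rule AE_I2)
      fix x
      obtain t where t: "f (x + h n *\<^sub>R b) - f (x + 0 *\<^sub>R b) = (h n - 0) * partial b f (x + t *\<^sub>R b)"
        using MVT2[OF h(1)[of n] line] by blast
      have "norm (q n x) \<le> C" unfolding q_def using t h(1)[of n] C by simp
      moreover have "q n x = 0" if "x \<notin> L"
      proof -
        have "x \<notin> K" using that R[of x] by (auto simp: L_def intro: order_trans)
        moreover have "x + h n *\<^sub>R b \<notin> K"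
        proof
          assume "x + h n *\<^sub>R b \<in> K"
          then have "norm (x + h n *\<^sub>R b) \<le> R" by (rule R)
          moreover have "norm x \<le> norm (x + h n *\<^sub>R b) + norm (h n *\<^sub>R b)" using norm_triangle_ineq4[of "x + h n *\<^sub>R b" "h n *\<^sub>R b"] by simp
          moreover have "norm (h n *\<^sub>R b) \<le> norm b" using h[of n] by (simp add: mult_left_le_one_le)
          ultimately show False using that by (simp add: L_def)
        qed
        ultimately show ?thesis by (simp add: q_def K(2))
      qed
      ultimately show "norm (q n x) \<le> indicator L x *\<^sub>R C" by (auto simp: indicator_def)
    qed
    show "q n \<in> borel_measurable lborel" for n unfolding q_def[abs_def] by measurable
  qed measurable
  moreover have "integral\<^sup>L lborel (q n) = 0" for n
  proof -
    have "integral\<^sup>L (distr lborel borel ((+) (h n *\<^sub>R b))) f = (\<integral>x. f (h n *\<^sub>R b + x) \<partial>lborel)"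
      by (rule integral_distr) auto
    then have e: "(\<integral>x. f (x + h n *\<^sub>R b) \<partial>lborel) = integral\<^sup>L lborel f"
      by (simp add: lborel_distr_plus add.commute)
    have "integrable (distr lborel borel ((+) (h n *\<^sub>R b))) f" using fi by (simp add: lborel_distr_plus)
    then have "integrable lborel (\<lambda>x. f (x + h n *\<^sub>R b))"
      by (subst (asm) integrable_distr_eq) (auto simp: add.commute)
    then show ?thesis unfolding q_def using fi e by simp
  qed
  ultimately show ?thesis by (simp add: LIMSEQ_const_iff)
qed

lemma test_integration_by_parts:
  assumes \<phi>: "\<phi> \<in> test_functions \<Omega>" and \<psi>: "\<psi> \<in> test_functions \<Omega>" and b: "b \<in> Basis"
  shows "(\<integral>x. \<phi> x * partial b \<psi> x \<partial>lborel) = - (\<integral>x. partial b \<phi> x * \<psi> x \<partial>lborel)"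
proof -
  obtain K where K: "compact K" "\<And>x. x \<notin> K \<Longrightarrow> \<phi> x = 0" using \<phi> unfolding test_functions_def by blast
  have pp: "partial b (\<lambda>x. \<phi> x * \<psi> x) = (\<lambda>x. \<phi> x * partial b \<psi> x + partial b \<phi> x * \<psi> x)"
    by (auto simp: partial_mult test_differentiable[OF \<phi>] test_differentiable[OF \<psi>])
  have "integral\<^sup>L lborel (partial b (\<lambda>x. \<phi> x * \<psi> x)) = 0"
  proof (rule integral_partial_zero[OF _ _ K(1)])
    show "(\<lambda>x. \<phi> x * \<psi> x) differentiable (at x)" for x
      by (intro differentiable_mult test_differentiable[OF \<phi>] test_differentiable[OF \<psi>])
    show "continuous_on UNIV (partial b (\<lambda>x. \<phi> x * \<psi> x))"
      unfolding pp by (intro continuous_intros test_continuous[OF \<phi>] test_continuous[OF \<psi>]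
          test_continuous[OF test_partial[OF \<phi> b]] test_continuous[OF test_partial[OF \<psi> b]])
  qed (simp add: K(2))
  moreover have "integrable lborel (\<lambda>x. \<phi> x * partial b \<psi> x)" "integrable lborel (\<lambda>x. partial b \<phi> x * \<psi> x)"
    using sqint_inner_integrable[OF sqint_test[OF \<phi>] sqint_test[OF test_partial[OF \<psi> b]]]
      sqint_inner_integrable[OF sqint_test[OF test_partial[OF \<phi> b]] sqint_test[OF \<psi>]] by simp_all
  ultimately show ?thesis unfolding pp by simp
qed

text \<open>Bumps converge boundedly to indicators of boxes, so by dominated convergence the
  hypothesis passes to integrals over boxes.\<close>

lemma fundamental_lemma:
  fixes f :: "'a::euclidean_space \<Rightarrow> real"
  assumes f: "sqint f" and "open \<Omega>" and z: "\<And>\<phi>. \<phi> \<in> test_functions \<Omega> \<Longrightarrow> (\<integral>x. f x * \<phi> x \<partial>lborel) = 0"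
  shows "AE x in lborel. x \<in> \<Omega> \<longrightarrow> f x = 0"
proof (rule lborel_AE_zero_if_box_integrals_zero)
  show "f \<in> borel_measurable lborel" using sqint_measurable[OF f] by simp
  fix a b :: 'a
  assume ab: "cbox a b \<subseteq> \<Omega>"
  have s: "sqint (\<lambda>x. indicator (box a b) x *\<^sub>R (1::real))" by (rule sqint_indicator_box)
  show i: "integrable lborel (\<lambda>x. indicator (box a b) x * f x)" using sqint_inner_integrable[OF s f] by simp
  note [measurable] = sqint_measurable[OF f] test_measurable[OF box_bump_test[OF ab]]
  have "(\<lambda>n. \<integral>x. f x * box_bump a b n x \<partial>lborel) \<longlonglongrightarrow> (\<integral>x. indicator (box a b) x * f x \<partial>lborel)"
  proof (rule integral_dominated_convergence[where w="\<lambda>x. \<bar>indicator (box a b) x * f x\<bar>"])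
    show "integrable lborel (\<lambda>x. \<bar>indicator (box a b) x * f x\<bar>)" using i by (rule integrable_abs)
    show "AE x in lborel. (\<lambda>n. f x * box_bump a b n x) \<longlonglongrightarrow> indicator (box a b) x * f x"
    proof (rule AE_I2)
      fix x
      have "(\<lambda>n. f x * box_bump a b n x) \<longlonglongrightarrow> f x * indicator (box a b) x" by (intro tendsto_intros box_bump_tendsto)
      then show "(\<lambda>n. f x * box_bump a b n x) \<longlonglongrightarrow> indicator (box a b) x * f x" by (simp add: mult.commute)
    qed
    show "AE x in lborel. norm (f x * box_bump a b n x) \<le> \<bar>indicator (box a b) x * f x\<bar>" for n
    proof (rule AE_I2)
      fix x
      show "norm (f x * box_bump a b n x) \<le> \<bar>indicator (box a b) x * f x\<bar>"
        using box_bump_range[of a b n x] box_bump_outside[of x a b n]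
        by (cases "x \<in> box a b") (auto simp: abs_mult mult_left_le)
    qed
    show "(\<lambda>x. f x * box_bump a b n x) \<in> borel_measurable lborel" for n by measurable
  qed measurable
  then show "(\<integral>x. indicator (box a b) x * f x \<partial>lborel) = 0"
    using z[OF box_bump_test[OF ab]] by (simp add: LIMSEQ_const_iff)
qed fact

section \<open>Function spaces as subspaces of Hilbert spaces\<close>

lemma lebesgue_measurable_AE:
  assumes g: "g \<in> measurable lebesgue N" and ae: "AE x in lborel. f x = g x"
    and f: "\<And>x. f x \<in> space N"
  shows "f \<in> measurable lebesgue N"
proof (rule measurableI)
  fix A assume A: "A \<in> sets N"
  obtain Z where Z: "Z \<in> null_sets lborel" "{x. f x \<noteq> g x} \<subseteq> Z"
    using ae unfolding eventually_ae_filter by auto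
  have s: "B \<in> sets lebesgue" if "B \<subseteq> Z" for B
    using sets_completionI_sub[OF Z(1) that] .
  have "g -` A \<inter> space lebesgue \<in> sets lebesgue" using g A by (rule measurable_sets)
  moreover have "f -` A \<inter> space lebesgue = (g -` A \<inter> space lebesgue - {x. f x \<noteq> g x}) \<union> (f -` A \<inter> {x. f x \<noteq> g x})"
    by auto
  moreover have "{x. f x \<noteq> g x} \<in> sets lebesgue" "f -` A \<inter> {x. f x \<noteq> g x} \<in> sets lebesgue"
    using Z(2) by (auto intro!: s)
  ultimately show "f -` A \<inter> space lebesgue \<in> sets lebesgue" by (metis sets.Diff sets.Un)
qed (use f in simp)

text \<open>Simple functions become Borel after a change on a null set. Countably many changes still
  concern a null set, and the pointwise \<open>lim\<close> of Borel functions is Borel even where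
  the sequence diverges.\<close>

lemma ex_borel_version:
  fixes f :: "'a::euclidean_space \<Rightarrow> 'b::{banach,second_countable_topology}"
  assumes "f \<in> borel_measurable lebesgue"
  shows "\<exists>h\<in>borel_measurable borel. AE x in lborel. h x = f x"
proof -
  obtain F where F: "\<And>i. simple_function lebesgue (F i)" "\<And>x. (\<lambda>i. F i x) \<longlonglongrightarrow> f x"
    using borel_measurable_implies_sequence_metric[OF assms, of 0] by auto
  have "\<forall>i. \<exists>F'. simple_function lborel F' \<and> (AE x in lborel. F i x = F' x)"
    using completion_ex_simple_function[OF F(1)] by blast
  then obtain F' where F': "\<And>i. simple_function lborel (F' i)" "\<And>i. AE x in lborel. F i x = F' i x" by metis
  have [measurable]: "F' i \<in> borel_measurable borel" for i
    using borel_measurable_simple_function[OF F'(1)[of i]] by simp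
  have "AE x in lborel. \<forall>i. F i x = F' i x" using F'(2) by (simp add: AE_all_countable)
  then have "AE x in lborel. lim (\<lambda>i. F' i x) = f x"
  proof eventually_elim
    case (elim x)
    then have "(\<lambda>i. F' i x) \<longlonglongrightarrow> f x" using F(2)[of x] by simp
    then show ?case by (rule limI)
  qed
  moreover have "(\<lambda>x. lim (\<lambda>i. F' i x)) \<in> borel_measurable borel" by measurable
  ultimately show ?thesis by (intro bexI[of _ "\<lambda>x. lim (\<lambda>i. F' i x)"]) auto
qed

lemma AE_lebesgue_on:
  assumes "S \<in> sets lebesgue"
  shows "(AE x in lebesgue_on S. P x) \<longleftrightarrow> (AE x in lborel. x \<in> S \<longrightarrow> P x)"
  using assms by (subst AE_restrict_space_iff) (auto simp: AE_completion_iff)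

lemma lebesgue_on_AE_eq:
  fixes f h :: "'a::euclidean_space \<Rightarrow> 'b::{banach,second_countable_topology}"
  assumes S: "S \<in> sets lebesgue" and h: "h \<in> borel_measurable borel"
    and ae: "AE x in lborel. x \<in> S \<longrightarrow> f x = h x"
  shows "f \<in> borel_measurable (lebesgue_on S)"
    "integral\<^sup>L (lebesgue_on S) f = (\<integral>x. indicator S x *\<^sub>R h x \<partial>lebesgue)"
    "integrable (lebesgue_on S) f \<longleftrightarrow> integrable lebesgue (\<lambda>x. indicator S x *\<^sub>R h x)"
proof -
  have hl: "(\<lambda>x. indicator S x *\<^sub>R h x) \<in> borel_measurable lebesgue"
    using S h by (intro borel_measurable_scaleR borel_measurable_indicator measurable_completion) auto
  have ae': "AE x in lborel. indicator S x *\<^sub>R f x = indicator S x *\<^sub>R h x"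
    using ae by eventually_elim (auto simp: indicator_def)
  have fl: "(\<lambda>x. indicator S x *\<^sub>R f x) \<in> borel_measurable lebesgue"
    by (rule lebesgue_measurable_AE[OF hl ae']) auto
  show "f \<in> borel_measurable (lebesgue_on S)"
    using fl S by (subst borel_measurable_restrict_space_iff) auto
  have "integral\<^sup>L (lebesgue_on S) f = (\<integral>x. indicator S x *\<^sub>R f x \<partial>lebesgue)"
    by (rule integral_restrict_space) (use S in auto)
  also have "\<dots> = (\<integral>x. indicator S x *\<^sub>R h x \<partial>lebesgue)"
    by (rule integral_cong_AE[OF fl hl AE_completion[OF ae']])
  finally show "integral\<^sup>L (lebesgue_on S) f = (\<integral>x. indicator S x *\<^sub>R h x \<partial>lebesgue)" .
  have "integrable (lebesgue_on S) f \<longleftrightarrow> integrable lebesgue (\<lambda>x. indicator S x *\<^sub>R f x)"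
    by (rule integrable_restrict_space) (use S in auto)
  also have "\<dots> \<longleftrightarrow> integrable lebesgue (\<lambda>x. indicator S x *\<^sub>R h x)"
    by (rule integrable_cong_AE[OF fl hl AE_completion[OF ae']])
  finally show "integrable (lebesgue_on S) f \<longleftrightarrow> integrable lebesgue (\<lambda>x. indicator S x *\<^sub>R h x)" .
qed

text \<open>The definitions integrate over \<open>lebesgue_on\<close>, the space of classes over
  \<open>lborel\<close>. This translates between the two for any Borel function that agrees almost
  everywhere on the set.\<close>

lemma lebesgue_on_open_AE_eq:
  fixes f h :: "'a::euclidean_space \<Rightarrow> 'b::{banach,second_countable_topology}"
  assumes S: "open S" and h: "h \<in> borel_measurable borel"
    and ae: "AE x in lborel. x \<in> S \<longrightarrow> f x = h x"
  shows "f \<in> borel_measurable (lebesgue_on S)"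
    "integral\<^sup>L (lebesgue_on S) f = (\<integral>x. indicator S x *\<^sub>R h x \<partial>lborel)"
    "integrable (lebesgue_on S) f \<longleftrightarrow> integrable lborel (\<lambda>x. indicator S x *\<^sub>R h x)"
proof -
  have S': "S \<in> sets lebesgue" using S by auto
  have m: "(\<lambda>x. indicator S x *\<^sub>R h x) \<in> measurable lborel borel" using S h by simp
  note * = lebesgue_on_AE_eq[OF S' h ae]
  show "f \<in> borel_measurable (lebesgue_on S)" by (rule *)
  show "integral\<^sup>L (lebesgue_on S) f = (\<integral>x. indicator S x *\<^sub>R h x \<partial>lborel)"
    using *(2) integral_completion[OF m] by simp
  show "integrable (lebesgue_on S) f \<longleftrightarrow> integrable lborel (\<lambda>x. indicator S x *\<^sub>R h x)"
    using *(3) integrable_completion[OF m] by simp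
qed

lemma lebesgue_on_ex_borel:
  fixes f :: "'a::euclidean_space \<Rightarrow> 'b::{banach,second_countable_topology}"
  assumes "S \<in> sets lebesgue" "f \<in> borel_measurable (lebesgue_on S)"
  shows "\<exists>h\<in>borel_measurable borel. AE x in lborel. h x = indicator S x *\<^sub>R f x"
proof (rule ex_borel_version)
  show "(\<lambda>x. indicator S x *\<^sub>R f x) \<in> borel_measurable lebesgue"
    using assms by (subst borel_measurable_restrict_space_iff[symmetric]) auto
qed

section \<open>Embedding of function spaces into spaces of classes\<close>

lemma sqint_sum: "finite A \<Longrightarrow> (\<And>i. i \<in> A \<Longrightarrow> sqint (f i)) \<Longrightarrow> sqint (\<lambda>x. \<Sum>i\<in>A. f i x)"
  by (induction A rule: finite_induct) (auto intro: sqint_add sqint_zero)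

lemma sqint_scaleR_vector:
  fixes b :: "'b::{real_inner,banach,second_countable_topology}"
  assumes "sqint \<phi>" shows "sqint (\<lambda>x. \<phi> x *\<^sub>R b)"
  by (rule sqint_bound[OF assms, of _ "norm b"]) (use sqint_measurable[OF assms] in \<open>auto simp: mult.commute\<close>)

text \<open>The class of a Borel version of \<open>f\<close>, extended by zero. Outside
  \<open>L2\<close> the value is 0, so that the map is total; on \<open>L2\<close> it identifies
  exactly the functions that agree almost everywhere on the domain.\<close>

definition emb :: "'a::euclidean_space set \<Rightarrow> ('a \<Rightarrow> 'b::euclidean_space) \<Rightarrow> ('a, 'b) lsq" where
  "emb \<Omega> f = (if f \<in> L2 \<Omega>
     then cls (SOME h. h \<in> borel_measurable borel \<and> (AE x in lborel. h x = indicator \<Omega> x *\<^sub>R f x)) else 0)"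

text \<open>Function and gradient as one vector of the product Hilbert space, whose norm is
  \<open>h1_norm\<close>.\<close>

definition jet :: "'a::euclidean_space set \<Rightarrow> ('a \<Rightarrow> real) \<Rightarrow> ('a, real) lsq \<times> ('a, 'a) lsq" where
  "jet \<Omega> u = (emb \<Omega> u, emb \<Omega> (weak_grad \<Omega> u))"

definition grd :: "('a::euclidean_space \<Rightarrow> real) \<Rightarrow> 'a \<Rightarrow> 'a" where
  "grd \<phi> x = (\<Sum>b\<in>Basis. partial b \<phi> x *\<^sub>R b)"

definition test_jets :: "'a::euclidean_space set \<Rightarrow> (('a, real) lsq \<times> ('a, 'a) lsq) set" where
  "test_jets \<Omega> = (\<lambda>\<phi>. (emb \<Omega> \<phi>, emb \<Omega> (grd \<phi>))) ` test_functions \<Omega>"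

context
  fixes \<Omega> :: "'a::euclidean_space set"
  assumes \<Omega>: "open \<Omega>"
begin

lemma Omega_borel[measurable]: "\<Omega> \<in> sets borel"
  using \<Omega> by simp

lemma L2I_AE:
  fixes f :: "'a \<Rightarrow> 'b::euclidean_space"
  assumes h: "sqint h" and ae: "AE x in lborel. x \<in> \<Omega> \<longrightarrow> f x = h x"
  shows "f \<in> L2 \<Omega>"
proof -
  have hm[measurable]: "h \<in> borel_measurable borel" by (rule sqint_measurable[OF h])
  have "integrable (lebesgue_on \<Omega>) (\<lambda>x. (norm (f x))\<^sup>2) \<longleftrightarrow> integrable lborel (\<lambda>x. indicator \<Omega> x *\<^sub>R (norm (h x))\<^sup>2)"
  proof (rule lebesgue_on_open_AE_eq(3)[OF \<Omega>])
    show "AE x in lborel. x \<in> \<Omega> \<longrightarrow> (norm (f x))\<^sup>2 = (norm (h x))\<^sup>2" using ae by eventually_elim auto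
  qed measurable
  moreover have "integrable lborel (\<lambda>x. indicator \<Omega> x *\<^sub>R (norm (h x))\<^sup>2)"
    by (rule integrable_mult_indicator) (use \<Omega> h in \<open>auto simp: sqint_def\<close>)
  moreover have "f \<in> borel_measurable (lebesgue_on \<Omega>)" by (rule lebesgue_on_open_AE_eq(1)[OF \<Omega> hm ae])
  ultimately show ?thesis by (simp add: L2_def)
qed

lemma emb_AE:
  fixes f :: "'a \<Rightarrow> 'b::euclidean_space"
  assumes f: "f \<in> L2 \<Omega>"
  shows "AE x in lborel. fn (emb \<Omega> f) x = indicator \<Omega> x *\<^sub>R f x"
proof -
  define h where "h = (SOME h. h \<in> borel_measurable borel \<and> (AE x in lborel. h x = indicator \<Omega> x *\<^sub>R f x))"
  have O: "\<Omega> \<in> sets lebesgue" using \<Omega> by auto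
  have "\<exists>h. h \<in> borel_measurable borel \<and> (AE x in lborel. h x = indicator \<Omega> x *\<^sub>R f x)"
    using lebesgue_on_ex_borel[OF O] f unfolding L2_def by blast
  from someI_ex[OF this] have h: "h \<in> borel_measurable borel" "AE x in lborel. h x = indicator \<Omega> x *\<^sub>R f x"
    by (auto simp: h_def)
  note [measurable] = h(1)
  have "integrable (lebesgue_on \<Omega>) (\<lambda>x. (norm (f x))\<^sup>2) \<longleftrightarrow> integrable lborel (\<lambda>x. indicator \<Omega> x *\<^sub>R (norm (h x))\<^sup>2)"
  proof (rule lebesgue_on_open_AE_eq(3)[OF \<Omega>])
    show "AE x in lborel. x \<in> \<Omega> \<longrightarrow> (norm (f x))\<^sup>2 = (norm (h x))\<^sup>2" using h(2) by eventually_elim auto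
  qed measurable
  then have "integrable lborel (\<lambda>x. indicator \<Omega> x *\<^sub>R (norm (h x))\<^sup>2)" using f by (simp add: L2_def)
  moreover have "integrable lborel (\<lambda>x. indicator \<Omega> x *\<^sub>R (norm (h x))\<^sup>2) \<longleftrightarrow> integrable lborel (\<lambda>x. (norm (h x))\<^sup>2)"
  proof (rule integrable_cong_AE)
    show "AE x in lborel. indicator \<Omega> x *\<^sub>R (norm (h x))\<^sup>2 = (norm (h x))\<^sup>2"
      using h(2) by eventually_elim (auto simp: indicator_def)
  qed measurable
  ultimately have "sqint h" using h(1) by (simp add: sqint_def)
  then have "AE x in lborel. fn (cls h) x = indicator \<Omega> x *\<^sub>R f x"
    using fn_cls[of h] h(2) by (auto elim: eventually_elim2)
  then show ?thesis using f by (simp add: emb_def h_def[symmetric])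
qed

lemma emb_eqI:
  assumes "f \<in> L2 \<Omega>" "AE x in lborel. fn F x = indicator \<Omega> x *\<^sub>R f x"
  shows "emb \<Omega> f = F"
proof -
  have "AE x in lborel. fn (emb \<Omega> f) x = fn F x" using emb_AE[OF assms(1)] assms(2) by eventually_elim simp
  then have "cls (fn (emb \<Omega> f)) = cls (fn F)" by (simp add: cls_eq_iff sqint_fn)
  then show ?thesis by (simp add: cls_fn)
qed

lemma fn_in_L2: "fn F \<in> L2 \<Omega>" for F :: "('a, 'b::euclidean_space) lsq"
  by (rule L2I_AE[OF sqint_fn]) auto

text \<open>\<open>F\<close> may be nonzero outside the domain: the second factor vanishes
  there.\<close>

lemma inner_emb_right:
  fixes h :: "'a \<Rightarrow> 'b::euclidean_space"
  assumes h: "h \<in> L2 \<Omega>" shows "F \<bullet> emb \<Omega> h = l2_inner \<Omega> (fn F) h"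
proof -
  have "l2_inner \<Omega> (fn F) h = (\<integral>x. indicator \<Omega> x *\<^sub>R (fn F x \<bullet> fn (emb \<Omega> h) x) \<partial>lborel)"
    unfolding l2_inner_def
  proof (rule lebesgue_on_open_AE_eq(2)[OF \<Omega>])
    show "AE x in lborel. x \<in> \<Omega> \<longrightarrow> fn F x \<bullet> h x = fn F x \<bullet> fn (emb \<Omega> h) x"
      using emb_AE[OF h] by eventually_elim auto
  qed measurable
  also have "\<dots> = (\<integral>x. fn F x \<bullet> fn (emb \<Omega> h) x \<partial>lborel)"
  proof (rule integral_cong_AE)
    show "AE x in lborel. indicator \<Omega> x *\<^sub>R (fn F x \<bullet> fn (emb \<Omega> h) x) = fn F x \<bullet> fn (emb \<Omega> h) x"
      using emb_AE[OF h] by eventually_elim (auto simp: indicator_def)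
  qed measurable
  finally show ?thesis by (simp add: inner_fn)
qed

lemma l2_inner_cong:
  fixes f f' :: "'a \<Rightarrow> 'b::euclidean_space"
  assumes "f \<in> L2 \<Omega>" "f' \<in> L2 \<Omega>" "h \<in> L2 \<Omega>" "AE x in lborel. x \<in> \<Omega> \<longrightarrow> f x = f' x"
  shows "l2_inner \<Omega> f h = l2_inner \<Omega> f' h"
proof -
  have "\<Omega> \<in> sets lebesgue" using \<Omega> by auto
  then show ?thesis
    unfolding l2_inner_def using assms(1-3)
    by (intro integral_cong_AE borel_measurable_inner)
       (auto simp: L2_def AE_lebesgue_on intro!: eventually_mono[OF assms(4)])
qed

lemma inner_emb:
  fixes f h :: "'a \<Rightarrow> 'b::euclidean_space"
  assumes "f \<in> L2 \<Omega>" "h \<in> L2 \<Omega>" shows "emb \<Omega> f \<bullet> emb \<Omega> h = l2_inner \<Omega> f h"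
  unfolding inner_emb_right[OF assms(2)]
  using emb_AE[OF assms(1)] by (intro l2_inner_cong fn_in_L2 assms) (auto elim!: eventually_mono)

lemma norm_emb: "f \<in> L2 \<Omega> \<Longrightarrow> norm (emb \<Omega> f) = l2_norm \<Omega> f" for f :: "'a \<Rightarrow> 'b::euclidean_space"
  by (simp add: norm_eq_sqrt_inner l2_norm_def inner_emb)

lemma L2_add_emb:
  fixes f h :: "'a \<Rightarrow> 'b::euclidean_space"
  assumes "f \<in> L2 \<Omega>" "h \<in> L2 \<Omega>"
  shows "(\<lambda>x. f x + h x) \<in> L2 \<Omega>" "emb \<Omega> (\<lambda>x. f x + h x) = emb \<Omega> f + emb \<Omega> h"
proof -
  have ae: "AE x in lborel. fn (emb \<Omega> f + emb \<Omega> h) x = indicator \<Omega> x *\<^sub>R (f x + h x)"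
    using fn_add[of "emb \<Omega> f" "emb \<Omega> h"] emb_AE[OF assms(1)] emb_AE[OF assms(2)]
    by eventually_elim (simp add: scaleR_add_right)
  show 1: "(\<lambda>x. f x + h x) \<in> L2 \<Omega>"
    by (rule L2I_AE[OF sqint_fn[of "emb \<Omega> f + emb \<Omega> h"]]) (use ae in eventually_elim, auto)
  show "emb \<Omega> (\<lambda>x. f x + h x) = emb \<Omega> f + emb \<Omega> h" by (rule emb_eqI[OF 1 ae])
qed

lemma L2_scaleR_emb:
  fixes f :: "'a \<Rightarrow> 'b::euclidean_space"
  assumes "f \<in> L2 \<Omega>"
  shows "(\<lambda>x. c *\<^sub>R f x) \<in> L2 \<Omega>" "emb \<Omega> (\<lambda>x. c *\<^sub>R f x) = c *\<^sub>R emb \<Omega> f"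
proof -
  have ae: "AE x in lborel. fn (c *\<^sub>R emb \<Omega> f) x = indicator \<Omega> x *\<^sub>R (c *\<^sub>R f x)"
    using fn_scaleR[of c "emb \<Omega> f"] emb_AE[OF assms(1)] by eventually_elim simp
  show 1: "(\<lambda>x. c *\<^sub>R f x) \<in> L2 \<Omega>"
    by (rule L2I_AE[OF sqint_fn[of "c *\<^sub>R emb \<Omega> f"]]) (use ae in eventually_elim, auto)
  show "emb \<Omega> (\<lambda>x. c *\<^sub>R f x) = c *\<^sub>R emb \<Omega> f" by (rule emb_eqI[OF 1 ae])
qed

lemma L2_diff_emb:
  fixes f h :: "'a \<Rightarrow> 'b::euclidean_space"
  assumes "f \<in> L2 \<Omega>" "h \<in> L2 \<Omega>"
  shows "(\<lambda>x. f x - h x) \<in> L2 \<Omega>" "emb \<Omega> (\<lambda>x. f x - h x) = emb \<Omega> f - emb \<Omega> h"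
  using L2_add_emb[OF assms(1) L2_scaleR_emb(1)[OF assms(2), of "-1"]] L2_scaleR_emb(2)[OF assms(2), of "-1"] by simp_all

lemma emb_eq_iff:
  fixes f h :: "'a \<Rightarrow> 'b::euclidean_space"
  assumes "f \<in> L2 \<Omega>" "h \<in> L2 \<Omega>"
  shows "emb \<Omega> f = emb \<Omega> h \<longleftrightarrow> (AE x in lborel. x \<in> \<Omega> \<longrightarrow> f x = h x)"
proof
  assume "emb \<Omega> f = emb \<Omega> h"
  then show "AE x in lborel. x \<in> \<Omega> \<longrightarrow> f x = h x"
    using emb_AE[OF assms(1)] emb_AE[OF assms(2)] by (simp, eventually_elim) auto
next
  assume "AE x in lborel. x \<in> \<Omega> \<longrightarrow> f x = h x"
  then have "AE x in lborel. fn (emb \<Omega> h) x = indicator \<Omega> x *\<^sub>R f x"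
    using emb_AE[OF assms(2)] by eventually_elim (auto simp: indicator_def)
  then show "emb \<Omega> f = emb \<Omega> h" by (rule emb_eqI[OF assms(1)])
qed

lemma emb_fn_emb: "f \<in> L2 \<Omega> \<Longrightarrow> emb \<Omega> (fn (emb \<Omega> f)) = emb \<Omega> f" for f :: "'a \<Rightarrow> 'b::euclidean_space"
  by (subst emb_eq_iff[OF fn_in_L2]) (auto elim!: eventually_mono dest!: emb_AE)

text \<open>Classes live on the whole space. Embedding a representative amounts to multiplying by
  the indicator of the domain, an orthogonal projection, and the norm bound is the usual one for
  projections.\<close>

lemma bounded_linear_restriction: "bounded_linear (\<lambda>F. emb \<Omega> (fn F) :: ('a, 'b::euclidean_space) lsq)"
proof (rule bounded_linear_intro[where K=1])
  fix F G :: "('a, 'b) lsq" and c :: real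
  show "emb \<Omega> (fn (F + G)) = emb \<Omega> (fn F) + emb \<Omega> (fn G)"
    unfolding L2_add_emb(2)[OF fn_in_L2 fn_in_L2, symmetric]
    using fn_add[of F G] by (subst emb_eq_iff) (auto intro!: fn_in_L2 L2_add_emb elim!: eventually_mono)
  show "emb \<Omega> (fn (c *\<^sub>R F)) = c *\<^sub>R emb \<Omega> (fn F)"
    unfolding L2_scaleR_emb(2)[OF fn_in_L2, symmetric]
    using fn_scaleR[of c F] by (subst emb_eq_iff) (auto intro!: fn_in_L2 L2_scaleR_emb elim!: eventually_mono)
  have "emb \<Omega> (fn F) \<bullet> emb \<Omega> (fn F) = l2_inner \<Omega> (fn F) (fn F)" by (rule inner_emb[OF fn_in_L2 fn_in_L2])
  then have "(norm (emb \<Omega> (fn F)))\<^sup>2 = F \<bullet> emb \<Omega> (fn F)"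
    by (simp add: inner_emb_right[OF fn_in_L2] power2_norm_eq_inner)
  also have "\<dots> \<le> norm F * norm (emb \<Omega> (fn F))" by (rule norm_cauchy_schwarz)
  finally show "norm (emb \<Omega> (fn F)) \<le> norm F * 1"
    by (cases "norm (emb \<Omega> (fn F)) = 0") (auto simp: power2_eq_square)
qed

lemma test_L2: "\<phi> \<in> test_functions \<Omega> \<Longrightarrow> \<phi> \<in> L2 \<Omega>"
  by (rule L2I_AE[OF sqint_test]) auto

lemma test_vector_L2: "\<phi> \<in> test_functions \<Omega> \<Longrightarrow> (\<lambda>x. \<phi> x *\<^sub>R b) \<in> L2 \<Omega>" for b :: "'b::euclidean_space"
  by (rule L2I_AE[OF sqint_scaleR_vector[OF sqint_test]]) auto

lemma sqint_grd: "\<phi> \<in> test_functions \<Omega> \<Longrightarrow> sqint (grd \<phi>)"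
  unfolding grd_def[abs_def]
  by (intro sqint_sum sqint_scaleR_vector sqint_test[OF test_partial]) auto

lemma grd_L2: "\<phi> \<in> test_functions \<Omega> \<Longrightarrow> grd \<phi> \<in> L2 \<Omega>"
  by (rule L2I_AE[OF sqint_grd]) auto

text \<open>In terms of classes the defining identity is a family of continuous linear equations,
  which is stable under sums, multiples and limits.\<close>

lemma weak_gradient_iff:
  assumes u: "u \<in> L2 \<Omega>"
  shows "has_weak_gradient \<Omega> u G \<longleftrightarrow> G \<in> L2 \<Omega> \<and> (\<forall>\<phi>\<in>test_functions \<Omega>. \<forall>b\<in>Basis.
    emb \<Omega> u \<bullet> emb \<Omega> (partial b \<phi>) = - (emb \<Omega> G \<bullet> emb \<Omega> (\<lambda>x. \<phi> x *\<^sub>R b)))"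
proof (cases "G \<in> L2 \<Omega>")
  case True
  have "emb \<Omega> u \<bullet> emb \<Omega> (partial b \<phi>) = (\<integral>x. u x * partial b \<phi> x \<partial>lebesgue_on \<Omega>)"
    if "\<phi> \<in> test_functions \<Omega>" "b \<in> Basis" for \<phi> b
    by (simp add: inner_emb[OF u test_L2[OF test_partial[OF that]]] l2_inner_def)
  moreover have "emb \<Omega> G \<bullet> emb \<Omega> (\<lambda>x. \<phi> x *\<^sub>R b) = (\<integral>x. (G x \<bullet> b) * \<phi> x \<partial>lebesgue_on \<Omega>)"
    if "\<phi> \<in> test_functions \<Omega>" "b \<in> Basis" for \<phi> b
    by (simp add: inner_emb[OF True test_vector_L2[OF that(1)]] l2_inner_def mult.commute)
  ultimately show ?thesis using True unfolding has_weak_gradient_def by simp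
qed (simp add: has_weak_gradient_def)

text \<open>\<open>weak_grad\<close> is a choice; the fundamental lemma in each coordinate shows
  that its class does not depend on the choice.\<close>

lemma weak_gradient_unique:
  assumes u: "u \<in> L2 \<Omega>" and "has_weak_gradient \<Omega> u G" "has_weak_gradient \<Omega> u G'"
  shows "emb \<Omega> G = emb \<Omega> G'"
proof -
  have G: "G \<in> L2 \<Omega>" "G' \<in> L2 \<Omega>" using assms by (auto simp: has_weak_gradient_def)
  define D where "D = emb \<Omega> G - emb \<Omega> G'"
  have orth: "D \<bullet> emb \<Omega> (\<lambda>x. \<phi> x *\<^sub>R b) = 0" if "\<phi> \<in> test_functions \<Omega>" "b \<in> Basis" for \<phi> b
    using assms(2,3) that unfolding weak_gradient_iff[OF u] D_def by (simp add: inner_diff_left)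
  have "AE x in lborel. x \<in> \<Omega> \<longrightarrow> fn D x \<bullet> b = 0" if b: "b \<in> Basis" for b
  proof (rule fundamental_lemma[OF _ \<Omega>])
    show "sqint (\<lambda>x. fn D x \<bullet> b)"
      by (rule sqint_bound[OF sqint_fn[of D], of _ 1]) (use b in \<open>auto simp: Basis_le_norm\<close>)
    fix \<phi> assume \<phi>: "\<phi> \<in> test_functions \<Omega>"
    have "D \<bullet> emb \<Omega> (\<lambda>x. \<phi> x *\<^sub>R b) = (\<integral>x. fn D x \<bullet> fn (emb \<Omega> (\<lambda>x. \<phi> x *\<^sub>R b)) x \<partial>lborel)" by (rule inner_fn)
    also have "\<dots> = (\<integral>x. (fn D x \<bullet> b) * \<phi> x \<partial>lborel)"
    proof (rule integral_cong_AE)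
      note [measurable] = test_measurable[OF \<phi>]
      show "AE x in lborel. fn D x \<bullet> fn (emb \<Omega> (\<lambda>x. \<phi> x *\<^sub>R b)) x = (fn D x \<bullet> b) * \<phi> x"
        using emb_AE[OF test_vector_L2[OF \<phi>, of b]]
        by eventually_elim (use test_outside[OF \<phi>] in \<open>auto simp: indicator_def mult.commute\<close>)
      show "(\<lambda>x. (fn D x \<bullet> b) * \<phi> x) \<in> borel_measurable lborel" by measurable
    qed measurable
    finally show "(\<integral>x. (fn D x \<bullet> b) * \<phi> x \<partial>lborel) = 0" using orth[OF \<phi> b] by simp
  qed
  then have "AE x in lborel. \<forall>b\<in>Basis. x \<in> \<Omega> \<longrightarrow> fn D x \<bullet> b = 0"
    by (subst AE_ball_countable) (auto intro: countable_finite)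
  then have "AE x in lborel. x \<in> \<Omega> \<longrightarrow> G x = G' x"
    using fn_diff[of "emb \<Omega> G" "emb \<Omega> G'", folded D_def] emb_AE[OF G(1)] emb_AE[OF G(2)]
  proof eventually_elim
    case (elim x)
    show ?case
    proof
      assume x: "x \<in> \<Omega>"
      then have "(G x - G' x) \<bullet> b = 0" if "b \<in> Basis" for b using elim that by auto
      then have "G x - G' x = 0" by (rule euclidean_all_zero_iff[THEN iffD1, rule_format])
      then show "G x = G' x" by simp
    qed
  qed
  then show ?thesis using emb_eq_iff[OF G] by simp
qed

lemma weak_grad_works: "u \<in> H1 \<Omega> \<Longrightarrow> u \<in> L2 \<Omega> \<and> has_weak_gradient \<Omega> u (weak_grad \<Omega> u)"
  unfolding H1_def weak_grad_def using someI_ex[of "has_weak_gradient \<Omega> u"] by blast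

lemma weak_grad_L2: "u \<in> H1 \<Omega> \<Longrightarrow> weak_grad \<Omega> u \<in> L2 \<Omega>"
  using weak_grad_works by (auto simp: has_weak_gradient_def)

lemma jet_eqI:
  assumes "u \<in> L2 \<Omega>" "has_weak_gradient \<Omega> u G"
  shows "u \<in> H1 \<Omega>" "jet \<Omega> u = (emb \<Omega> u, emb \<Omega> G)"
proof -
  show 1: "u \<in> H1 \<Omega>" using assms by (auto simp: H1_def)
  show "jet \<Omega> u = (emb \<Omega> u, emb \<Omega> G)"
    using weak_gradient_unique[OF assms(1) _ assms(2)] weak_grad_works[OF 1] by (simp add: jet_def)
qed

lemma h1_norm_jet: "u \<in> H1 \<Omega> \<Longrightarrow> h1_norm \<Omega> u = norm (jet \<Omega> u)"
  using weak_grad_works[of u] weak_grad_L2[of u] by (simp add: h1_norm_def jet_def norm_prod_def norm_emb)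

lemma jet_add:
  assumes u: "u \<in> H1 \<Omega>" and v: "v \<in> H1 \<Omega>"
  shows "(\<lambda>x. u x + v x) \<in> H1 \<Omega>" "jet \<Omega> (\<lambda>x. u x + v x) = jet \<Omega> u + jet \<Omega> v"
proof -
  have L: "u \<in> L2 \<Omega>" "v \<in> L2 \<Omega>" using weak_grad_works u v by auto
  note G = weak_grad_L2[OF u] weak_grad_L2[OF v]
  have 1: "has_weak_gradient \<Omega> (\<lambda>x. u x + v x) (\<lambda>x. weak_grad \<Omega> u x + weak_grad \<Omega> v x)"
    using weak_grad_works[OF u] weak_grad_works[OF v]
    unfolding weak_gradient_iff[OF L2_add_emb(1)[OF L]] L2_add_emb(2)[OF L] L2_add_emb(2)[OF G]
    using L2_add_emb(1)[OF G] by (auto simp: weak_gradient_iff inner_add_left)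
  show "(\<lambda>x. u x + v x) \<in> H1 \<Omega>" "jet \<Omega> (\<lambda>x. u x + v x) = jet \<Omega> u + jet \<Omega> v"
    using jet_eqI[OF L2_add_emb(1)[OF L] 1] by (simp_all add: L2_add_emb(2)[OF L] L2_add_emb(2)[OF G] jet_def)
qed

lemma jet_scaleR:
  assumes u: "u \<in> H1 \<Omega>"
  shows "(\<lambda>x. c * u x) \<in> H1 \<Omega>" "jet \<Omega> (\<lambda>x. c * u x) = c *\<^sub>R jet \<Omega> u"
proof -
  have L: "u \<in> L2 \<Omega>" using weak_grad_works u by auto
  note G = weak_grad_L2[OF u]
  note s = L2_scaleR_emb[OF L, of c, simplified] L2_scaleR_emb[OF G, of c]
  have 1: "has_weak_gradient \<Omega> (\<lambda>x. c * u x) (\<lambda>x. c *\<^sub>R weak_grad \<Omega> u x)"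
    using weak_grad_works[OF u] s unfolding weak_gradient_iff[OF s(1)] s(2,4) by (auto simp: weak_gradient_iff)
  show "(\<lambda>x. c * u x) \<in> H1 \<Omega>" "jet \<Omega> (\<lambda>x. c * u x) = c *\<^sub>R jet \<Omega> u"
    using jet_eqI[OF s(1) 1] s by (simp_all add: jet_def)
qed

lemma jet_diff:
  assumes u: "u \<in> H1 \<Omega>" and v: "v \<in> H1 \<Omega>"
  shows "(\<lambda>x. u x - v x) \<in> H1 \<Omega>" "jet \<Omega> (\<lambda>x. u x - v x) = jet \<Omega> u - jet \<Omega> v"
  using jet_add[OF u jet_scaleR(1)[OF v, of "-1"]] jet_scaleR(2)[OF v, of "-1"] by simp_all

lemma test_weak_gradient:
  assumes \<phi>: "\<phi> \<in> test_functions \<Omega>"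
  shows "has_weak_gradient \<Omega> \<phi> (grd \<phi>)"
  unfolding has_weak_gradient_def
proof (intro conjI ballI grd_L2[OF \<phi>])
  fix \<psi> and b :: 'a assume \<psi>: "\<psi> \<in> test_functions \<Omega>" and b: "b \<in> Basis"
  have gb: "grd \<phi> x \<bullet> b = partial b \<phi> x" for x using b by (simp add: grd_def inner_sum_left inner_Basis if_distrib cong: if_cong)
  note [measurable] = test_measurable[OF \<phi>] test_measurable[OF \<psi>] test_measurable[OF test_partial[OF \<psi> b]] test_measurable[OF test_partial[OF \<phi> b]]
  have "(\<integral>x. \<phi> x * partial b \<psi> x \<partial>lebesgue_on \<Omega>) = (\<integral>x. indicator \<Omega> x *\<^sub>R (\<phi> x * partial b \<psi> x) \<partial>lborel)"
    by (rule lebesgue_on_open_AE_eq(2)[OF \<Omega>]) auto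
  also have "\<dots> = (\<integral>x. \<phi> x * partial b \<psi> x \<partial>lborel)"
    by (rule Bochner_Integration.integral_cong) (auto simp: indicator_def test_outside[OF \<phi>])
  also have "\<dots> = - (\<integral>x. partial b \<phi> x * \<psi> x \<partial>lborel)" by (rule test_integration_by_parts[OF \<phi> \<psi> b])
  also have "(\<integral>x. partial b \<phi> x * \<psi> x \<partial>lborel) = (\<integral>x. indicator \<Omega> x *\<^sub>R (partial b \<phi> x * \<psi> x) \<partial>lborel)"
    by (rule Bochner_Integration.integral_cong) (auto simp: indicator_def test_outside[OF \<psi>])
  also have "\<dots> = (\<integral>x. partial b \<phi> x * \<psi> x \<partial>lebesgue_on \<Omega>)"
    by (rule lebesgue_on_open_AE_eq(2)[OF \<Omega>, symmetric]) auto
  finally show "(\<integral>x. \<phi> x * partial b \<psi> x \<partial>lebesgue_on \<Omega>) = - (\<integral>x. (grd \<phi> x \<bullet> b) * \<psi> x \<partial>lebesgue_on \<Omega>)"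
    by (simp add: gb)
qed

lemma test_jet:
  assumes "\<phi> \<in> test_functions \<Omega>"
  shows "\<phi> \<in> H1 \<Omega>" "jet \<Omega> \<phi> = (emb \<Omega> \<phi>, emb \<Omega> (grd \<phi>))"
  using jet_eqI[OF test_L2 test_weak_gradient] assms by auto

lemma test_jets_eq: "test_jets \<Omega> = jet \<Omega> ` test_functions \<Omega>"
  unfolding test_jets_def using test_jet(2) by auto

lemma subspace_test_jets: "subspace (test_jets \<Omega>)"
  unfolding test_jets_eq
proof (rule subspaceI)
  have z: "(\<lambda>x. 0) \<in> test_functions \<Omega>"
    unfolding test_functions_def by (auto intro!: smooth_Ck smooth.intros exI[of _ "{}"])
  have "jet \<Omega> (\<lambda>x. 0) = 0" using jet_scaleR(2)[OF test_jet(1)[OF z], of 0] by simp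
  then show "0 \<in> jet \<Omega> ` test_functions \<Omega>" using z by (metis imageI)
next
  fix x y assume "x \<in> jet \<Omega> ` test_functions \<Omega>" "y \<in> jet \<Omega> ` test_functions \<Omega>"
  then obtain \<phi> \<psi> where "x = jet \<Omega> \<phi>" "y = jet \<Omega> \<psi>" "\<phi> \<in> test_functions \<Omega>" "\<psi> \<in> test_functions \<Omega>" by blast
  then show "x + y \<in> jet \<Omega> ` test_functions \<Omega>"
    by (intro image_eqI[of _ _ "\<lambda>x. \<phi> x + \<psi> x"]) (simp_all add: jet_add(2) test_jet(1) test_add)
next
  fix c x assume "x \<in> jet \<Omega> ` test_functions \<Omega>"
  then obtain \<phi> where "x = jet \<Omega> \<phi>" "\<phi> \<in> test_functions \<Omega>" by blast
  then show "c *\<^sub>R x \<in> jet \<Omega> ` test_functions \<Omega>"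
    by (intro image_eqI[of _ _ "\<lambda>x. c * \<phi> x"]) (simp_all add: jet_scaleR(2) test_jet(1) test_cmult)
qed

lemma H01_H1: "u \<in> H01 \<Omega> \<Longrightarrow> u \<in> H1 \<Omega>" by (simp add: H01_def)

lemma jet_H01: assumes u: "u \<in> H01 \<Omega>" shows "jet \<Omega> u \<in> closure (test_jets \<Omega>)"
proof -
  obtain \<phi> where \<phi>: "\<And>k. \<phi> k \<in> test_functions \<Omega>" "(\<lambda>k::nat. h1_norm \<Omega> (\<lambda>x. \<phi> k x - u x)) \<longlonglongrightarrow> 0"
    using u unfolding H01_def by blast
  have "h1_norm \<Omega> (\<lambda>x. \<phi> k x - u x) = norm (jet \<Omega> (\<phi> k) - jet \<Omega> u)" for k
    using jet_diff[OF test_jet(1)[OF \<phi>(1)] H01_H1[OF u]] by (simp add: h1_norm_jet)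
  then have "(\<lambda>k. jet \<Omega> (\<phi> k)) \<longlonglongrightarrow> jet \<Omega> u" using \<phi>(2) by (simp add: LIM_zero_iff tendsto_norm_zero_iff)
  then show ?thesis unfolding closure_sequential test_jets_eq using \<phi>(1) by (intro exI[of _ "\<lambda>k. jet \<Omega> (\<phi> k)"]) auto
qed

text \<open>Weak gradients survive the closure, so the closed space of jets consists of jets of \<open>H01\<close> functions.\<close>

lemma H01_of_jet:
  assumes x: "x \<in> closure (test_jets \<Omega>)"
  shows "fn (fst x) \<in> H01 \<Omega>" "jet \<Omega> (fn (fst x)) = x"
proof -
  obtain y where "\<And>k. y k \<in> test_jets \<Omega>" and lim: "y \<longlonglongrightarrow> x" using x closure_sequential by metis
  then have "\<forall>k. \<exists>\<phi>. \<phi> \<in> test_functions \<Omega> \<and> y k = jet \<Omega> \<phi>" by (auto simp: test_jets_eq)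
  then obtain \<phi> where \<phi>: "\<And>k. \<phi> k \<in> test_functions \<Omega>" "\<And>k. y k = jet \<Omega> (\<phi> k)" by metis
  have y: "y k = (emb \<Omega> (\<phi> k), emb \<Omega> (grd (\<phi> k)))" for k using \<phi> test_jet(2) by simp
  obtain U G where UG: "x = (U, G)" by (cases x)
  have l1: "(\<lambda>k. emb \<Omega> (\<phi> k)) \<longlonglongrightarrow> U" and l2: "(\<lambda>k. emb \<Omega> (grd (\<phi> k))) \<longlonglongrightarrow> G"
    using tendsto_fst[OF lim] tendsto_snd[OF lim] by (simp_all add: y UG)
  \<comment> \<open>Restriction to the domain is continuous and fixes each approximant, so it fixes
    the limit: limit classes vanish outside the domain.\<close>
  have "(\<lambda>k. emb \<Omega> (fn (emb \<Omega> (\<phi> k)))) \<longlonglongrightarrow> emb \<Omega> (fn U)"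
    by (rule bounded_linear.tendsto[OF bounded_linear_restriction l1])
  then have U: "emb \<Omega> (fn U) = U"
    unfolding emb_fn_emb[OF test_L2[OF \<phi>(1)]] by (rule LIMSEQ_unique[OF _ l1])
  have "(\<lambda>k. emb \<Omega> (fn (emb \<Omega> (grd (\<phi> k))))) \<longlonglongrightarrow> emb \<Omega> (fn G)"
    by (rule bounded_linear.tendsto[OF bounded_linear_restriction l2])
  then have G: "emb \<Omega> (fn G) = G"
    unfolding emb_fn_emb[OF grd_L2[OF \<phi>(1)]] by (rule LIMSEQ_unique[OF _ l2])
  \<comment> \<open>Each approximant satisfies the equations of \<open>weak_gradient_iff\<close>,
    and these are continuous in the function and in the gradient.\<close>
  have wg: "has_weak_gradient \<Omega> (fn U) (fn G)"
    unfolding weak_gradient_iff[OF fn_in_L2] U G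
  proof (intro conjI ballI fn_in_L2)
    fix \<psi> and b :: 'a assume \<psi>: "\<psi> \<in> test_functions \<Omega>" "b \<in> Basis"
    have e: "emb \<Omega> (\<phi> k) \<bullet> emb \<Omega> (partial b \<psi>) = - (emb \<Omega> (grd (\<phi> k)) \<bullet> emb \<Omega> (\<lambda>x. \<psi> x *\<^sub>R b))" for k
      using test_weak_gradient[OF \<phi>(1)[of k]] \<psi> unfolding weak_gradient_iff[OF test_L2[OF \<phi>(1)]] by blast
    have 1: "(\<lambda>k. emb \<Omega> (\<phi> k) \<bullet> emb \<Omega> (partial b \<psi>)) \<longlonglongrightarrow> U \<bullet> emb \<Omega> (partial b \<psi>)"
      by (intro tendsto_intros l1)
    have 2: "(\<lambda>k. - (emb \<Omega> (grd (\<phi> k)) \<bullet> emb \<Omega> (\<lambda>x. \<psi> x *\<^sub>R b))) \<longlonglongrightarrow> - (G \<bullet> emb \<Omega> (\<lambda>x. \<psi> x *\<^sub>R b))"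
      by (intro tendsto_intros l2)
    show "U \<bullet> emb \<Omega> (partial b \<psi>) = - (G \<bullet> emb \<Omega> (\<lambda>x. \<psi> x *\<^sub>R b))"
      by (rule LIMSEQ_unique[OF 1[unfolded e] 2])
  qed
  note J = jet_eqI[OF fn_in_L2 wg]
  show 1: "jet \<Omega> (fn (fst x)) = x" using J(2) by (simp add: UG U G)
  have H: "fn (fst x) \<in> H1 \<Omega>" using J(1) by (simp add: UG)
  have "h1_norm \<Omega> (\<lambda>z. \<phi> k z - fn (fst x) z) = norm (y k - x)" for k
    using jet_diff[OF test_jet(1)[OF \<phi>(1)[of k]] H] by (simp add: h1_norm_jet 1 \<phi>(2))
  moreover have "(\<lambda>k. norm (y k - x)) \<longlonglongrightarrow> 0" using lim by (simp add: LIM_zero_iff tendsto_norm_zero_iff)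
  ultimately show "fn (fst x) \<in> H01 \<Omega>" unfolding H01_def mem_Collect_eq
    using H \<phi>(1) by (intro conjI exI[of _ \<phi>]) simp_all
qed

end

section \<open>Functions of time with values in a function space\<close>

text \<open>Strong measurability is stated through seminorms of differences. Under a map
  \<open>e\<close> that is isometric in this sense, the images of the simple approximants converge
  in norm in a Hilbert space, and the limit of their Borel versions is an ordinary Borel
  function.\<close>

lemma bochner_L2_typed:
  fixes e :: "('c \<Rightarrow> real) \<Rightarrow> 'h::{real_inner,banach,second_countable_topology}" and u :: "real \<Rightarrow> 'c \<Rightarrow> real"
  assumes S: "open S" and u: "u \<in> bochner_L2 S X N"
    and N: "\<And>f. f \<in> X \<Longrightarrow> N f = norm (e f)"
    and d: "\<And>f h. f \<in> X \<Longrightarrow> h \<in> X \<Longrightarrow> N (\<lambda>x. f x - h x) = norm (e f - e h)"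
  obtains U where "U \<in> borel_measurable borel" "AE t in lborel. t \<in> S \<longrightarrow> u t \<in> X \<and> U t = e (u t)"
    "integrable lborel (\<lambda>t. indicator S t *\<^sub>R (norm (U t))\<^sup>2)"
proof -
  have Sl: "S \<in> sets lebesgue" using S by auto
  obtain s where s: "\<And>k::nat. simple_function (lebesgue_on S) (s k)" "\<And>k t. t \<in> S \<Longrightarrow> s k t \<in> X"
    and lim: "AE t in lebesgue_on S. (\<lambda>k. N (\<lambda>x. s k t x - u t x)) \<longlonglongrightarrow> 0"
    using u unfolding bochner_L2_def strongly_measurable_def by blast
  have uX: "AE t in lebesgue_on S. u t \<in> X" and ui: "integrable (lebesgue_on S) (\<lambda>t. (N (u t))\<^sup>2)"
    using u by (auto simp: bochner_L2_def)
  have "e \<circ> s k \<in> borel_measurable (lebesgue_on S)" for k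
    by (rule borel_measurable_simple_function[OF simple_function_compose[OF s(1)]])
  then have "\<exists>h\<in>borel_measurable borel. AE t in lborel. h t = indicator S t *\<^sub>R (e \<circ> s k) t" for k
    by (rule lebesgue_on_ex_borel[OF Sl])
  then obtain h where h[measurable]: "\<And>k. h k \<in> borel_measurable borel"
    and ha: "\<And>k. AE t in lborel. h k t = indicator S t *\<^sub>R (e \<circ> s k) t" by metis
  define U where "U t = lim (\<lambda>k. h k t)" for t
  have [measurable]: "U \<in> borel_measurable borel" unfolding U_def by measurable
  have "AE t in lborel. \<forall>k. h k t = indicator S t *\<^sub>R (e \<circ> s k) t" using ha by (simp add: AE_all_countable)
  then have ae: "AE t in lborel. t \<in> S \<longrightarrow> u t \<in> X \<and> U t = e (u t)"
    using lim[unfolded AE_lebesgue_on[OF Sl]] uX[unfolded AE_lebesgue_on[OF Sl]]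
  proof eventually_elim
    case (elim t)
    show ?case
    proof
      assume t: "t \<in> S"
      have "(\<lambda>k. norm (e (s k t) - e (u t))) \<longlonglongrightarrow> 0" using elim t d[OF s(2)[OF t]] by simp
      then have "(\<lambda>k. e (s k t)) \<longlonglongrightarrow> e (u t)" by (simp add: tendsto_norm_zero_iff LIM_zero_iff)
      then have "(\<lambda>k. h k t) \<longlonglongrightarrow> e (u t)" using elim t by simp
      then show "u t \<in> X \<and> U t = e (u t)" using elim t by (simp add: U_def limI)
    qed
  qed
  have "integrable lborel (\<lambda>t. indicator S t *\<^sub>R (norm (U t))\<^sup>2)"
  proof (subst lebesgue_on_open_AE_eq(3)[OF S, symmetric])
    show "AE t in lborel. t \<in> S \<longrightarrow> (N (u t))\<^sup>2 = (norm (U t))\<^sup>2"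
      using ae by eventually_elim (auto simp: N)
  qed (use ui in auto)
  with ae show ?thesis by (intro that[of U]) auto
qed

text \<open>The simple approximants of \<open>U\<close> take arbitrary values in the Hilbert space,
  so \<open>r\<close> has to send every vector into \<open>X\<close>. In the applications
  \<open>e\<close> after \<open>r\<close> is an orthogonal projection, not the identity; continuity
  and the norm bound are what is asked of it.\<close>

lemma typed_bochner_L2:
  fixes e :: "('c \<Rightarrow> real) \<Rightarrow> 'h::{real_inner,banach,second_countable_topology}" and r :: "'h \<Rightarrow> 'c \<Rightarrow> real"
  assumes S: "open S" and U: "U \<in> borel_measurable borel" "integrable lborel (\<lambda>t. indicator S t *\<^sub>R (norm (U t))\<^sup>2)"
    and r: "\<And>h. r h \<in> X" and er: "continuous_on UNIV (\<lambda>h. e (r h))" "\<And>h. norm (e (r h)) \<le> norm h"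
    and N: "\<And>f. f \<in> X \<Longrightarrow> N f = norm (e f)"
    and d: "\<And>f h. f \<in> X \<Longrightarrow> h \<in> X \<Longrightarrow> N (\<lambda>x. f x - h x) = norm (e f - e h)"
  shows "(\<lambda>t. r (U t)) \<in> bochner_L2 S X N"
  unfolding bochner_L2_def mem_Collect_eq
proof (intro conjI)
  note [measurable] = U(1) borel_open[OF S]
  have "U \<in> borel_measurable (lebesgue_on S)" by (rule lebesgue_on_open_AE_eq(1)[OF S U(1)]) auto
  then obtain F where F: "\<And>i. simple_function (lebesgue_on S) (F i)" "\<And>t. t \<in> S \<Longrightarrow> (\<lambda>i. F i t) \<longlonglongrightarrow> U t"
    using borel_measurable_implies_sequence_metric[of U "lebesgue_on S" 0] by auto
  show "strongly_measurable S X N (\<lambda>t. r (U t))"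
    unfolding strongly_measurable_def
  proof (intro exI[of _ "\<lambda>i. r \<circ> F i"] conjI allI ballI AE_I2)
    fix t assume "t \<in> space (lebesgue_on S)"
    then have t: "t \<in> S" by simp
    have "(\<lambda>i. e (r (F i t))) \<longlonglongrightarrow> e (r (U t))"
      by (rule continuous_on_tendsto_compose[OF er(1) F(2)[OF t]]) auto
    then have "(\<lambda>i. norm (e (r (F i t)) - e (r (U t)))) \<longlonglongrightarrow> 0" by (simp add: tendsto_norm_zero_iff LIM_zero_iff)
    then show "(\<lambda>i. N (\<lambda>x. (r \<circ> F i) t x - r (U t) x)) \<longlonglongrightarrow> 0" by (simp add: d r)
  qed (use F(1) r in \<open>auto intro: simple_function_compose\<close>)
  have erm: "(\<lambda>t. e (r (U t))) \<in> borel_measurable borel"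
    using borel_measurable_continuous_on[OF er(1) U(1)] .
  note [measurable] = this
  have "integrable lborel (\<lambda>t. indicator S t *\<^sub>R (norm (e (r (U t))))\<^sup>2)"
    by (rule Bochner_Integration.integrable_bound[OF U(2)])
       (auto simp: indicator_def intro!: power_mono er(2))
  then show "integrable (lebesgue_on S) (\<lambda>t. (N (r (U t)))\<^sup>2)"
    by (subst lebesgue_on_open_AE_eq(3)[OF S, where h="\<lambda>t. (norm (e (r (U t))))\<^sup>2"]) (auto simp: N r)
qed (use r in simp)

section \<open>Test functions of time and the lemma of du Bois-Reymond\<close>

context time_interval
begin

abbreviation "J \<equiv> {0<..<T}"

lemma integral_J:
  fixes f h :: "real \<Rightarrow> 'b::{banach,second_countable_topology}"
  assumes "h \<in> borel_measurable borel" "AE t in M. f t = h t"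
  shows "integral\<^sup>L (lebesgue_on J) f = integral\<^sup>L M h"
  using lebesgue_on_open_AE_eq(2)[OF _ assms(1), of J f] assms(2) by (simp add: integral_M[OF assms(1)] AE_M)

lemma AE_J: "(AE t in lebesgue_on J. P t) \<longleftrightarrow> (AE t in M. P t)"
  by (subst AE_lebesgue_on) (auto simp: AE_M)

lemma AE_M_imp_ex: "AE t in M. P t \<Longrightarrow> \<exists>t. 0 < t \<and> t < T \<and> P t"
proof (rule ccontr)
  assume "AE t in M. P t" "\<not> (\<exists>t. 0 < t \<and> t < T \<and> P t)"
  then have "AE t in M. (1::real) = 0" using AE_M_interval by (auto elim: eventually_elim2)
  then have "(\<integral>t. (1::real) \<partial>M) = 0" by (rule integral_eq_zero_AE)
  then show False using emeasure_M T_pos by (simp add: measure_def)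
qed

lemma test_deriv:
  assumes "\<phi> \<in> test_functions J"
  shows "(\<phi> has_real_derivative deriv \<phi> x) (at x)" "deriv \<phi> = partial 1 \<phi>"
    "continuous_on UNIV (deriv \<phi>)"
proof -
  have d: "(\<phi> has_real_derivative partial 1 \<phi> x) (at x)" for x
  proof -
    have 1: "(\<phi> has_derivative frechet_derivative \<phi> (at x)) (at x)"
      by (rule has_derivative_frechet[OF test_differentiable[OF assms]])
    have "frechet_derivative \<phi> (at x) h = partial 1 \<phi> x * h" for h
      using linear_cmul[OF has_derivative_linear[OF 1], of h 1] by (simp add: partial_def mult.commute)
    then show ?thesis using 1 unfolding has_field_derivative_def by (metis (no_types, lifting) ext)
  qed
  then show "deriv \<phi> = partial 1 \<phi>" using DERIV_imp_deriv by blast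
  then show "(\<phi> has_real_derivative deriv \<phi> x) (at x)" "continuous_on UNIV (deriv \<phi>)"
    using d test_continuous[OF test_partial[OF assms]] by auto
qed

lemma test_as_prim:
  assumes "\<phi> \<in> test_functions J" "0 \<le> t" "t \<le> T"
  shows "\<phi> t = prim (deriv \<phi>) t"
proof -
  have "\<phi> t = \<phi> 0 + prim (deriv \<phi>) t"
    by (rule prim_FTC[OF assms(2,3)])
       (use test_deriv[OF assms(1)] in \<open>auto intro: has_field_derivative_at_within continuous_on_subset borel_measurable_continuous_onI\<close>)
  then show ?thesis using test_outside[OF assms(1), of 0] by simp
qed

lemma sq_continuous:
  fixes f :: "real \<Rightarrow> 'b::{real_inner,banach,second_countable_topology}"
  assumes "continuous_on UNIV f" shows "sq f"
proof -
  have "bounded (f ` {0..T})"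
    by (intro compact_imp_bounded compact_continuous_image continuous_on_subset[OF assms]) auto
  then obtain B where "\<And>t. t \<in> {0..T} \<Longrightarrow> norm (f t) \<le> B" by (auto simp: bounded_iff simp del: atLeastAtMost_iff)
  then show ?thesis using assms by (intro sq_bounded[where B=B]) (auto intro: borel_measurable_continuous_onI)
qed

text \<open>Integration by parts with exponent 0, where the test function vanishes at both
  ends.\<close>

lemma test_prim_integral:
  fixes a :: "real \<Rightarrow> 'b::{real_inner,banach,second_countable_topology}"
  assumes \<phi>: "\<phi> \<in> test_functions J" and a: "integrable M a"
  shows "(\<integral>t. deriv \<phi> t * ((A0 + prim a t) \<bullet> c) \<partial>M) = - (\<integral>t. \<phi> t * (a t \<bullet> c) \<partial>M)"
proof -
  define \<alpha> where "\<alpha> t = a t \<bullet> c" for t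
  have ai: "integrable M \<alpha>" unfolding \<alpha>_def using a by simp
  have A: "(A0 + prim a t) \<bullet> c = A0 \<bullet> c + prim \<alpha> t" for t
    by (simp add: inner_add_left prim_inner[OF a] \<alpha>_def[abs_def])
  have di: "integrable M (deriv \<phi>)" by (rule sq_integrable[OF sq_continuous[OF test_deriv(3)[OF \<phi>]]])
  have ps: "sq \<phi>" by (rule sq_continuous[OF test_continuous[OF \<phi>]])
  have As: "sq (\<lambda>t. A0 \<bullet> c + prim \<alpha> t)" by (rule sq_prim[OF ai])
  note [measurable] = test_measurable[OF \<phi>] sq_measurable[OF As]
  have "(\<integral>t. exp (0 * t) * (\<alpha> t \<bullet> \<phi> t + (A0 \<bullet> c + prim \<alpha> t) \<bullet> deriv \<phi> t + 0 * ((A0 \<bullet> c + prim \<alpha> t) \<bullet> \<phi> t)) \<partial>M)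
    = exp (0 * T) * ((A0 \<bullet> c + prim \<alpha> T) \<bullet> \<phi> T) - (A0 \<bullet> c) \<bullet> 0"
    by (rule weighted_product_integral[OF ai di refl]) (use test_as_prim[OF \<phi>] in auto)
  then have "(\<integral>t. \<phi> t * \<alpha> t + deriv \<phi> t * (A0 \<bullet> c + prim \<alpha> t) \<partial>M) = 0"
    using test_outside[OF \<phi>, of T] by (simp add: mult.commute)
  moreover have "integrable M (\<lambda>t. \<phi> t * \<alpha> t)"
  proof -
    have "bounded (\<phi> ` {0..T})"
      by (intro compact_imp_bounded compact_continuous_image continuous_on_subset[OF test_continuous[OF \<phi>]]) auto
    then obtain B where "\<And>t. t \<in> {0..T} \<Longrightarrow> norm (\<phi> t) \<le> B" by (auto simp: bounded_iff simp del: atLeastAtMost_iff)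
    then show ?thesis using integrable_inner_bounded(2)[OF ai test_measurable[OF \<phi>], of B] by simp
  qed
  moreover have "integrable M (\<lambda>t. deriv \<phi> t * (A0 \<bullet> c + prim \<alpha> t))"
    using sq_inner_integrable[OF sq_continuous[OF test_deriv(3)[OF \<phi>]] As] by simp
  ultimately show ?thesis by (simp add: A \<alpha>_def)
qed

text \<open>A primitive is constant on either side of the support, and the vanishing mean makes the
  two constants equal; subtracting this constant gives compact support.\<close>

lemma zero_mean_test_antiderivative:
  assumes \<zeta>: "\<zeta> \<in> test_functions J" and zero: "integral\<^sup>L lborel \<zeta> = 0"
  shows "\<exists>\<phi>\<in>test_functions J. deriv \<phi> = \<zeta>"
proof -
  obtain K where K: "compact K" "K \<subseteq> J" "\<And>x. x \<notin> K \<Longrightarrow> \<zeta> x = 0" using \<zeta> unfolding test_functions_def by blast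
  obtain a b where ab: "0 < a" "a \<le> b" "b < T" "K \<subseteq> {a..b}"
  proof (cases "K = {}")
    \<comment> \<open>For empty support any interior point serves as a degenerate interval.\<close>
    case True
    then show ?thesis using that[of "T/2" "T/2"] T_pos by simp
  next
    case False
    obtain l where l: "l \<in> K" "\<forall>x\<in>K. l \<le> x" using compact_attains_inf[OF K(1) False] by blast
    obtain u where u: "u \<in> K" "\<forall>x\<in>K. x \<le> u" using compact_attains_sup[OF K(1) False] by blast
    show ?thesis using that[of l u] l u K(2) by force
  qed
  have zc: "continuous_on UNIV \<zeta>" by (rule test_continuous[OF \<zeta>])
  have "\<exists>F. \<forall>x::real. (- \<infinity> :: ereal) < ereal x \<longrightarrow> ereal x < (\<infinity> :: ereal) \<longrightarrow> (F has_vector_derivative \<zeta> x) (at x)"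
    by (rule einterval_antiderivative) (use zc in \<open>auto simp: continuous_on_eq_continuous_at\<close>)
  then obtain F where F: "\<And>x. (F has_real_derivative \<zeta> x) (at x)"
    by (auto simp: has_real_derivative_iff_has_vector_derivative)
  have z0: "\<zeta> x = 0" if "x < a \<or> b < x" for x using that K(3) ab(4) by force
  have Fa: "F x = F a" if lt: "x < a" for x
  proof -
    obtain y where "x < y" "y < a" "F a - F x = (a - x) * \<zeta> y" using MVT2[OF lt F] by blast
    then show ?thesis using z0[of y] by simp
  qed
  have Fb: "F x = F b" if lt: "b < x" for x
  proof -
    obtain y where "b < y" "y < x" "F x - F b = (x - b) * \<zeta> y" using MVT2[OF lt F] by blast
    then show ?thesis using z0[of y] by simp
  qed
  have "(\<integral>x. indicator {a..b} x *\<^sub>R \<zeta> x \<partial>lborel) = F b - F a"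
    by (rule integral_FTC_Icc[OF ab(2)])
       (use F zc in \<open>auto simp: has_real_derivative_iff_has_vector_derivative[symmetric] intro: has_field_derivative_at_within continuous_on_subset\<close>)
  moreover have "(\<lambda>x. indicator {a..b} x *\<^sub>R \<zeta> x) = \<zeta>"
  proof
    fix x show "indicator {a..b} x *\<^sub>R \<zeta> x = \<zeta> x"
      using z0[of x] by (cases "x \<in> {a..b}") (auto simp: not_le)
  qed
  ultimately have Fab: "F b = F a" using zero by simp
  define \<phi> where "\<phi> x = F x - F a" for x
  have d: "(\<phi> has_real_derivative \<zeta> x) (at x)" for x
    unfolding \<phi>_def using F[of x] by (auto intro!: derivative_eq_intros)
  have p: "partial 1 \<phi> = \<zeta>"
  proof
    fix x show "partial 1 \<phi> x = \<zeta> x"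
      using partial_eqI[OF d[unfolded has_field_derivative_def, of x], of 1] by simp
  qed
  have "Ck k \<phi>" for k
  proof (cases k)
    case 0
    then show ?thesis using d by (auto intro!: continuous_at_imp_continuous_on DERIV_isCont)
  next
    case (Suc j)
    have "Ck j \<zeta>" using \<zeta> by (auto simp: test_functions_def)
    then show ?thesis using Suc d p by (auto simp: Basis_real_def differentiable_def has_field_derivative_def)
  qed
  moreover have "\<phi> x = 0" if "x \<notin> {a..b}" for x
    using that Fa[of x] Fb[of x] Fab by (auto simp: \<phi>_def not_le)
  ultimately have "\<phi> \<in> test_functions J"
    unfolding test_functions_def using ab by (auto intro!: exI[of _ "{a..b}"])
  moreover have "deriv \<phi> = \<zeta>" using d DERIV_imp_deriv by blast
  ultimately show ?thesis by blast
qed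

text \<open>The set where the functions differ is open in \<open>J\<close>, and a nonempty open set
  has positive measure.\<close>

lemma continuous_AE_eq:
  fixes f h :: "real \<Rightarrow> real"
  assumes "continuous_on J f" "continuous_on J h" "AE t in M. f t = h t" "t \<in> J"
  shows "f t = h t"
proof (rule ccontr)
  assume ne: "f t \<noteq> h t"
  have "open (J \<inter> (\<lambda>t. f t - h t) -` (- {0}))"
    by (rule continuous_open_preimage) (auto intro!: continuous_intros assms)
  moreover have "t \<in> J \<inter> (\<lambda>t. f t - h t) -` (- {0})" using ne assms(4) by simp
  ultimately obtain e where e: "e > 0" "ball t e \<subseteq> J \<inter> (\<lambda>t. f t - h t) -` (- {0})" by (rule openE)
  have "AE s in lborel. s \<notin> ball t e" using assms(3) unfolding AE_M by eventually_elim (use e in auto)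
  then have "emeasure lborel (ball t e) = 0" by (subst AE_iff_measurable[symmetric]) auto
  moreover have "ball t e = {t - e<..<t + e}" by (auto simp: dist_real_def)
  ultimately show False using e(1) by simp
qed

text \<open>Any test function becomes one of mean zero after subtracting a multiple of a fixed bump,
  and is then a derivative. Hence \<open>k\<close> and a constant have the same integrals against
  all test functions.\<close>

lemma du_Bois_Reymond:
  assumes k: "continuous_on UNIV k" and z: "\<And>\<phi>. \<phi> \<in> test_functions J \<Longrightarrow> (\<integral>t. deriv \<phi> t * k t \<partial>M) = 0"
  shows "\<exists>c. \<forall>t\<in>J. k t = (c::real)"
proof -
  have ks: "sq k" by (rule sq_continuous[OF k])
  \<comment> \<open>A bump on the middle half of the interval; it is nonnegative and positive at T /
    2, so its mean is not zero and can be divided by.\<close>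
  define \<eta>0 where "\<eta>0 = box_bump (T/4) (3*T/4) 0"
  have t0: "\<eta>0 \<in> test_functions J" unfolding \<eta>0_def by (rule box_bump_test) (use T_pos in auto)
  have int: "integrable lborel \<eta>" if t: "\<eta> \<in> test_functions J" for \<eta>
  proof -
    obtain K where "compact K" "\<And>x. x \<notin> K \<Longrightarrow> \<eta> x = 0" using t unfolding test_functions_def by blast
    then show ?thesis using integrable_compact_support[OF test_continuous[OF t]] by blast
  qed
  have n0: "integral\<^sup>L lborel \<eta>0 \<noteq> 0"
  proof
    assume "integral\<^sup>L lborel \<eta>0 = 0"
    then have "AE x in lborel. \<eta>0 x = 0"
      using int[OF t0] by (subst (asm) integral_nonneg_eq_0_iff_AE) (auto simp: \<eta>0_def intro!: AE_I2 box_bump_range)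
    then have "AE t in M. \<eta>0 t = 0" unfolding AE_M by eventually_elim simp
    then have "\<eta>0 (T/2) = 0"
      by (intro continuous_AE_eq[of \<eta>0 "\<lambda>_. 0"]) (use T_pos test_continuous[OF t0] in \<open>auto intro: continuous_on_subset\<close>)
    then show False using T_pos by (auto simp: \<eta>0_def box_bump_def Basis_real_def flat_exp_def)
  qed
  have tm: "(\<integral>t. \<eta> t \<partial>M) = integral\<^sup>L lborel \<eta>" if t: "\<eta> \<in> test_functions J" for \<eta>
    unfolding integral_M[OF test_measurable[OF t]]
    by (rule Bochner_Integration.integral_cong) (use test_outside[OF t] in \<open>auto simp: indicator_def\<close>)
  define c where "c = (\<integral>t. \<eta>0 t * k t \<partial>M) / integral\<^sup>L lborel \<eta>0"
  have sqt: "sq \<eta>" if t: "\<eta> \<in> test_functions J" for \<eta> by (rule sq_continuous[OF test_continuous[OF t]])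
  have ek: "(\<integral>t. \<eta> t * k t \<partial>M) = integral\<^sup>L lborel \<eta> * c" if t: "\<eta> \<in> test_functions J" for \<eta>
  proof -
    define q where "q = integral\<^sup>L lborel \<eta> / integral\<^sup>L lborel \<eta>0"
    define \<zeta> where "\<zeta> x = \<eta> x + (- q) * \<eta>0 x" for x
    have zt: "\<zeta> \<in> test_functions J" unfolding \<zeta>_def by (intro test_add test_cmult t t0)
    have "integral\<^sup>L lborel \<zeta> = 0" unfolding \<zeta>_def using int[OF t] int[OF t0] n0 by (simp add: q_def)
    from zero_mean_test_antiderivative[OF zt this] obtain \<phi> where "\<phi> \<in> test_functions J" "deriv \<phi> = \<zeta>" by blast
    then have "(\<integral>t. \<zeta> t * k t \<partial>M) = 0" using z by metis
    moreover have "(\<integral>t. \<zeta> t * k t \<partial>M) = (\<integral>t. \<eta> t * k t - q * (\<eta>0 t * k t) \<partial>M)"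
      by (rule Bochner_Integration.integral_cong) (auto simp: \<zeta>_def algebra_simps)
    moreover have "\<dots> = (\<integral>t. \<eta> t * k t \<partial>M) - q * (\<integral>t. \<eta>0 t * k t \<partial>M)"
      using sq_inner_integrable[OF sqt[OF t] ks] sq_inner_integrable[OF sqt[OF t0] ks] by simp
    ultimately show ?thesis by (simp add: q_def c_def)
  qed
  have kc: "sq (\<lambda>t. k t - c)" by (intro sq_diff ks sq_bounded[where B="\<bar>c\<bar>"]) auto
  have "AE x in lborel. x \<in> J \<longrightarrow> indicator J x *\<^sub>R (k x - c) = 0"
  proof (rule fundamental_lemma[OF sqD[OF kc]])
    fix \<phi> assume t: "\<phi> \<in> test_functions J"
    note [measurable] = sq_measurable[OF ks] test_measurable[OF t]
    have "(\<integral>x. (indicator J x *\<^sub>R (k x - c)) * \<phi> x \<partial>lborel) = (\<integral>x. (k x - c) * \<phi> x \<partial>M)"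
      by (subst integral_M) (auto simp: mult.assoc)
    also have "\<dots> = (\<integral>x. \<phi> x * k x - c * \<phi> x \<partial>M)"
      by (rule Bochner_Integration.integral_cong) (auto simp: algebra_simps)
    also have "\<dots> = 0"
      using sq_inner_integrable[OF sqt[OF t] ks] sq_integrable[OF sqt[OF t]] by (simp add: ek[OF t] tm[OF t])
    finally show "(\<integral>x. (indicator J x *\<^sub>R (k x - c)) * \<phi> x \<partial>lborel) = 0" .
  qed simp
  then have "AE t in M. k t = c" unfolding AE_M by eventually_elim auto
  then have "\<forall>t\<in>J. k t = c"
    using continuous_AE_eq[OF continuous_on_subset[OF k subset_UNIV] continuous_on_const] by blast
  then show ?thesis by blast
qed

end

section \<open>Bochner spaces and time derivatives over a spatial domain\<close>

locale space_time = time_interval T for T :: real +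
  fixes \<Omega> :: "'a::euclidean_space set"
  assumes Omega: "open \<Omega>"
begin

abbreviation restr :: "('a, real) lsq \<Rightarrow> ('a, real) lsq" where "restr F \<equiv> emb \<Omega> (fn F)"

lemma inner_restr: "h \<in> L2 \<Omega> \<Longrightarrow> restr F \<bullet> emb \<Omega> h = F \<bullet> emb \<Omega> h"
  using inner_emb[OF Omega fn_in_L2[OF Omega], of h F] inner_emb_right[OF Omega, of h F] by argo

lemma norm_restr_le: "norm (restr F) \<le> norm F"
proof -
  have "(norm (restr F))\<^sup>2 = F \<bullet> restr F"
    using inner_restr[OF fn_in_L2[OF Omega], of F F] by (simp add: power2_norm_eq_inner)
  also have "\<dots> \<le> norm F * norm (restr F)" by (rule norm_cauchy_schwarz)
  finally show ?thesis by (cases "norm (restr F) = 0") (auto simp: power2_eq_square)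
qed

lemma l2_norm_diff:
  "f \<in> L2 \<Omega> \<Longrightarrow> h \<in> L2 \<Omega> \<Longrightarrow> l2_norm \<Omega> (\<lambda>x. f x - h x) = norm (emb \<Omega> f - emb \<Omega> h)" for f h :: "'a \<Rightarrow> real"
  using L2_diff_emb[OF Omega, of f h] norm_emb[OF Omega, of "\<lambda>x. f x - h x"] by simp

lemma sq_iff_J: "U \<in> borel_measurable borel \<Longrightarrow> sq U \<longleftrightarrow> integrable lborel (\<lambda>t. indicator J t * (norm (U t))\<^sup>2)"
  unfolding sq_def by (subst integrable_M) auto

lemma bochner_L2_L2_typed:
  fixes v :: "real \<Rightarrow> 'a \<Rightarrow> real"
  assumes "v \<in> bochner_L2 J (L2 \<Omega>) (l2_norm \<Omega>)"
  obtains V where "sq V" "AE t in M. v t \<in> L2 \<Omega> \<and> V t = emb \<Omega> (v t)"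
proof -
  obtain V where V: "V \<in> borel_measurable borel" "AE t in lborel. t \<in> J \<longrightarrow> v t \<in> L2 \<Omega> \<and> V t = emb \<Omega> (v t)"
    "integrable lborel (\<lambda>t. indicator J t *\<^sub>R (norm (V t))\<^sup>2)"
    by (rule bochner_L2_typed[OF _ assms, of "emb \<Omega>"]) (auto simp: norm_emb[OF Omega] l2_norm_diff)
  show ?thesis by (rule that[of V]) (use V in \<open>auto simp: sq_iff_J AE_M\<close>)
qed

lemma bochner_L2_H01_typed:
  fixes v :: "real \<Rightarrow> 'a \<Rightarrow> real"
  assumes "v \<in> bochner_L2 J (H01 \<Omega>) (h1_norm \<Omega>)"
  obtains V where "sq V" "AE t in M. v t \<in> H01 \<Omega> \<and> V t = jet \<Omega> (v t)"
proof -
  have 1: "h1_norm \<Omega> f = norm (jet \<Omega> f)" if "f \<in> H01 \<Omega>" for f using h1_norm_jet[OF Omega H01_H1[OF Omega that]] .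
  have 2: "h1_norm \<Omega> (\<lambda>x. f x - h x) = norm (jet \<Omega> f - jet \<Omega> h)" if "f \<in> H01 \<Omega>" "h \<in> H01 \<Omega>" for f h
    using h1_norm_jet[OF Omega] jet_diff[OF Omega H01_H1[OF Omega that(1)] H01_H1[OF Omega that(2)]] by simp
  obtain V where V: "V \<in> borel_measurable borel" "AE t in lborel. t \<in> J \<longrightarrow> v t \<in> H01 \<Omega> \<and> V t = jet \<Omega> (v t)"
    "integrable lborel (\<lambda>t. indicator J t *\<^sub>R (norm (V t))\<^sup>2)"
    by (rule bochner_L2_typed[OF _ assms 1 2]) auto
  show ?thesis by (rule that[of V]) (use V in \<open>auto simp: sq_iff_J AE_M\<close>)
qed

lemma bochner_L2_L2I:
  assumes "sq U" shows "(\<lambda>t. fn (U t)) \<in> bochner_L2 J (L2 \<Omega>) (l2_norm \<Omega>)"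
proof (rule typed_bochner_L2[where e="emb \<Omega>"])
  show "continuous_on UNIV (\<lambda>h. restr h)"
    by (rule linear_continuous_on[OF bounded_linear_restriction[OF Omega]])
  show "norm (restr h) \<le> norm h" for h by (rule norm_restr_le)
  show "integrable lborel (\<lambda>t. indicator J t *\<^sub>R (norm (U t))\<^sup>2)" using assms sq_iff_J[OF sq_measurable[OF assms]] by simp
qed (use sq_measurable[OF assms] in \<open>auto simp: fn_in_L2[OF Omega] norm_emb[OF Omega] l2_norm_diff\<close>)

lemma VV_subspace: "subspace (closure (test_jets \<Omega>))" "closed (closure (test_jets \<Omega>))"
  using subspace_closure[OF subspace_test_jets[OF Omega]] by auto

text \<open>Projecting first gives a member of \<open>H01\<close> at every time, also where
  \<open>U\<close> leaves the space of jets.\<close>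

lemma bochner_L2_H01I:
  assumes "sq U"
  shows "(\<lambda>t. fn (fst (hproj (closure (test_jets \<Omega>)) (U t)))) \<in> bochner_L2 J (H01 \<Omega>) (h1_norm \<Omega>)"
proof (rule typed_bochner_L2[where e="jet \<Omega>" and r="\<lambda>x. fn (fst (hproj (closure (test_jets \<Omega>)) x))"])
  note j = H01_of_jet[OF Omega hproj_in[OF VV_subspace]]
  show "fn (fst (hproj (closure (test_jets \<Omega>)) h)) \<in> H01 \<Omega>" for h by (rule j)
  show "continuous_on UNIV (\<lambda>h. jet \<Omega> (fn (fst (hproj (closure (test_jets \<Omega>)) h))))"
    unfolding j by (rule linear_continuous_on[OF hproj_bounded_linear[OF VV_subspace]])
  show "norm (jet \<Omega> (fn (fst (hproj (closure (test_jets \<Omega>)) h)))) \<le> norm h" for h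
  proof -
    let ?p = "hproj (closure (test_jets \<Omega>)) h"
    have "(norm ?p)\<^sup>2 = ?p \<bullet> h" using hproj_inner[OF VV_subspace hproj_in[OF VV_subspace]] by (simp add: power2_norm_eq_inner)
    also have "\<dots> \<le> norm ?p * norm h" by (rule norm_cauchy_schwarz)
    finally show ?thesis unfolding j by (cases "norm ?p = 0") (auto simp: power2_eq_square)
  qed
  show "h1_norm \<Omega> f = norm (jet \<Omega> f)" if "f \<in> H01 \<Omega>" for f using h1_norm_jet[OF Omega H01_H1[OF Omega that]] .
  show "h1_norm \<Omega> (\<lambda>x. f x - h x) = norm (jet \<Omega> f - jet \<Omega> h)" if "f \<in> H01 \<Omega>" "h \<in> H01 \<Omega>" for f h
    using h1_norm_jet[OF Omega] jet_diff[OF Omega H01_H1[OF Omega that(1)] H01_H1[OF Omega that(2)]] by simp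
  show "integrable lborel (\<lambda>t. indicator J t *\<^sub>R (norm (U t))\<^sup>2)" using assms sq_iff_J[OF sq_measurable[OF assms]] by simp
qed (use sq_measurable[OF assms] in auto)

text \<open>The hypotheses speak of pairings with \<open>L2\<close>, which do not see values outside
  the domain; \<open>W\<close> may fail to vanish there.\<close>

lemma has_time_derivI:
  assumes W: "sq W" and w: "w \<in> bochner_L2 J (L2 \<Omega>) (l2_norm \<Omega>)"
    and wW: "AE t in M. \<forall>\<psi>\<in>L2 \<Omega>. l2_inner \<Omega> (w t) \<psi> = W t \<bullet> emb \<Omega> \<psi>"
    and uU: "AE t in M. \<forall>\<psi>\<in>L2 \<Omega>. l2_inner \<Omega> (u t) \<psi> = (U0 + prim W t) \<bullet> emb \<Omega> \<psi>"
  shows "has_time_deriv \<Omega> T u w"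
  unfolding has_time_deriv_def
proof (intro conjI ballI w)
  fix \<phi> and \<psi> :: "'a \<Rightarrow> real" assume \<phi>: "\<phi> \<in> test_functions J" and \<psi>: "\<psi> \<in> L2 \<Omega>"
  note Wi = sq_integrable[OF W]
  note [measurable] = sq_measurable[OF W] test_measurable[OF \<phi>] borel_measurable_continuous_onI[OF test_deriv(3)[OF \<phi>]] prim_measurable[OF Wi]
  have "(\<integral>t. deriv \<phi> t * l2_inner \<Omega> (u t) \<psi> \<partial>lebesgue_on J) = (\<integral>t. deriv \<phi> t * ((U0 + prim W t) \<bullet> emb \<Omega> \<psi>) \<partial>M)"
  proof (rule integral_J)
    show "AE t in M. deriv \<phi> t * l2_inner \<Omega> (u t) \<psi> = deriv \<phi> t * ((U0 + prim W t) \<bullet> emb \<Omega> \<psi>)"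
      using uU by eventually_elim (use \<psi> in simp)
  qed measurable
  also have "\<dots> = - (\<integral>t. \<phi> t * (W t \<bullet> emb \<Omega> \<psi>) \<partial>M)" by (rule test_prim_integral[OF \<phi> Wi])
  also have "(\<integral>t. \<phi> t * (W t \<bullet> emb \<Omega> \<psi>) \<partial>M) = (\<integral>t. \<phi> t * l2_inner \<Omega> (w t) \<psi> \<partial>lebesgue_on J)"
  proof (rule integral_J[symmetric])
    show "AE t in M. \<phi> t * l2_inner \<Omega> (w t) \<psi> = \<phi> t * (W t \<bullet> emb \<Omega> \<psi>)"
      using wW by eventually_elim (use \<psi> in simp)
  qed measurable
  finally show "(\<integral>t. deriv \<phi> t * l2_inner \<Omega> (u t) \<psi> \<partial>lebesgue_on J) = - (\<integral>t. \<phi> t * l2_inner \<Omega> (w t) \<psi> \<partial>lebesgue_on J)" .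
qed

lemma continuous_version_emb:
  assumes vc: "L2_continuous_version \<Omega> T v vc" and v: "AE t in M. v t \<in> L2 \<Omega>"
  shows "AE s in M. vc s \<in> L2 \<Omega> \<and> emb \<Omega> (vc s) = emb \<Omega> (v s)"
proof -
  have "AE s in M. AE x in lebesgue_on \<Omega>. vc s x = v s x" using vc unfolding L2_continuous_version_def AE_J by simp
  then show ?thesis using v AE_M_interval
  proof eventually_elim
    case (elim s)
    have O: "\<Omega> \<in> sets lebesgue" using Omega by auto
    have 1: "vc s \<in> L2 \<Omega>" using vc elim by (auto simp: L2_continuous_version_def space_continuous_on_def)
    then show ?case using emb_eq_iff[OF Omega 1, of "v s"] elim by (auto simp: AE_lebesgue_on[OF O])
  qed
qed

text \<open>The continuous version minus the primitive of \<open>Z\<close> has vanishing weak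
  derivative in every pairing, so it is constant by the lemma of du Bois-Reymond. This expresses the
  values at the end points in terms of \<open>Z\<close>.\<close>

lemma continuous_version_is_primitive:
  assumes z: "has_time_deriv \<Omega> T v z" and vc: "L2_continuous_version \<Omega> T v vc"
    and v: "AE t in M. v t \<in> L2 \<Omega>" and Z: "sq Z" "AE t in M. z t \<in> L2 \<Omega> \<and> Z t = emb \<Omega> (z t)"
    and t: "0 \<le> t" "t \<le> T"
  shows "emb \<Omega> (vc t) = emb \<Omega> (vc 0) + prim Z t"
proof -
  note Zi = sq_integrable[OF Z(1)]
  \<comment> \<open>Clamping time to the interval extends the continuous version continuously to the
    line, as the lemma of du Bois-Reymond requires.\<close>
  define cl where "cl s = max 0 (min T s)" for s
  have cl: "cl s \<in> {0..T}" for s using T_pos by (auto simp: cl_def)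
  have clc: "continuous_on UNIV cl" unfolding cl_def[abs_def] by (intro continuous_intros)
  have vcL: "vc s \<in> L2 \<Omega>" if "s \<in> {0..T}" for s
    using vc that by (auto simp: L2_continuous_version_def space_continuous_on_def)
  have "continuous_on {0..T} (\<lambda>s. emb \<Omega> (vc s))"
    unfolding continuous_on_def
  proof
    fix s assume s: "s \<in> {0..T}"
    have "((\<lambda>r. l2_norm \<Omega> (\<lambda>x. vc r x - vc s x)) \<longlongrightarrow> 0) (at s within {0..T})"
      using vc s by (auto simp: L2_continuous_version_def space_continuous_on_def)
    then have "((\<lambda>r. norm (emb \<Omega> (vc r) - emb \<Omega> (vc s))) \<longlongrightarrow> 0) (at s within {0..T})"
      by (rule Lim_transform_eventually)
         (auto simp: eventually_at_filter l2_norm_diff vcL[OF s] vcL)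
    then show "((\<lambda>r. emb \<Omega> (vc r)) \<longlongrightarrow> emb \<Omega> (vc s)) (at s within {0..T})"
      by (simp add: tendsto_norm_zero_iff Lim_null[symmetric] LIM_zero_iff)
  qed
  then have Vc: "continuous_on UNIV (\<lambda>s. emb \<Omega> (vc (cl s)))"
    by (rule continuous_on_compose2[OF _ clc]) (use cl in auto)
  define H where "H s = emb \<Omega> (vc (cl s)) - prim Z s" for s
  have Hc: "continuous_on UNIV H" unfolding H_def by (intro continuous_intros Vc prim_continuous Zi)
  note vv = continuous_version_emb[OF vc v]
  have const: "H s \<bullet> emb \<Omega> \<psi> = H 0 \<bullet> emb \<Omega> \<psi>" if \<psi>: "\<psi> \<in> L2 \<Omega>" and s: "0 \<le> s" "s \<le> T" for s \<psi>
  proof -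
    define k where "k s = H s \<bullet> emb \<Omega> \<psi>" for s
    have kc: "continuous_on UNIV k" unfolding k_def by (intro continuous_intros Hc)
    have "\<exists>c. \<forall>s\<in>J. k s = c"
    proof (rule du_Bois_Reymond[OF kc])
      fix \<phi> assume \<phi>: "\<phi> \<in> test_functions J"
      note dm = borel_measurable_continuous_onI[OF test_deriv(3)[OF \<phi>]]
      note [measurable] = sq_measurable[OF Z(1)] test_measurable[OF \<phi>] dm prim_measurable[OF Zi] borel_measurable_continuous_onI[OF Vc]
      have ds: "sq (deriv \<phi>)" by (rule sq_continuous[OF test_deriv(3)[OF \<phi>]])
      have i1: "integrable M (\<lambda>t. deriv \<phi> t * (emb \<Omega> (vc (cl t)) \<bullet> emb \<Omega> \<psi>))"
        using sq_inner_integrable[OF ds sq_continuous[OF continuous_on_inner[OF Vc continuous_on_const]]] by simp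
      have i2: "integrable M (\<lambda>t. deriv \<phi> t * (prim Z t \<bullet> emb \<Omega> \<psi>))"
        using sq_inner_integrable[OF ds sq_continuous[OF continuous_on_inner[OF prim_continuous[OF Zi] continuous_on_const]]] by simp
      have "(\<integral>t. deriv \<phi> t * (emb \<Omega> (vc (cl t)) \<bullet> emb \<Omega> \<psi>) \<partial>M) = (\<integral>t. deriv \<phi> t * l2_inner \<Omega> (v t) \<psi> \<partial>lebesgue_on J)"
      proof (rule integral_J[symmetric])
        show "AE t in M. deriv \<phi> t * l2_inner \<Omega> (v t) \<psi> = deriv \<phi> t * (emb \<Omega> (vc (cl t)) \<bullet> emb \<Omega> \<psi>)"
          using vv v AE_M_interval by eventually_elim (simp add: cl_def inner_emb[OF Omega _ \<psi>])
      qed measurable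
      also have "\<dots> = - (\<integral>t. \<phi> t * l2_inner \<Omega> (z t) \<psi> \<partial>lebesgue_on J)"
        using z \<phi> \<psi> unfolding has_time_deriv_def by blast
      also have "(\<integral>t. \<phi> t * l2_inner \<Omega> (z t) \<psi> \<partial>lebesgue_on J) = (\<integral>t. \<phi> t * (Z t \<bullet> emb \<Omega> \<psi>) \<partial>M)"
      proof (rule integral_J)
        show "AE t in M. \<phi> t * l2_inner \<Omega> (z t) \<psi> = \<phi> t * (Z t \<bullet> emb \<Omega> \<psi>)"
          using Z(2) by eventually_elim (simp add: inner_emb[OF Omega _ \<psi>])
      qed measurable
      also have "- \<dots> = (\<integral>t. deriv \<phi> t * (prim Z t \<bullet> emb \<Omega> \<psi>) \<partial>M)"
        using test_prim_integral[OF \<phi> Zi, of 0 "emb \<Omega> \<psi>"] by simp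
      finally have "(\<integral>t. deriv \<phi> t * (emb \<Omega> (vc (cl t)) \<bullet> emb \<Omega> \<psi>) \<partial>M) = (\<integral>t. deriv \<phi> t * (prim Z t \<bullet> emb \<Omega> \<psi>) \<partial>M)" .
      then show "(\<integral>t. deriv \<phi> t * k t \<partial>M) = 0"
        unfolding k_def H_def inner_diff_left right_diff_distrib using i1 i2 by simp
    qed
    then obtain c where c: "\<And>s. s \<in> J \<Longrightarrow> k s = c" by blast
    \<comment> \<open>Continuity carries the constant from the open interval to its end
      points.\<close>
    have "closed {s. k s = c}" by (intro closed_Collect_eq kc continuous_on_const)
    then have "closure J \<subseteq> {s. k s = c}" using c by (intro closure_minimal) auto
    then have "k s = c" if "0 \<le> s" "s \<le> T" for s using that T_pos by (auto simp: closure_greaterThanLessThan)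
    then show ?thesis using s T_pos unfolding k_def by (metis order_refl less_imp_le)
  qed
  \<comment> \<open>Pairings determine a class only up to its part outside the domain. The primitive
    has no such part because almost all values of \<open>Z\<close> have none.\<close>
  have fix0: "restr (prim Z s) = prim Z s" for s
  proof -
    have "restr (prim Z s) = prim (\<lambda>s. restr (Z s)) s" by (rule prim_linear[OF bounded_linear_restriction[OF Omega] Zi])
    also have "\<dots> = prim Z s"
    proof (rule prim_cong_AE)
      show "AE s in M. restr (Z s) = Z s" using Z(2) by eventually_elim (simp add: emb_fn_emb[OF Omega])
      show "(\<lambda>s. restr (Z s)) \<in> borel_measurable borel"
        using borel_measurable_continuous_on[OF linear_continuous_on[OF bounded_linear_restriction[OF Omega]] sq_measurable[OF Z(1)]] .
    qed (rule sq_measurable[OF Z(1)])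
    finally show ?thesis .
  qed
  interpret R: bounded_linear restr by (rule bounded_linear_restriction[OF Omega])
  have "restr (H s) = H s" for s
    unfolding H_def R.diff fix0 using vcL[OF cl, of s] by (simp add: emb_fn_emb[OF Omega])
  then have fixH: "restr (H t - H 0) = H t - H 0" by (simp add: R.diff)
  \<comment> \<open>The difference is paired with its own representative.\<close>
  have "(H t - H 0) \<bullet> restr (H t - H 0) = 0"
    using const[OF fn_in_L2[OF Omega] t, of "H t - H 0"] by (simp add: inner_diff_left)
  then have "H t = H 0" unfolding fixH by simp
  then show ?thesis using t T_pos by (simp add: H_def cl_def prim_0 algebra_simps)
qed

end

section \<open>Weak solutions\<close>

text \<open>Moves the statement about the history from (-\<tau>, 0) to (0, \<tau>), where the
  initial condition is posed.\<close>

lemma AE_lborel_translate: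
  fixes a :: "'a::euclidean_space"
  assumes "AE x in lborel. P x" shows "AE x in lborel. P (x - a)"
proof -
  obtain N where N: "N \<in> null_sets lborel" "{x. \<not> P x} \<subseteq> N" using assms unfolding eventually_ae_filter by auto
  have "{x. x - a \<in> N} \<in> null_sets lborel" by (rule null_sets_translation[OF N(1)])
  then show ?thesis unfolding eventually_ae_filter using N(2) by (intro bexI[of _ "{x. x - a \<in> N}"]) auto
qed

context space_time
begin

abbreviation "VV \<equiv> closure (test_jets \<Omega>)"

lemma H01_L2: "f \<in> H01 \<Omega> \<Longrightarrow> f \<in> L2 \<Omega>"
  by (simp add: H01_def H1_def)

lemma weak_grad_H01_L2: "f \<in> H01 \<Omega> \<Longrightarrow> weak_grad \<Omega> f \<in> L2 \<Omega>"
  by (rule weak_grad_L2[OF Omega H01_H1[OF Omega]])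

lemma l2_inner_fn: "h \<in> L2 \<Omega> \<Longrightarrow> l2_inner \<Omega> (fn F) h = F \<bullet> emb \<Omega> h"
  by (simp add: inner_emb_right[OF Omega])

text \<open>Turns a test function of the weak formulation into the pair of time derivative and
  gradient used by the abstract problem. The end condition at \<open>T\<close> fixes the constant of
  integration: the value is the primitive of \<open>Z\<close> that vanishes there.\<close>

lemma space_V_typed:
  assumes v: "v \<in> space_V \<Omega> T" and z: "has_time_deriv \<Omega> T v z" and vc: "L2_continuous_version \<Omega> T v vc"
  obtains Z k where "sq Z" "sq k" "AE t in M. z t \<in> L2 \<Omega> \<and> Z t = emb \<Omega> (z t)"
    "AE t in M. v t \<in> H01 \<Omega> \<and> jet \<Omega> (v t) = (- integral\<^sup>L M Z + prim Z t, k t)"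
    "emb \<Omega> (vc 0) = - integral\<^sup>L M Z"
proof -
  have "v \<in> bochner_L2 J (H01 \<Omega>) (h1_norm \<Omega>)" using v by (simp add: space_V_def space_U_def)
  then obtain V where V: "sq V" "AE t in M. v t \<in> H01 \<Omega> \<and> V t = jet \<Omega> (v t)" by (rule bochner_L2_H01_typed)
  obtain vc' where vc': "L2_continuous_version \<Omega> T v vc'" "AE x in lebesgue_on \<Omega>. vc' T x = 0"
    using v unfolding space_V_def by blast
  have "z \<in> bochner_L2 J (L2 \<Omega>) (l2_norm \<Omega>)" using z by (simp add: has_time_deriv_def)
  then obtain Z where Z: "sq Z" "AE t in M. z t \<in> L2 \<Omega> \<and> Z t = emb \<Omega> (z t)" by (rule bochner_L2_L2_typed)
  note Zi = sq_integrable[OF Z(1)]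
  have vL: "AE t in M. v t \<in> L2 \<Omega>" using V(2) by eventually_elim (simp add: H01_L2)
  note P = continuous_version_is_primitive[OF z vc vL Z]
  note P' = continuous_version_is_primitive[OF z vc'(1) vL Z]
  \<comment> \<open>The version with end value 0 need not be the given one. They agree at some time
    and both are primitives of the same \<open>Z\<close>, so their initial values agree.\<close>
  have "AE t in M. emb \<Omega> (vc t) = emb \<Omega> (vc' t)"
    using continuous_version_emb[OF vc vL] continuous_version_emb[OF vc'(1) vL] by eventually_elim simp
  from AE_M_imp_ex[OF this] obtain t where "0 < t" "t < T" "emb \<Omega> (vc t) = emb \<Omega> (vc' t)" by blast
  then have e0: "emb \<Omega> (vc 0) = emb \<Omega> (vc' 0)" using P[of t] P'[of t] by simp
  have "vc' T \<in> L2 \<Omega>" using vc'(1) T_pos by (auto simp: L2_continuous_version_def space_continuous_on_def)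
  moreover have "AE x in lborel. x \<in> \<Omega> \<longrightarrow> vc' T x = 0"
    using vc'(2) Omega by (subst (asm) AE_lebesgue_on) auto
  ultimately have "emb \<Omega> (vc' T) = 0"
    using fn_zero[where ?'a='a and ?'b=real] by (intro emb_eqI[OF Omega]) (auto elim!: eventually_elim2 simp: indicator_def)
  then have 1: "emb \<Omega> (vc 0) = - integral\<^sup>L M Z"
    using P'[of T] T_pos e0 by (simp add: prim_T[OF Zi] eq_neg_iff_add_eq_0)
  show ?thesis
  proof (rule that[OF Z(1) sq_bounded_linear[OF bounded_linear_snd V(1)] Z(2) _ 1])
    show "AE t in M. v t \<in> H01 \<Omega> \<and> jet \<Omega> (v t) = (- integral\<^sup>L M Z + prim Z t, snd (V t))"
      using V(2) continuous_version_emb[OF vc vL] AE_M_interval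
    proof eventually_elim
      case (elim t)
      then have "fst (jet \<Omega> (v t)) = - integral\<^sup>L M Z + prim Z t" using P[of t] 1 by (simp add: jet_def)
      then show ?case using elim by (metis prod.collapse)
    qed
  qed
qed

text \<open>Functionals are represented by vectors acting on jets. The dual norm is at most the norm
  of the vector, so continuity of \<open>x\<close> in the Hilbert space gives continuity in the dual
  norm.\<close>

lemma Hm1_versionI:
  assumes x: "continuous_on UNIV x" and w: "AE t in M. \<forall>y\<in>VV. W t \<bullet> fst y = x t \<bullet> y"
    and wW: "AE t in M. \<forall>\<psi>\<in>L2 \<Omega>. l2_inner \<Omega> (w t) \<psi> = W t \<bullet> emb \<Omega> \<psi>"
  shows "Hm1_continuous_version \<Omega> T w (\<lambda>t \<phi>. x t \<bullet> jet \<Omega> \<phi>)"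
  unfolding Hm1_continuous_version_def space_continuous_on_def AE_J
proof (intro conjI ballI)
  have n: "\<bar>y \<bullet> jet \<Omega> \<phi>\<bar> \<le> norm y * h1_norm \<Omega> \<phi>" if "\<phi> \<in> H01 \<Omega>" for y \<phi>
    using Cauchy_Schwarz_ineq2[of y "jet \<Omega> \<phi>"] h1_norm_jet[OF Omega H01_H1[OF Omega that]] by simp
  show "(\<lambda>\<phi>. x t \<bullet> jet \<Omega> \<phi>) \<in> Hm1 \<Omega>" for t
    unfolding Hm1_def
    using n[of _ "x t"] jet_add(2)[OF Omega H01_H1[OF Omega] H01_H1[OF Omega]] jet_scaleR(2)[OF Omega H01_H1[OF Omega]]
    by (auto simp: inner_add_right intro!: exI[of _ "norm (x t)"])
  fix t assume "t \<in> {0..T}"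
  have b: "0 \<le> hm1_norm \<Omega> (\<lambda>\<phi>. x s \<bullet> jet \<Omega> \<phi> - x t \<bullet> jet \<Omega> \<phi>) \<and>
    hm1_norm \<Omega> (\<lambda>\<phi>. x s \<bullet> jet \<Omega> \<phi> - x t \<bullet> jet \<Omega> \<phi>) \<le> norm (x s - x t)" for s
  proof -
    let ?B = "{\<phi> \<in> H01 \<Omega>. h1_norm \<Omega> \<phi> \<le> 1}"
    \<comment> \<open>The zero jet provides a member of the unit ball: the supremum is over a
      nonempty set, as both bounds require.\<close>
    have "0 \<in> VV" using VV_subspace(1) subspace_0 by blast
    note j0 = H01_of_jet[OF Omega this]
    define \<phi>0 where "\<phi>0 = fn (fst (0 :: ('a, real) lsq \<times> ('a, 'a) lsq))"
    have "\<phi>0 \<in> ?B" using j0 h1_norm_jet[OF Omega H01_H1[OF Omega j0(1)]] by (simp add: \<phi>0_def)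
    moreover have u: "\<bar>x s \<bullet> jet \<Omega> \<phi> - x t \<bullet> jet \<Omega> \<phi>\<bar> \<le> norm (x s - x t)" if "\<phi> \<in> ?B" for \<phi>
    proof -
      have "\<bar>(x s - x t) \<bullet> jet \<Omega> \<phi>\<bar> \<le> norm (x s - x t) * 1"
        using that by (intro order_trans[OF n] mult_left_mono) auto
      then show ?thesis by (simp add: inner_diff_left)
    qed
    ultimately have "hm1_norm \<Omega> (\<lambda>\<phi>. x s \<bullet> jet \<Omega> \<phi> - x t \<bullet> jet \<Omega> \<phi>) \<le> norm (x s - x t)"
      unfolding hm1_norm_def by (intro cSUP_least) auto
    moreover have "\<bar>x s \<bullet> jet \<Omega> \<phi>0 - x t \<bullet> jet \<Omega> \<phi>0\<bar> \<le> hm1_norm \<Omega> (\<lambda>\<phi>. x s \<bullet> jet \<Omega> \<phi> - x t \<bullet> jet \<Omega> \<phi>)"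
      unfolding hm1_norm_def by (rule cSUP_upper[OF \<open>\<phi>0 \<in> ?B\<close> bdd_aboveI2[OF u]])
    ultimately show ?thesis using abs_ge_zero order_trans by blast
  qed
  define N where "N s = hm1_norm \<Omega> (\<lambda>\<phi>. x s \<bullet> jet \<Omega> \<phi> - x t \<bullet> jet \<Omega> \<phi>)" for s
  have "continuous_on {0..T} x" using x by (rule continuous_on_subset) simp
  then have "(x \<longlongrightarrow> x t) (at t within {0..T})" using \<open>t \<in> {0..T}\<close> by (simp add: continuous_on_def)
  then have "((\<lambda>s. norm (x s - x t)) \<longlongrightarrow> 0) (at t within {0..T})" by (intro tendsto_norm_zero LIM_zero)
  moreover have "0 \<le> N s" "N s \<le> norm (x s - x t)" for s using b unfolding N_def by blast+
  ultimately have "(N \<longlongrightarrow> 0) (at t within {0..T})"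
    by (intro tendsto_sandwich[of "\<lambda>_. 0" N _ "\<lambda>s. norm (x s - x t)"] always_eventually allI tendsto_const)
  then show "((\<lambda>s. hm1_norm \<Omega> (\<lambda>\<phi>. x s \<bullet> jet \<Omega> \<phi> - x t \<bullet> jet \<Omega> \<phi>)) \<longlongrightarrow> 0) (at t within {0..T})"
    unfolding N_def .
next
  show "AE t in M. \<forall>\<phi>\<in>H01 \<Omega>. x t \<bullet> jet \<Omega> \<phi> = l2_inner \<Omega> (w t) \<phi>"
    using w wW
  proof eventually_elim
    case (elim t)
    show ?case
    proof
      fix \<phi> assume \<phi>: "\<phi> \<in> H01 \<Omega>"
      then show "x t \<bullet> jet \<Omega> \<phi> = l2_inner \<Omega> (w t) \<phi>"
        using bspec[OF elim(1) jet_H01[OF Omega \<phi>]] bspec[OF elim(2) H01_L2[OF \<phi>]] by (simp add: jet_def)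
    qed
  qed
qed

lemma continuous_versionI:
  assumes U: "continuous_on UNIV U" and u: "AE t in M. u t = fn (U t)"
  shows "L2_continuous_version \<Omega> T u (\<lambda>t. fn (U t))"
  unfolding L2_continuous_version_def space_continuous_on_def AE_J
proof (intro conjI ballI fn_in_L2[OF Omega])
  fix t assume "t \<in> {0..T}"
  interpret R: bounded_linear restr by (rule bounded_linear_restriction[OF Omega])
  have e: "l2_norm \<Omega> (\<lambda>x. fn (U s) x - fn (U t) x) = norm (restr (U s) - restr (U t))" for s
    by (rule l2_norm_diff[OF fn_in_L2[OF Omega] fn_in_L2[OF Omega]])
  have "((\<lambda>s. norm (restr (U s) - restr (U t))) \<longlongrightarrow> norm (restr (U t) - restr (U t))) (at t within {0..T})"
    using U by (intro tendsto_intros R.tendsto) (meson UNIV_I continuous_on_def subset_UNIV tendsto_within_subset)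
  then show "((\<lambda>s. l2_norm \<Omega> (\<lambda>x. fn (U s) x - fn (U t) x)) \<longlongrightarrow> 0) (at t within {0..T})" by (simp add: e)
next
  show "AE t in M. AE x in lebesgue_on \<Omega>. fn (U t) x = u t x" using u by eventually_elim simp
qed

theorem exists_weak_solution:
  fixes g g' :: "real \<Rightarrow> real" and f0 :: "real \<Rightarrow> 'a \<Rightarrow> real"
  assumes tau: "\<tau> > 0"
    and g: "\<And>t. t \<ge> 0 \<Longrightarrow> (g has_real_derivative g' t) (at t within {0..})" "continuous_on {0..} g'"
    and u0: "u0 \<in> H01 \<Omega>" and u1: "u1 \<in> L2 \<Omega>"
    and f0: "f0 \<in> bochner_L2 {-\<tau><..<0} (L2 \<Omega>) (l2_norm \<Omega>)"
  shows "\<exists>u. weak_solution \<Omega> g \<mu>1 \<mu>2 \<tau> T u0 u1 f0 u"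
proof -
  \<comment> \<open>The kernel is given for nonnegative times. Clamping its argument to [0, T] makes
    it and its derivative bounded and continuous on the line, without changing them on
    [0, T].\<close>
  define cl where "cl s = max 0 (min T s)" for s
  have cl: "cl s \<in> {0..T}" for s using T_pos by (auto simp: cl_def)
  have cl_id: "cl s = s" if "0 \<le> s" "s \<le> T" for s using that by (simp add: cl_def)
  have clc: "continuous_on UNIV cl" unfolding cl_def[abs_def] by (intro continuous_intros)
  define gt where "gt s = g (cl s)" for s
  define gt' where "gt' s = g' (cl s)" for s
  have gc: "continuous_on {0..T} g" "continuous_on {0..T} g'"
    using DERIV_continuous_on[of "{0..}" g g'] g by (auto intro: continuous_on_subset)
  have gtc: "continuous_on UNIV gt" "continuous_on UNIV gt'"
    unfolding gt_def[abs_def] gt'_def[abs_def]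
    by (rule continuous_on_compose2[OF gc(1) clc] continuous_on_compose2[OF gc(2) clc]; use cl in blast)+
  have "bounded (g ` {0..T})" "bounded (g' ` {0..T})"
    by (intro compact_imp_bounded compact_continuous_image gc; simp)+
  then obtain K1 K2 where "\<And>s. s \<in> {0..T} \<Longrightarrow> \<bar>g s\<bar> \<le> K1" "\<And>s. s \<in> {0..T} \<Longrightarrow> \<bar>g' s\<bar> \<le> K2"
    by (auto simp: bounded_iff simp del: atLeastAtMost_iff)
  then have K: "\<bar>gt s\<bar> \<le> max K1 K2" "\<bar>gt' s\<bar> \<le> max K1 K2" for s
    using cl[of s] unfolding gt_def gt'_def by (meson max.coboundedI1 max.coboundedI2)+
  have gtd: "(gt has_real_derivative gt' x) (at x within {0..T})" if x: "0 \<le> x" "x \<le> T" for x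
  proof -
    have "(g has_real_derivative g' x) (at x within {0..T})" by (rule DERIV_subset[OF g(1)[OF x(1)]]) auto
    then have "(gt has_real_derivative g' x) (at x within {0..T})"
      by (rule has_field_derivative_transform_within[where d=1]) (use x in \<open>auto simp: gt_def cl_id\<close>)
    then show ?thesis using x by (simp add: gt'_def cl_id)
  qed
  have VVu0: "(emb \<Omega> u0, emb \<Omega> (weak_grad \<Omega> u0)) \<in> VV" using jet_H01[OF Omega u0] by (simp add: jet_def)
  obtain f where f[measurable]: "f \<in> borel_measurable borel"
    and ff: "AE t in lborel. t \<in> {-\<tau><..<0} \<longrightarrow> f0 t \<in> L2 \<Omega> \<and> f t = emb \<Omega> (f0 t)"
    and fi: "integrable lborel (\<lambda>t. indicator {-\<tau><..<0} t *\<^sub>R (norm (f t))\<^sup>2)"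
    by (rule bochner_L2_typed[OF _ f0, of "emb \<Omega>"]) (auto simp: norm_emb[OF Omega] l2_norm_diff)
  \<comment> \<open>The history translated to (0, \<tau>); it fills in the delayed velocity where
    \<open>shift\<close> is zero.\<close>
  define p where "p t = (if t < \<tau> then f (t - \<tau>) else 0)" for t
  have [measurable]: "p \<in> borel_measurable borel" unfolding p_def[abs_def] by measurable
  have p: "sq p"
  proof -
    have "integrable lborel (\<lambda>t. indicator {-\<tau><..<0} (- \<tau> + 1 * t) *\<^sub>R (norm (f (- \<tau> + 1 * t)))\<^sup>2)"
      by (rule lborel_integrable_real_affine[OF fi]) simp
    then have "integrable lborel (\<lambda>t. indicator J t * (norm (p t))\<^sup>2)"
      by (rule Bochner_Integration.integrable_bound) (auto simp: p_def indicator_def)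
    then show ?thesis by (simp add: sq_iff_J)
  qed
  interpret H: hyperbolic_problem T VV gt gt' "max K1 K2" \<mu>1 \<mu>2 \<tau> "emb \<Omega> u0" "emb \<Omega> (weak_grad \<Omega> u0)" "emb \<Omega> u1" p
    by unfold_locales (use VV_subspace tau gtc K gtd VVu0 p in auto)
  obtain w G where w: "sq w" and G: "sq G" and VVae: "AE t in M. (emb \<Omega> u0 + prim w t, G t) \<in> VV"
    and eq: "\<And>z k. H.is_test z k \<Longrightarrow>
        - (\<integral>t. w t \<bullet> z t \<partial>M) + (\<integral>t. G t \<bullet> k t \<partial>M) - (\<integral>t. conv gt G t \<bullet> k t \<partial>M)
        + \<mu>1 * (\<integral>t. w t \<bullet> H.val z t \<partial>M) + \<mu>2 * (\<integral>t. (shift \<tau> w t + p t) \<bullet> H.val z t \<partial>M)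
        - H.val z 0 \<bullet> emb \<Omega> u1 = 0"
    using H.exists_solution by blast
  obtain a b where ab: "continuous_on UNIV a" "continuous_on UNIV b" "a 0 = emb \<Omega> u1" "b 0 = 0"
    and dual: "AE t in M. \<forall>(\<phi>, \<kappa>)\<in>VV. w t \<bullet> \<phi> = a t \<bullet> \<phi> + b t \<bullet> \<kappa>"
    using H.velocity_in_dual[OF w G eq] by blast
  note wi = sq_integrable[OF w] and Gi = sq_integrable[OF G]
  note [measurable] = sq_measurable[OF w] sq_measurable[OF G] H.g_meas(1)
  define U where "U t = emb \<Omega> u0 + prim w t" for t
  have Uc: "continuous_on UNIV U" unfolding U_def[abs_def] by (intro continuous_intros prim_continuous wi)
  have UG: "sq (\<lambda>t. (U t, G t))" unfolding U_def by (intro sq_Pair sq_prim wi G)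
  \<comment> \<open>The pair lies in \<open>VV\<close> at almost every time only. The projection
    makes the value a member of \<open>H01\<close> at all times and changes nothing where the pair
    already lies in \<open>VV\<close>.\<close>
  define u where "u t = fn (fst (hproj VV (U t, G t)))" for t
  define wr where "wr t = restr (w t)" for t
  have wr: "sq wr" unfolding wr_def by (rule sq_bounded_linear[OF bounded_linear_restriction[OF Omega] w])
  \<comment> \<open>One function on (-\<tau>, T), as the delay term of the weak identity demands:
    the history at negative times, and from 0 on the velocity cut off outside the domain.\<close>
  define wf where "wf t = (if t < 0 then fn (f t) else fn (wr t))" for t
  have uU: "AE t in M. u t = fn (U t) \<and> jet \<Omega> (u t) = (U t, G t) \<and> u t \<in> H01 \<Omega>"
    using VVae
  proof eventually_elim
    case (elim t)
    then show ?case
      using hproj_id[OF VV_subspace, of "(U t, G t)"] H01_of_jet[OF Omega, of "(U t, G t)"]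
      by (simp add: u_def U_def)
  qed
  have uB: "u \<in> bochner_L2 J (H01 \<Omega>) (h1_norm \<Omega>)"
    unfolding u_def[abs_def] by (rule bochner_L2_H01I[OF UG])
  have wfw: "AE t in M. wf t = fn (wr t)" by (rule AE_MI) (simp add: wf_def)
  have wfB: "wf \<in> bochner_L2 J (L2 \<Omega>) (l2_norm \<Omega>)"
  proof -
    define wx where "wx t = (if t < 0 then f t else wr t)" for t
    note [measurable] = sq_measurable[OF wr]
    have [measurable]: "wx \<in> borel_measurable borel" unfolding wx_def[abs_def] by measurable
    have "integrable M (\<lambda>t. (norm (wx t))\<^sup>2) \<longleftrightarrow> integrable M (\<lambda>t. (norm (wr t))\<^sup>2)"
      by (rule integrable_cong_AE) (auto simp: wx_def intro!: AE_MI)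
    then have "sq wx" using wr by (simp add: sq_def)
    from bochner_L2_L2I[OF this] show ?thesis
      unfolding wx_def wf_def[abs_def] by (simp add: if_distrib[of fn])
  qed
  have wfin: "AE t in M. \<forall>\<psi>\<in>L2 \<Omega>. l2_inner \<Omega> (wf t) \<psi> = w t \<bullet> emb \<Omega> \<psi>"
    using wfw by eventually_elim (simp add: l2_inner_fn wr_def inner_restr)
  have uin: "AE t in M. \<forall>\<psi>\<in>L2 \<Omega>. l2_inner \<Omega> (u t) \<psi> = (emb \<Omega> u0 + prim w t) \<bullet> emb \<Omega> \<psi>"
    using uU by eventually_elim (simp add: l2_inner_fn U_def)
  have td: "has_time_deriv \<Omega> T u wf" by (rule has_time_derivI[OF w wfB wfin uin])
  have "u \<in> space_U \<Omega> T" using uB td by (auto simp: space_U_def)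
  moreover have "L2_continuous_version \<Omega> T u (\<lambda>t. fn (U t))"
    by (rule continuous_versionI[OF Uc]) (use uU in \<open>auto elim: eventually_mono\<close>)
  moreover have Ol: "\<Omega> \<in> sets lebesgue" using Omega by auto
  have "AE x in lebesgue_on \<Omega>. fn (U 0) x = u0 x"
    unfolding AE_lebesgue_on[OF Ol]
    using emb_AE[OF Omega H01_L2[OF u0]] by eventually_elim (simp add: U_def prim_0)
  moreover have "Hm1_continuous_version \<Omega> T wf (\<lambda>t \<phi>. (a t, b t) \<bullet> jet \<Omega> \<phi>)"
  proof (rule Hm1_versionI[OF _ _ wfin])
    show "continuous_on UNIV (\<lambda>t. (a t, b t))" by (intro continuous_on_Pair ab)
    show "AE t in M. \<forall>y\<in>VV. w t \<bullet> fst y = (a t, b t) \<bullet> y"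
      using dual
    proof eventually_elim
      case (elim t)
      show ?case
      proof
        fix y assume "y \<in> VV"
        then show "w t \<bullet> fst y = (a t, b t) \<bullet> y" using elim by (cases y) auto
      qed
    qed
  qed
  moreover have "\<forall>\<phi>\<in>H01 \<Omega>. (a 0, b 0) \<bullet> jet \<Omega> \<phi> = l2_inner \<Omega> u1 \<phi>"
    using inner_emb[OF Omega u1 H01_L2] by (simp add: ab jet_def)
  moreover have "AE t in lebesgue_on {0<..<\<tau>}. AE x in lebesgue_on \<Omega>. wf (t - \<tau>) x = f0 (t - \<tau>) x"
  proof -
    have S: "{0<..<\<tau>} \<in> sets lebesgue" by auto
    show ?thesis
      unfolding AE_lebesgue_on[OF S] AE_lebesgue_on[OF Ol]
      using AE_lborel_translate[OF ff, of \<tau>]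
    proof eventually_elim
      case (elim t)
      show ?case
      proof
        assume t: "t \<in> {0<..<\<tau>}"
        then have 1: "f0 (t - \<tau>) \<in> L2 \<Omega>" "f (t - \<tau>) = emb \<Omega> (f0 (t - \<tau>))" using elim by auto
        have "wf (t - \<tau>) = fn (emb \<Omega> (f0 (t - \<tau>)))" using t 1(2) by (simp add: wf_def)
        then show "AE x in lborel. x \<in> \<Omega> \<longrightarrow> wf (t - \<tau>) x = f0 (t - \<tau>) x"
          using emb_AE[OF Omega 1(1)] by (auto elim!: eventually_mono)
      qed
    qed
  qed
  moreover have "weak_identity \<Omega> g \<mu>1 \<mu>2 \<tau> T u1 u wf v z (vc 0)"
    if v: "v \<in> space_V \<Omega> T" and z: "has_time_deriv \<Omega> T v z" and vc: "L2_continuous_version \<Omega> T v vc" for v z vc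
  proof -
    obtain Z k where Z: "sq Z" and k: "sq k" and zZ: "AE t in M. z t \<in> L2 \<Omega> \<and> Z t = emb \<Omega> (z t)"
      and vv: "AE t in M. v t \<in> H01 \<Omega> \<and> jet \<Omega> (v t) = (- integral\<^sup>L M Z + prim Z t, k t)"
      and vc0: "emb \<Omega> (vc 0) = - integral\<^sup>L M Z"
      by (rule space_V_typed[OF v z vc])
    have vj: "AE t in M. v t \<in> H01 \<Omega> \<and> emb \<Omega> (v t) = H.val Z t \<and> emb \<Omega> (weak_grad \<Omega> (v t)) = k t"
      using vv by eventually_elim (simp add: jet_def H.val_def)
    have "AE t in M. (H.val Z t, k t) \<in> VV"
      using vv
    proof eventually_elim
      case (elim t)
      then have "jet \<Omega> (v t) \<in> VV" using jet_H01[OF Omega] by blast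
      then show ?case using elim by (simp add: H.val_def)
    qed
    then have test: "H.is_test Z k" using Z k by (simp add: H.is_test_def)
    note [measurable] = sq_measurable[OF Z] sq_measurable[OF k] sq_measurable[OF H.sq_val[OF Z]]
      sq_measurable[OF H.sq_conv(1)[OF Gi]]
    have uj: "AE t in M. u t \<in> H01 \<Omega> \<and> emb \<Omega> (weak_grad \<Omega> (u t)) = G t"
      using uU by eventually_elim (unfold jet_def prod.inject, blast)
    have grad: "l2_inner \<Omega> (weak_grad \<Omega> (u s)) (weak_grad \<Omega> (v t)) = G s \<bullet> k t"
      if "u s \<in> H01 \<Omega> \<and> emb \<Omega> (weak_grad \<Omega> (u s)) = G s"
        "v t \<in> H01 \<Omega> \<and> emb \<Omega> (v t) = H.val Z t \<and> emb \<Omega> (weak_grad \<Omega> (v t)) = k t" for s t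
      using inner_emb[OF Omega weak_grad_H01_L2 weak_grad_H01_L2, of "u s" "v t"] that by simp
    have 1: "(\<integral>t. l2_inner \<Omega> (wf t) (z t) \<partial>lebesgue_on J) = (\<integral>t. w t \<bullet> Z t \<partial>M)"
    proof (rule integral_J)
      show "AE t in M. l2_inner \<Omega> (wf t) (z t) = w t \<bullet> Z t" using wfin zZ by eventually_elim simp
    qed measurable
    have 2: "(\<integral>t. l2_inner \<Omega> (weak_grad \<Omega> (u t)) (weak_grad \<Omega> (v t)) \<partial>lebesgue_on J) = (\<integral>t. G t \<bullet> k t \<partial>M)"
    proof (rule integral_J)
      show "AE t in M. l2_inner \<Omega> (weak_grad \<Omega> (u t)) (weak_grad \<Omega> (v t)) = G t \<bullet> k t"
        using uj vj by eventually_elim (rule grad)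
    qed measurable
    have 3: "(\<integral>t. (\<integral>s. g (t - s) * l2_inner \<Omega> (weak_grad \<Omega> (u s)) (weak_grad \<Omega> (v t)) \<partial>lebesgue_on {0<..<t}) \<partial>lebesgue_on J)
      = (\<integral>t. conv gt G t \<bullet> k t \<partial>M)"
    proof (rule integral_J)
      show "AE t in M. (\<integral>s. g (t - s) * l2_inner \<Omega> (weak_grad \<Omega> (u s)) (weak_grad \<Omega> (v t)) \<partial>lebesgue_on {0<..<t})
          = conv gt G t \<bullet> k t"
        using vj AE_M_interval
      proof eventually_elim
        case (elim t)
        define h where "h s = gt (t - s) * (G s \<bullet> k t)" for s
        have [measurable]: "h \<in> borel_measurable borel" unfolding h_def[abs_def] by measurable
        have ae: "AE s in lborel. s \<in> {0<..<t} \<longrightarrow>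
            g (t - s) * l2_inner \<Omega> (weak_grad \<Omega> (u s)) (weak_grad \<Omega> (v t)) = h s"
          using uj[unfolded AE_M]
        proof eventually_elim
          case (elim s)
          show ?case
          proof
            assume s: "s \<in> {0<..<t}"
            then have "l2_inner \<Omega> (weak_grad \<Omega> (u s)) (weak_grad \<Omega> (v t)) = G s \<bullet> k t"
              using elim \<open>0 < t \<and> t < T\<close> \<open>v t \<in> H01 \<Omega> \<and> emb \<Omega> (v t) = H.val Z t \<and> emb \<Omega> (weak_grad \<Omega> (v t)) = k t\<close>
              by (intro grad) auto
            moreover have "gt (t - s) = g (t - s)" using s \<open>0 < t \<and> t < T\<close> by (simp add: gt_def cl_id)
            ultimately show "g (t - s) * l2_inner \<Omega> (weak_grad \<Omega> (u s)) (weak_grad \<Omega> (v t)) = h s" by (simp add: h_def)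
          qed
        qed
        have "(\<integral>s. g (t - s) * l2_inner \<Omega> (weak_grad \<Omega> (u s)) (weak_grad \<Omega> (v t)) \<partial>lebesgue_on {0<..<t})
            = (\<integral>s. indicator {0<..<t} s *\<^sub>R h s \<partial>lborel)"
          by (rule lebesgue_on_open_AE_eq(2)[OF _ _ ae]) auto
        also have "\<dots> = (\<integral>s. indicator J s *\<^sub>R (if s < t then h s else 0) \<partial>lborel)"
          by (rule Bochner_Integration.integral_cong) (use elim in \<open>auto simp: indicator_def\<close>)
        also have "\<dots> = prim h t" unfolding prim_def by (rule integral_M[symmetric]) measurable
        also have "\<dots> = conv gt G t \<bullet> k t"
          unfolding conv_def by (subst prim_inner[OF integrable_kernel_mult(1)[OF H.g_meas(1) H.gK Gi]]) (simp add: h_def[abs_def])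
        finally show ?case .
      qed
    qed measurable
    have 4: "(\<integral>t. l2_inner \<Omega> (wf t) (v t) \<partial>lebesgue_on J) = (\<integral>t. w t \<bullet> H.val Z t \<partial>M)"
    proof (rule integral_J)
      show "AE t in M. l2_inner \<Omega> (wf t) (v t) = w t \<bullet> H.val Z t" using wfin vj by eventually_elim (auto simp: H01_L2)
    qed measurable
    have 5: "(\<integral>t. l2_inner \<Omega> (wf (t - \<tau>)) (v t) \<partial>lebesgue_on J) = (\<integral>t. (shift \<tau> w t + p t) \<bullet> H.val Z t \<partial>M)"
    proof (rule integral_J)
      \<comment> \<open>At t = \<tau> both \<open>shift\<close> and \<open>p\<close> are 0 by
        convention, so this single time is discarded; elsewhere exactly one of them gives the
        delayed velocity.\<close>
      show "AE t in M. l2_inner \<Omega> (wf (t - \<tau>)) (v t) = (shift \<tau> w t + p t) \<bullet> H.val Z t"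
        using vj AE_M_neq[of \<tau>]
      proof eventually_elim
        case (elim t)
        then have "v t \<in> L2 \<Omega>" by (simp add: H01_L2)
        then show ?case using elim inner_restr[of "v t" "w (t - \<tau>)"]
          by (cases "t < \<tau>") (auto simp: wf_def p_def shift_def l2_inner_fn wr_def)
      qed
    qed measurable
    have vcL: "vc 0 \<in> L2 \<Omega>" using vc T_pos by (auto simp: L2_continuous_version_def space_continuous_on_def)
    have 6: "l2_inner \<Omega> (vc 0) u1 = H.val Z 0 \<bullet> emb \<Omega> u1"
      using inner_emb[OF Omega vcL u1] vc0 by (simp add: H.val_def prim_0)
    show ?thesis unfolding weak_identity_def 1 2 3 4 5 6 by (rule eq[OF test])
  qed
  ultimately have "weak_solution \<Omega> g \<mu>1 \<mu>2 \<tau> T u0 u1 f0 u"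
    unfolding weak_solution_def using td
    by (intro conjI exI[of _ "\<lambda>t. fn (U t)"] exI[of _ wf] exI[of _ "\<lambda>t \<phi>. (a t, b t) \<bullet> jet \<Omega> \<phi>"]) auto
  then show ?thesis by blast
qed

end

theorem theorem3p3:
  fixes \<Omega> :: "(real ^ 'n) set"
    and g g' :: "real \<Rightarrow> real"
    and \<mu>1 \<mu>2 \<tau> l \<zeta> T :: real
    and u0 u1 :: "real ^ 'n \<Rightarrow> real"
    and f0 :: "real \<Rightarrow> real ^ 'n \<Rightarrow> real"
  assumes "bounded_C2_domain \<Omega>"
    and "\<tau> > 0"
    and "\<And>t. t \<ge> 0 \<Longrightarrow> g t \<ge> 0"
    and "\<And>t. t \<ge> 0 \<Longrightarrow> (g has_real_derivative g' t) (at t within {0..})"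
    and "continuous_on {0..} g'"
    and "g 0 > 0"
    and "(g has_integral (1 - l)) {0..}"
    and "l > 0"
    and "\<zeta> > 0"
    and "\<And>t. t > 0 \<Longrightarrow> g' t \<le> - \<zeta> * g t"
    and "u0 \<in> H01 \<Omega>"
    and "u1 \<in> L2 \<Omega>"
    and "f0 \<in> bochner_L2 {-\<tau><..<0} (L2 \<Omega>) (l2_norm \<Omega>)"
    and "T > 0"
  shows "\<exists>u. weak_solution \<Omega> g \<mu>1 \<mu>2 \<tau> T u0 u1 f0 u"
proof -
  interpret space_time T \<Omega>
    by unfold_locales (use assms in \<open>auto simp: bounded_C2_domain_def\<close>)
  show ?thesis
    by (rule exists_weak_solution) (use assms in auto)
qed

end
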